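(* If $\Gamma_k\rightrightarrows B_k$ is a weighted Lie groupoid of degree $k$ with respect to a homogeneity structure $h$ on $\Gamma_k$, then its Lie algebroid $\mathrm A(\Gamma_k)\to B_k$ is a weighted Lie algebroid of degree $k+1$ with respect to the homogeneity structure $\widehat h$ defined by $$\widehat h_t=(h_t)'=\mathrm{Lie}(h_t),\qquad t\in\mathbb R .$$
   Context: Everything is smooth. A homogeneity structure on a (super)manifold $F$ is a smooth action $h\colon\mathbb R\times F\to F$ of the monoid $(\mathbb R,\cdot)$ of multiplicative reals ($h_1=\mathrm{id}$, $h_t\circ h_s=h_{ts}$; on a supermanifold each $h_t$ is a morphism of supermanifolds). A function $f$ is homogeneous of weight $w$ if $h_t^*f=t^wf$ for all $t$. There is always an atlas of homogeneous coordinates with non-negative integer weights, and $h$ is of degree $k$ if these weights can be taken $\le k$; then $(F,h)$ is a graded bundle of degree $k$. Degree $1$ homogeneity structures with coordinates of weights $0,1$ are the same as vector bundle structures (multiplication by scalars). A weighted Lie groupoid of degree $k$ is a Lie groupoid $\Gamma_k\rightrightarrows B_k$ with a homogeneity structure $h$ of degree $k$ on $\Gamma_k$ such that $h_t$ (together with the induced action on $B_k$) is a Lie groupoid morphism for every $t\in\mathbb R$. $\mathrm{Lie}$ denotes the Lie functor from Lie groupoids to Lie algebroids: $\mathrm{Lie}(\mathcal G)=\mathrm A(\mathcal G)=\ker(\mathsf T\underline s)|_{\iota(B)}$ for a Lie groupoid $\mathcal G\rightrightarrows B$ with source $\underline s$ and unit inclusion $\iota$, and $\Phi'=\mathrm{Lie}(\Phi)$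 is the restriction of $\mathsf T\Phi$ to $\mathrm A$. A graded-linear bundle ($\mathcal{GL}$-bundle) of degree $k$ is a manifold $D_k$ with two commuting homogeneity structures $\widehat{\mathrm h}$ of degree $k-1$ and $\widehat{\mathrm l}$ of degree $1$ (a vector bundle structure $D_k\to B_{k-1}$). $\Pi D_k$ is obtained by reversing the parity of the linear fibre coordinates; the actions induce $\Pi\widehat{\mathrm h}_t,\Pi\widehat{\mathrm l}_s$. A weighted Lie algebroid of degree $k$ with respect to $\widehat{\mathrm h}$ is a $\mathcal{GL}$-bundle $(D_k,\widehat{\mathrm h},\widehat{\mathrm l})$ of degree $k$ with a homological vector field $Q$ on $\Pi D_k$ (odd, $Q^2=0$) such that for all $t,s\in\mathbb R$: $Q\circ(\Pi\widehat{\mathrm h}_t)^*=(\Pi\widehat{\mathrm h}_t)^*\circ Q$ and $s\,Q\circ(\Pi\widehat{\mathrm l}_s)^*=(\Pi\widehat{\mathrm l}_s)^*\circ Q$. (Thus degree $k+1$ means $\widehat{\mathrm h}$ has degree $k$.) A Lie algebroid structure on a vector bundle $E$ is identified with a homological vector field $Q$ of weight one on $\Pi E$; the vector bundle structure $\widehat{\mathrm l}$ and $Q$ for $\mathrm A(\Gamma_k)$ are those of the Lie algebroid $\mathrm A(\Gamma_k)$. *)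

theory Defs
  imports "HOL-Analysis.Analysis"
begin

section \<open>Smooth manifolds\<close>

text \<open>
  A space is a set of points together with the global smooth functions on it; a manifold is such
  a space that is locally isomorphic to Euclidean n-space. The dimension is a natural number, so
  charts take values in the topological space \<^const>\<open>Euclidean_space\<close> n, the sequences that vanish
  from index n on. Functions and maps on a space are total HOL functions of which only the values
  at the points matter.
\<close>

text \<open>All iterated partial derivatives exist and are continuous; U is an open subset of
  \<^const>\<open>Euclidean_space\<close> n.\<close>

coinductive smooth_on :: "nat \<Rightarrow> (nat \<Rightarrow> real) set \<Rightarrow> ((nat \<Rightarrow> real) \<Rightarrow> real) \<Rightarrow> bool"
  for n :: nat and U :: "(nat \<Rightarrow> real) set" where
  "\<lbrakk>continuous_map (subtopology (Euclidean_space n) U) euclideanreal F;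
    \<And>i x. i < n \<Longrightarrow> x \<in> U \<Longrightarrow> ((\<lambda>t. F (x(i := t))) has_real_derivative F' i x) (at (x i));
    \<And>i. i < n \<Longrightarrow> smooth_on n U (F' i)\<rbrakk>
   \<Longrightarrow> smooth_on n U F"

record 'a space =
  pts :: "'a set"
  Cinf :: "('a \<Rightarrow> real) set"

definition initial_topology :: "'a set \<Rightarrow> ('a \<Rightarrow> real) set \<Rightarrow> 'a topology" where
  "initial_topology S C =
     topology_generated_by (insert S {{p \<in> S. f p \<in> V} |f V. f \<in> C \<and> open V})"

abbreviation top_of :: "'a space \<Rightarrow> 'a topology" where
  "top_of M \<equiv> initial_topology (pts M) (Cinf M)"

definition locally_smooth :: "'a space \<Rightarrow> 'a set \<Rightarrow> ('a \<Rightarrow> real) \<Rightarrow> bool" where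
  "locally_smooth M U f \<longleftrightarrow>
     (\<forall>p\<in>U. \<exists>W g. openin (top_of M) W \<and> p \<in> W \<and> W \<subseteq> U \<and> g \<in> Cinf M \<and> (\<forall>q\<in>W. f q = g q))"

definition chart :: "nat \<Rightarrow> 'a space \<Rightarrow> 'a set \<Rightarrow> ('a \<Rightarrow> nat \<Rightarrow> real) \<Rightarrow> bool" where
  "chart n M U x \<longleftrightarrow>
     openin (top_of M) U \<and> openin (Euclidean_space n) (x ` U) \<and>
     homeomorphic_map (subtopology (top_of M) U) (subtopology (Euclidean_space n) (x ` U)) x \<and>
     (\<forall>f. locally_smooth M U f \<longleftrightarrow> smooth_on n (x ` U) (f \<circ> inv_into U x))"

definition manifold :: "nat \<Rightarrow> 'a space \<Rightarrow> bool" where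
  "manifold n M \<longleftrightarrow>
     (\<forall>f. f \<in> Cinf M \<longleftrightarrow> locally_smooth M (pts M) f) \<and>
     Hausdorff_space (top_of M) \<and> second_countable (top_of M) \<and>
     (\<forall>p\<in>pts M. \<exists>U x. p \<in> U \<and> chart n M U x)"

definition smooth_map :: "'a space \<Rightarrow> 'b space \<Rightarrow> ('a \<Rightarrow> 'b) \<Rightarrow> bool" where
  "smooth_map M N \<phi> \<longleftrightarrow> \<phi> ` pts M \<subseteq> pts N \<and> (\<forall>f\<in>Cinf N. f \<circ> \<phi> \<in> Cinf M)"

text \<open>The smooth structure generated by a set of functions: locally, its members are smooth
  functions of finitely many generators. Products, embedded submanifolds and the
  tangent bundle all carry structures of this form.\<close>

definition generated_space :: "'a set \<Rightarrow> ('a \<Rightarrow> real) set \<Rightarrow> 'a space" where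
  "generated_space S C = \<lparr>pts = S, Cinf = {f. \<forall>p\<in>S. \<exists>W m c F.
     openin (initial_topology S C) W \<and> p \<in> W \<and> (\<forall>i<m. c i \<in> C) \<and>
     smooth_on m (topspace (Euclidean_space m)) F \<and>
     (\<forall>q\<in>W. f q = F (\<lambda>i. if i < m then c i q else 0))}\<rparr>"

definition real_line :: "real space" where
  "real_line = generated_space UNIV {\<lambda>t. t}"

definition prod_space :: "'a space \<Rightarrow> 'b space \<Rightarrow> ('a \<times> 'b) space" where
  "prod_space M N = generated_space (pts M \<times> pts N)
     ({f \<circ> fst |f. f \<in> Cinf M} \<union> {f \<circ> snd |f. f \<in> Cinf N})"

definition subspace_of :: "'a space \<Rightarrow> 'a set \<Rightarrow> 'a space" where
  "subspace_of M S = generated_space S (Cinf M)"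


section \<open>Tangent vectors and vector fields\<close>

type_synonym 'a tvec = "('a \<Rightarrow> real) \<Rightarrow> real"

text \<open>Tangent vectors are derivations of the smooth functions. They are set to 0 on non-smooth
  functions, so that equality of HOL functions is equality of tangent vectors.\<close>

definition tangent_space :: "'a space \<Rightarrow> 'a \<Rightarrow> 'a tvec set" where
  "tangent_space M p = {v. (\<forall>f. f \<notin> Cinf M \<longrightarrow> v f = 0) \<and>
     (\<forall>f\<in>Cinf M. \<forall>g\<in>Cinf M. v (\<lambda>q. f q + g q) = v f + v g) \<and>
     (\<forall>f\<in>Cinf M. \<forall>c. v (\<lambda>q. c * f q) = c * v f) \<and>
     (\<forall>f\<in>Cinf M. \<forall>g\<in>Cinf M. v (\<lambda>q. f q * g q) = v f * g p + f p * v g)}"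

definition tangent_bundle :: "'a space \<Rightarrow> ('a \<times> 'a tvec) space" where
  "tangent_bundle M = generated_space {(p, v). p \<in> pts M \<and> v \<in> tangent_space M p}
     ({f \<circ> fst |f. f \<in> Cinf M} \<union> {\<lambda>(p, v). v f |f. f \<in> Cinf M})"

definition tangent_map ::
  "'a space \<Rightarrow> 'b space \<Rightarrow> ('a \<Rightarrow> 'b) \<Rightarrow> 'a \<times> 'a tvec \<Rightarrow> 'b \<times> 'b tvec" where
  "tangent_map M N \<phi> = (\<lambda>(p, v). (\<phi> p, \<lambda>f. if f \<in> Cinf N then v (f \<circ> \<phi>) else 0))"

definition submersion :: "'a space \<Rightarrow> 'b space \<Rightarrow> ('a \<Rightarrow> 'b) \<Rightarrow> bool" where
  "submersion M N \<phi> \<longleftrightarrow> smooth_map M N \<phi> \<and>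
     (\<forall>p\<in>pts M. \<forall>w\<in>tangent_space N (\<phi> p). \<exists>v\<in>tangent_space M p.
        tangent_map M N \<phi> (p, v) = (\<phi> p, w))"

definition vector_field :: "'a space \<Rightarrow> ('a \<Rightarrow> 'a tvec) \<Rightarrow> bool" where
  "vector_field M X \<longleftrightarrow> smooth_map M (tangent_bundle M) (\<lambda>p. (p, X p)) \<and>
     (\<forall>p. p \<notin> pts M \<longrightarrow> X p = (\<lambda>f. 0))"

definition vf_bracket ::
  "'a space \<Rightarrow> ('a \<Rightarrow> 'a tvec) \<Rightarrow> ('a \<Rightarrow> 'a tvec) \<Rightarrow> 'a \<Rightarrow> 'a tvec" where
  "vf_bracket M X Y = (\<lambda>p f. if p \<in> pts M \<and> f \<in> Cinf M
     then X p (\<lambda>q. Y q f) - Y p (\<lambda>q. X q f) else 0)"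


section \<open>Homogeneity structures\<close>

definition homogeneity_structure :: "'a space \<Rightarrow> (real \<Rightarrow> 'a \<Rightarrow> 'a) \<Rightarrow> bool" where
  "homogeneity_structure M h \<longleftrightarrow>
     smooth_map (prod_space real_line M) M (\<lambda>(t, p). h t p) \<and>
     (\<forall>p\<in>pts M. h 1 p = p) \<and>
     (\<forall>t s. \<forall>p\<in>pts M. h t (h s p) = h (t * s) p)"

text \<open>Note that 0 ^ 0 = 1: coordinates of weight 0 are invariant under h 0 as well.\<close>

definition homogeneous_chart ::
  "nat \<Rightarrow> 'a space \<Rightarrow> (real \<Rightarrow> 'a \<Rightarrow> 'a) \<Rightarrow> 'a set \<Rightarrow> ('a \<Rightarrow> nat \<Rightarrow> real) \<Rightarrow> (nat \<Rightarrow> nat) \<Rightarrow> bool" where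
  "homogeneous_chart n M h U x w \<longleftrightarrow> chart n M U x \<and> (\<forall>t. h t ` U \<subseteq> U) \<and>
     (\<forall>i<n. \<forall>t. \<forall>q\<in>U. x (h t q) i = t ^ w i * x q i)"

definition graded_bundle :: "nat \<Rightarrow> 'a space \<Rightarrow> (real \<Rightarrow> 'a \<Rightarrow> 'a) \<Rightarrow> bool" where
  "graded_bundle k M h \<longleftrightarrow> homogeneity_structure M h \<and>
     (\<exists>n. manifold n M \<and>
        (\<forall>p\<in>pts M. \<exists>U x w. p \<in> U \<and> homogeneous_chart n M h U x w \<and> (\<forall>i<n. w i \<le> k)))"


section \<open>Lie groupoids\<close>

record ('g, 'b) groupoid =
  arrows :: "'g space"
  objects :: "'b space"
  src :: "'g \<Rightarrow> 'b"
  tgt :: "'g \<Rightarrow> 'b"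
  ident :: "'b \<Rightarrow> 'g"
  mult :: "'g \<Rightarrow> 'g \<Rightarrow> 'g"
  ginv :: "'g \<Rightarrow> 'g"

text \<open>The product of g and g' is defined if the source of g is the target of g'.\<close>

definition composable :: "('g, 'b) groupoid \<Rightarrow> ('g \<times> 'g) set" where
  "composable G = {(g, g'). g \<in> pts (arrows G) \<and> g' \<in> pts (arrows G) \<and> src G g = tgt G g'}"

definition lie_groupoid :: "('g, 'b) groupoid \<Rightarrow> bool" where
  "lie_groupoid G \<longleftrightarrow>
     (\<exists>n. manifold n (arrows G)) \<and> (\<exists>m. manifold m (objects G)) \<and>
     submersion (arrows G) (objects G) (src G) \<and>
     submersion (arrows G) (objects G) (tgt G) \<and>
     smooth_map (objects G) (arrows G) (ident G) \<and>
     smooth_map (subspace_of (prod_space (arrows G) (arrows G)) (composable G)) (arrows G)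
       (\<lambda>(g, g'). mult G g g') \<and>
     smooth_map (arrows G) (arrows G) (ginv G) \<and>
     (\<forall>b\<in>pts (objects G). src G (ident G b) = b \<and> tgt G (ident G b) = b) \<and>
     (\<forall>(g, g')\<in>composable G. src G (mult G g g') = src G g' \<and> tgt G (mult G g g') = tgt G g) \<and>
     (\<forall>g g' g''. (g, g') \<in> composable G \<and> (g', g'') \<in> composable G \<longrightarrow>
        mult G (mult G g g') g'' = mult G g (mult G g' g'')) \<and>
     (\<forall>g\<in>pts (arrows G). mult G g (ident G (src G g)) = g \<and> mult G (ident G (tgt G g)) g = g) \<and>
     (\<forall>g\<in>pts (arrows G). src G (ginv G g) = tgt G g \<and> tgt G (ginv G g) = src G g \<and>
        mult G g (ginv G g) = ident G (tgt G g) \<and> mult G (ginv G g) g = ident G (src G g))"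

definition groupoid_morphism ::
  "('g, 'b) groupoid \<Rightarrow> ('g1, 'b1) groupoid \<Rightarrow> ('g \<Rightarrow> 'g1) \<Rightarrow> ('b \<Rightarrow> 'b1) \<Rightarrow> bool" where
  "groupoid_morphism G H \<Phi> \<phi> \<longleftrightarrow>
     smooth_map (arrows G) (arrows H) \<Phi> \<and> smooth_map (objects G) (objects H) \<phi> \<and>
     (\<forall>g\<in>pts (arrows G). src H (\<Phi> g) = \<phi> (src G g) \<and> tgt H (\<Phi> g) = \<phi> (tgt G g)) \<and>
     (\<forall>b\<in>pts (objects G). \<Phi> (ident G b) = ident H (\<phi> b)) \<and>
     (\<forall>(g, g')\<in>composable G. \<Phi> (mult G g g') = mult H (\<Phi> g) (\<Phi> g'))"

definition weighted_lie_groupoid ::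
  "nat \<Rightarrow> ('g, 'b) groupoid \<Rightarrow> (real \<Rightarrow> 'g \<Rightarrow> 'g) \<Rightarrow> bool" where
  "weighted_lie_groupoid k G h \<longleftrightarrow> lie_groupoid G \<and> graded_bundle k (arrows G) h \<and>
     (\<forall>t. groupoid_morphism G G (h t) (\<lambda>b. src G (h t (ident G b))))"


section \<open>Graded-linear bundles and superfunctions\<close>

definition gl_bundle ::
  "nat \<Rightarrow> 'd space \<Rightarrow> (real \<Rightarrow> 'd \<Rightarrow> 'd) \<Rightarrow> (real \<Rightarrow> 'd \<Rightarrow> 'd) \<Rightarrow> bool" where
  "gl_bundle k D h l \<longleftrightarrow> 1 \<le> k \<and> graded_bundle (k - 1) D h \<and> graded_bundle 1 D l \<and>
     (\<forall>t s. \<forall>e\<in>pts D. h t (l s e) = l s (h t e))"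

text \<open>The vector bundle given by a homogeneity structure l of degree 1 on D: its base is embedded
  as the zero section, the image of l 0, and the linear functions are those of weight 1.
  Since they separate the points of a fibre, they determine the addition.\<close>

definition vb_base :: "'d space \<Rightarrow> (real \<Rightarrow> 'd \<Rightarrow> 'd) \<Rightarrow> 'd set" where
  "vb_base D l = l 0 ` pts D"

definition vb_fibre :: "'d space \<Rightarrow> (real \<Rightarrow> 'd \<Rightarrow> 'd) \<Rightarrow> 'd \<Rightarrow> 'd set" where
  "vb_fibre D l b = {e \<in> pts D. l 0 e = b}"

definition linear_functions :: "'d space \<Rightarrow> (real \<Rightarrow> 'd \<Rightarrow> 'd) \<Rightarrow> ('d \<Rightarrow> real) set" where
  "linear_functions D l = {f \<in> Cinf D. \<forall>t. \<forall>e\<in>pts D. f (l t e) = t * f e}"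

definition vb_add :: "'d space \<Rightarrow> (real \<Rightarrow> 'd \<Rightarrow> 'd) \<Rightarrow> 'd \<Rightarrow> 'd \<Rightarrow> 'd" where
  "vb_add D l u v = (THE e. e \<in> vb_fibre D l (l 0 u) \<and>
     (\<forall>f\<in>linear_functions D l. f e = f u + f v))"

definition fibre_power :: "'d space \<Rightarrow> (real \<Rightarrow> 'd \<Rightarrow> 'd) \<Rightarrow> nat \<Rightarrow> ('d \<times> 'd list) space" where
  "fibre_power D l p = generated_space
     {(b, es). b \<in> vb_base D l \<and> set es \<subseteq> vb_fibre D l b \<and> length es = p}
     ({f \<circ> fst |f. f \<in> Cinf D} \<union> {\<lambda>(b, es). f (es ! i) |f i. f \<in> Cinf D \<and> i < p})"

text \<open>
  Reversing the parity of the linear fibre coordinates turns D into a supermanifold whose smooth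
  functions are the smooth sections of the exterior algebra of the dual bundle. Such a section
  is encoded as a function \<^term>\<open>\<omega>\<close> of a base point b and a list of vectors in the fibre over b;
  its component of degree p, an alternating p-linear form, is given by the lists of length p.
  The values elsewhere are set to 0. Since the components of degree above the rank
  vanish, no finiteness condition is needed.
\<close>

type_synonym 'd sfun = "'d \<Rightarrow> 'd list \<Rightarrow> real"

definition superfunctions :: "'d space \<Rightarrow> (real \<Rightarrow> 'd \<Rightarrow> 'd) \<Rightarrow> 'd sfun set" where
  "superfunctions D l = {\<omega>.
     (\<forall>b es. \<not> (b \<in> vb_base D l \<and> set es \<subseteq> vb_fibre D l b) \<longrightarrow> \<omega> b es = 0) \<and>
     (\<forall>p. (\<lambda>(b, es). \<omega> b es) \<in> Cinf (fibre_power D l p)) \<and>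
     (\<forall>b\<in>vb_base D l. \<forall>es. set es \<subseteq> vb_fibre D l b \<longrightarrow>
        (\<forall>i<length es. \<forall>u\<in>vb_fibre D l b. \<forall>v\<in>vb_fibre D l b.
           \<omega> b (es[i := vb_add D l u v]) = \<omega> b (es[i := u]) + \<omega> b (es[i := v])) \<and>
        (\<forall>i<length es. \<forall>u\<in>vb_fibre D l b. \<forall>t.
           \<omega> b (es[i := l t u]) = t * \<omega> b (es[i := u])) \<and>
        (\<forall>i<length es. \<forall>j<length es. i \<noteq> j \<and> es ! i = es ! j \<longrightarrow> \<omega> b es = 0))}"

text \<open>The exterior product is the signed sum over all shuffles; I is the set of positions of the
  arguments of the first factor.\<close>

definition wedge :: "'d sfun \<Rightarrow> 'd sfun \<Rightarrow> 'd sfun" where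
  "wedge \<omega> \<eta> = (\<lambda>b es. \<Sum>I\<in>Pow {..<length es}.
     (-1) ^ card {(i, j). i \<in> I \<and> j \<in> {..<length es} - I \<and> j < i}
       * \<omega> b (nths es I) * \<eta> b (nths es (- I)))"

definition has_parity :: "nat \<Rightarrow> 'd sfun \<Rightarrow> bool" where
  "has_parity d \<omega> \<longleftrightarrow> (\<forall>b es. \<omega> b es \<noteq> 0 \<longrightarrow> even (length es + d))"

text \<open>An odd vector field on the supermanifold, as an odd derivation of its functions.\<close>

definition odd_vector_field ::
  "'d space \<Rightarrow> (real \<Rightarrow> 'd \<Rightarrow> 'd) \<Rightarrow> ('d sfun \<Rightarrow> 'd sfun) \<Rightarrow> bool" where
  "odd_vector_field D l Q \<longleftrightarrow>
     (\<forall>\<omega>\<in>superfunctions D l. Q \<omega> \<in> superfunctions D l) \<and>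
     (\<forall>\<omega>\<in>superfunctions D l. \<forall>\<eta>\<in>superfunctions D l.
        Q (\<lambda>b es. \<omega> b es + \<eta> b es) = (\<lambda>b es. Q \<omega> b es + Q \<eta> b es)) \<and>
     (\<forall>\<omega>\<in>superfunctions D l. \<forall>c. Q (\<lambda>b es. c * \<omega> b es) = (\<lambda>b es. c * Q \<omega> b es)) \<and>
     (\<forall>\<omega>\<in>superfunctions D l. \<forall>d. has_parity d \<omega> \<longrightarrow> has_parity (d + 1) (Q \<omega>)) \<and>
     (\<forall>\<omega>\<in>superfunctions D l. \<forall>\<eta>\<in>superfunctions D l. \<forall>d. has_parity d \<omega> \<longrightarrow>
        Q (wedge \<omega> \<eta>) = (\<lambda>b es. wedge (Q \<omega>) \<eta> b es + (-1) ^ d * wedge \<omega> (Q \<eta>) b es))"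

definition homological :: "'d space \<Rightarrow> (real \<Rightarrow> 'd \<Rightarrow> 'd) \<Rightarrow> ('d sfun \<Rightarrow> 'd sfun) \<Rightarrow> bool" where
  "homological D l Q \<longleftrightarrow> odd_vector_field D l Q \<and>
     (\<forall>\<omega>\<in>superfunctions D l. Q (Q \<omega>) = (\<lambda>b es. 0))"

text \<open>Pullback of superfunctions by the parity reversed version of \<^term>\<open>\<phi>\<close>, which commutes with l
  and hence maps the base to the base and is linear on the fibres.\<close>

definition sf_pullback ::
  "'d space \<Rightarrow> (real \<Rightarrow> 'd \<Rightarrow> 'd) \<Rightarrow> ('d \<Rightarrow> 'd) \<Rightarrow> 'd sfun \<Rightarrow> 'd sfun" where
  "sf_pullback D l \<phi> \<omega> = (\<lambda>b es. if b \<in> vb_base D l \<and> set es \<subseteq> vb_fibre D l b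
     then \<omega> (\<phi> b) (map \<phi> es) else 0)"

definition weighted_lie_algebroid ::
  "nat \<Rightarrow> 'd space \<Rightarrow> (real \<Rightarrow> 'd \<Rightarrow> 'd) \<Rightarrow> (real \<Rightarrow> 'd \<Rightarrow> 'd) \<Rightarrow> ('d sfun \<Rightarrow> 'd sfun) \<Rightarrow> bool" where
  "weighted_lie_algebroid k D h l Q \<longleftrightarrow> gl_bundle k D h l \<and> homological D l Q \<and>
     (\<forall>t. \<forall>\<omega>\<in>superfunctions D l.
        Q (sf_pullback D l (h t) \<omega>) = sf_pullback D l (h t) (Q \<omega>)) \<and>
     (\<forall>s. \<forall>\<omega>\<in>superfunctions D l.
        (\<lambda>b es. s * Q (sf_pullback D l (l s) \<omega>) b es) = sf_pullback D l (l s) (Q \<omega>))"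


section \<open>The Lie algebroid of a Lie groupoid\<close>

definition lie_pts :: "('g, 'b) groupoid \<Rightarrow> ('g \<times> 'g tvec) set" where
  "lie_pts G = {(p, v) \<in> pts (tangent_bundle (arrows G)). p \<in> ident G ` pts (objects G) \<and>
     snd (tangent_map (arrows G) (objects G) (src G) (p, v)) = (\<lambda>f. 0)}"

definition lie_alg :: "('g, 'b) groupoid \<Rightarrow> ('g \<times> 'g tvec) space" where
  "lie_alg G = subspace_of (tangent_bundle (arrows G)) (lie_pts G)"

definition lie_scale :: "real \<Rightarrow> 'g \<times> 'g tvec \<Rightarrow> 'g \<times> 'g tvec" where
  "lie_scale s = (\<lambda>(p, v). (p, \<lambda>f. s * v f))"

definition lie_map ::
  "('g, 'b) groupoid \<Rightarrow> ('g1, 'b1) groupoid \<Rightarrow> ('g \<Rightarrow> 'g1) \<Rightarrow> 'g \<times> 'g tvec \<Rightarrow> 'g1 \<times> 'g1 tvec" where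
  "lie_map G H \<Phi> = restrict (tangent_map (arrows G) (arrows H) \<Phi>) (lie_pts G)"

definition lie_sections :: "('g, 'b) groupoid \<Rightarrow> ('b \<Rightarrow> 'g \<times> 'g tvec) set" where
  "lie_sections G = {\<sigma>. smooth_map (objects G) (lie_alg G) \<sigma> \<and>
     (\<forall>b\<in>pts (objects G). fst (\<sigma> b) = ident G b)}"

text \<open>A vector field tangent to the source fibres is right-invariant if, for every arrow a, its
  restrictions to the source fibre over the target of a and to the one over the source of a
  are related by right translation by a. In the last clause f' extends the pullback of f by this
  translation, which is defined on the former fibre only, to a smooth function on all arrows.\<close>

definition right_invariant :: "('g, 'b) groupoid \<Rightarrow> ('g \<Rightarrow> 'g tvec) \<Rightarrow> bool" where
  "right_invariant G X \<longleftrightarrow> vector_field (arrows G) X \<and>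
     (\<forall>g\<in>pts (arrows G). \<forall>f\<in>Cinf (objects G). X g (f \<circ> src G) = 0) \<and>
     (\<forall>a\<in>pts (arrows G). \<forall>f\<in>Cinf (arrows G). \<forall>f'\<in>Cinf (arrows G).
        (\<forall>g. (g, a) \<in> composable G \<longrightarrow> f' g = f (mult G g a)) \<longrightarrow>
        (\<forall>g. (g, a) \<in> composable G \<longrightarrow> X g f' = X (mult G g a) f))"

definition right_invariant_extension ::
  "('g, 'b) groupoid \<Rightarrow> ('b \<Rightarrow> 'g \<times> 'g tvec) \<Rightarrow> 'g \<Rightarrow> 'g tvec" where
  "right_invariant_extension G \<sigma> = (THE X. right_invariant G X \<and>
     (\<forall>b\<in>pts (objects G). X (ident G b) = snd (\<sigma> b)))"

definition lie_bracket ::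
  "('g, 'b) groupoid \<Rightarrow> ('b \<Rightarrow> 'g \<times> 'g tvec) \<Rightarrow> ('b \<Rightarrow> 'g \<times> 'g tvec) \<Rightarrow> 'b \<Rightarrow> 'g \<times> 'g tvec" where
  "lie_bracket G \<sigma> \<tau> = (\<lambda>b. (ident G b,
     vf_bracket (arrows G) (right_invariant_extension G \<sigma>) (right_invariant_extension G \<tau>)
       (ident G b)))"

definition lie_anchor :: "('g, 'b) groupoid \<Rightarrow> 'g \<times> 'g tvec \<Rightarrow> 'b \<times> 'b tvec" where
  "lie_anchor G = tangent_map (arrows G) (objects G) (tgt G)"

definition sf_eval ::
  "('g, 'b) groupoid \<Rightarrow> ('g \<times> 'g tvec) sfun \<Rightarrow> ('b \<Rightarrow> 'g \<times> 'g tvec) list \<Rightarrow> 'b \<Rightarrow> real" where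
  "sf_eval G \<omega> \<sigma>s = (\<lambda>b. \<omega> (ident G b, \<lambda>f. 0) (map (\<lambda>\<sigma>. \<sigma> b) \<sigma>s))"

text \<open>The homological vector field of the Lie algebroid is its de Rham differential, given by
  Cartan's formula in terms of anchor and bracket.\<close>

definition cartan_formula ::
  "('g, 'b) groupoid \<Rightarrow> ('g \<times> 'g tvec) sfun \<Rightarrow> ('b \<Rightarrow> 'g \<times> 'g tvec) list \<Rightarrow> 'b \<Rightarrow> real" where
  "cartan_formula G \<omega> \<sigma>s = (\<lambda>b.
     (\<Sum>i<length \<sigma>s. (-1) ^ i *
        snd (lie_anchor G ((\<sigma>s ! i) b)) (sf_eval G \<omega> (nths \<sigma>s (- {i})))) +
     (\<Sum>j<length \<sigma>s. \<Sum>i<j. (-1) ^ (i + j) *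
        sf_eval G \<omega> (lie_bracket G (\<sigma>s ! i) (\<sigma>s ! j) # nths \<sigma>s (- {i, j})) b))"

definition lie_differential ::
  "('g, 'b) groupoid \<Rightarrow> ('g \<times> 'g tvec) sfun \<Rightarrow> ('g \<times> 'g tvec) sfun" where
  "lie_differential G \<omega> = (THE \<eta>. \<eta> \<in> superfunctions (lie_alg G) lie_scale \<and>
     (\<forall>\<sigma>s b. set \<sigma>s \<subseteq> lie_sections G \<and> b \<in> pts (objects G) \<longrightarrow>
        sf_eval G \<eta> \<sigma>s b = cartan_formula G \<omega> \<sigma>s b))"

end

theory Submission
 imports Defs "HOL-Homology.Invariance_of_Domain" "HOL-Library.Function_Algebras"
begin

text \<open>
 A vector tangent to the source fibres at a unit extends to a right-invariant vector field. Thus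
 the sections of the Lie algebroid form a Lie-Rinehart algebra over the functions on the objects,
 superfunctions are the alternating function-multilinear forms on it (tensoriality follows from
 local frames), and the homological vector field is its Chevalley-Eilenberg differential, for which
 square zero and the Leibniz rule follow from Cartan calculus. For t different from 0, h t is an
 automorphism of the groupoid, so it acts on right-invariant vector fields and its lift commutes
 with the differential by naturality; both sides of this identity are smooth in t, whence the case
 t = 0.

 Homogeneous coordinates of the Lie algebroid arise from homogeneous coordinates x of the arrows near
 the limit unit h 0 p: some of the restrictions of x to the units are base coordinates, and the
 differentials of suitable other x are fibre coordinates of the same weight. The lift of h
 contracts towards these units, so the coordinates extend by homogeneity. All charts are found
 by exchanging one coordinate at a time for a function, which reduces the inverse function theorem to
 invariance of domain and the mean value theorem.
\<close>


section \<open>Smooth functions on open subsets of Euclidean space\<close>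

text \<open>A coinductive predicate offers no induction for closure properties, so smoothness is
  first split into the finite orders \<open>ck k\<close>. Charts are local while \<open>Cinf\<close>
  and tangent vectors are global; calculus is therefore done with germs (\<open>smooth_at\<close>,
  \<open>smap_at\<close>, \<open>tv\<close>), and cut-off functions lead from germs back to global
  functions. Three obstacles shape the groupoid part. Right translation by an arrow a is defined on
  one source fibre only, so smoothness of right-invariant fields needs a family of local sections of
  the target map passing through the arrows near a. At t = 0 the map \<open>h t\<close> is in
  general not invertible: fields cannot be pushed forward, and that the pullback of a form is a form
  has to be shown pointwise, for all t, before a passage to the limit makes sense. Finally, the
  addition in a fibre is given only through functions of weight 1; that such functions are additive
  is a statement about their derivative at the zero section.\<close>

abbreviation "E n \<equiv> topspace (Euclidean_space n)"
abbreviation "open_E n \<equiv> openin (Euclidean_space n)"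
abbreviation "open_in M \<equiv> openin (top_of M)"
abbreviation "ES \<equiv> Euclidean_space"
abbreviation "TS \<equiv> tangent_space"

definition tup :: "nat => (nat => real) => nat => real" where
 "tup m c = (\<lambda>i. if i < m then c i else 0)"

text \<open>Open cubes form a neighbourhood basis of \<open>Euclidean_space n\<close>, which carries
  the product topology; with them openness and continuity become epsilon-delta statements in
  coordinates.\<close>

definition box_at :: "nat => (nat => real) => real => (nat => real) set" where
 "box_at n x e = {y \<in> E n. \<forall>i<n. \<bar>y i - x i\<bar> < e}"

lemma mem_E: "x \<in> E n \<longleftrightarrow> (\<forall>i\<ge>n. x i = 0)"
 by (simp add: topspace_Euclidean_space)

lemma tup_in_E [simp]: "tup m c \<in> E m"
 by (simp add: mem_E tup_def)

lemma tup_id: "x \<in> E m ==> tup m x = x"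
 by (auto simp: mem_E tup_def fun_eq_iff)

lemma tup_nth [simp]: "i < m ==> tup m c i = c i"
 by (simp add: tup_def)

lemma tup_cong: "(!!i. i < m ==> c i = d i) ==> tup m c = tup m d"
 by (auto simp: tup_def)

lemma E_eqI: "x \<in> E n ==> y \<in> E n ==> (!!i. i < n ==> x i = y i) ==> x = y"
 by (auto simp: mem_E fun_eq_iff) (metis not_le)

lemma upd_in_E: "x \<in> E n ==> i < n ==> x(i := t) \<in> E n"
 by (auto simp: mem_E)

lemma openin_box_at: "open_E n (box_at n x e)"
proof -
 have 1: "open_E n {y \<in> E n. y i \<in> {t. \<bar>t - x i\<bar> < e}}" for i
 proof (rule openin_continuous_map_preimage)
  show "continuous_map (ES n) euclideanreal (\<lambda>y. y i)"
   unfolding Euclidean_space_def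
   by (intro continuous_map_from_subtopology continuous_map_product_projection) simp
  have "{t. \<bar>t - x i\<bar> < e} = ball (x i) e"
   by (auto simp: dist_real_def)
  then show "openin euclideanreal {t. \<bar>t - x i\<bar> < e}"
   by simp
 qed
 have "box_at n x e = E n \<inter> (\<Inter>i\<in>{..<n}. {y \<in> E n. y i \<in> {t. \<bar>t - x i\<bar> < e}})"
  by (auto simp: box_at_def)
 then show ?thesis
  using 1 by (cases "n = 0") (auto intro!: openin_Inter openin_Int)
qed

lemma box_at_self: "x \<in> E n ==> e > 0 ==> x \<in> box_at n x e"
 by (simp add: box_at_def)

lemma box_at_mono: "d \<le> e ==> box_at n x d \<subseteq> box_at n x e"
 by (fastforce simp: box_at_def)

text \<open>Points of \<open>E n\<close> agree from index n on, so of the factors of a basic open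
  set of the product topology only the first n restrict anything, and the least of n radii
  suffices.\<close>

lemma openE_box:
 assumes "open_E n U" "x \<in> U"
 shows "\<exists>e>0. box_at n x e \<subseteq> U"
proof -
 obtain T where T: "openin (powertop_real UNIV) T" "U = T \<inter> {x. \<forall>i\<ge>n. x i = 0}"
  using assms(1) unfolding Euclidean_space_def openin_subtopology by auto
 then have "x \<in> T" "\<forall>x\<in>T. \<exists>X. finite {i. X i ~= UNIV} \<and> (\<forall>i. open (X i)) \<and> x \<in> Pi UNIV X \<and> Pi UNIV X \<subseteq> T"
  using assms(2) unfolding openin_product_topology_alt by (auto simp: PiE_UNIV_domain)
 then obtain X where X: "!!i. open (X i)" "x \<in> Pi UNIV X" "Pi UNIV X \<subseteq> T"
  by blast
 have "\<exists>e>0. \<forall>t. \<bar>t - x i\<bar> < e --> t \<in> X i" for i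
  using X(1)[of i] X(2) unfolding open_dist dist_real_def by auto
 then obtain e where e: "!!i. e i > 0" "!!i t. \<bar>t - x i\<bar> < e i ==> t \<in> X i"
  by metis
 \<comment> \<open>The extra element 1 keeps the minimum defined for n = 0.\<close>
 define d where "d = Min (insert 1 (e ` {..<n}))"
 have d: "d > 0" "!!i. i < n ==> d \<le> e i"
  using e(1) by (auto simp: d_def)
 have "box_at n x d \<subseteq> U"
 proof
  fix y assume y: "y \<in> box_at n x d"
  have "y i \<in> X i" for i
  proof (cases "i < n")
   case True
   then have "\<bar>y i - x i\<bar> < e i"
    using y d(2)[OF True] by (fastforce simp: box_at_def)
   then show ?thesis by (rule e(2))
  next
   case False
   then have "y i = x i"
    using y assms(2) T(2) by (simp add: box_at_def mem_E)
   then show ?thesis using X(2) by (simp add: Pi_iff)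
  qed
  then have "y \<in> T"
   using X(3) by blast
  then show "y \<in> U"
   using T(2) y by (simp add: box_at_def mem_E)
 qed
 then show ?thesis using d(1) by blast
qed

lemma openE_iff: "open_E n U \<longleftrightarrow> U \<subseteq> E n \<and> (\<forall>x\<in>U. \<exists>e>0. box_at n x e \<subseteq> U)"
proof
 show "open_E n U" if *: "U \<subseteq> E n \<and> (\<forall>x\<in>U. \<exists>e>0. box_at n x e \<subseteq> U)"
 proof (subst openin_subopen, intro ballI)
  fix x assume "x \<in> U"
  then obtain e where "e > 0" "box_at n x e \<subseteq> U"
   using * by blast
  then show "\<exists>T. open_E n T \<and> x \<in> T \<and> T \<subseteq> U"
   using * openin_box_at[of n x e] box_at_self[of x n e] \<open>x \<in> U\<close> by blast
 qed
 show "U \<subseteq> E n \<and> (\<forall>x\<in>U. \<exists>e>0. box_at n x e \<subseteq> U)" if "open_E n U"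
  using openin_subset[OF that] openE_box[OF that] by blast
qed

lemma openE_sub: "open_E n U ==> x \<in> U ==> x \<in> E n"
 by (auto dest: openin_subset)

lemma Euclidean_space_eq: "ES n = top_of_set (E n)"
 by (simp add: Euclidean_space_def topspace_Euclidean_space euclidean_product_topology)

lemma subtop_E: "U \<subseteq> E n ==> subtopology (ES n) U = top_of_set U"
 by (subst Euclidean_space_eq) (simp add: subtopology_subtopology Int_absorb1)

lemma cont_E_iff: "U \<subseteq> E n ==>
  continuous_map (subtopology (ES n) U) euclideanreal F \<longleftrightarrow> continuous_on U F"
 by (simp add: subtop_E)

lemma cont_box:
 fixes F :: "(nat => real) => real"
 assumes "open_E n U" "continuous_on U F" "x \<in> U" "e > 0"
 shows "\<exists>d>0. \<forall>y\<in>box_at n x d. y \<in> U \<and> \<bar>F y - F x\<bar> < e"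
proof -
 have "openin (top_of_set U) (U \<inter> F -` ball (F x) e)"
  using assms(2) by (rule continuous_openin_preimage_gen) simp
 then have "open_E n (U \<inter> F -` ball (F x) e)"
  using assms(1) subtop_E[of U n] openin_subset by (metis openin_trans_full)
 moreover have "x \<in> U \<inter> F -` ball (F x) e"
  using assms by simp
 ultimately obtain d where "d > 0" "box_at n x d \<subseteq> U \<inter> F -` ball (F x) e"
  using openE_box by blast
 then show ?thesis
  by (intro exI[of _ d]) (auto simp: dist_real_def abs_minus_commute)
qed

lemma cont_onI_box:
 fixes F :: "(nat => real) => real"
 assumes "U \<subseteq> E n"
  and "!!x e. x \<in> U ==> e > 0 ==> \<exists>d>0. \<forall>y\<in>box_at n x d. y \<in> U --> \<bar>F y - F x\<bar> < e"
 shows "continuous_on U F"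
proof -
 have "openin (top_of_set U) (U \<inter> F -` T)" if T: "open T" for T
 proof (subst openin_subopen, safe)
  fix x assume x: "x \<in> U" "F x \<in> T"
  obtain e where e: "e > 0" "ball (F x) e \<subseteq> T"
   using T x(2) open_contains_ball by blast
  obtain d where d: "d > 0" "\<forall>y\<in>box_at n x d. y \<in> U --> \<bar>F y - F x\<bar> < e"
   using assms(2)[OF x(1) e(1)] by blast
  have "openin (top_of_set U) (U \<inter> box_at n x d)"
   using openin_box_at[of n x d] assms(1) subtop_E[of U n]
   by (metis openin_subtopology_Int2)
  moreover have "x \<in> U \<inter> box_at n x d"
   using x d assms(1) by (auto intro: box_at_self)
  moreover have "U \<inter> box_at n x d \<subseteq> U \<inter> F -` T"
   using d e(2) by (auto simp: dist_real_def abs_minus_commute subset_iff)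
  ultimately show "\<exists>V. openin (top_of_set U) V \<and> x \<in> V \<and> V \<subseteq> U \<inter> F -` T"
   by blast
 qed
 then show ?thesis
  by (simp add: continuous_on_open_gen[of F U UNIV])
qed

lemma eventually_upd:
 assumes "open_E n U" "x \<in> U" "i < n"
 shows "eventually (\<lambda>t. x(i := t) \<in> U) (nhds (x i))"
proof -
 obtain e where e: "e > 0" "box_at n x e \<subseteq> U"
  using openE_box assms by blast
 have "\<forall>t. dist t (x i) < e --> x(i := t) \<in> U"
  using e upd_in_E openE_sub[OF assms(1,2)] assms(3)
  by (fastforce simp: box_at_def dist_real_def)
 then show ?thesis
  using e(1) eventually_nhds_metric by blast
qed

subsection \<open>Functions of class C k\<close>

definition pd :: "nat => ((nat => real) => real) => (nat => real) => real" where
 "pd i F x = deriv (\<lambda>t. F (x(i := t))) (x i)"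

text \<open>The finite-order counterpart of the coinductive \<open>smooth_on\<close>, with the
  partial derivatives fixed to \<open>pd i F\<close>. Closure properties are proved for each k by
  induction and transferred through \<open>smooth_on_iff_ck\<close>.\<close>

fun ck :: "nat => nat => (nat => real) set => ((nat => real) => real) => bool" where
 "ck 0 n U F \<longleftrightarrow> continuous_on U F"
| "ck (Suc k) n U F \<longleftrightarrow> continuous_on U F \<and>
  (\<forall>i<n. (\<forall>x\<in>U. ((\<lambda>t. F (x(i := t))) has_real_derivative pd i F x) (at (x i))) \<and> ck k n U (pd i F))"

lemma ck_continuous: "ck k n U F ==> continuous_on U F"
 by (cases k) auto

lemma pdI: "((\<lambda>t. F (x(i := t))) has_real_derivative D) (at (x i)) ==> pd i F x = D"
 unfolding pd_def by (rule DERIV_imp_deriv)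

lemma deriv_upd_cong:
 assumes "open_E n U" "x \<in> U" "i < n" "!!y. y \<in> U ==> F y = G y"
 shows "((\<lambda>t. F (x(i := t))) has_real_derivative D) (at (x i)) \<longleftrightarrow>
    ((\<lambda>t. G (x(i := t))) has_real_derivative D) (at (x i))"
 by (rule DERIV_cong_ev[OF refl _ refl])
  (use eventually_upd[OF assms(1-3)] assms(4) in "auto elim: eventually_mono")

lemma pd_cong:
 assumes "open_E n U" "x \<in> U" "i < n" "!!y. y \<in> U ==> F y = G y"
 shows "pd i F x = pd i G x"
 unfolding pd_def deriv_def using deriv_upd_cong[of n U x i F G] assms by simp

text \<open>Openness matters: a partial derivative at x depends on the values at nearby points of a
  coordinate line, so the functions must agree on a neighbourhood.\<close>

lemma ck_cong:
 assumes "open_E n U" "!!y. y \<in> U ==> F y = G y" "ck k n U F"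
 shows "ck k n U G"
 using assms(2,3)
proof (induction k arbitrary: F G)
 case 0
 then show ?case by (auto cong: continuous_on_cong)
next
 case (Suc k)
 have "continuous_on U G"
  using Suc.prems by (auto cong: continuous_on_cong)
 moreover have "((\<lambda>t. G (x(i := t))) has_real_derivative pd i G x) (at (x i))"
  if "i < n" "x \<in> U" for i x
 proof -
  have "((\<lambda>t. F (x(i := t))) has_real_derivative pd i F x) (at (x i))"
   using that Suc.prems(2) by simp
  then show ?thesis
   using deriv_upd_cong[OF assms(1) that(2,1), of F G] pd_cong[OF assms(1) that(2,1), of F G]
    Suc.prems(1) by simp
 qed
 moreover have "ck k n U (pd i G)" if "i < n" for i
 proof (rule Suc.IH[of "pd i F"])
  show "pd i F y = pd i G y" if "y \<in> U" for y
   by (rule pd_cong[OF assms(1) that \<open>i < n\<close> Suc.prems(1)])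
  show "ck k n U (pd i F)"
   using Suc.prems(2) that by simp
 qed
 ultimately show ?case by simp
qed

text \<open>Frees applications from \<open>pd\<close>: since derivatives are unique, any formulas
  for the partial derivatives may be supplied.\<close>

lemma ck_SucI:
 assumes "open_E n U" "continuous_on U F"
  and "!!i x. i < n ==> x \<in> U ==> ((\<lambda>t. F (x(i := t))) has_real_derivative F' i x) (at (x i))"
  and "!!i. i < n ==> ck k n U (F' i)"
 shows "ck (Suc k) n U F"
proof -
 have *: "pd i F x = F' i x" if "i < n" "x \<in> U" for i x
  using assms(3) that pdI by blast
 then have "ck k n U (pd i F)" if "i < n" for i
  using ck_cong[OF assms(1) _ assms(4)[OF that], of "pd i F"] that by simp
 then show ?thesis
  using assms(2,3) * by simp
qed

lemma ck_lower: "ck (Suc k) n U F ==> ck k n U F"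
 by (induction k arbitrary: F) auto

lemma smooth_on_iff_ck:
 assumes U: "open_E n U"
 shows "smooth_on n U F \<longleftrightarrow> (\<forall>k. ck k n U F)"
proof
 have UE: "U \<subseteq> E n" using U openin_subset by blast
 show "\<forall>k. ck k n U F" if "smooth_on n U F"
 proof
  fix k show "ck k n U F"
   using that
  proof (induction k arbitrary: F)
   case 0
   then show ?case by cases (simp add: cont_E_iff[OF UE])
  next
   case (Suc k)
   obtain F' where "continuous_on U F"
    "!!i x. i < n ==> x \<in> U ==> ((\<lambda>t. F (x(i := t))) has_real_derivative F' i x) (at (x i))"
    "!!i. i < n ==> smooth_on n U (F' i)"
    using Suc.prems by cases (use cont_E_iff[OF UE] in blast)
   then show ?case
    using Suc.IH ck_SucI[OF U] by blast
  qed
 qed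
 show "smooth_on n U F" if "\<forall>k. ck k n U F"
  using that
 \<comment> \<open>The invariant is to be of class \<open>ck k\<close> for every k; the functions
   \<open>pd i F\<close> are the derivatives that the coinductive rule asks for.\<close>
 proof (coinduction arbitrary: F)
  case (smooth_on F)
  then have "ck (Suc k) n U F" for k by blast
  then show ?case
   by (intro exI[of _ F] exI[of _ "\<lambda>i. pd i F"]) (auto simp: cont_E_iff[OF UE])
 qed
qed

lemma smooth_on_continuous: "open_E n U ==> smooth_on n U F ==> continuous_on U F"
 using smooth_on_iff_ck[of n U F] ck.simps(1)[of n U F] by blast

lemma smooth_on_deriv:
 assumes "open_E n U" "smooth_on n U F" "i < n" "x \<in> U"
 shows "((\<lambda>t. F (x(i := t))) has_real_derivative pd i F x) (at (x i))"
proof -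
 have "ck (Suc 0) n U F"
  using assms(2) smooth_on_iff_ck[OF assms(1)] by blast
 then show ?thesis using assms by simp
qed

lemma smooth_on_pd:
 assumes "open_E n U" "smooth_on n U F" "i < n"
 shows "smooth_on n U (pd i F)"
proof -
 have "ck (Suc k) n U F" for k
  using assms(2) smooth_on_iff_ck[OF assms(1)] by blast
 then show ?thesis using assms(3) by (simp add: smooth_on_iff_ck[OF assms(1)])
qed

lemma smooth_on_cong:
 assumes "open_E n U" "!!y. y \<in> U ==> F y = G y" "smooth_on n U F"
 shows "smooth_on n U G"
proof -
 have "ck k n U G" for k
 proof (rule ck_cong[of n U F G, OF assms(1,2)])
  show "ck k n U F" using assms(3) smooth_on_iff_ck[OF assms(1)] by blast
 qed
 then show ?thesis
  using smooth_on_iff_ck[OF assms(1)] by blast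
qed

lemma ck_local:
 assumes U: "open_E n U"
  and loc: "!!x. x \<in> U ==> \<exists>V. open_E n V \<and> x \<in> V \<and> ck k n V F"
 shows "ck k n U F"
 using loc
proof (induction k arbitrary: F)
 have c: "continuous_on U F" if loc: "!!x. x \<in> U ==> \<exists>V. open_E n V \<and> x \<in> V \<and> continuous_on V F" for F :: "_ => real"
 proof (rule cont_onI_box[of _ n])
  show "U \<subseteq> E n" using U openin_subset by blast
  fix x and e :: real assume "x \<in> U" "e > 0"
  then show "\<exists>d>0. \<forall>y\<in>box_at n x d. y \<in> U --> \<bar>F y - F x\<bar> < e"
   using loc cont_box by metis
 qed
 {
  case 0
  then show ?case using c by simp
 next
  case (Suc k)
  have "continuous_on U F"
   by (rule c) (use Suc.prems in fastforce)
  moreover have "((\<lambda>t. F (x(i := t))) has_real_derivative pd i F x) (at (x i))"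
   if "i < n" "x \<in> U" for i x
   using that Suc.prems by fastforce
  moreover have "ck k n U (pd i F)" if "i < n" for i
   by (rule Suc.IH) (use Suc.prems that in fastforce)
  ultimately show ?case by simp
 }
qed

lemma ck_subset:
 assumes "V \<subseteq> U" "ck k n U F"
 shows "ck k n V F"
 using assms(2)
proof (induction k arbitrary: F)
 case 0
 then show ?case using assms(1) continuous_on_subset by auto
next
 case (Suc k)
 then show ?case using assms(1) continuous_on_subset[of U F V] by auto
qed

lemma smooth_on_subset:
 assumes "open_E n U" "open_E n V" "V \<subseteq> U" "smooth_on n U F"
 shows "smooth_on n V F"
 using assms(4) ck_subset[OF assms(3)] smooth_on_iff_ck[OF assms(1)] smooth_on_iff_ck[OF assms(2)] by blast

lemma smooth_on_local:
 assumes "open_E n U"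
  and "!!x. x \<in> U ==> \<exists>V. open_E n V \<and> x \<in> V \<and> smooth_on n V F"
 shows "smooth_on n U F"
proof -
 have "ck k n U F" for k
 proof (rule ck_local[OF assms(1)])
  fix x assume "x \<in> U"
  then obtain V where V: "open_E n V" "x \<in> V" "smooth_on n V F"
   using assms(2) by blast
  then have "ck k n V F"
   using smooth_on_iff_ck[OF V(1)] by blast
  then show "\<exists>V. open_E n V \<and> x \<in> V \<and> ck k n V F"
   using V by blast
 qed
 then show ?thesis
  using smooth_on_iff_ck[OF assms(1)] by blast
qed

section \<open>Arithmetic of functions of class C k\<close>

lemma cont_coord: "continuous_on U (\<lambda>x::nat => real. x i)"
 by (rule continuous_on_subset[OF continuous_on_product_coordinates subset_UNIV])

lemma ck_const:
 assumes U: "open_E n U"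
 shows "ck k n U (\<lambda>x. c)"
proof (induction k arbitrary: c)
 case (Suc k)
 show ?case
  by (rule ck_SucI[OF U, of _ "\<lambda>i x. 0"]) (use Suc in auto)
qed simp

lemma ck_coord:
 assumes U: "open_E n U"
 shows "ck k n U (\<lambda>x. x j)"
proof (cases k)
 case (Suc k')
 have "ck (Suc k') n U (\<lambda>x. x j)"
 proof (rule ck_SucI[OF U, of _ "\<lambda>i x. if i = j then 1 else 0"])
  fix i x
  show "((\<lambda>t. (x(i := t)) j) has_real_derivative (if i = j then 1 else 0)) (at (x i))"
   by (cases "i = j") auto
 qed (auto simp: cont_coord ck_const[OF U])
 then show ?thesis using Suc by simp
qed (simp add: cont_coord)

lemma ck_add:
 assumes U: "open_E n U"
 shows "ck k n U F ==> ck k n U G ==> ck k n U (\<lambda>x. F x + G x)"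
proof (induction k arbitrary: F G)
 case (Suc k)
 show ?case
 proof (rule ck_SucI[OF U, of _ "\<lambda>i x. pd i F x + pd i G x"])
  fix i x assume "i < n" "x \<in> U"
  then show "((\<lambda>t. F (x(i := t)) + G (x(i := t))) has_real_derivative pd i F x + pd i G x) (at (x i))"
   using Suc.prems by (intro DERIV_add) auto
 next
  show "continuous_on U (\<lambda>x. F x + G x)"
   using Suc.prems by (intro continuous_on_add) auto
  show "ck k n U (\<lambda>x. pd i F x + pd i G x)" if "i < n" for i
   using Suc.prems that by (intro Suc.IH) auto
 qed
qed (auto intro: continuous_on_add)

lemma ck_mult:
 assumes U: "open_E n U"
 shows "ck k n U F ==> ck k n U G ==> ck k n U (\<lambda>x. F x * G x)"
proof (induction k arbitrary: F G)
 case (Suc k)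
 show ?case
 proof (rule ck_SucI[OF U, of _ "\<lambda>i x. pd i F x * G x + pd i G x * F x"])
  fix i x assume "i < n" "x \<in> U"
  then have "((\<lambda>t. F (x(i := t))) has_real_derivative pd i F x) (at (x i))"
   "((\<lambda>t. G (x(i := t))) has_real_derivative pd i G x) (at (x i))"
   using Suc.prems by auto
  from DERIV_mult[OF this]
  show "((\<lambda>t. F (x(i := t)) * G (x(i := t))) has_real_derivative pd i F x * G x + pd i G x * F x) (at (x i))"
   by simp
 next
  fix i assume "i < n"
  then have "ck k n U (pd i F)" "ck k n U (pd i G)" "ck k n U F" "ck k n U G"
   using Suc.prems ck_lower by auto
  then show "ck k n U (\<lambda>x. pd i F x * G x + pd i G x * F x)"
   by (intro ck_add[OF U] Suc.IH)
 next
  show "continuous_on U (\<lambda>x. F x * G x)"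
   using Suc.prems by (intro continuous_on_mult) auto
 qed
qed (auto intro: continuous_on_mult)

text \<open>The derivative is a product of \<open>pd i F\<close> and \<open>inverse (F x)\<close>,
  so the induction hypothesis applies to the inverse itself at the lower order.\<close>

lemma ck_inverse:
 assumes U: "open_E n U"
 shows "ck k n U F ==> (!!x. x \<in> U ==> F x ~= 0) ==> ck k n U (\<lambda>x. inverse (F x))"
proof (induction k arbitrary: F)
 case (Suc k)
 show ?case
 proof (rule ck_SucI[OF U, of _ "\<lambda>i x. -1 * (pd i F x * (inverse (F x) * inverse (F x)))"])
  fix i x assume x: "i < n" "x \<in> U"
  then have "((\<lambda>t. F (x(i := t))) has_real_derivative pd i F x) (at (x i))"
   using Suc.prems by auto
  moreover have "F (x(i := x i)) ~= 0"
   using Suc.prems x by simp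
  ultimately show "((\<lambda>t. inverse (F (x(i := t)))) has_real_derivative -1 * (pd i F x * (inverse (F x) * inverse (F x)))) (at (x i))"
   by (auto intro!: derivative_eq_intros simp: mult_ac)
 next
  fix i assume "i < n"
  then have "ck k n U (pd i F)" "ck k n U F"
   using Suc.prems ck_lower by auto
  then show "ck k n U (\<lambda>x. -1 * (pd i F x * (inverse (F x) * inverse (F x))))"
   using Suc.prems(2) by (intro ck_mult[OF U] ck_const[OF U] Suc.IH)
 next
  show "continuous_on U (\<lambda>x. inverse (F x))"
   using Suc.prems by (intro continuous_on_inverse) auto
 qed
qed (auto intro!: continuous_on_inverse)

lemma ck_sum:
 assumes U: "open_E n U"
 shows "(!!j. j \<in> J ==> ck k n U (F j)) ==> ck k n U (\<lambda>x. \<Sum>j\<in>J. F j x)"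
proof (induction J rule: infinite_finite_induct)
 case (insert a J)
 then have "ck k n U (\<lambda>x. F a x + (\<Sum>j\<in>J. F j x))"
  by (intro ck_add[OF U]) auto
 then show ?case using insert by simp
qed (auto intro: ck_const[OF U])

subsection \<open>The chain rule\<close>

text \<open>The corners of a path from y0 to y that changes one coordinate at a time. It replaces
  total differentiability: increments are split into increments along the edges.\<close>

definition hyb :: "nat => (nat => real) => (nat => real) => nat => real" where
 "hyb j y y0 = (\<lambda>i. if i < j then y i else y0 i)"

text \<open>The slope of F along the j-th edge of this path. On a degenerate edge the partial
  derivative fills in, which makes the slope continuous at y0 for F of class C 1.\<close>

definition dq :: "((nat => real) => real) => (nat => real) => nat => (nat => real) => real" where
 "dq F y0 j y = (if y j = y0 j then pd j F y0
  else (F (hyb (Suc j) y y0) - F (hyb j y y0)) / (y j - y0 j))"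

lemma hyb_Suc: "hyb (Suc j) y y0 = (hyb j y y0)(j := y j)"
 by (auto simp: hyb_def fun_eq_iff)

lemma hyb_upd: "(hyb j y y0)(j := y0 j) = hyb j y y0"
 by (auto simp: hyb_def fun_eq_iff)

text \<open>The edge increments telescope. On a degenerate edge the two corners coincide and the
  factor \<open>y j - y0 j\<close> is 0, so the filled-in value does no harm.\<close>

lemma dq_telescope:
 assumes "y \<in> E m" "y0 \<in> E m"
 shows "F y - F y0 = (\<Sum>j<m. dq F y0 j y * (y j - y0 j))"
proof -
 have "F (hyb p y y0) - F y0 = (\<Sum>j<p. dq F y0 j y * (y j - y0 j))" for p
 proof (induction p)
  case 0
  then show ?case by (simp add: hyb_def)
 next
  case (Suc p)
  have "dq F y0 p y * (y p - y0 p) = F (hyb (Suc p) y y0) - F (hyb p y y0)"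
   using hyb_upd[of p y y0] by (simp add: dq_def hyb_Suc)
  then show ?case using Suc by simp
 qed
 moreover have "hyb m y y0 = y"
  using assms by (auto simp: hyb_def mem_E)
 ultimately show ?thesis by metis
qed

text \<open>By the mean value theorem the slope is a value of \<open>pd j F\<close> at a point of
  the j-th edge, and the edge stays in the same cube around y0.\<close>

lemma dq_close:
 assumes V: "open_E m V" and F: "ck (Suc 0) m V F" and "y0 \<in> V" "j < m" "e > 0"
 shows "\<exists>d>0. \<forall>y\<in>box_at m y0 d. \<bar>dq F y0 j y - pd j F y0\<bar> < e"
proof -
 have "continuous_on V (pd j F)"
  using F assms(4) by simp
 then obtain d where d: "d > 0" "!!y. y \<in> box_at m y0 d ==> y \<in> V \<and> \<bar>pd j F y - pd j F y0\<bar> < e"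
  using cont_box[OF V _ assms(3,5)] by blast
 have "\<bar>dq F y0 j y - pd j F y0\<bar> < e" if y: "y \<in> box_at m y0 d" for y
 proof (cases "y j = y0 j")
  case True
  then show ?thesis using assms(5) by (simp add: dq_def)
 next
  case False
  define H where "H = hyb j y y0"
  have box: "H(j := t) \<in> box_at m y0 d" if "min (y j) (y0 j) \<le> t" "t \<le> max (y j) (y0 j)" for t
  proof -
   have "\<bar>y j - y0 j\<bar> < d" using y assms(4) by (auto simp: box_at_def)
   then have "\<bar>t - y0 j\<bar> < d" using that by linarith
   moreover have "y0 \<in> E m" using openE_sub[OF V assms(3)] .
   ultimately show ?thesis
    using y assms(4) d(1) by (auto simp: box_at_def H_def hyb_def mem_E)
  qed
  have der: "((\<lambda>t. F (H(j := t))) has_real_derivative pd j F (H(j := t))) (at t)"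
   if "min (y j) (y0 j) \<le> t" "t \<le> max (y j) (y0 j)" for t
  proof -
   have "H(j := t) \<in> V" using box[OF that] d(2) by blast
   moreover have "\<forall>x\<in>V. ((\<lambda>t. F (x(j := t))) has_real_derivative pd j F x) (at (x j))"
    using F assms(4) by simp
   ultimately show ?thesis by fastforce
  qed
  \<comment> \<open>Minimum and maximum cover both orders of \<open>y j\<close> and
    \<open>y0 j\<close>; the sign is restored afterwards.\<close>
  have "\<exists>z. min (y j) (y0 j) < z \<and> z < max (y j) (y0 j) \<and>
   F (H(j := max (y j) (y0 j))) - F (H(j := min (y j) (y0 j))) = (max (y j) (y0 j) - min (y j) (y0 j)) * pd j F (H(j := z))"
  proof (rule MVT2)
   show "min (y j) (y0 j) < max (y j) (y0 j)" using False by auto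
  qed (rule der)
  then obtain z where z: "min (y j) (y0 j) < z" "z < max (y j) (y0 j)"
   "F (H(j := max (y j) (y0 j))) - F (H(j := min (y j) (y0 j))) = (max (y j) (y0 j) - min (y j) (y0 j)) * pd j F (H(j := z))"
   by blast
  have "F (H(j := y j)) - F (H(j := y0 j)) = (y j - y0 j) * pd j F (H(j := z))"
   using z(3) False by (cases "y j < y0 j") (auto simp: max_def min_def algebra_simps split: if_splits)
  then have "dq F y0 j y = pd j F (H(j := z))"
   using False hyb_upd[of j y y0] by (simp add: dq_def hyb_Suc H_def[symmetric])
  then show ?thesis
   using d(2)[OF box[of z]] z by simp
 qed
 then show ?thesis using d(1) by blast
qed

lemma dq_tendsto:
 assumes V: "open_E m V" and F: "ck (Suc 0) m V F" and "y0 \<in> V" "j < m"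
  and g: "eventually (\<lambda>t. g t \<in> E m) A" "!!i. i < m ==> tendsto (\<lambda>t. g t i) (y0 i) A"
 shows "tendsto (\<lambda>t. dq F y0 j (g t)) (pd j F y0) A"
proof (rule tendstoI)
 fix e :: real assume "e > 0"
 then obtain d where d: "d > 0" "\<forall>y\<in>box_at m y0 d. \<bar>dq F y0 j y - pd j F y0\<bar> < e"
  using dq_close[OF V F assms(3,4)] by blast
 have "eventually (\<lambda>t. \<forall>i\<in>{..<m}. dist (g t i) (y0 i) < d) A"
  by (rule eventually_ball_finite) (auto intro!: tendstoD[OF g(2) d(1)])
 then show "eventually (\<lambda>t. dist (dq F y0 j (g t)) (pd j F y0) < e) A"
  using g(1)
 proof eventually_elim
  case (elim t)
  then have "g t \<in> box_at m y0 d"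
   by (auto simp: box_at_def dist_real_def)
  then show ?case using d(2) by (simp add: dist_real_def)
 qed
qed

text \<open>Only the coordinates of the curve are differentiated, and only at t0: the telescoped
  difference quotient converges factor by factor.\<close>

lemma chain_curve:
 assumes V: "open_E m V" and F: "ck (Suc 0) m V F" and y0: "g t0 \<in> V"
  and g: "!!t. g t \<in> E m" "!!j. j < m ==> ((\<lambda>t. g t j) has_real_derivative g' j) (at t0)"
 shows "((\<lambda>t. F (g t)) has_real_derivative (\<Sum>j<m. pd j F (g t0) * g' j)) (at t0)"
proof -
 have "tendsto (\<lambda>t. \<Sum>j<m. dq F (g t0) j (g t) * ((g t j - g t0 j) / (t - t0)))
  (\<Sum>j<m. pd j F (g t0) * g' j) (at t0)"
 proof (intro tendsto_sum tendsto_mult)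
  fix j assume "j \<in> {..<m}"
  then have j: "j < m" by simp
  show "tendsto (\<lambda>t. dq F (g t0) j (g t)) (pd j F (g t0)) (at t0)"
  proof (rule dq_tendsto[OF V F y0 j])
   show "tendsto (\<lambda>t. g t i) (g t0 i) (at t0)" if "i < m" for i
    using DERIV_isCont[OF g(2)[OF that]] by (simp add: isCont_def)
  qed (use g(1) in simp)
  show "tendsto (\<lambda>t. (g t j - g t0 j) / (t - t0)) (g' j) (at t0)"
   using g(2)[OF j] by (simp add: has_field_derivative_iff)
 qed
 moreover have "(\<Sum>j<m. dq F (g t0) j (g t) * ((g t j - g t0 j) / (t - t0))) = (F (g t) - F (g t0)) / (t - t0)" for t
  by (simp add: dq_telescope[OF g(1) g(1), of F t t0] sum_divide_distrib)
 ultimately show ?thesis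
  by (simp add: has_field_derivative_iff)
qed

lemma cont_tup:
 assumes "!!j. j < m ==> continuous_on U (G j)"
 shows "continuous_on U (\<lambda>x. tup m (\<lambda>j. G j x))"
proof (rule continuous_on_coordinatewise_then_product)
 fix i
 show "continuous_on U (\<lambda>x. tup m (\<lambda>j. G j x) i)"
  by (cases "i < m") (use assms in "auto simp: tup_def")
qed

lemma compose_deriv:
 assumes V: "open_E m V" and F: "ck (Suc 0) m V F"
  and "!!j. j < m ==> ((\<lambda>t. G j (x(i := t))) has_real_derivative G' j) (at (x i))"
  and "tup m (\<lambda>j. G j x) \<in> V"
 shows "((\<lambda>t. F (tup m (\<lambda>j. G j (x(i := t))))) has_real_derivative
     (\<Sum>j<m. pd j F (tup m (\<lambda>j. G j x)) * G' j)) (at (x i))"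
 using chain_curve[OF V F, of "\<lambda>t. tup m (\<lambda>j. G j (x(i := t)))" "x i" G'] assms(3,4) by simp

text \<open>The chain rule yields sums of products of \<open>pd j F\<close> composed with G and
  derivatives of G. The inner functions stay the same, so the induction runs over all outer
  functions F at once.\<close>

lemma ck_compose:
 assumes U: "open_E n U" and V: "open_E m V"
  and "ck k m V F" "!!j. j < m ==> ck k n U (G j)" "!!x. x \<in> U ==> tup m (\<lambda>j. G j x) \<in> V"
 shows "ck k n U (\<lambda>x. F (tup m (\<lambda>j. G j x)))"
 using assms(3,4)
proof (induction k arbitrary: F)
 case 0
 then have "continuous_on U (\<lambda>x. tup m (\<lambda>j. G j x))"
  by (intro cont_tup) auto
 then show ?case
  using continuous_on_compose2[of V F U "\<lambda>x. tup m (\<lambda>j. G j x)"] 0 assms(5) by auto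
next
 case (Suc k)
 have G: "!!j. j < m ==> continuous_on U (G j)" "!!j. j < m ==> ck k n U (G j)"
  using Suc.prems(2) ck_lower ck_continuous by blast+
 have F: "ck (Suc 0) m V F"
  using Suc.prems(1) by (auto intro: ck_continuous)
 show ?case
 proof (rule ck_SucI[OF U, of _ "\<lambda>i x. \<Sum>j<m. pd j F (tup m (\<lambda>j. G j x)) * pd i (G j) x"])
  show "continuous_on U (\<lambda>x. F (tup m (\<lambda>j. G j x)))"
   using continuous_on_compose2[of V F U "\<lambda>x. tup m (\<lambda>j. G j x)"] Suc.prems(1) assms(5) cont_tup[of m U G] G(1) by auto
  show "((\<lambda>t. F (tup m (\<lambda>j. G j (x(i := t))))) has_real_derivative
     (\<Sum>j<m. pd j F (tup m (\<lambda>j. G j x)) * pd i (G j) x)) (at (x i))" if "i < n" "x \<in> U" for i x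
  proof (rule compose_deriv[OF V F])
   show "((\<lambda>t. G j (x(i := t))) has_real_derivative pd i (G j) x) (at (x i))" if "j < m" for j
    using Suc.prems(2)[OF that] \<open>i < n\<close> \<open>x \<in> U\<close> by simp
  qed (use that assms(5) in simp)
  show "ck k n U (\<lambda>x. \<Sum>j<m. pd j F (tup m (\<lambda>j. G j x)) * pd i (G j) x)" if "i < n" for i
   by (intro ck_sum[OF U] ck_mult[OF U] Suc.IH) (use Suc.prems G that in auto)
 qed
qed

subsection \<open>Closure properties of smooth functions\<close>

context
 fixes n U assumes U: "open_E n U"
begin

lemma smooth_on_const: "smooth_on n U (\<lambda>x. c)"
 by (simp add: smooth_on_iff_ck[OF U] ck_const[OF U])

lemma smooth_on_coord: "smooth_on n U (\<lambda>x. x j)"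
 by (simp add: smooth_on_iff_ck[OF U] ck_coord[OF U])

lemma smooth_on_add: "smooth_on n U F ==> smooth_on n U G ==> smooth_on n U (\<lambda>x. F x + G x)"
 by (simp add: smooth_on_iff_ck[OF U] ck_add[OF U])

lemma smooth_on_mult: "smooth_on n U F ==> smooth_on n U G ==> smooth_on n U (\<lambda>x. F x * G x)"
 by (simp add: smooth_on_iff_ck[OF U] ck_mult[OF U])

lemma smooth_on_diff: "smooth_on n U F ==> smooth_on n U G ==> smooth_on n U (\<lambda>x. F x - G x)"
 using smooth_on_add[of F "\<lambda>x. -1 * G x"] smooth_on_mult[of "\<lambda>x. -1" G] smooth_on_const by simp

lemma smooth_on_divide:
 "smooth_on n U F ==> smooth_on n U G ==> (!!x. x \<in> U ==> G x ~= 0) ==> smooth_on n U (\<lambda>x. F x / G x)"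
 by (simp add: smooth_on_iff_ck[OF U] divide_inverse ck_mult[OF U] ck_inverse[OF U])

lemma smooth_on_compose:
 assumes "open_E m V" "smooth_on m V F" "!!j. j < m ==> smooth_on n U (G j)"
  "!!x. x \<in> U ==> tup m (\<lambda>j. G j x) \<in> V"
 shows "smooth_on n U (\<lambda>x. F (tup m (\<lambda>j. G j x)))"
 using assms by (simp add: smooth_on_iff_ck[OF U] smooth_on_iff_ck[OF assms(1)] ck_compose[OF U assms(1)])

lemma smooth_on_ck: "smooth_on n U F ==> ck k n U F"
 by (simp add: smooth_on_iff_ck[OF U])

end

lemma pd_coord: "pd i (\<lambda>x. x j) x = (if i = j then 1 else 0)"
 by (rule pdI) (cases "i = j"; simp)

subsection \<open>Hadamard's lemma\<close>

definition seg :: "(nat => real) => (nat => real) => real => nat => real" where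
 "seg x y s = (\<lambda>i. x i + s * (y i - x i))"

lemma seg_in_box:
 assumes "x \<in> E n" "y \<in> box_at n x e" "0 \<le> s" "s \<le> 1"
 shows "seg x y s \<in> box_at n x e"
proof -
 have "\<bar>s * (y i - x i)\<bar> < e" if "i < n" for i
 proof -
  have "\<bar>s * (y i - x i)\<bar> \<le> 1 * \<bar>y i - x i\<bar>"
   unfolding abs_mult by (intro mult_right_mono) (use assms in auto)
  then show ?thesis using assms(2) that by (auto simp: box_at_def)
 qed
 then show ?thesis
  using assms(1,2) by (auto simp: box_at_def mem_E seg_def)
qed

text \<open>Hadamard's integral along the segment from x to y. The power of s is there because
  differentiating in y under the integral sign brings out one more factor s; as a family in k and F
  these integrals are closed under differentiation.\<close>

definition hint :: "(nat => real) => nat => ((nat => real) => real) => (nat => real) => real" where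
 "hint x k F y = integral {0..1} (\<lambda>s. s ^ k * F (seg x y s))"

lemma cont_hint_integrand:
 assumes "x \<in> E n" and F: "continuous_on (box_at n x e) F"
 shows "continuous_on (box_at n x e \<times> {0..1}) (\<lambda>(y, s). s ^ k * F (seg x y s))"
proof -
 have seg: "continuous_on (box_at n x e \<times> {0..1}) (\<lambda>p. seg x (fst p) (snd p))"
 proof (rule continuous_on_coordinatewise_then_product)
  fix i
  have "continuous_on (box_at n x e \<times> {0..1::real}) (\<lambda>p. fst p i)"
   by (rule continuous_on_compose2[OF cont_coord[of UNIV i]]) (auto intro: continuous_intros)
  then show "continuous_on (box_at n x e \<times> {0..1}) (\<lambda>p. seg x (fst p) (snd p) i)"
   unfolding seg_def by (intro continuous_intros)
 qed
 have "continuous_on (box_at n x e \<times> {0..1}) (\<lambda>p. F (seg x (fst p) (snd p)))"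
  by (rule continuous_on_compose2[OF F seg]) (use seg_in_box[OF assms(1)] in auto)
 then show ?thesis
  unfolding case_prod_unfold by (intro continuous_intros)
qed

lemma ck_hint:
 assumes "x0 \<in> E n"
 shows "smooth_on n (box_at n x0 e) F ==> ck K n (box_at n x0 e) (hint x0 k F)"
proof (induction K arbitrary: k F)
 let ?B = "box_at n x0 e"
 have cont: "continuous_on ?B (hint x0 k F)" if "smooth_on n ?B F" for k F
 proof -
  have "continuous_on ?B F"
   using smooth_on_continuous[OF openin_box_at that] .
  from integral_continuous_on_param[of ?B 0 1 "\<lambda>y s. s ^ k * F (seg x0 y s)", unfolded cbox_interval, OF cont_hint_integrand[OF assms this]]
  show ?thesis
   unfolding hint_def[abs_def] .
 qed
 {
  case 0
  then show ?case using cont by simp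
 next
  case (Suc K)
  show ?case
  proof (rule ck_SucI[OF openin_box_at cont[OF Suc.prems], of _ "\<lambda>i. hint x0 (Suc k) (pd i F)"])
   show "ck K n ?B (hint x0 (Suc k) (pd i F))" if "i < n" for i
    by (rule Suc.IH, rule smooth_on_pd[OF openin_box_at Suc.prems that])
   fix i x assume i: "i < n" and x: "x \<in> ?B"
   \<comment> \<open>The interval of values of the i-th coordinate that keep x in the cube; the
     Leibniz rule asks for a convex set of parameters.\<close>
   define J where "J = {x0 i - e<..<x0 i + e}"
   have J: "x(i := t) \<in> ?B" if "t \<in> J" for t
    using x i that by (auto simp: box_at_def J_def mem_E)
   have xi: "x i \<in> J"
    using x i by (auto simp: box_at_def J_def abs_less_iff)
   have mapJ: "continuous_on (J \<times> {0..1}) (\<lambda>p. (x(i := fst p), snd p::real))"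
   proof (intro continuous_on_Pair continuous_on_coordinatewise_then_product)
    fix j
    show "continuous_on (J \<times> {0..1}) (\<lambda>p. (x(i := fst p)) j)"
     by (cases "j = i") (auto intro: continuous_intros)
   qed (auto intro: continuous_intros)
   have cF: "continuous_on ?B (pd i F)"
    using smooth_on_continuous[OF openin_box_at smooth_on_pd[OF openin_box_at Suc.prems i]] .
   have cJ: "continuous_on (J \<times> {0..1}) (\<lambda>(t, s). s ^ Suc k * pd i F (seg x0 (x(i := t)) s))"
   proof -
    have "(\<lambda>p. (x(i := fst p), snd p)) ` (J \<times> {0..1}) \<subseteq> ?B \<times> {0..1}"
     using J by auto
    then show ?thesis
     using continuous_on_compose2[OF cont_hint_integrand[OF assms cF, of "Suc k"] mapJ]
     by (simp add: case_prod_unfold)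
   qed
   have "((\<lambda>t. integral (cbox 0 1) (\<lambda>s. s ^ k * F (seg x0 (x(i := t)) s))) has_field_derivative
       integral (cbox 0 1) (\<lambda>s. s ^ Suc k * pd i F (seg x0 (x(i := x i)) s))) (at (x i) within J)"
   proof (rule leibniz_rule_field_derivative[OF _ _ _ xi])
    fix t s assume t: "t \<in> J" and s: "s \<in> cbox 0 (1::real)"
    let ?z = "seg x0 (x(i := t)) s"
    have zB: "?z \<in> ?B"
     using seg_in_box[OF assms J[OF t]] s by simp
    have "((\<lambda>u. F (?z(i := u))) has_real_derivative pd i F ?z) (at (?z i))"
     by (rule smooth_on_deriv[OF openin_box_at Suc.prems i zB])
    then have D1: "((\<lambda>u. F (?z(i := u))) has_real_derivative pd i F ?z) (at (x0 i + s * (t - x0 i)))"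
     by (simp add: seg_def)
    have D2: "((\<lambda>t. x0 i + s * (t - x0 i)) has_real_derivative s) (at t)"
     by (auto intro!: derivative_eq_intros)
    have "((\<lambda>u. F (?z(i := x0 i + s * (u - x0 i)))) has_real_derivative pd i F ?z * s) (at t)"
     using DERIV_chain2[OF D1 D2] .
    moreover have "?z(i := x0 i + s * (u - x0 i)) = seg x0 (x(i := u)) s" for u
     by (auto simp: seg_def fun_eq_iff)
    ultimately have "((\<lambda>u. F (seg x0 (x(i := u)) s)) has_real_derivative pd i F ?z * s) (at t)"
     by simp
    then have "((\<lambda>u. s ^ k * F (seg x0 (x(i := u)) s)) has_real_derivative s ^ k * (pd i F ?z * s)) (at t)"
     by (rule DERIV_cmult)
    then show "((\<lambda>t. s ^ k * F (seg x0 (x(i := t)) s)) has_field_derivative s ^ Suc k * pd i F ?z) (at t within J)"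
     by (simp add: has_field_derivative_at_within mult_ac)
   next
    fix t assume t: "t \<in> J"
    have "continuous_on {0..1::real} (Pair (x(i := t)))" "Pair (x(i := t)) ` {0..1} \<subseteq> ?B \<times> {0..1::real}"
     using J[OF t] by (auto intro: continuous_intros)
    then have "continuous_on {0..1} (\<lambda>s. s ^ k * F (seg x0 (x(i := t)) s))"
     using continuous_on_compose2[OF cont_hint_integrand[OF assms smooth_on_continuous[OF openin_box_at Suc.prems], of k],
       of "{0..1}" "\<lambda>s. (x(i := t), s)"]
     by simp
    then show "(\<lambda>s. s ^ k * F (seg x0 (x(i := t)) s)) integrable_on cbox 0 1"
     by (simp add: integrable_continuous_interval)
   next
    show "continuous_on (J \<times> cbox 0 1) (\<lambda>(t, s). s ^ Suc k * pd i F (seg x0 (x(i := t)) s))"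
     using cJ by simp
    show "convex J" by (simp add: J_def)
   qed
   then show "((\<lambda>t. hint x0 k F (x(i := t))) has_real_derivative hint x0 (Suc k) (pd i F) x) (at (x i))"
    using at_within_open[OF xi] by (simp add: hint_def J_def)
  qed
 }
qed

text \<open>Integrate the derivative of F along the segment from x0 to y, which stays in the cube.
  At y = x0 the integrand is constant, whence the value of \<open>q j x0\<close>. This is the tool
  for evaluating derivations.\<close>

lemma hadamard:
 assumes x0: "x0 \<in> E n" and e: "e > 0" and F: "smooth_on n (box_at n x0 e) F"
 shows "\<exists>q. (\<forall>j<n. smooth_on n (box_at n x0 e) (q j) \<and> q j x0 = pd j F x0) \<and>
  (\<forall>y\<in>box_at n x0 e. F y = F x0 + (\<Sum>j<n. (y j - x0 j) * q j y))"
proof (intro exI conjI allI impI ballI)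
 let ?B = "box_at n x0 e"
 fix j assume j: "j < n"
 have pF: "smooth_on n ?B (pd j F)"
  by (rule smooth_on_pd[OF openin_box_at F j])
 show "smooth_on n ?B (hint x0 0 (pd j F))"
  using ck_hint[OF x0 pF] smooth_on_iff_ck[OF openin_box_at] by blast
 show "hint x0 0 (pd j F) x0 = pd j F x0"
  by (simp add: hint_def seg_def)
next
 let ?B = "box_at n x0 e"
 fix y assume y: "y \<in> ?B"
 have yE: "y \<in> E n" using y by (simp add: box_at_def)
 have cont: "continuous_on {0..1} (\<lambda>s. pd j F (seg x0 y s))" if j: "j < n" for j
 proof -
  have c: "continuous_on ?B (pd j F)"
   using smooth_on_continuous[OF openin_box_at smooth_on_pd[OF openin_box_at F j]] .
  have "continuous_on {0..1::real} (Pair y)" "Pair y ` {0..1} \<subseteq> ?B \<times> {0..1::real}"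
   using y by (auto intro: continuous_intros)
  then show ?thesis
   using continuous_on_compose2[OF cont_hint_integrand[OF x0 c, of 0], of "{0..1}" "\<lambda>s. (y, s)"]
   by simp
 qed
 have "((\<lambda>s. \<Sum>j<n. pd j F (seg x0 y s) * (y j - x0 j)) has_integral F (seg x0 y 1) - F (seg x0 y 0)) {0..1}"
 proof (rule fundamental_theorem_of_calculus)
  fix s :: real assume s: "s \<in> {0..1}"
  have "((\<lambda>s. F (seg x0 y s)) has_real_derivative (\<Sum>j<n. pd j F (seg x0 y s) * (y j - x0 j))) (at s)"
  proof (rule chain_curve[OF openin_box_at])
   show "ck (Suc 0) n ?B F"
    using F smooth_on_iff_ck[OF openin_box_at] by blast
   show "seg x0 y s \<in> ?B"
    using seg_in_box[OF x0 y] s by simp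
   show "seg x0 y t \<in> E n" for t
    using x0 yE by (simp add: mem_E seg_def)
   show "((\<lambda>t. seg x0 y t j) has_real_derivative y j - x0 j) (at s)" for j
    unfolding seg_def by (auto intro!: derivative_eq_intros)
  qed
  then show "((\<lambda>s. F (seg x0 y s)) has_vector_derivative (\<Sum>j<n. pd j F (seg x0 y s) * (y j - x0 j))) (at s within {0..1})"
   by (simp add: has_real_derivative_iff_has_vector_derivative has_vector_derivative_at_within)
 qed simp
 then have "F (seg x0 y 1) - F (seg x0 y 0) = integral {0..1} (\<lambda>s. \<Sum>j<n. pd j F (seg x0 y s) * (y j - x0 j))"
  by (simp add: integral_unique)
 also have "\<dots> = (\<Sum>j<n. integral {0..1} (\<lambda>s. pd j F (seg x0 y s) * (y j - x0 j)))"
  by (rule integral_sum) (auto intro!: integrable_continuous_interval continuous_intros cont)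
 also have "\<dots> = (\<Sum>j<n. (y j - x0 j) * hint x0 0 (pd j F) y)"
  by (simp add: hint_def mult.commute)
 finally show "F y = F x0 + (\<Sum>j<n. (y j - x0 j) * hint x0 0 (pd j F) y)"
  by (simp add: seg_def)
qed

subsection \<open>Bump functions\<close>

text \<open>The functions t^(-k) exp (-1/t), extended by 0. With k as a parameter the family is
  closed under differentiation up to linear combinations, so that smoothness of all members is one
  induction.\<close>

definition flat :: "nat => real => real" where
 "flat k t = (if t > 0 then inverse t ^ k * exp (- inverse t) else 0)"

lemma flat_tendsto_0: "tendsto (flat k) 0 (at 0)"
proof -
 have "tendsto (\<lambda>t::real. inverse t ^ k / exp (inverse t)) 0 (at_right 0)"
  using filterlim_compose[OF tendsto_power_div_exp_0[of k] filterlim_inverse_at_top_right] .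
 then have r: "tendsto (flat k) 0 (at_right 0)"
  by (rule Lim_transform_eventually)
   (auto simp: flat_def eventually_at_right_less exp_minus divide_inverse intro!: eventually_mono[OF eventually_at_right_less[of 0]])
 have "tendsto (flat k) 0 (at_left 0)"
  by (rule Lim_transform_eventually[OF tendsto_const])
   (auto simp: flat_def intro!: eventually_mono[OF eventually_at_left_real[of "-1" 0]])
 then show ?thesis
  using r by (simp add: filterlim_at_split)
qed

lemma flat_deriv: "(flat k has_real_derivative flat (k + 2) t - real k * flat (k + 1) t) (at t)"
proof (cases t "0::real" rule: linorder_cases)
 case less
 have "((\<lambda>t. 0) has_real_derivative 0) (at t)" by simp
 then have "(flat k has_real_derivative 0) (at t)"
  by (rule has_field_derivative_transform_within[of _ _ _ _ "-t"]) (use less in "auto simp: flat_def dist_real_def")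
 then show ?thesis using less by (simp add: flat_def)
next
 case equal
 have "tendsto (\<lambda>s. (flat k s - flat k 0) / (s - 0)) 0 (at 0)"
  by (rule Lim_transform_eventually[OF flat_tendsto_0[of "Suc k"]])
   (auto simp: flat_def divide_inverse eventually_at_filter)
 then show ?thesis
  using equal by (simp add: has_field_derivative_iff flat_def)
next
 case greater
 have "((\<lambda>t. inverse t ^ k * exp (- inverse t)) has_real_derivative
  (inverse t ^ k * (exp (- inverse t) * (inverse t * inverse t)) + real k * inverse t ^ (k - 1) * (- (inverse t * inverse t)) * exp (- inverse t))) (at t)"
  using greater by (auto intro!: derivative_eq_intros)
 then have "(flat k has_real_derivative
  (inverse t ^ k * (exp (- inverse t) * (inverse t * inverse t)) + real k * inverse t ^ (k - 1) * (- (inverse t * inverse t)) * exp (- inverse t))) (at t)"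
  by (rule has_field_derivative_transform_within[of _ _ _ _ t]) (use greater in "auto simp: flat_def dist_real_def")
 moreover have "inverse t ^ k * (exp (- inverse t) * (inverse t * inverse t)) + real k * inverse t ^ (k - 1) * (- (inverse t * inverse t)) * exp (- inverse t)
  = flat (k + 2) t - real k * flat (k + 1) t"
  using greater by (cases k) (simp_all add: flat_def algebra_simps)
 ultimately show ?thesis by simp
qed

lemma ck_flat:
 assumes U: "open_E n U"
 shows "ck K n U F ==> ck K n U (\<lambda>x. flat k (F x))"
proof (induction K arbitrary: k)
 have c: "continuous_on UNIV (flat k)" for k
  using flat_deriv DERIV_isCont continuous_at_imp_continuous_on by blast
 have c2: "continuous_on U (\<lambda>x. flat k (F x))" if "continuous_on U F" for k
  by (rule continuous_on_compose2[OF c that]) simp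
 {
  case 0
  then show ?case using c2 by simp
 next
  case (Suc K)
  show ?case
  proof (rule ck_SucI[OF U, of _ "\<lambda>i x. (flat (k + 2) (F x) + - real k * flat (k + 1) (F x)) * pd i F x"])
   show "continuous_on U (\<lambda>x. flat k (F x))"
    using Suc.prems c2 by simp
   have F: "ck K n U F" using Suc.prems ck_lower by blast
   show "ck K n U (\<lambda>x. (flat (k + 2) (F x) + - real k * flat (k + 1) (F x)) * pd i F x)" if "i < n" for i
    by (intro ck_mult[OF U] ck_add[OF U] ck_const[OF U] Suc.IH F) (use Suc.prems that in simp)
   fix i x assume "i < n" "x \<in> U"
   then have D: "((\<lambda>t. F (x(i := t))) has_real_derivative pd i F x) (at (x i))"
    using Suc.prems by simp
   have "((\<lambda>t. flat k (F (x(i := t)))) has_real_derivative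
    (flat (k + 2) (F (x(i := x i))) - real k * flat (k + 1) (F (x(i := x i)))) * pd i F x) (at (x i))"
    by (rule DERIV_chain2[OF flat_deriv D])
   then show "((\<lambda>t. flat k (F (x(i := t)))) has_real_derivative
    (flat (k + 2) (F x) + - real k * flat (k + 1) (F x)) * pd i F x) (at (x i))"
    by simp
  qed
 }
qed

text \<open>The usual smooth step flat 0 s / (flat 0 s + flat 0 (1 - s)) at s = 2 - 2 (u/e)^2. The
  square keeps s smooth in u; for e > 0, s is at least 1 if |u| \<le> e/2 and at most 0 if |u| \<ge>
  e.\<close>

definition bmp :: "real => real => real" where
 "bmp e u = flat 0 (2 - 2 * (u / e)\<^sup>2) / (flat 0 (2 - 2 * (u / e)\<^sup>2) + flat 0 (1 - (2 - 2 * (u / e)\<^sup>2)))"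

lemma flat_nonneg: "flat 0 t \<ge> 0" "t > 0 ==> flat 0 t > 0" "t \<le> 0 ==> flat 0 t = 0"
 by (auto simp: flat_def)

lemma bmp_eq_1:
 assumes "e > 0" "\<bar>u\<bar> \<le> e / 2"
 shows "bmp e u = 1"
proof -
 have "\<bar>u / e\<bar> \<le> 1 / 2"
  using assms by (simp add: abs_divide field_simps)
 then have "(u / e)\<^sup>2 \<le> (1 / 2)\<^sup>2"
  by (metis abs_ge_zero power2_abs power_mono)
 then have "(u / e)\<^sup>2 \<le> 1 / 4"
  by (simp add: power2_eq_square)
 then have "2 - 2 * (u / e)\<^sup>2 > 0" "1 - (2 - 2 * (u / e)\<^sup>2) \<le> 0"
  by linarith+
 then show ?thesis
  using flat_nonneg(2)[of "2 - 2 * (u / e)\<^sup>2"] flat_nonneg(3)[of "1 - (2 - 2 * (u / e)\<^sup>2)"]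
  unfolding bmp_def by simp
qed

lemma bmp_eq_0:
 assumes "e > 0" "\<bar>u\<bar> \<ge> e"
 shows "bmp e u = 0"
proof -
 have "\<bar>u / e\<bar> \<ge> 1"
  using assms by (simp add: abs_divide field_simps)
 then have "(u / e)\<^sup>2 \<ge> 1"
  by (metis abs_le_square_iff abs_one one_power2)
 then have "2 - 2 * (u / e)\<^sup>2 \<le> 0"
  by linarith
 then show ?thesis
  using flat_nonneg(3) unfolding bmp_def by simp
qed

lemma smooth_on_bmp:
 assumes U: "open_E n U" and F: "smooth_on n U F"
 shows "smooth_on n U (\<lambda>x. bmp e (F x))"
proof -
 have f: "smooth_on n U (\<lambda>x. flat 0 (G x))" if "smooth_on n U G" for G
  using that ck_flat[OF U] by (simp add: smooth_on_iff_ck[OF U])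
 have 1: "smooth_on n U (\<lambda>x. 2 - 2 * (F x / e)\<^sup>2)"
  unfolding power2_eq_square divide_inverse
  by (intro smooth_on_diff[OF U] smooth_on_mult[OF U] smooth_on_const[OF U] F)
 have 2: "smooth_on n U (\<lambda>x. 1 - (2 - 2 * (F x / e)\<^sup>2))"
  by (rule smooth_on_diff[OF U smooth_on_const[OF U] 1])
 have "flat 0 t + flat 0 (1 - t) ~= 0" for t
  using flat_nonneg(1)[of t] flat_nonneg(1)[of "1 - t"] flat_nonneg(2)[of t] flat_nonneg(2)[of "1 - t"]
  by (cases "t > 0") auto
 then show ?thesis
  unfolding bmp_def
  by (intro smooth_on_divide[OF U] smooth_on_add[OF U] f 1 2)
qed

subsection \<open>Exchanging a coordinate for a function\<close>

text \<open>The inverse function theorem for a map that changes a single coordinate. The mean value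
  theorem on the i-th coordinate lines gives injectivity near y0, invariance of domain gives open
  images, and implicit differentiation then raises the regularity of the inverse order by
  order.\<close>

lemma exchange:
 assumes O: "open_E n A" and F: "smooth_on n A F" and y0: "y0 \<in> A" and i: "i < n"
  and nz: "pd i F y0 ~= 0"
 shows "\<exists>B g. open_E n B \<and> y0 \<in> B \<and> B \<subseteq> A \<and>
  open_E n ((\<lambda>y. y(i := F y)) ` B) \<and>
  smooth_on n ((\<lambda>y. y(i := F y)) ` B) g \<and> (\<forall>y\<in>B. g (y(i := F y)) = y i)"
proof -
 define \<Phi> where "\<Phi> = (\<lambda>y. y(i := F y))"
 have "continuous_on A (pd i F)"
  using smooth_on_continuous[OF O smooth_on_pd[OF O F i]] .
 \<comment> \<open>Closer to its value at y0 than that value is to 0, \<open>pd i F\<close> cannot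
   vanish on the cube.\<close>
 then obtain d where d: "d > 0" "!!y. y \<in> box_at n y0 d ==> y \<in> A \<and> \<bar>pd i F y - pd i F y0\<bar> < \<bar>pd i F y0\<bar>"
  using cont_box[OF O _ y0, of "pd i F" "\<bar>pd i F y0\<bar>"] nz by auto
 define B where "B = box_at n y0 d"
 have B: "open_E n B" "y0 \<in> B" "B \<subseteq> A" "B \<subseteq> E n"
  using openin_box_at box_at_self[OF openE_sub[OF O y0] d(1)] d(2) by (auto simp: B_def box_at_def)
 have nzB: "pd i F y ~= 0" if "y \<in> B" for y
  using d(2)[of y] that by (auto simp: B_def)
 have FB: "smooth_on n B F" by (rule smooth_on_subset[OF O B(1,3) F])
 have inj: "inj_on \<Phi> B"
 proof (rule inj_onI, rule ccontr)
  fix y z assume yz: "y \<in> B" "z \<in> B" "\<Phi> y = \<Phi> z" "y ~= z"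
  have eq: "z = y(i := z i)"
   using yz(3) unfolding \<Phi>_def by (metis fun_upd_triv fun_upd_upd)
  have Feq: "F (y(i := z i)) = F (y(i := y i))"
   using yz(3) eq unfolding \<Phi>_def by (metis fun_upd_same fun_upd_triv)
  have ne: "y i ~= z i"
   using yz(4) eq by (metis fun_upd_triv)
  let ?a = "min (y i) (z i)" and ?b = "max (y i) (z i)"
  have mem: "y(i := t) \<in> B" if "?a \<le> t" "t \<le> ?b" for t
  proof -
   have "\<bar>y i - y0 i\<bar> < d" "\<bar>z i - y0 i\<bar> < d"
    using yz(1,2) i by (auto simp: B_def box_at_def)
   then have "\<bar>t - y0 i\<bar> < d" using that by linarith
   then show ?thesis
    using yz(1) i by (auto simp: B_def box_at_def mem_E)
  qed
  have "\<exists>t. ?a < t \<and> t < ?b \<and> F (y(i := ?b)) - F (y(i := ?a)) = (?b - ?a) * pd i F (y(i := t))"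
  proof (rule MVT2)
   show "?a < ?b" using ne by auto
   show "((\<lambda>t. F (y(i := t))) has_real_derivative pd i F (y(i := t))) (at t)" if "?a \<le> t" "t \<le> ?b" for t
    using smooth_on_deriv[OF B(1) FB i mem[OF that]] by simp
  qed
  then obtain t where t: "?a < t" "t < ?b" "F (y(i := ?b)) - F (y(i := ?a)) = (?b - ?a) * pd i F (y(i := t))"
   by blast
  have "F (y(i := ?b)) - F (y(i := ?a)) = 0"
   using Feq by (auto simp: max_def min_def)
  then show False
   using t nzB[OF mem[of t]] ne by auto
 qed
 have cont: "continuous_map (subtopology (ES n) W) (ES n) \<Phi>" if W: "W \<subseteq> B" for W
 proof -
  have cF: "continuous_on W F"
   using continuous_on_subset[OF smooth_on_continuous[OF B(1) FB] W] .
  have WE: "W \<subseteq> E n" using W B(4) by blast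
  have "continuous_on W (\<lambda>y. \<Phi> y j)" for j
   unfolding \<Phi>_def by (cases "j = i") (use cF cont_coord in simp_all)
  then have "continuous_map (subtopology (ES n) W) (ES n) (\<lambda>y j. if j < n then \<Phi> y j else 0)"
   unfolding continuous_map_componentwise_Euclidean_space using cont_E_iff[OF WE] by blast
  then show ?thesis
  proof (rule continuous_map_eq)
   fix y assume "y \<in> topspace (subtopology (ES n) W)"
   then have "y \<in> E n" by simp
   then show "(\<lambda>j. if j < n then \<Phi> y j else 0) = \<Phi> y"
    using i by (auto simp: \<Phi>_def mem_E)
  qed
 qed
 have op: "open_E n (\<Phi> ` W)" if "open_E n W" "W \<subseteq> B" for W
  by (rule invariance_of_domain_Euclidean_space[OF that(1) cont[OF that(2)] inj_on_subset[OF inj that(2)]])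
 let ?D = "\<Phi> ` B"
 have D: "open_E n ?D" using op[OF B(1)] by simp
 \<comment> \<open>Only the i-th component of the inverse map is unknown; the other components are
   those of z.\<close>
 define g where "g z = inv_into B \<Phi> z i" for z
 have g: "g (\<Phi> y) = y i" if "y \<in> B" for y
  using that inj by (simp add: g_def)
 have inv: "(\<Phi> y)(i := g (\<Phi> y)) = y" if "y \<in> B" for y
  using g[OF that] by (simp add: \<Phi>_def)
 have contg: "continuous_on ?D g"
 proof (rule cont_onI_box)
  show "?D \<subseteq> E n" using D openin_subset by blast
  fix z and e :: real assume z: "z \<in> ?D" and e: "e > 0"
  then obtain y where y: "y \<in> B" "z = \<Phi> y" by blast
  have "open_E n (\<Phi> ` (box_at n y e \<inter> B))"
   by (rule op) (auto intro: openin_Int openin_box_at B(1))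
  moreover have "z \<in> \<Phi> ` (box_at n y e \<inter> B)"
   using y box_at_self[OF openE_sub[OF B(1) y(1)] e] by blast
  ultimately obtain r where r: "r > 0" "box_at n z r \<subseteq> \<Phi> ` (box_at n y e \<inter> B)"
   using openE_box by blast
  have "\<bar>g z' - g z\<bar> < e" if "z' \<in> box_at n z r" for z'
  proof -
   obtain y' where "y' \<in> box_at n y e" "y' \<in> B" "z' = \<Phi> y'"
    using r(2) \<open>z' \<in> box_at n z r\<close> by blast
   then show ?thesis
    using g y i by (auto simp: box_at_def)
  qed
  then show "\<exists>r>0. \<forall>z'\<in>box_at n z r. z' \<in> ?D --> \<bar>g z' - g z\<bar> < e"
   using r(1) by blast
 qed
 define \<Psi> where "\<Psi> z = tup n (\<lambda>k. if k = i then g z else z k)" for z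
 have \<Psi>: "\<Psi> (\<Phi> y) = y" if "y \<in> B" for y
 proof (rule E_eqI)
  show "y \<in> E n" using that B(4) by blast
  show "\<Psi> (\<Phi> y) k = y k" if "k < n" for k
   using that g[OF \<open>y \<in> B\<close>] by (simp add: \<Psi>_def) (simp add: \<Phi>_def)
 qed (simp add: \<Psi>_def)
 \<comment> \<open>The partial derivatives to be expected of g, by implicit differentiation of F
   (\<Psi> z) = z i.\<close>
 define R where "R j y = (if j = i then 1 else - 1 * pd j F y) / pd i F y" for j y
 have deriv: "((\<lambda>t. g (z(j := t))) has_real_derivative R j (\<Psi> z)) (at (z j))" if j: "j < n" and z: "z \<in> ?D" for j z
 proof -
  obtain y where y: "y \<in> B" "z = \<Phi> y" using z by blast
  have yz: "\<Psi> z = y" using \<Psi> y by simp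
  define Y where "Y t = \<Psi> (z(j := t))" for t
  have evD: "eventually (\<lambda>t. z(j := t) \<in> ?D) (at (z j))"
   using eventually_upd[OF D z j] eventually_nhds_conv_at by blast
  have YE: "Y t \<in> E n" for t by (simp add: Y_def \<Psi>_def)
  have tg: "tendsto (\<lambda>t. g (z(j := t))) (g z) (at (z j))"
  proof (rule tendstoI)
   fix e :: real assume "e > 0"
   then obtain r where r: "r > 0" "!!z'. z' \<in> box_at n z r ==> \<bar>g z' - g z\<bar> < e"
    using cont_box[OF D contg z] by blast
   have "eventually (\<lambda>t. z(j := t) \<in> box_at n z r) (at (z j))"
    using eventually_upd[OF openin_box_at box_at_self[OF openE_sub[OF D z] r(1)] j] eventually_nhds_conv_at by blast
   then show "eventually (\<lambda>t. dist (g (z(j := t))) (g z) < e) (at (z j))"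
    by eventually_elim (use r(2) in "simp add: dist_real_def")
  qed
  have tY: "tendsto (\<lambda>t. Y t k) (y k) (at (z j))" if k: "k < n" for k
  proof (cases "k = i")
   case True
   then show ?thesis
    using tg g y i by (simp add: Y_def \<Psi>_def)
  next
   case False
   then have "y k = z k" using y by (simp add: \<Phi>_def)
   moreover have "tendsto (\<lambda>t. (z(j := t)) k) (z k) (at (z j))"
    by (cases "k = j") auto
   ultimately show ?thesis using False k by (simp add: Y_def \<Psi>_def)
  qed
  have ckF: "ck (Suc 0) n B F" by (rule smooth_on_ck[OF B(1) FB])
  have td: "tendsto (\<lambda>t. dq F y k (Y t)) (pd k F y) (at (z j))" if "k < n" for k
   by (rule dq_tendsto[OF B(1) ckF y(1) that]) (use YE tY in auto)
  have evnz: "eventually (\<lambda>t. dq F y i (Y t) ~= 0) (at (z j))"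
   by (rule tendsto_imp_eventually_ne[OF td[OF i] nzB[OF y(1)]])
  \<comment> \<open>Two points of B whose images differ in coordinate j alone can differ in
    coordinates i and j only. So two terms of the telescoped increment of F remain, and they are
    solved for the increment of g.\<close>
  have evq: "eventually (\<lambda>t. (if j = i then 1 else - 1 * dq F y j (Y t)) / dq F y i (Y t)
    = (g (z(j := t)) - g z) / (t - z j)) (at (z j))"
   using evD evnz eventually_neq_at_within[of "z j" "z j" UNIV]
  proof eventually_elim
   case (elim t)
   obtain y' where y': "y' \<in> B" "z(j := t) = \<Phi> y'" using elim(1) by blast
   have Y: "Y t = y'" using \<Psi>[OF y'(1)] y'(2) by (simp add: Y_def)
   have Fy: "F y' = (z(j := t)) i" "F y = z i"
    using y' y by (simp_all add: \<Phi>_def)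
   have gy: "g (z(j := t)) = y' i" "g z = y i"
    using g y y' by simp_all
   have other: "y' k = (z(j := t)) k" "y k = z k" if "k ~= i" for k
    using y' y that by (simp_all add: \<Phi>_def)
   have "F y' - F y = (\<Sum>k<n. dq F y k y' * (y' k - y k))"
    by (rule dq_telescope) (use y y' B(4) in auto)
   also have "\<dots> = (\<Sum>k<n. (if k = i then dq F y i y' * (y' i - y i) else 0) +
     (if k = j then (if j = i then 0 else dq F y j y' * (t - z j)) else 0))"
    by (rule sum.cong) (auto simp: other)
   also have "\<dots> = dq F y i y' * (y' i - y i) + (if j = i then 0 else dq F y j y' * (t - z j))"
    unfolding sum.distrib using i j by simp
   finally have *: "(z(j := t)) i - z i = dq F y i y' * (g (z(j := t)) - g z) + (if j = i then 0 else dq F y j y' * (t - z j))"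
    using Fy gy by simp
   show ?case
    using * elim(2,3) unfolding Y by (auto simp: divide_simps split: if_splits) (simp_all add: algebra_simps)
  qed
  have "tendsto (\<lambda>t. (if j = i then 1 else - 1 * dq F y j (Y t)) / dq F y i (Y t)) (R j y) (at (z j))"
   unfolding R_def
   by (cases "j = i") (use td[OF i] td[OF j] nzB[OF y(1)] in "auto intro!: tendsto_intros")
  then have "tendsto (\<lambda>t. (g (z(j := t)) - g z) / (t - z j)) (R j y) (at (z j))"
   using evq by (rule Lim_transform_eventually)
  then show ?thesis
   by (simp add: has_field_derivative_iff yz)
 qed
 have sR: "smooth_on n B (R j)" if "j < n" for j
 proof -
  have "smooth_on n B (\<lambda>y. if j = i then 1 else - 1 * pd j F y)"
   by (cases "j = i")
    (use smooth_on_const[OF B(1)] smooth_on_mult[OF B(1) smooth_on_const[OF B(1), of "-1"] smooth_on_pd[OF B(1) FB that]] in simp_all)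
  then show ?thesis
   unfolding R_def using smooth_on_divide[OF B(1) _ smooth_on_pd[OF B(1) FB i]] nzB by blast
 qed
 have "ck K n ?D g" for K
 proof (induction K)
  case 0
  then show ?case using contg by simp
 next
  case (Suc K)
  show ?case
  proof (rule ck_SucI[OF D contg deriv])
   fix j assume j: "j < n"
   \<comment> \<open>Bootstrap: apart from g, the components of \<Psi> are coordinates, so a g of
     class \<open>ck K\<close> has derivatives of class \<open>ck K\<close>.\<close>
   have "ck K n ?D (\<lambda>z. R j (tup n (\<lambda>k. if k = i then g z else z k)))"
   proof (rule ck_compose[OF D B(1) smooth_on_ck[OF B(1) sR[OF j]]])
    show "ck K n ?D (\<lambda>z. if k = i then g z else z k)" for k
     by (cases "k = i") (use Suc ck_coord[OF D] in auto)
    show "tup n (\<lambda>k. if k = i then g z else z k) \<in> B" if "z \<in> ?D" for z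
     using that \<Psi> by (auto simp: \<Psi>_def[symmetric])
   qed
   then show "ck K n ?D (\<lambda>z. R j (\<Psi> z))"
    by (simp add: \<Psi>_def)
  qed
 qed
 then have "smooth_on n ?D g"
  by (simp add: smooth_on_iff_ck[OF D])
 then show ?thesis
  using B D g unfolding \<Phi>_def by blast
qed

section \<open>Spaces with germs of smooth functions\<close>

lemma topspace_initial [simp]: "topspace (initial_topology S C) = S"
 by (auto simp: initial_topology_def)

lemma openin_initial_sub: "openin (initial_topology S C) W ==> W \<subseteq> S"
 using openin_subset[of "initial_topology S C" W] by simp

lemma continuous_map_initial:
 assumes "f \<in> C"
 shows "continuous_map (initial_topology S C) euclideanreal f"
 unfolding continuous_map
proof (intro conjI allI impI)
 fix V assume "openin euclideanreal V"
 then have "{p \<in> S. f p \<in> V} \<in> insert S {{p \<in> S. f p \<in> V} |f V. f \<in> C \<and> open V}"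
  using assms by auto
 then show "openin (initial_topology S C) {x \<in> topspace (initial_topology S C). f x \<in> V}"
  unfolding topspace_initial unfolding initial_topology_def by (rule topology_generated_by_Basis)
qed simp

lemma initial_basis:
 assumes "openin (initial_topology S C) W" "p \<in> W"
 shows "\<exists>I e. finite I \<and> I \<subseteq> C \<and> e > 0 \<and> {q \<in> S. \<forall>f\<in>I. \<bar>f q - f p\<bar> < e} \<subseteq> W"
proof -
 have "generate_topology_on (insert S {{p \<in> S. f p \<in> V} |f V. f \<in> C \<and> open V}) W"
  using assms(1) unfolding initial_topology_def openin_topology_generated_by_iff .
 then show ?thesis
  using assms(2)
 proof (induction rule: generate_topology_on.induct)
  case (Int a b)
  then obtain I e J d where "finite I" "I \<subseteq> C" "e > 0" "{q \<in> S. \<forall>f\<in>I. \<bar>f q - f p\<bar> < e} \<subseteq> a"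
   "finite J" "J \<subseteq> C" "d > 0" "{q \<in> S. \<forall>f\<in>J. \<bar>f q - f p\<bar> < d} \<subseteq> b"
   by blast
  then have "finite (I \<union> J)" "I \<union> J \<subseteq> C" "min e d > 0"
   "{q \<in> S. \<forall>f\<in>I \<union> J. \<bar>f q - f p\<bar> < min e d} \<subseteq> a \<inter> b"
   by auto
  then show ?case by blast
 next
  case (UN K)
  then obtain k where k: "k \<in> K" "p \<in> k" by blast
  obtain I e where *: "finite I" "I \<subseteq> C" "e > 0" "{q \<in> S. \<forall>f\<in>I. \<bar>f q - f p\<bar> < e} \<subseteq> k"
   using UN.IH[OF k] by (elim exE conjE)
  have "{q \<in> S. \<forall>f\<in>I. \<bar>f q - f p\<bar> < e} \<subseteq> \<Union>K"
   by (rule subset_trans[OF *(4)]) (use k in auto)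
  then show ?case
   using *(1-3) by (intro exI[of _ I] exI[of _ e]) simp
 next
  case (Basis s)
  show ?case
  proof (cases "s = S")
   case True
   then show ?thesis by (intro exI[of _ "{}"] exI[of _ 1]) auto
  next
   case False
   then obtain f V where s: "s = {p \<in> S. f p \<in> V}" "f \<in> C" "open V"
    using Basis by auto
   then obtain e where "e > 0" "ball (f p) e \<subseteq> V"
    using Basis.prems open_contains_ball by blast
   then show ?thesis
    using s by (intro exI[of _ "{f}"] exI[of _ e]) (auto simp: dist_real_def abs_minus_commute subset_iff)
  qed
 qed simp
qed

section \<open>Neighbourhood filters and germs of functions\<close>

abbreviation "nh M p \<equiv> nhdsin (top_of M) p"

lemma ev_nh: "p \<in> pts M ==> eventually P (nh M p) \<longleftrightarrow> (\<exists>W. open_in M W \<and> p \<in> W \<and> (\<forall>q\<in>W. P q))"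
 by (simp add: eventually_nhdsin)

lemma ev_nhI: "open_in M W ==> p \<in> W ==> (!!q. q \<in> W ==> P q) ==> eventually P (nh M p)"
 unfolding eventually_nhdsin by (intro disjI2 exI[of _ W]) simp

lemma openin_ev:
 assumes "!!p. p \<in> W ==> p \<in> pts M \<and> eventually (\<lambda>q. q \<in> W) (nh M p)"
 shows "open_in M W"
proof (subst openin_subopen, rule ballI)
 fix p assume "p \<in> W"
 from assms[OF this] show "\<exists>T. open_in M T \<and> p \<in> T \<and> T \<subseteq> W" using ev_nh[of p M "\<lambda>q. q \<in> W"] by blast
qed

lemma ev_nh_self: "eventually P (nh M p) ==> p \<in> pts M ==> P p"
 by (auto simp: ev_nh)

lemma ev_nh_pts: "eventually (\<lambda>q. q \<in> pts M) (nh M p)"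
 unfolding eventually_nhdsin using openin_topspace[of "top_of M"] by auto

lemmas ev_ptsI = eventually_mono[OF ev_nh_pts]

lemma ev_nh_ev: "eventually P (nh M p) ==> eventually (\<lambda>q. eventually P (nh M q)) (nh M p)"
proof (cases "p \<in> pts M")
 case True
 assume "eventually P (nh M p)"
 then obtain W where W: "open_in M W" "p \<in> W" "\<forall>q\<in>W. P q"
  using ev_nh[OF True] by blast
 show ?thesis
 proof (rule ev_nhI[OF W(1,2)])
  show "eventually P (nh M q)" if "q \<in> W" for q
   by (rule ev_nhI[OF W(1) that]) (use W(3) in blast)
 qed
qed (simp add: eventually_nhdsin)

text \<open>Agreement near p with a global smooth function. This is the right notion for chart
  coordinates, whose values outside the chart domain are arbitrary.\<close>

definition smooth_at :: "'a space => 'a => ('a => real) => bool" where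
 "smooth_at M p f \<longleftrightarrow> p \<in> pts M \<and> (\<exists>g\<in>Cinf M. eventually (\<lambda>q. f q = g q) (nh M p))"

lemma smooth_atI:
 "p \<in> pts M ==> g \<in> Cinf M ==> eventually (\<lambda>q. f q = g q) (nh M p) ==> smooth_at M p f"
 unfolding smooth_at_def by (intro conjI bexI[of _ g])

lemma smooth_atE:
 assumes "smooth_at M p f"
 obtains g where "p \<in> pts M" "g \<in> Cinf M" "eventually (\<lambda>q. f q = g q) (nh M p)"
 using assms unfolding smooth_at_def by (elim conjE bexE)

lemma sm_cong:
 assumes "eventually (\<lambda>q. f q = g q) (nh M p)" "smooth_at M p f"
 shows "smooth_at M p g"
proof -
 obtain k where k: "k \<in> Cinf M" "eventually (\<lambda>q. f q = k q) (nh M p)" "p \<in> pts M"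
  using assms(2) by (auto simp: smooth_at_def)
 have "eventually (\<lambda>q. g q = k q) (nh M p)"
  using assms(1) k(2) by eventually_elim simp
 then show ?thesis using k(1,3) unfolding smooth_at_def by blast
qed

lemma sm_Cinf: "f \<in> Cinf M ==> p \<in> pts M ==> smooth_at M p f"
 unfolding smooth_at_def by (intro conjI bexI[of _ f] always_eventually) simp_all

lemma sm_pts: "smooth_at M p f ==> p \<in> pts M"
 by (simp add: smooth_at_def)

lemma sm_ev: "smooth_at M p f ==> eventually (\<lambda>q. smooth_at M q f) (nh M p)"
proof -
 assume f: "smooth_at M p f"
 then obtain g where g: "g \<in> Cinf M" "eventually (\<lambda>q. f q = g q) (nh M p)"
  by (auto simp: smooth_at_def)
 show ?thesis
  using ev_nh_ev[OF g(2)] ev_nh_pts[of M p]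
  by eventually_elim (use g(1) in "auto simp: smooth_at_def")
qed

lemma locally_smooth_iff:
 assumes "open_in M U"
 shows "locally_smooth M U f \<longleftrightarrow> (\<forall>p\<in>U. smooth_at M p f)"
proof -
 have U: "U \<subseteq> pts M" using assms by (rule openin_initial_sub)
 have "(\<exists>W g. open_in M W \<and> p \<in> W \<and> W \<subseteq> U \<and> g \<in> Cinf M \<and> (\<forall>q\<in>W. f q = g q)) \<longleftrightarrow> smooth_at M p f" (is "?l = ?r")
  if p: "p \<in> U" for p
 proof
  show ?l if r: ?r
  proof -
   obtain g where "p \<in> pts M" "g \<in> Cinf M" "eventually (\<lambda>q. f q = g q) (nh M p)"
    using r by (rule smooth_atE)
   then obtain W where g: "g \<in> Cinf M" "open_in M W" "p \<in> W" "\<forall>q\<in>W. f q = g q"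
    using ev_nh[of p M "\<lambda>q. f q = g q"] U p by blast
   then show ?l
    using assms p by (intro exI[of _ "W \<inter> U"] exI[of _ g]) auto
  qed
  show ?r if ?l
  proof -
   obtain W g where "open_in M W" "p \<in> W" "g \<in> Cinf M" "\<forall>q\<in>W. f q = g q"
    using \<open>?l\<close> by (elim exE conjE)
   then show ?r
    using U p smooth_atI[of p M g f] ev_nhI[of M W p "\<lambda>q. f q = g q"] by blast
  qed
 qed
 then show ?thesis unfolding locally_smooth_def by blast
qed

text \<open>The axioms of a differential space in the sense of Sikorski: locality and closure under
  smooth composition. Manifolds and generated spaces both satisfy them, so products and tangent
  bundles can be handled without charts.\<close>

definition diffspace :: "'a space => bool" where
 "diffspace M \<longleftrightarrow> (\<forall>f. (\<forall>p\<in>pts M. smooth_at M p f) --> f \<in> Cinf M) \<and>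
  (\<forall>m c F. (\<forall>i<m. c i \<in> Cinf M) --> smooth_on m (E m) F --> (\<lambda>q. F (tup m (\<lambda>i. c i q))) \<in> Cinf M)"

lemma diffspace_Cinf_iff: "diffspace M ==> f \<in> Cinf M \<longleftrightarrow> (\<forall>p\<in>pts M. smooth_at M p f)"
 unfolding diffspace_def using sm_Cinf[of f M] by blast

lemma CinfI: "diffspace M ==> (!!p. p \<in> pts M ==> smooth_at M p f) ==> f \<in> Cinf M"
 unfolding diffspace_def by blast

lemma openin_E [simp]: "open_E m (E m)"
 by simp

lemma ev_close:
 assumes "finite I" "!!f. f \<in> I ==> smooth_at M p f" "e > 0"
 shows "eventually (\<lambda>q. \<forall>f\<in>I. \<bar>f q - f p\<bar> < e) (nh M p)"
proof (rule eventually_ball_finite[OF assms(1)], rule ballI)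
 fix f assume f: "f \<in> I"
 then obtain g where g: "g \<in> Cinf M" "eventually (\<lambda>q. f q = g q) (nh M p)" and p: "p \<in> pts M"
  using assms(2)[OF f] by (auto simp: smooth_at_def)
 have "open_in M {q \<in> topspace (top_of M). g q \<in> {t. \<bar>t - f p\<bar> < e}}"
 proof (rule openin_continuous_map_preimage[OF continuous_map_initial[OF g(1)]])
  have "{t. \<bar>t - f p\<bar> < e} = ball (f p) e"
   by (auto simp: dist_real_def)
  then show "openin euclideanreal {t. \<bar>t - f p\<bar> < e}" by simp
 qed
 moreover have "f p = g p" using ev_nh_self[OF g(2) p] .
 ultimately have "eventually (\<lambda>q. \<bar>g q - f p\<bar> < e) (nh M p)"
  using p assms(3) by (intro ev_nhI[of M "{q \<in> topspace (top_of M). g q \<in> {t. \<bar>t - f p\<bar> < e}}"]) auto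
 then show "eventually (\<lambda>q. \<bar>f q - f p\<bar> < e) (nh M p)"
  using g(2) by eventually_elim simp
qed

lemma smooth_on_prod:
 assumes U: "open_E n U"
 shows "(!!j. j \<in> J ==> smooth_on n U (F j)) ==> smooth_on n U (\<lambda>x. \<Prod>j\<in>J. F j x)"
proof (induction J rule: infinite_finite_induct)
 case (insert a J)
 then have "smooth_on n U (\<lambda>x. F a x * (\<Prod>j\<in>J. F j x))"
  by (intro smooth_on_mult[OF U]) auto
 then show ?case using insert by simp
qed (auto intro: smooth_on_const[OF U])

lemma tup_box:
 assumes "!!i. i < m ==> \<bar>c i - d i\<bar> < e"
 shows "tup m c \<in> box_at m (tup m d) e"
 using assms by (auto simp: box_at_def)

text \<open>A product of functions \<open>bmp (e / 2)\<close>, which are 1 up to e/4 and 0 from e/2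
  on. The room between e/2 and e makes the extension by 0 smooth at the points outside V.\<close>

lemma smooth_cutoff:
 assumes V: "open_E m V" and F: "smooth_on m V F" and e: "e > 0" "box_at m y0 e \<subseteq> V"
  and y0: "y0 \<in> E m"
 shows "\<exists>G. smooth_on m (E m) G \<and> (\<forall>y\<in>box_at m y0 (e / 4). G y = F y) \<and>
  (\<forall>y\<in>E m - box_at m y0 (e / 2). G y = 0)"
proof -
 define b where "b y = (\<Prod>i<m. bmp (e / 2) (y i - y0 i))" for y
 have sb: "smooth_on m U b" if U: "open_E m U" for U
  unfolding b_def by (intro smooth_on_prod[OF U] smooth_on_bmp[OF U] smooth_on_diff[OF U] smooth_on_coord[OF U] smooth_on_const[OF U])
 have b0: "b y = 0" if "y \<in> E m" "y \<notin> box_at m y0 (e / 2)" for y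
 proof -
  have "\<exists>i<m. \<not> \<bar>y i - y0 i\<bar> < e / 2"
   using that by (simp add: box_at_def)
  then obtain i where "i < m" "\<bar>y i - y0 i\<bar> \<ge> e / 2"
   unfolding not_less by blast
  then show ?thesis
   using bmp_eq_0[of "e / 2" "y i - y0 i"] e by (auto simp: b_def intro!: prod_zero)
 qed
 have b1: "b y = 1" if "y \<in> box_at m y0 (e / 4)" for y
  unfolding b_def using that e by (intro prod.neutral ballI bmp_eq_1) (auto simp: box_at_def less_imp_le)
 define G where "G y = (if y \<in> V then b y * F y else 0)" for y
 have "smooth_on m (E m) G"
 proof (rule smooth_on_local[OF openin_E])
  fix y assume y: "y \<in> E m"
  show "\<exists>W. open_E m W \<and> y \<in> W \<and> smooth_on m W G"
  proof (cases "y \<in> V")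
   case True
   have "smooth_on m V G"
    by (rule smooth_on_cong[OF V _ smooth_on_mult[OF V sb[OF V] F]]) (simp add: G_def)
   then show ?thesis using V True by blast
  next
   case False
   then obtain i where i: "i < m" "\<bar>y i - y0 i\<bar> \<ge> e"
    using y e(2) by (force simp: box_at_def not_less)
   \<comment> \<open>A point outside V is at least e away from y0 in some coordinate, so the cube of
     half that size around it misses the support of b.\<close>
   have "z \<notin> box_at m y0 (e / 2)" if "z \<in> box_at m y (e / 2)" for z
   proof -
    have "\<bar>z i - y i\<bar> < e / 2" using that i(1) by (simp add: box_at_def)
    then have "\<not> \<bar>z i - y0 i\<bar> < e / 2" using i(2) by linarith
    then show ?thesis using i(1) by (auto simp: box_at_def)
   qed
   then have "smooth_on m (box_at m y (e / 2)) G"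
    by (intro smooth_on_cong[OF openin_box_at _ smooth_on_const[OF openin_box_at, of _ _ _ 0]])
     (auto simp: G_def b0 box_at_def)
   then show ?thesis
    using openin_box_at box_at_self[OF y] e(1) by (intro exI[of _ "box_at m y (e / 2)"]) auto
  qed
 qed
 moreover have "G y = F y" if "y \<in> box_at m y0 (e / 4)" for y
 proof -
  have "y \<in> V" using that e box_at_mono[of "e / 4" e m y0] by auto
  then show ?thesis using b1[OF that] by (simp add: G_def)
 qed
 moreover have "G y = 0" if "y \<in> E m - box_at m y0 (e / 2)" for y
  using that b0 by (simp add: G_def)
 ultimately show ?thesis by blast
qed

text \<open>A cut-off of finitely many smooth functions that describe a neighbourhood of p inside W.
  The open set W' is recorded for gluing: it covers the space together with W, so a function smooth
  on W, multiplied by \<rho> and extended by 0, is smooth everywhere.\<close>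

lemma bump:
 assumes M: "diffspace M" and W: "open_in M W" "p \<in> W"
 shows "\<exists>\<rho>\<in>Cinf M. eventually (\<lambda>q. \<rho> q = 1) (nh M p) \<and>
  (\<exists>W'. open_in M W' \<and> W \<union> W' = pts M \<and> (\<forall>q\<in>W'. \<rho> q = 0))"
proof -
 have p: "p \<in> pts M" using W openin_initial_sub by blast
 obtain I e where I: "finite I" "I \<subseteq> Cinf M" and e: "e > 0" "{q \<in> pts M. \<forall>f\<in>I. \<bar>f q - f p\<bar> < e} \<subseteq> W"
  using initial_basis[OF W] by blast
 obtain fs :: "('a => real) list" where fs: "set fs = I"
  using finite_list[OF I(1)] by blast
 define m where "m = length fs"
 define y0 where "y0 = tup m (\<lambda>i. (fs ! i) p)"
 obtain G where G: "smooth_on m (E m) G" "\<forall>y\<in>box_at m y0 (e / 4). G y = 1"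
  "\<forall>y\<in>E m - box_at m y0 (e / 2). G y = 0"
  using smooth_cutoff[OF openin_E smooth_on_const[OF openin_E], of e m y0 1] e(1)
  by (auto simp: box_at_def y0_def)
 define \<rho> where "\<rho> q = G (tup m (\<lambda>i. (fs ! i) q))" for q
 have "fs ! i \<in> Cinf M" if "i < m" for i
  using I(2) fs that by (auto simp: m_def)
 then have "(\<lambda>q. G (tup m (\<lambda>i. (fs ! i) q))) \<in> Cinf M"
  using M G(1) unfolding diffspace_def by blast
 then have \<rho>: "\<rho> \<in> Cinf M"
  unfolding \<rho>_def .
 have sm: "smooth_at M q f" if "f \<in> I" "q \<in> pts M" for q f
  using that I(2) by (intro sm_Cinf) auto
 have "eventually (\<lambda>q. \<forall>f\<in>I. \<bar>f q - f p\<bar> < e / 4) (nh M p)"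
  by (rule ev_close) (use I(1) sm p e(1) in auto)
 then have 1: "eventually (\<lambda>q. \<rho> q = 1) (nh M p)"
 proof eventually_elim
  case (elim q)
  then have "tup m (\<lambda>i. (fs ! i) q) \<in> box_at m y0 (e / 4)"
   unfolding y0_def by (intro tup_box) (auto simp: fs[symmetric] m_def)
  then show ?case using G(2) by (simp add: \<rho>_def)
 qed
 define W' where "W' = {q \<in> pts M. \<exists>f\<in>I. \<bar>f q - f p\<bar> > e / 2}"
 have "W' = (\<Union>f\<in>I. {q \<in> topspace (top_of M). f q \<in> - cball (f p) (e / 2)})"
  by (auto simp: W'_def dist_real_def abs_minus_commute not_le)
 moreover have "open_in M {q \<in> topspace (top_of M). f q \<in> - cball (f p) (e / 2)}" if "f \<in> I" for f
  by (rule openin_continuous_map_preimage[OF continuous_map_initial]) (use that I in auto)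
 ultimately have W': "open_in M W'"
  by auto
 have "\<rho> q = 0" if q: "q \<in> W'" for q
 proof -
  obtain i where i: "i < m" "\<bar>(fs ! i) q - (fs ! i) p\<bar> > e / 2"
   using q fs by (auto simp: W'_def m_def in_set_conv_nth)
  then have "tup m (\<lambda>i. (fs ! i) q) \<in> E m - box_at m y0 (e / 2)"
   by (auto simp: box_at_def y0_def)
  then show ?thesis using G(3) by (simp add: \<rho>_def)
 qed
 moreover have "W \<union> W' = pts M"
 proof -
  have "q \<in> W \<union> W'" if "q \<in> pts M" for q
  proof (cases "\<forall>f\<in>I. \<bar>f q - f p\<bar> < e")
   case True
   then show ?thesis using e(2) that by blast
  next
   case False
   then obtain f where "f \<in> I" "\<bar>f q - f p\<bar> \<ge> e" by (auto simp: not_less)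
   then show ?thesis using that e(1) by (auto simp: W'_def intro!: bexI[of _ f])
  qed
  then show ?thesis using openin_initial_sub[OF W(1)] by (auto simp: W'_def)
 qed
 ultimately show ?thesis using \<rho> 1 W' by blast
qed

lemma sm_const: "diffspace M ==> p \<in> pts M ==> smooth_at M p (\<lambda>q. c)"
 using smooth_on_const[OF openin_E, of 0 c]
 by (intro sm_Cinf) (auto simp: diffspace_def)

text \<open>\<open>diffspace\<close> only speaks of functions F that are smooth on all of
  \<open>E m\<close>; a cut-off of F around the value at p has the same germ there.\<close>

lemma sm_compose:
 assumes M: "diffspace M" and p: "p \<in> pts M" and c: "!!i. i < m ==> smooth_at M p (c i)"
  and V: "open_E m V" "smooth_on m V F" "tup m (\<lambda>i. c i p) \<in> V"
 shows "smooth_at M p (\<lambda>q. F (tup m (\<lambda>i. c i q)))"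
proof -
 let ?y0 = "tup m (\<lambda>i. c i p)"
 obtain e where e: "e > 0" "box_at m ?y0 e \<subseteq> V"
  using openE_box[OF V(1,3)] by blast
 obtain G where G: "smooth_on m (E m) G" "\<forall>y\<in>box_at m ?y0 (e / 4). G y = F y"
  using smooth_cutoff[OF V(1,2) e] by auto
 have "\<forall>i<m. \<exists>g. g \<in> Cinf M \<and> eventually (\<lambda>q. c i q = g q) (nh M p)"
  using c by (auto simp: smooth_at_def)
 then obtain g where g: "!!i. i < m ==> g i \<in> Cinf M" "!!i. i < m ==> eventually (\<lambda>q. c i q = g i q) (nh M p)"
  by metis
 have G_Cinf: "(\<lambda>q. G (tup m (\<lambda>i. g i q))) \<in> Cinf M"
  using M g(1) G(1) unfolding diffspace_def by blast
 have "eventually (\<lambda>q. \<forall>i\<in>{..<m}. c i q = g i q) (nh M p)"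
  by (rule eventually_ball_finite) (use g(2) in auto)
 moreover have "eventually (\<lambda>q. \<forall>f\<in>c ` {..<m}. \<bar>f q - f p\<bar> < e / 4) (nh M p)"
  by (rule ev_close) (use c e(1) in auto)
 ultimately have "eventually (\<lambda>q. F (tup m (\<lambda>i. c i q)) = G (tup m (\<lambda>i. g i q))) (nh M p)"
 proof (eventually_elim)
  case (elim q)
  then have "tup m (\<lambda>i. c i q) \<in> box_at m ?y0 (e / 4)"
   by (intro tup_box) auto
  moreover have "tup m (\<lambda>i. c i q) = tup m (\<lambda>i. g i q)"
   using elim by (intro tup_cong) auto
  ultimately show ?case using G(2) by metis
 qed
 then show ?thesis
  by (rule smooth_atI[OF p G_Cinf])
qed

lemma sm_compose2:
 assumes M: "diffspace M" and f: "smooth_at M p f" and g: "smooth_at M p g"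
  and F: "smooth_on 2 (E 2) (\<lambda>y. F (y 0) (y 1))"
 shows "smooth_at M p (\<lambda>q. F (f q) (g q))"
 using sm_compose[OF M sm_pts[OF f] _ openin_E F, of "\<lambda>i. if i = 0 then f else g"] f g
 by auto

lemma sm_add: "diffspace M ==> smooth_at M p f ==> smooth_at M p g ==> smooth_at M p (\<lambda>q. f q + g q)"
 by (rule sm_compose2) (auto intro: smooth_on_add[OF openin_E] smooth_on_coord[OF openin_E])

lemma sm_mult: "diffspace M ==> smooth_at M p f ==> smooth_at M p g ==> smooth_at M p (\<lambda>q. f q * g q)"
 by (rule sm_compose2) (auto intro: smooth_on_mult[OF openin_E] smooth_on_coord[OF openin_E])

lemma sm_diff: "diffspace M ==> smooth_at M p f ==> smooth_at M p g ==> smooth_at M p (\<lambda>q. f q - g q)"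
 by (rule sm_compose2) (auto intro: smooth_on_diff[OF openin_E] smooth_on_coord[OF openin_E])

lemma sm_cmult: "diffspace M ==> smooth_at M p f ==> smooth_at M p (\<lambda>q. c * f q)"
 using sm_mult[of M p "\<lambda>q. c" f] sm_const[of M p c] sm_pts[of M p f] by blast

lemma sm_sum:
 assumes "diffspace M" "p \<in> pts M"
 shows "(!!j. j \<in> J ==> smooth_at M p (f j)) ==> smooth_at M p (\<lambda>q. \<Sum>j\<in>J. f j q)"
proof (induction J rule: infinite_finite_induct)
 case (insert a J)
 then have "smooth_at M p (\<lambda>q. f a q + (\<Sum>j\<in>J. f j q))"
  by (intro sm_add[OF assms(1)]) auto
 then show ?case using insert by simp
qed (simp_all add: sm_const[OF assms])

lemma Cinf_const: "diffspace M ==> (\<lambda>q. c) \<in> Cinf M"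
 by (rule CinfI) (auto intro: sm_const)

lemma Cinf_add: "diffspace M ==> f \<in> Cinf M ==> g \<in> Cinf M ==> (\<lambda>q. f q + g q) \<in> Cinf M"
 by (rule CinfI) (auto intro: sm_add sm_Cinf)

lemma Cinf_diff: "diffspace M ==> f \<in> Cinf M ==> g \<in> Cinf M ==> (\<lambda>q. f q - g q) \<in> Cinf M"
 by (rule CinfI) (auto intro: sm_diff sm_Cinf)

lemma Cinf_mult: "diffspace M ==> f \<in> Cinf M ==> g \<in> Cinf M ==> (\<lambda>q. f q * g q) \<in> Cinf M"
 by (rule CinfI) (auto intro: sm_mult sm_Cinf)

lemma Cinf_cmult: "diffspace M ==> f \<in> Cinf M ==> (\<lambda>q. c * f q) \<in> Cinf M"
 by (rule CinfI) (auto intro: sm_cmult sm_Cinf)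

lemma Cinf_cong:
 assumes "diffspace M" "f \<in> Cinf M" "!!q. q \<in> pts M ==> f q = g q"
 shows "g \<in> Cinf M"
proof (rule CinfI[OF assms(1)])
 fix p assume p: "p \<in> pts M"
 have "eventually (\<lambda>q. f q = g q) (nh M p)"
  using ev_nh_pts by (rule eventually_mono) (rule assms(3))
 then show "smooth_at M p g"
  using sm_Cinf[OF assms(2) p] by (rule sm_cong)
qed

lemma manifold_diffspace:
 assumes M: "manifold n M"
 shows "diffspace M"
 unfolding diffspace_def
proof (intro conjI allI impI)
 have *: "open_in M (pts M)"
  by (metis openin_topspace topspace_initial)
 show 1: "f \<in> Cinf M" if "\<forall>p\<in>pts M. smooth_at M p f" for f
  using M that locally_smooth_iff[OF *] unfolding manifold_def by blast
 fix m c F assume c: "\<forall>i<m. c i \<in> Cinf M" and F: "smooth_on m (E m) F"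
 show "(\<lambda>q. F (tup m (\<lambda>i. c i q))) \<in> Cinf M"
 proof (rule 1, rule ballI)
  fix p assume "p \<in> pts M"
  then obtain U x where U: "p \<in> U" "chart n M U x"
   using M unfolding manifold_def by blast
  then have op: "open_in M U" "open_E n (x ` U)"
   and iff: "!!f. locally_smooth M U f \<longleftrightarrow> smooth_on n (x ` U) (f \<circ> inv_into U x)"
   by (auto simp: chart_def)
  have "smooth_on n (x ` U) (\<lambda>y. c i (inv_into U x y))" if "i < m" for i
  proof -
   have "locally_smooth M U (c i)"
    using c that op(1) unfolding locally_smooth_def by blast
   then show ?thesis using iff by (simp add: o_def)
  qed
  then have "smooth_on n (x ` U) (\<lambda>y. F (tup m (\<lambda>i. c i (inv_into U x y))))"
   by (intro smooth_on_compose[OF op(2) openin_E F]) auto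
  then have "locally_smooth M U (\<lambda>q. F (tup m (\<lambda>i. c i q)))"
   unfolding iff by (simp add: o_def)
  then show "smooth_at M p (\<lambda>q. F (tup m (\<lambda>i. c i q)))"
   using locally_smooth_iff[OF op(1)] U(1) by blast
 qed
qed

subsection \<open>Generated smooth structures\<close>

definition rep :: "('a => real) set => 'a set => ('a => real) => bool" where
 "rep C W f \<longleftrightarrow> (\<exists>m c F. (\<forall>i<m. c i \<in> C) \<and> smooth_on m (E m) F \<and> (\<forall>q\<in>W. f q = F (tup m (\<lambda>i. c i q))))"

lemma Cinf_gen: "f \<in> Cinf (generated_space S C) \<longleftrightarrow>
  (\<forall>p\<in>S. \<exists>W. openin (initial_topology S C) W \<and> p \<in> W \<and> rep C W f)"
 unfolding generated_space_def rep_def tup_def by simp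

lemma openin_initial_self [simp]: "openin (initial_topology S C) S"
 using openin_topspace[of "initial_topology S C"] by simp

lemma pts_gen [simp]: "pts (generated_space S C) = S"
 by (simp add: generated_space_def)

lemma rep_subset: "rep C W f ==> V \<subseteq> W ==> rep C V f"
 unfolding rep_def by (meson subsetD)

lemma rep_cong: "rep C W f ==> (!!q. q \<in> W ==> g q = f q) ==> rep C W g"
 unfolding rep_def by simp

lemma rep_generator: "c \<in> C ==> rep C W c"
 unfolding rep_def
 by (intro exI[of _ 1] exI[of _ "\<lambda>i. c"] exI[of _ "\<lambda>y. y 0"]) (simp add: smooth_on_coord)

text \<open>Concatenating the lists of generators makes several functions share one list, after
  which composing them with a smooth function is a composition in Euclidean space.\<close>

lemma rep_common:
 fixes N :: nat
 assumes "!!i. i < N ==> rep C W (f i)"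
 shows "\<exists>m c F. (\<forall>i<m. c i \<in> C) \<and> (\<forall>i<N. smooth_on m (E m) (F i)) \<and>
  (\<forall>i<N. \<forall>q\<in>W. f i q = F i (tup m (\<lambda>i. c i q)))"
 using assms
proof (induction N)
 case (Suc N)
 obtain m c F where 1: "\<forall>i<m. c i \<in> C" "\<forall>i<N. smooth_on m (E m) (F i)"
  "\<forall>i<N. \<forall>q\<in>W. f i q = F i (tup m (\<lambda>i. c i q))"
  using Suc.IH Suc.prems less_SucI by blast
 obtain k d G where 2: "\<forall>i<k. d i \<in> C" "smooth_on k (E k) G" "\<forall>q\<in>W. f N q = G (tup k (\<lambda>i. d i q))"
  using Suc.prems[of N] unfolding rep_def by blast
 define c' where "c' j = (if j < m then c j else d (j - m))" for j
 define F' where "F' i y = (if i < N then F i (tup m (\<lambda>j. y j)) else G (tup k (\<lambda>j. y (m + j))))" for i y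
 have "c' i \<in> C" if "i < m + k" for i
  using 1(1) 2(1) that by (auto simp: c'_def)
 moreover have "smooth_on (m + k) (E (m + k)) (F' i)" if "i < Suc N" for i
 proof (cases "i < N")
  case True
  have "smooth_on (m + k) (E (m + k)) (\<lambda>y. F i (tup m (\<lambda>j. y j)))"
   by (rule smooth_on_compose[OF openin_E openin_E]) (use 1(2) True smooth_on_coord[OF openin_E] in auto)
  then show ?thesis using True by (simp add: F'_def[abs_def])
 next
  case False
  have "smooth_on (m + k) (E (m + k)) (\<lambda>y. G (tup k (\<lambda>j. y (m + j))))"
   by (rule smooth_on_compose[OF openin_E openin_E 2(2)]) (auto intro: smooth_on_coord[OF openin_E])
  then show ?thesis using False by (simp add: F'_def[abs_def])
 qed
 moreover have "f i q = F' i (tup (m + k) (\<lambda>i. c' i q))" if "i < Suc N" "q \<in> W" for i q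
 proof (cases "i < N")
  case True
  have "tup m (\<lambda>j. tup (m + k) (\<lambda>i. c' i q) j) = tup m (\<lambda>i. c i q)"
   by (rule tup_cong) (simp add: c'_def)
  then show ?thesis using True 1(3) that by (simp add: F'_def)
 next
  case False
  have "tup k (\<lambda>j. tup (m + k) (\<lambda>i. c' i q) (m + j)) = tup k (\<lambda>i. d i q)"
   by (rule tup_cong) (simp add: c'_def)
  moreover have "i = N" using False that by simp
  ultimately show ?thesis using 2(3) that by (simp add: F'_def)
 qed
 ultimately show ?case by (intro exI[of _ "m + k"] exI[of _ c'] exI[of _ F']) simp
next
 case 0
 show ?case by (intro exI[of _ 0]) simp
qed

lemma rep_compose:
 assumes "!!i. i < N ==> rep C W (f i)" and G: "smooth_on N (E N) G"
 shows "rep C W (\<lambda>q. G (tup N (\<lambda>i. f i q)))"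
proof -
 obtain m c F where 1: "\<forall>i<m. c i \<in> C" "\<forall>i<N. smooth_on m (E m) (F i)"
  "\<forall>i<N. \<forall>q\<in>W. f i q = F i (tup m (\<lambda>i. c i q))"
  using rep_common[of N C W f] assms(1) by blast
 have "smooth_on m (E m) (\<lambda>y. G (tup N (\<lambda>i. F i y)))"
  by (rule smooth_on_compose[OF openin_E openin_E G]) (use 1(2) in auto)
 moreover have "G (tup N (\<lambda>i. f i q)) = G (tup N (\<lambda>i. F i (tup m (\<lambda>i. c i q))))" if "q \<in> W" for q
  using 1(3) that by (metis (no_types, lifting) tup_cong)
 ultimately show ?thesis
  unfolding rep_def using 1(1) by (intro exI[of _ m] exI[of _ c] exI[of _ "\<lambda>y. G (tup N (\<lambda>i. F i y))"]) simp
qed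

lemma cont_gen:
 assumes "f \<in> Cinf (generated_space S C)"
 shows "continuous_map (initial_topology S C) euclideanreal f"
 unfolding continuous_map_atin topspace_initial
proof
 fix p assume p: "p \<in> S"
 obtain W where W: "openin (initial_topology S C) W" "p \<in> W" "rep C W f"
  using assms p unfolding Cinf_gen by blast
 obtain m c F where 1: "\<forall>i<m. c i \<in> C" "smooth_on m (E m) F" "\<forall>q\<in>W. f q = F (tup m (\<lambda>i. c i q))"
  using W(3) unfolding rep_def by blast
 show "limitin euclideanreal f (f p) (atin (initial_topology S C) p)"
  unfolding limitin_canonical_iff
 proof (rule tendstoI)
  fix e :: real assume "e > 0"
  then obtain d where d: "d > 0" "!!y. y \<in> box_at m (tup m (\<lambda>i. c i p)) d ==> \<bar>F y - F (tup m (\<lambda>i. c i p))\<bar> < e"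
   using cont_box[OF openin_E smooth_on_continuous[OF openin_E 1(2)], of "tup m (\<lambda>i. c i p)" e] by auto
  define V where "V = W \<inter> {q \<in> topspace (initial_topology S C). \<forall>i<m. c i q \<in> ball (c i p) d}"
  have "openin (initial_topology S C) {q \<in> topspace (initial_topology S C). c i q \<in> ball (c i p) d}" if "i < m" for i
   by (rule openin_continuous_map_preimage[OF continuous_map_initial]) (use 1(1) that in auto)
  then have "openin (initial_topology S C) (W \<inter> (\<Inter>i\<in>{..<m}. {q \<in> topspace (initial_topology S C). c i q \<in> ball (c i p) d}))"
   using W(1) by (cases "m = 0") auto
  moreover have "W \<inter> (\<Inter>i\<in>{..<m}. {q \<in> topspace (initial_topology S C). c i q \<in> ball (c i p) d}) = V"
   using openin_initial_sub[OF W(1)] by (auto simp: V_def)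
  ultimately have V: "openin (initial_topology S C) V" by simp
  have "dist (f q) (f p) < e" if "q \<in> V" for q
  proof -
   have "tup m (\<lambda>i. c i q) \<in> box_at m (tup m (\<lambda>i. c i p)) d"
    using that by (intro tup_box) (auto simp: V_def dist_real_def abs_minus_commute)
   then show ?thesis
    using d(2) 1(3) that W(2) by (simp add: V_def dist_real_def)
  qed
  moreover have "p \<in> V" using W(2) p d(1) by (simp add: V_def)
  ultimately show "eventually (\<lambda>q. dist (f q) (f p) < e) (atin (initial_topology S C) p)"
   using V p unfolding eventually_atin by (intro disjI2 exI[of _ V]) auto
 qed
qed

lemma initial_topology_mono:
 assumes "!!f. f \<in> C ==> continuous_map (initial_topology S D) euclideanreal f"
 assumes "openin (initial_topology S C) W"
 shows "openin (initial_topology S D) W"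
proof (subst openin_subopen, rule ballI)
 fix p assume p: "p \<in> W"
 obtain I e where I: "finite I" "I \<subseteq> C" "e > 0" "{q \<in> S. \<forall>f\<in>I. \<bar>f q - f p\<bar> < e} \<subseteq> W"
  using initial_basis[OF assms(2) p] by (elim exE conjE)
 have pS: "p \<in> S" using p openin_initial_sub[OF assms(2)] by blast
 define V where "V = topspace (initial_topology S D) \<inter> (\<Inter>f\<in>I. {q \<in> topspace (initial_topology S D). f q \<in> ball (f p) e})"
 have "openin (initial_topology S D) {q \<in> topspace (initial_topology S D). f q \<in> ball (f p) e}" if "f \<in> I" for f
  by (rule openin_continuous_map_preimage[OF assms(1)]) (use I(2) that in auto)
 then have "openin (initial_topology S D) V"
  unfolding V_def using I(1) by (cases "I = {}") (auto intro!: openin_Int openin_INT2)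
 moreover have "p \<in> V" using pS I(3) by (simp add: V_def)
 moreover have "V \<subseteq> {q \<in> S. \<forall>f\<in>I. \<bar>f q - f p\<bar> < e}"
  by (auto simp: V_def dist_real_def abs_minus_commute)
 ultimately show "\<exists>V. openin (initial_topology S D) V \<and> p \<in> V \<and> V \<subseteq> W"
  using I(4) by (intro exI[of _ V]) auto
qed

lemma generators_Cinf: "c \<in> C ==> c \<in> Cinf (generated_space S C)"
 unfolding Cinf_gen by (intro ballI exI[of _ S] conjI rep_generator) simp_all

text \<open>Locally the generated functions are continuous functions of finitely many generators, so
  requiring them to be continuous adds no open sets.\<close>

lemma top_of_gen: "top_of (generated_space S C) = initial_topology S C"
 unfolding topology_eq pts_gen
proof (intro allI iffI)
 fix W
 show "openin (initial_topology S C) W" if "openin (initial_topology S (Cinf (generated_space S C))) W"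
  by (rule initial_topology_mono[OF cont_gen that])
 show "openin (initial_topology S (Cinf (generated_space S C))) W" if "openin (initial_topology S C) W"
  by (rule initial_topology_mono[OF continuous_map_initial that]) (rule generators_Cinf)
qed

lemma Cinf_gen': "f \<in> Cinf (generated_space S C) \<longleftrightarrow>
  (\<forall>p\<in>S. \<exists>W. openin (top_of (generated_space S C)) W \<and> p \<in> W \<and> rep C W f)"
 unfolding top_of_gen by (rule Cinf_gen)

lemma sm_gen:
 assumes "smooth_at (generated_space S C) p f"
 shows "\<exists>W. openin (top_of (generated_space S C)) W \<and> p \<in> W \<and> rep C W f"
proof -
 obtain g where g: "p \<in> pts (generated_space S C)" "g \<in> Cinf (generated_space S C)"
  "eventually (\<lambda>q. f q = g q) (nh (generated_space S C) p)"
  using assms by (rule smooth_atE)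
 have pS: "p \<in> S" using g(1) by simp
 obtain W where W: "openin (top_of (generated_space S C)) W" "p \<in> W" "rep C W g"
  using pS g(2) unfolding Cinf_gen' by blast
 obtain V where V: "openin (top_of (generated_space S C)) V" "p \<in> V" "\<forall>q\<in>V. f q = g q"
  using g(3) unfolding ev_nh[OF g(1)] by blast
 have "rep C (W \<inter> V) f"
  by (rule rep_cong[OF rep_subset[OF W(3)]]) (use V in auto)
 then show ?thesis using W V by (intro exI[of _ "W \<inter> V"]) auto
qed

lemma diffspace_gen: "diffspace (generated_space S C)"
 unfolding diffspace_def
proof (intro conjI allI impI)
 let ?M = "generated_space S C"
 show "f \<in> Cinf ?M" if "\<forall>p\<in>pts ?M. smooth_at ?M p f" for f
  unfolding Cinf_gen'
 proof
  fix p assume "p \<in> S"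
  then have "smooth_at ?M p f" using that by simp
  then show "\<exists>W. open_in ?M W \<and> p \<in> W \<and> rep C W f" by (rule sm_gen)
 qed
 fix m c F assume c: "\<forall>i<m. c i \<in> Cinf ?M" and F: "smooth_on m (E m) F"
 show "(\<lambda>q. F (tup m (\<lambda>i. c i q))) \<in> Cinf ?M"
  unfolding Cinf_gen'
 proof
  fix p assume p: "p \<in> S"
  have "\<forall>i<m. \<exists>W. open_in ?M W \<and> p \<in> W \<and> rep C W (c i)"
   using c p unfolding Cinf_gen' by blast
  then obtain W where W: "!!i. i < m ==> open_in ?M (W i)" "!!i. i < m ==> p \<in> W i" "!!i. i < m ==> rep C (W i) (c i)"
   by metis
  define V where "V = topspace (top_of ?M) \<inter> (\<Inter>i\<in>{..<m}. W i)"
  have "open_in ?M V"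
   unfolding V_def using W(1) by (cases "m = 0") (auto intro!: openin_Int openin_INT2)
  moreover have "p \<in> V" using W(2) p by (simp add: V_def)
  moreover have "rep C V (\<lambda>q. F (tup m (\<lambda>i. c i q)))"
   by (rule rep_compose[OF _ F]) (rule rep_subset[OF W(3)], auto simp: V_def)
  ultimately show "\<exists>W. open_in ?M W \<and> p \<in> W \<and> rep C W (\<lambda>q. F (tup m (\<lambda>i. c i q)))"
   by blast
 qed
qed

lemma diffspace_prod [simp]: "diffspace (prod_space M N)"
 and diffspace_subspace [simp]: "diffspace (subspace_of M S)"
 and diffspace_tangent [simp]: "diffspace (tangent_bundle M)"
 and diffspace_real [simp]: "diffspace real_line"
 by (simp_all add: prod_space_def subspace_of_def tangent_bundle_def real_line_def diffspace_gen)

subsection \<open>Germs of smooth maps\<close>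

definition smap_at :: "'a space => 'b space => 'a => ('a => 'b) => bool" where
 "smap_at M N p \<phi> \<longleftrightarrow> p \<in> pts M \<and> eventually (\<lambda>q. \<phi> q \<in> pts N) (nh M p) \<and>
  (\<forall>f\<in>Cinf N. smooth_at M p (\<lambda>q. f (\<phi> q)))"

lemma smap_at_pts: "smap_at M N p \<phi> ==> p \<in> pts M"
 by (simp add: smap_at_def)

lemma smap_at_img: "smap_at M N p \<phi> ==> \<phi> p \<in> pts N"
 using ev_nh_self[of "\<lambda>q. \<phi> q \<in> pts N" M p] by (simp add: smap_at_def)

lemma smooth_map_Cinf: "smooth_map M N \<phi> ==> f \<in> Cinf N ==> (\<lambda>q. f (\<phi> q)) \<in> Cinf M"
 by (auto simp: smooth_map_def o_def)

lemma smooth_mapD: "smooth_map M N \<phi> ==> p \<in> pts M ==> smap_at M N p \<phi>"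
 unfolding smap_at_def smooth_map_def
 by (auto intro: sm_Cinf ev_ptsI simp: o_def)

lemma smooth_mapI:
 assumes "diffspace M" "!!p. p \<in> pts M ==> smap_at M N p \<phi>"
 shows "smooth_map M N \<phi>"
 unfolding smooth_map_def
proof (intro conjI ballI)
 show "\<phi> ` pts M \<subseteq> pts N" by (auto intro: smap_at_img[OF assms(2)])
 show "f \<circ> \<phi> \<in> Cinf M" if "f \<in> Cinf N" for f
  using assms that by (auto simp: o_def smap_at_def intro: CinfI)
qed

lemma smap_at_cong:
 assumes "eventually (\<lambda>q. \<phi> q = \<psi> q) (nh M p)" "smap_at M N p \<phi>"
 shows "smap_at M N p \<psi>"
 unfolding smap_at_def
proof (intro conjI ballI)
 have *: "p \<in> pts M" "eventually (\<lambda>q. \<phi> q \<in> pts N) (nh M p)"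
  "!!f. f \<in> Cinf N ==> smooth_at M p (\<lambda>q. f (\<phi> q))"
  using assms(2) by (auto simp: smap_at_def)
 show "p \<in> pts M" by (rule *(1))
 show "eventually (\<lambda>q. \<psi> q \<in> pts N) (nh M p)"
  using assms(1) *(2) by eventually_elim simp
 show "smooth_at M p (\<lambda>q. f (\<psi> q))" if "f \<in> Cinf N" for f
  by (rule sm_cong[OF _ *(3)[OF that]]) (use assms(1) in "auto elim: eventually_mono")
qed

lemma smap_at_cont:
 assumes \<phi>: "smap_at M N p \<phi>" and V: "open_in N V" "\<phi> p \<in> V"
 shows "eventually (\<lambda>q. \<phi> q \<in> V) (nh M p)"
proof -
 obtain I e where I: "finite I" "I \<subseteq> Cinf N" "e > 0" "{y \<in> pts N. \<forall>f\<in>I. \<bar>f y - f (\<phi> p)\<bar> < e} \<subseteq> V"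
  using initial_basis[OF V] by (elim exE conjE)
 have "eventually (\<lambda>q. \<forall>g\<in>(\<lambda>f q. f (\<phi> q)) ` I. \<bar>g q - g p\<bar> < e) (nh M p)"
  by (rule ev_close) (use I \<phi> in "auto simp: smap_at_def")
 moreover have "eventually (\<lambda>q. \<phi> q \<in> pts N) (nh M p)"
  using \<phi> by (simp add: smap_at_def)
 ultimately show ?thesis
  by eventually_elim (use I(4) in auto)
qed

lemma smap_at_ev:
 assumes \<phi>: "smap_at M N p \<phi>" and P: "eventually P (nh N (\<phi> p))"
 shows "eventually (\<lambda>q. P (\<phi> q)) (nh M p)"
proof -
 obtain V where V: "open_in N V" "\<phi> p \<in> V" "\<forall>y\<in>V. P y"
  using P ev_nh[OF smap_at_img[OF \<phi>], of P] by blast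
 show ?thesis
  using smap_at_cont[OF \<phi> V(1,2)] by eventually_elim (use V(3) in blast)
qed

lemma sm_pull:
 assumes \<phi>: "smap_at M N p \<phi>" and f: "smooth_at N (\<phi> p) f"
 shows "smooth_at M p (\<lambda>q. f (\<phi> q))"
proof -
 obtain g where g: "g \<in> Cinf N" "eventually (\<lambda>y. f y = g y) (nh N (\<phi> p))"
  using f by (rule smooth_atE)
 have "smooth_at M p (\<lambda>q. g (\<phi> q))"
  using \<phi> g(1) by (simp add: smap_at_def)
 moreover have "eventually (\<lambda>q. g (\<phi> q) = f (\<phi> q)) (nh M p)"
  using smap_at_ev[OF \<phi> g(2)] by eventually_elim simp
 ultimately show ?thesis by (rule sm_cong[rotated])
qed

lemma smap_at_comp:
 assumes \<phi>: "smap_at M N p \<phi>" and \<psi>: "smap_at N K (\<phi> p) \<psi>"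
 shows "smap_at M K p (\<lambda>q. \<psi> (\<phi> q))"
 unfolding smap_at_def
proof (intro conjI ballI)
 show "p \<in> pts M" using \<phi> by (rule smap_at_pts)
 have "eventually (\<lambda>y. \<psi> y \<in> pts K) (nh N (\<phi> p))"
  using \<psi> by (simp add: smap_at_def)
 then show "eventually (\<lambda>q. \<psi> (\<phi> q) \<in> pts K) (nh M p)"
  by (rule smap_at_ev[OF \<phi>])
 show "smooth_at M p (\<lambda>q. f (\<psi> (\<phi> q)))" if "f \<in> Cinf K" for f
  using sm_pull[OF \<phi>, of "\<lambda>y. f (\<psi> y)"] \<psi> that by (simp add: smap_at_def)
qed

lemma smap_at_id: "p \<in> pts M ==> smap_at M M p (\<lambda>q. q)"
 unfolding smap_at_def using ev_nh_pts sm_Cinf by auto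

lemma smap_at_const: "diffspace M ==> p \<in> pts M ==> y \<in> pts N ==> smap_at M N p (\<lambda>q. y)"
 unfolding smap_at_def by (auto intro: sm_const)

text \<open>Testing on generators is enough, because near the image point every smooth function is a
  smooth function of finitely many of them. Nearly all smoothness proofs for maps into products,
  subspaces and bundles go through this.\<close>

lemma smap_at_gen:
 assumes M: "diffspace M" and p: "p \<in> pts M" and S: "eventually (\<lambda>q. \<phi> q \<in> S) (nh M p)"
  and C: "!!c. c \<in> C ==> smooth_at M p (\<lambda>q. c (\<phi> q))"
 shows "smap_at M (generated_space S C) p \<phi>"
 unfolding smap_at_def
proof (intro conjI ballI)
 fix f assume f: "f \<in> Cinf (generated_space S C)"
 have pS: "\<phi> p \<in> S" using ev_nh_self[OF S p] .
 then obtain W where W: "openin (initial_topology S C) W" "\<phi> p \<in> W" "rep C W f"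
  using f unfolding Cinf_gen by blast
 obtain m c F where F: "\<forall>i<m. c i \<in> C" "smooth_on m (E m) F" "\<forall>q\<in>W. f q = F (tup m (\<lambda>i. c i q))"
  using W(3) unfolding rep_def by blast
 obtain I e where I: "finite I" "I \<subseteq> C" "e > 0" "{y \<in> S. \<forall>f\<in>I. \<bar>f y - f (\<phi> p)\<bar> < e} \<subseteq> W"
  using initial_basis[OF W(1,2)] by (elim exE conjE)
 have "eventually (\<lambda>q. \<forall>g\<in>(\<lambda>f q. f (\<phi> q)) ` I. \<bar>g q - g p\<bar> < e) (nh M p)"
  by (rule ev_close) (use I C in auto)
 then have "eventually (\<lambda>q. F (tup m (\<lambda>i. c i (\<phi> q))) = f (\<phi> q)) (nh M p)"
  using S by eventually_elim (use I(4) F(3) in auto)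
 moreover have "smooth_at M p (\<lambda>q. F (tup m (\<lambda>i. c i (\<phi> q))))"
  by (rule sm_compose[OF M p _ openin_E F(2)]) (use F(1) C in auto)
 ultimately show "smooth_at M p (\<lambda>q. f (\<phi> q))"
  by (rule sm_cong)
qed (use p S in auto)

lemma smap_at_prod:
 assumes M: "diffspace M" and "smap_at M N p \<phi>" "smap_at M K p \<psi>"
 shows "smap_at M (prod_space N K) p (\<lambda>q. (\<phi> q, \<psi> q))"
 unfolding prod_space_def
proof (rule smap_at_gen[OF M smap_at_pts[OF assms(2)]])
 have "eventually (\<lambda>q. \<phi> q \<in> pts N) (nh M p)" "eventually (\<lambda>q. \<psi> q \<in> pts K) (nh M p)"
  using assms by (auto simp: smap_at_def)
 then show "eventually (\<lambda>q. (\<phi> q, \<psi> q) \<in> pts N \<times> pts K) (nh M p)"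
  by eventually_elim simp
qed (use assms in "auto simp: smap_at_def")

lemma pts_prod [simp]: "pts (prod_space M N) = pts M \<times> pts N"
 by (simp add: prod_space_def)

lemma pts_subspace [simp]: "pts (subspace_of M S) = S"
 by (simp add: subspace_of_def)

lemma pts_real [simp]: "pts real_line = UNIV"
 by (simp add: real_line_def)

lemma fst_Cinf: "f \<in> Cinf M ==> (\<lambda>z. f (fst z)) \<in> Cinf (prod_space M N)"
 unfolding prod_space_def by (rule generators_Cinf) (auto simp: o_def)

lemma snd_Cinf: "f \<in> Cinf N ==> (\<lambda>z. f (snd z)) \<in> Cinf (prod_space M N)"
 unfolding prod_space_def by (rule generators_Cinf) (auto simp: o_def)

lemma smap_at_fst: "z \<in> pts M \<times> pts N ==> smap_at (prod_space M N) M z fst"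
 unfolding smap_at_def
 by (intro conjI ballI sm_Cinf fst_Cinf ev_ptsI) auto

lemma smap_at_snd: "z \<in> pts M \<times> pts N ==> smap_at (prod_space M N) N z snd"
 unfolding smap_at_def
 by (intro conjI ballI sm_Cinf snd_Cinf ev_ptsI) auto

lemma smap_at_subspace:
 assumes "diffspace M" "smap_at M N p \<phi>" "eventually (\<lambda>q. \<phi> q \<in> S) (nh M p)"
 shows "smap_at M (subspace_of N S) p \<phi>"
 unfolding subspace_of_def
 by (rule smap_at_gen[OF assms(1) smap_at_pts[OF assms(2)] assms(3)])
  (use assms(2) in "auto simp: smap_at_def")

lemma sm_real:
 assumes "diffspace M" "smooth_at M p f"
 shows "smap_at M real_line p f"
 unfolding real_line_def
 by (rule smap_at_gen[OF assms(1) sm_pts[OF assms(2)]]) (use assms in auto)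

abbreviation "RL \<equiv> prod_space real_line"

lemma real_Cinf: "(\<lambda>t. t) \<in> Cinf real_line"
 unfolding real_line_def by (rule generators_Cinf) simp

section \<open>Tangent vectors\<close>

text \<open>Tangent vectors only see germs; \<open>tv\<close> applies them to functions that are smooth near the
 point, through a global function with the same germ.\<close>

definition glob :: "'a space => 'a => ('a => real) => 'a => real" where
 "glob M p f = (SOME g. g \<in> Cinf M \<and> eventually (\<lambda>q. f q = g q) (nh M p))"

definition tv :: "'a space => 'a => 'a tvec => ('a => real) => real" where
 "tv M p v f = v (glob M p f)"

lemma tvecD:
 assumes "v \<in> TS M p"
 shows "f \<notin> Cinf M ==> v f = 0"
  and "f \<in> Cinf M ==> g \<in> Cinf M ==> v (\<lambda>q. f q + g q) = v f + v g"
  and "f \<in> Cinf M ==> v (\<lambda>q. c * f q) = c * v f"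
  and "f \<in> Cinf M ==> g \<in> Cinf M ==> v (\<lambda>q. f q * g q) = v f * g p + f p * v g"
 using assms unfolding tangent_space_def by simp_all

lemma tangent_eqI:
 assumes "v \<in> TS M p" "w \<in> TS M p" "!!f. f \<in> Cinf M ==> v f = w f"
 shows "v = w"
 using tvecD(1)[OF assms(1)] tvecD(1)[OF assms(2)] assms(3) by (metis ext)

lemma tangent_zero: "(\<lambda>f. 0) \<in> TS M p"
 by (simp add: tangent_space_def)

lemma tangent_add:
 "v \<in> TS M p ==> w \<in> TS M p ==> (\<lambda>f. v f + w f) \<in> TS M p"
 by (simp add: tangent_space_def algebra_simps)

lemma tangent_scale: "v \<in> TS M p ==> (\<lambda>f. c * v f) \<in> TS M p"
 by (simp add: tangent_space_def algebra_simps)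

text \<open>Let z be the difference of the two functions. It vanishes near p, hence z = z w for some
  w with w p = 0, and the product rule gives v z = 0.\<close>

lemma tangent_local:
 assumes M: "diffspace M" and p: "p \<in> pts M" and v: "v \<in> TS M p"
  and f: "f \<in> Cinf M" and g: "g \<in> Cinf M" and ev: "eventually (\<lambda>q. f q = g q) (nh M p)"
 shows "v f = v g"
proof -
 obtain W where W: "open_in M W" "p \<in> W" "\<forall>q\<in>W. f q = g q"
  using ev unfolding ev_nh[OF p] by blast
 obtain \<rho> W' where \<rho>: "\<rho> \<in> Cinf M" "eventually (\<lambda>q. \<rho> q = 1) (nh M p)"
  "W \<union> W' = pts M" "\<forall>q\<in>W'. \<rho> q = 0"
  using bump[OF M W(1,2)] by blast
 \<comment> \<open>The value 1 off the points of M makes z w = z an equality of total functions,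
   which is what v is applied to.\<close>
 define w where "w q = (if q \<in> pts M then 1 - \<rho> q else 1)" for q
 define z where "z q = f q + -1 * g q" for q
 have "(\<lambda>q. 1 - \<rho> q) \<in> Cinf M"
  by (rule Cinf_diff[OF M Cinf_const[OF M] \<rho>(1)])
 then have w: "w \<in> Cinf M"
  by (rule Cinf_cong[OF M]) (simp add: w_def)
 have mg: "(\<lambda>q. -1 * g q) \<in> Cinf M"
  by (rule Cinf_cmult[OF M g])
 have z: "z \<in> Cinf M"
  unfolding z_def[abs_def] by (rule Cinf_add[OF M f mg])
 have "z q * w q = z q" for q
 proof (cases "q \<in> W")
  case True
  then show ?thesis using W(3) by (simp add: z_def)
 next
  case False
  then have "w q = 1"
   using \<rho>(3,4) by (auto simp: w_def)
  then show ?thesis by simp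
 qed
 then have "(\<lambda>q. z q * w q) = z" by (rule ext)
 then have "v z = v (\<lambda>q. z q * w q)" by (rule arg_cong[OF sym])
 also have "\<dots> = v z * w p + z p * v w"
  by (rule tvecD(4)[OF v z w])
 also have "\<dots> = 0"
  using ev_nh_self[OF \<rho>(2) p] p W(2,3) by (simp add: w_def z_def)
 finally have "v (\<lambda>q. f q + -1 * g q) = 0"
  by (simp add: z_def[abs_def])
 then show ?thesis
  using tvecD(2)[OF v f mg] tvecD(3)[OF v g, of "-1"] by simp
qed

context
 fixes M :: "'a space" and p :: 'a and v :: "'a tvec"
 assumes M: "diffspace M" and p: "p \<in> pts M" and v: "v \<in> TS M p"
begin

lemma tv_eq:
 assumes g: "g \<in> Cinf M" "eventually (\<lambda>q. f q = g q) (nh M p)"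
 shows "tv M p v f = v g"
proof -
 have *: "glob M p f \<in> Cinf M \<and> eventually (\<lambda>q. f q = glob M p f q) (nh M p)"
  unfolding glob_def by (rule someI[of _ g]) (use g in simp)
 then have "eventually (\<lambda>q. glob M p f q = g q) (nh M p)"
  using g(2) by (auto elim: eventually_elim2)
 then show ?thesis
  unfolding tv_def using tangent_local[OF M p v _ g(1)] * by blast
qed

lemma tv_Cinf: "f \<in> Cinf M ==> tv M p v f = v f"
 by (rule tv_eq) simp_all

lemma tv_cong:
 assumes "eventually (\<lambda>q. f q = g q) (nh M p)" "smooth_at M p f"
 shows "tv M p v f = tv M p v g"
proof -
 obtain k where k: "k \<in> Cinf M" "eventually (\<lambda>q. f q = k q) (nh M p)"
  using assms(2) by (rule smooth_atE)
 have "eventually (\<lambda>q. g q = k q) (nh M p)"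
  using assms(1) k(2) by eventually_elim simp
 then show ?thesis using tv_eq k by metis
qed

lemma tv_add:
 assumes "smooth_at M p f" "smooth_at M p g"
 shows "tv M p v (\<lambda>q. f q + g q) = tv M p v f + tv M p v g"
proof -
 obtain a where a: "a \<in> Cinf M" "eventually (\<lambda>q. f q = a q) (nh M p)"
  using assms(1) by (rule smooth_atE)
 obtain b where b: "b \<in> Cinf M" "eventually (\<lambda>q. g q = b q) (nh M p)"
  using assms(2) by (rule smooth_atE)
 have "eventually (\<lambda>q. f q + g q = a q + b q) (nh M p)"
  using a(2) b(2) by eventually_elim simp
 then have "tv M p v (\<lambda>q. f q + g q) = v (\<lambda>q. a q + b q)"
  by (rule tv_eq[OF Cinf_add[OF M a(1) b(1)]])
 then show ?thesis
  using tvecD(2)[OF v a(1) b(1)] tv_eq[OF a] tv_eq[OF b] by simp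
qed

lemma tv_mult:
 assumes "smooth_at M p f" "smooth_at M p g"
 shows "tv M p v (\<lambda>q. f q * g q) = tv M p v f * g p + f p * tv M p v g"
proof -
 obtain a where a: "a \<in> Cinf M" "eventually (\<lambda>q. f q = a q) (nh M p)"
  using assms(1) by (rule smooth_atE)
 obtain b where b: "b \<in> Cinf M" "eventually (\<lambda>q. g q = b q) (nh M p)"
  using assms(2) by (rule smooth_atE)
 have "eventually (\<lambda>q. f q * g q = a q * b q) (nh M p)"
  using a(2) b(2) by eventually_elim simp
 then have "tv M p v (\<lambda>q. f q * g q) = v (\<lambda>q. a q * b q)"
  by (rule tv_eq[OF Cinf_mult[OF M a(1) b(1)]])
 then show ?thesis
  using tvecD(4)[OF v a(1) b(1)] tv_eq[OF a] tv_eq[OF b] ev_nh_self[OF a(2) p] ev_nh_self[OF b(2) p] by simp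
qed

lemma tv_const: "tv M p v (\<lambda>q. c) = 0"
proof -
 have "tv M p v (\<lambda>q. 1 * 1) = tv M p v (\<lambda>q. 1) * 1 + 1 * tv M p v (\<lambda>q. 1)"
  by (rule tv_mult) (rule sm_const[OF M p])+
 then have "v (\<lambda>q. 1) = 0"
  using tv_Cinf[OF Cinf_const[OF M]] by simp
 then show ?thesis
  using tvecD(3)[OF v Cinf_const[OF M, of 1], of c] tv_Cinf[OF Cinf_const[OF M]] by simp
qed

lemma tv_cmult: "smooth_at M p f ==> tv M p v (\<lambda>q. c * f q) = c * tv M p v f"
 using tv_mult[OF sm_const[OF M p, of c], of f] by (simp add: tv_const)

lemma tv_diff: "smooth_at M p f ==> smooth_at M p g ==> tv M p v (\<lambda>q. f q - g q) = tv M p v f - tv M p v g"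
 using tv_add[of f "\<lambda>q. -1 * g q"] tv_cmult[of g "-1"] sm_cmult[OF M, of p g "-1"] by simp

lemma tv_sum: "(!!j. j \<in> J ==> smooth_at M p (f j)) ==> tv M p v (\<lambda>q. \<Sum>j\<in>J. f j q) = (\<Sum>j\<in>J. tv M p v (f j))"
proof (induction J rule: infinite_finite_induct)
 case (insert a J)
 then have "tv M p v (\<lambda>q. f a q + (\<Sum>j\<in>J. f j q)) = tv M p v (f a) + tv M p v (\<lambda>q. \<Sum>j\<in>J. f j q)"
  by (intro tv_add sm_sum[OF M p]) auto
 then show ?case using insert by simp
qed (simp_all add: tv_const)

text \<open>Hadamard's lemma writes F along c as a constant plus products with one factor vanishing
  at p. The product rule leaves the other factor, whose value at p is a partial derivative of
  F.\<close>

lemma tv_chain: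
 assumes c: "!!i. i < m ==> smooth_at M p (c i)"
  and V: "open_E m V" "smooth_on m V F" "tup m (\<lambda>i. c i p) \<in> V"
 shows "tv M p v (\<lambda>q. F (tup m (\<lambda>i. c i q))) = (\<Sum>i<m. pd i F (tup m (\<lambda>i. c i p)) * tv M p v (c i))"
proof -
 let ?y0 = "tup m (\<lambda>i. c i p)"
 obtain e where e: "e > 0" "box_at m ?y0 e \<subseteq> V"
  using openE_box[OF V(1,3)] by blast
 have F: "smooth_on m (box_at m ?y0 e) F"
  by (rule smooth_on_subset[OF V(1) openin_box_at e(2) V(2)])
 obtain q where q: "\<forall>j<m. smooth_on m (box_at m ?y0 e) (q j) \<and> q j ?y0 = pd j F ?y0"
  "\<forall>y\<in>box_at m ?y0 e. F y = F ?y0 + (\<Sum>j<m. (y j - ?y0 j) * q j y)"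
  using hadamard[OF tup_in_E e(1) F] by (elim exE conjE)
 define Q where "Q j z = q j (tup m (\<lambda>i. c i z))" for j z
 have sQ: "smooth_at M p (Q j)" if "j < m" for j
  unfolding Q_def[abs_def]
  by (rule sm_compose[OF M p c openin_box_at]) (use q(1) that box_at_self[OF tup_in_E e(1)] in auto)
 have sc: "smooth_at M p (\<lambda>z. c j z - c j p)" if "j < m" for j
  by (rule sm_diff[OF M c[OF that] sm_const[OF M p]])
 have sQc: "smooth_at M p (\<lambda>z. (c j z - c j p) * Q j z)" if "j < m" for j
  by (rule sm_mult[OF M sc[OF that] sQ[OF that]])
 have "eventually (\<lambda>z. \<forall>f\<in>c ` {..<m}. \<bar>f z - f p\<bar> < e) (nh M p)"
  by (rule ev_close) (use c e(1) in auto)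
 then have ev: "eventually (\<lambda>z. F (tup m (\<lambda>i. c i z)) = F ?y0 + (\<Sum>j<m. (c j z - c j p) * Q j z)) (nh M p)"
 proof eventually_elim
  case (elim z)
  then have "tup m (\<lambda>i. c i z) \<in> box_at m ?y0 e"
   by (intro tup_box) auto
  then have "F (tup m (\<lambda>i. c i z)) = F ?y0 + (\<Sum>j<m. (tup m (\<lambda>i. c i z) j - ?y0 j) * q j (tup m (\<lambda>i. c i z)))"
   using q(2) by blast
  then show ?case by (simp add: Q_def)
 qed
 have "tv M p v (\<lambda>z. F (tup m (\<lambda>i. c i z))) = tv M p v (\<lambda>z. F ?y0 + (\<Sum>j<m. (c j z - c j p) * Q j z))"
  by (rule tv_cong[OF ev sm_compose[OF M p c V]])
 also have "\<dots> = (\<Sum>j<m. tv M p v (\<lambda>z. (c j z - c j p) * Q j z))"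
  using tv_add[OF sm_const[OF M p, of "F ?y0"] sm_sum[OF M p, of "{..<m}" "\<lambda>j z. (c j z - c j p) * Q j z"]]
   tv_sum[of "{..<m}" "\<lambda>j z. (c j z - c j p) * Q j z"] sQc tv_const by simp
 also have "\<dots> = (\<Sum>j<m. pd j F ?y0 * tv M p v (c j))"
 proof (rule sum.cong[OF refl])
  fix j assume "j \<in> {..<m}"
  then have j: "j < m" by simp
  have "tv M p v (\<lambda>z. (c j z - c j p) * Q j z) = tv M p v (\<lambda>z. c j z - c j p) * Q j p"
   using tv_mult[OF sc[OF j] sQ[OF j]] by simp
  also have "\<dots> = pd j F ?y0 * tv M p v (c j)"
   using tv_diff[OF c[OF j] sm_const[OF M p, of "c j p"]] tv_const q(1) j by (simp add: Q_def)
  finally show "tv M p v (\<lambda>z. (c j z - c j p) * Q j z) = pd j F ?y0 * tv M p v (c j)" .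
 qed
 finally show ?thesis .
qed

end

text \<open>The tangent map at p of a map that may be smooth near p only; for global maps it agrees
  with \<open>tangent_map\<close>, by \<open>tangent_map_push\<close>.\<close>

definition push :: "'a space => 'b space => 'a => ('a => 'b) => 'a tvec => 'b tvec" where
 "push M N p \<phi> v = (\<lambda>f. if f \<in> Cinf N then tv M p v (\<lambda>q. f (\<phi> q)) else 0)"

lemma push_tangent:
 assumes M: "diffspace M" and N: "diffspace N" and \<phi>: "smap_at M N p \<phi>" and v: "v \<in> TS M p"
 shows "push M N p \<phi> v \<in> TS N (\<phi> p)"
proof -
 note p = smap_at_pts[OF \<phi>]
 have s: "smooth_at M p (\<lambda>q. f (\<phi> q))" if "f \<in> Cinf N" for f
  using \<phi> that by (simp add: smap_at_def)
 show ?thesis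
  unfolding tangent_space_def push_def
  using Cinf_add[OF N] Cinf_cmult[OF N] Cinf_mult[OF N] tv_add[OF M p v s s] tv_cmult[OF M p v s] tv_mult[OF M p v s s]
  by simp
qed

lemma tv_push:
 assumes M: "diffspace M" and N: "diffspace N" and \<phi>: "smap_at M N p \<phi>" and v: "v \<in> TS M p"
  and f: "smooth_at N (\<phi> p) f"
 shows "tv N (\<phi> p) (push M N p \<phi> v) f = tv M p v (\<lambda>q. f (\<phi> q))"
proof -
 obtain g where g: "g \<in> Cinf N" "eventually (\<lambda>y. f y = g y) (nh N (\<phi> p))"
  using f by (rule smooth_atE)
 have "tv N (\<phi> p) (push M N p \<phi> v) f = push M N p \<phi> v g"
  by (rule tv_eq[OF N smap_at_img[OF \<phi>] push_tangent[OF M N \<phi> v] g])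
 also have "\<dots> = tv M p v (\<lambda>q. g (\<phi> q))"
  using g by (simp add: push_def)
 also have "\<dots> = tv M p v (\<lambda>q. f (\<phi> q))"
 proof (rule tv_cong[OF M smap_at_pts[OF \<phi>] v])
  show "eventually (\<lambda>q. g (\<phi> q) = f (\<phi> q)) (nh M p)"
   using smap_at_ev[OF \<phi> g(2)] by eventually_elim simp
  show "smooth_at M p (\<lambda>q. g (\<phi> q))"
   using \<phi> g(1) by (simp add: smap_at_def)
 qed
 finally show ?thesis .
qed

lemma tangent_map_push:
 assumes "diffspace M" "smooth_map M N \<phi>" "p \<in> pts M" "v \<in> TS M p"
 shows "tangent_map M N \<phi> (p, v) = (\<phi> p, push M N p \<phi> v)"
proof -
 have "v (f \<circ> \<phi>) = tv M p v (\<lambda>q. f (\<phi> q))" if "f \<in> Cinf N" for f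
  using tv_Cinf[OF assms(1,3,4), of "f \<circ> \<phi>"] assms(2) that by (simp add: smooth_map_def o_def)
 then show ?thesis by (auto simp: tangent_map_def push_def fun_eq_iff)
qed

text \<open>Each of the finitely many functions that describe a neighbourhood in the product depends
  on one factor only. Hence the initial topology is the product topology.\<close>

lemma prod_nbhd:
 assumes W: "openin (top_of (prod_space M N)) W" "(p, q) \<in> W"
 shows "\<exists>U V. open_in M U \<and> p \<in> U \<and> open_in N V \<and> q \<in> V \<and> U \<times> V \<subseteq> W"
proof -
 let ?C = "{f \<circ> fst |f. f \<in> Cinf M} \<union> {f \<circ> snd |f. f \<in> Cinf N}"
 have pq: "p \<in> pts M" "q \<in> pts N"
  using openin_initial_sub[OF W(1)] W(2) by auto
 have "openin (initial_topology (pts M \<times> pts N) ?C) W"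
  using W(1) unfolding prod_space_def top_of_gen .
 from initial_basis[OF this W(2)]
 obtain I e where I: "finite I" "I \<subseteq> ?C" "e > 0" "{z \<in> pts M \<times> pts N. \<forall>f\<in>I. \<bar>f z - f (p, q)\<bar> < e} \<subseteq> W"
  by (elim exE conjE)
 define A where "A = {f \<in> I. \<exists>g\<in>Cinf M. f = g \<circ> fst}"
 define B where "B = {f \<in> I. \<exists>g\<in>Cinf N. f = g \<circ> snd}"
 have AB: "I = A \<union> B" using I(2) by (auto simp: A_def B_def)
 have "eventually (\<lambda>a. \<forall>g\<in>(\<lambda>f a. f (a, q)) ` A. \<bar>g a - g p\<bar> < e) (nh M p)"
  by (rule ev_close) (use I pq in "auto simp: A_def intro!: sm_Cinf")
 then obtain U where U: "open_in M U" "p \<in> U" "\<forall>a\<in>U. \<forall>g\<in>(\<lambda>f a. f (a, q)) ` A. \<bar>g a - g p\<bar> < e"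
  unfolding ev_nh[OF pq(1)] by blast
 have "eventually (\<lambda>b. \<forall>g\<in>(\<lambda>f b. f (p, b)) ` B. \<bar>g b - g q\<bar> < e) (nh N q)"
  by (rule ev_close) (use I pq in "auto simp: B_def intro!: sm_Cinf")
 then obtain V where V: "open_in N V" "q \<in> V" "\<forall>b\<in>V. \<forall>g\<in>(\<lambda>f b. f (p, b)) ` B. \<bar>g b - g q\<bar> < e"
  unfolding ev_nh[OF pq(2)] by blast
 have "\<bar>f (a, b) - f (p, q)\<bar> < e" if "a \<in> U" "b \<in> V" "f \<in> I" for a b f
 proof (cases "f \<in> A")
  case True
  then have "\<bar>f (a, q) - f (p, q)\<bar> < e" using U(3) that by simp
  moreover have "f (a, b) = f (a, q)" using True by (auto simp: A_def)
  ultimately show ?thesis by simp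
 next
  case False
  then have f: "f \<in> B" using AB that by blast
  then have "\<bar>f (p, b) - f (p, q)\<bar> < e" using V(3) that by simp
  moreover have "f (a, b) = f (p, b)" using f by (auto simp: B_def)
  ultimately show ?thesis by simp
 qed
 then have "U \<times> V \<subseteq> W"
  using I(4) openin_initial_sub[OF U(1)] openin_initial_sub[OF V(1)] by auto
 then show ?thesis using U V by blast
qed

text \<open>Write K through generators and apply the chain rule in the second variable. The vector v
  enters only through its values on fixed global functions \<open>d j\<close>, with coefficients
  smooth in both variables; so smooth families of vectors have smooth families of
  derivatives.\<close>

lemma partial_deriv:
 assumes M: "diffspace M" and N: "diffspace N" and K: "smooth_at (prod_space M N) (p, q) K"
 shows "\<exists>(r::nat) d k U V. open_in M U \<and> p \<in> U \<and> open_in N V \<and> q \<in> V \<and>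
  (\<forall>j<r. d j \<in> Cinf N \<and> k j \<in> Cinf (prod_space M N)) \<and>
  (\<forall>a\<in>U. \<forall>b\<in>V. smooth_at N b (\<lambda>z. K (a, z)) \<and>
   (\<forall>v\<in>TS N b. tv N b v (\<lambda>z. K (a, z)) = (\<Sum>j<r. k j (a, b) * v (d j))))"
proof -
 let ?C = "{f \<circ> fst |f. f \<in> Cinf M} \<union> {f \<circ> snd |f. f \<in> Cinf N}"
 let ?P = "prod_space M N"
 obtain W where W: "open_in ?P W" "(p, q) \<in> W" "rep ?C W K"
  using sm_gen[OF K[unfolded prod_space_def]] unfolding prod_space_def by blast
 obtain m c F where F: "\<forall>i<m. c i \<in> ?C" "smooth_on m (E m) F" "\<forall>z\<in>W. K z = F (tup m (\<lambda>i. c i z))"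
  using W(3) unfolding rep_def by blast
 obtain U V where UV: "open_in M U" "p \<in> U" "open_in N V" "q \<in> V" "U \<times> V \<subseteq> W"
  using prod_nbhd[OF W(1,2)] by blast
 have UVs: "U \<subseteq> pts M" "V \<subseteq> pts N"
  using UV openin_initial_sub by blast+
 have "\<forall>i<m. \<exists>d. d \<in> Cinf N \<and> (\<forall>a\<in>U. \<forall>b\<in>V. smooth_at N b (\<lambda>z. c i (a, z)) \<and>
   (\<forall>v\<in>TS N b. tv N b v (\<lambda>z. c i (a, z)) = v d))"
 proof (intro allI impI)
  fix i assume "i < m"
  then consider g where "g \<in> Cinf M" "c i = g \<circ> fst" | g where "g \<in> Cinf N" "c i = g \<circ> snd"
   using F(1) by blast
  then show "\<exists>d. d \<in> Cinf N \<and> (\<forall>a\<in>U. \<forall>b\<in>V. smooth_at N b (\<lambda>z. c i (a, z)) \<and>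
   (\<forall>v\<in>TS N b. tv N b v (\<lambda>z. c i (a, z)) = v d))"
  proof cases
   \<comment> \<open>A generator pulled back from M is constant in the second variable; the zero
     function stands in for it, as every vector kills both.\<close>
   case (1 g)
   then show ?thesis
    using UVs tv_const[OF N] tv_Cinf[OF N _ _ Cinf_const[OF N, of 0]]
    by (intro exI[of _ "\<lambda>z. 0"]) (auto intro!: Cinf_const[OF N] sm_const[OF N] simp: subset_iff)
  next
   case (2 g)
   then show ?thesis
    using UVs tv_Cinf[OF N] by (intro exI[of _ g]) (auto intro!: sm_Cinf simp: subset_iff o_def)
  qed
 qed
 then obtain d where d: "!!i. i < m ==> d i \<in> Cinf N"
  "!!i a b. i < m ==> a \<in> U ==> b \<in> V ==> smooth_at N b (\<lambda>z. c i (a, z))"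
  "!!i a b v. i < m ==> a \<in> U ==> b \<in> V ==> v \<in> TS N b ==> tv N b v (\<lambda>z. c i (a, z)) = v (d i)"
  by metis
 define k where "k j z = pd j F (tup m (\<lambda>i. c i z))" for j z
 have cC: "c i \<in> Cinf ?P" if "i < m" for i
  using F(1) that unfolding prod_space_def by (intro generators_Cinf) blast
 have k: "k j \<in> Cinf ?P" if "j < m" for j
 proof -
  have "\<forall>i<m. c i \<in> Cinf ?P" using cC by blast
  then have "(\<lambda>z. pd j F (tup m (\<lambda>i. c i z))) \<in> Cinf ?P"
   using diffspace_prod[of M N] smooth_on_pd[OF openin_E F(2) that] unfolding diffspace_def by blast
  then show ?thesis by (simp add: k_def[abs_def])
 qed
 have main: "smooth_at N b (\<lambda>z. K (a, z)) \<and>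
   (\<forall>v\<in>TS N b. tv N b v (\<lambda>z. K (a, z)) = (\<Sum>j<m. k j (a, b) * v (d j)))" if ab: "a \<in> U" "b \<in> V" for a b
 proof -
  have b: "b \<in> pts N" using ab UVs by blast
  have ev: "eventually (\<lambda>z. F (tup m (\<lambda>i. c i (a, z))) = K (a, z)) (nh N b)"
   by (rule ev_nhI[OF UV(3) ab(2)]) (use UV(5) ab F(3) in auto)
  have s: "smooth_at N b (\<lambda>z. F (tup m (\<lambda>i. c i (a, z))))"
   by (rule sm_compose[OF N b d(2)[OF _ ab] openin_E F(2)]) auto
  have "tv N b v (\<lambda>z. K (a, z)) = (\<Sum>j<m. k j (a, b) * v (d j))" if v: "v \<in> TS N b" for v
  proof -
   have "tv N b v (\<lambda>z. F (tup m (\<lambda>i. c i (a, z)))) = (\<Sum>j<m. pd j F (tup m (\<lambda>i. c i (a, b))) * tv N b v (\<lambda>z. c j (a, z)))"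
    by (rule tv_chain[OF N b v d(2)[OF _ ab] openin_E F(2)]) auto
   then show ?thesis
    using tv_cong[OF N b v ev s] d(3)[OF _ ab v] by (simp add: k_def)
  qed
  then show ?thesis using sm_cong[OF ev s] by blast
 qed
 show ?thesis
  by (intro exI[of _ m] exI[of _ d] exI[of _ k] exI[of _ U] exI[of _ V]) (use UV d(1) k main in auto)
qed

section \<open>Charts\<close>

definition lf :: "'a set => ('a => nat => real) => ('a => real) => (nat => real) => real" where
 "lf U x f = (\<lambda>y. f (inv_into U x y))"

lemma chartD:
 assumes "chart n M U x"
 shows "open_in M U" "open_E n (x ` U)" "inj_on x U"
  and "!!f. locally_smooth M U f \<longleftrightarrow> smooth_on n (x ` U) (lf U x f)"
proof -
 show op: "open_in M U" "open_E n (x ` U)"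
  and "!!f. locally_smooth M U f \<longleftrightarrow> smooth_on n (x ` U) (lf U x f)"
  using assms by (simp_all add: chart_def lf_def o_def)
 have "homeomorphic_map (subtopology (top_of M) U) (subtopology (ES n) (x ` U)) x"
  using assms by (simp add: chart_def)
 then have "inj_on x (topspace (subtopology (top_of M) U))"
  by (simp add: homeomorphic_eq_everything_map)
 moreover have "topspace (subtopology (top_of M) U) = U"
  using openin_initial_sub[OF op(1)] by auto
 ultimately show "inj_on x U" by simp
qed

lemma lf_apply: "inj_on x U ==> q \<in> U ==> lf U x f (x q) = f q"
 by (simp add: lf_def)

lemma chart_sub: "chart n M U x ==> q \<in> U ==> q \<in> pts M"
 using chartD(1)[of n M U x] openin_initial_sub[of "pts M" "Cinf M" U] by blast

lemma chart_E: "chart n M U x ==> q \<in> U ==> x q \<in> E n"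
 using openE_sub[OF chartD(2)] by blast

lemma chart_tup: "chart n M U x ==> q \<in> U ==> tup n (x q) = x q"
 using tup_id[OF chart_E] .

lemma chart_smooth:
 assumes "chart n M U x" "!!q. q \<in> U ==> smooth_at M q f"
 shows "smooth_on n (x ` U) (lf U x f)"
 using chartD(4)[OF assms(1), of f] locally_smooth_iff[OF chartD(1)[OF assms(1)], of f] assms(2) by blast

lemma chart_coord:
 assumes "chart n M U x" "q \<in> U" "i < n"
 shows "smooth_at M q (\<lambda>q. x q i)"
proof -
 have "smooth_on n (x ` U) (lf U x (\<lambda>q. x q i))"
  by (rule smooth_on_cong[OF chartD(2)[OF assms(1)] _ smooth_on_coord[OF chartD(2)[OF assms(1)], of i]])
   (auto simp: lf_apply[OF chartD(3)[OF assms(1)]])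
 then show ?thesis
  using chartD(4)[OF assms(1)] locally_smooth_iff[OF chartD(1)[OF assms(1)]] assms(2) by blast
qed

text \<open>The homeomorphism demanded by \<open>chart\<close> comes for free: smooth coordinates
  are continuous, and x is open because the topology is initial for functions whose local
  expressions are continuous.\<close>

lemma chartI:
 assumes M: "diffspace M" and U: "open_in M U" and inj: "inj_on x U"
  and xU: "open_E n (x ` U)"
  and x: "!!q i. q \<in> U ==> i < n ==> smooth_at M q (\<lambda>q. x q i)"
  and f: "!!f. f \<in> Cinf M ==> smooth_on n (x ` U) (lf U x f)"
 shows "chart n M U x"
proof -
 have Us: "U \<subseteq> pts M" using U by (rule openin_initial_sub)
 have UE: "x q \<in> E n" if "q \<in> U" for q
  using openE_sub[OF xU] that by blast
 have tsp: "topspace (subtopology (top_of M) U) = U" "topspace (subtopology (ES n) (x ` U)) = x ` U"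
  using Us openin_subset[OF xU] by auto
 have opn: "open_E n (x ` W)" if W: "open_in M W" "W \<subseteq> U" for W
  unfolding openE_iff
 proof (intro conjI ballI)
  show "x ` W \<subseteq> E n" using UE W(2) by auto
  fix y assume "y \<in> x ` W"
  then obtain q where q: "q \<in> W" "y = x q" by blast
  obtain I e where I: "finite I" "I \<subseteq> Cinf M" "e > 0" "{z \<in> pts M. \<forall>f\<in>I. \<bar>f z - f q\<bar> < e} \<subseteq> W"
   using initial_basis[OF W(1) q(1)] by (elim exE conjE)
  have "\<exists>d>0. \<forall>z\<in>box_at n y d. \<bar>lf U x f z - f q\<bar> < e" if "f \<in> I" for f
  proof -
   have "f \<in> Cinf M" using that I(2) by blast
   then have "continuous_on (x ` U) (lf U x f)"
    using smooth_on_continuous[OF xU assms(6)] by blast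
   then show ?thesis
    using cont_box[OF xU _ _ I(3), of "lf U x f" y] q W(2) lf_apply[OF inj subsetD[OF W(2) q(1)], of f] by auto
  qed
  then obtain d where d: "!!f. f \<in> I ==> d f > 0" "!!f z. f \<in> I ==> z \<in> box_at n y (d f) ==> \<bar>lf U x f z - f q\<bar> < e"
   by metis
  obtain d0 where d0: "d0 > 0" "box_at n y d0 \<subseteq> x ` U"
   using openE_box[OF xU, of y] q W(2) by auto
  define r where "r = Min (insert d0 (d ` I))"
  have r: "r > 0" "r \<le> d0" "!!f. f \<in> I ==> r \<le> d f"
   using I(1) d(1) d0(1) by (auto simp: r_def)
  have "z \<in> x ` W" if z: "z \<in> box_at n y r" for z
  proof -
   obtain p where p: "p \<in> U" "z = x p"
    using z d0(2) box_at_mono[OF r(2), of n y] by blast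
   have "\<bar>f p - f q\<bar> < e" if "f \<in> I" for f
    using d(2)[OF that, of z] box_at_mono[OF r(3)[OF that], of n y] z lf_apply[OF inj p(1), of f] p(2) by auto
   then show ?thesis using p I(4) Us by blast
  qed
  then show "\<exists>e>0. box_at n y e \<subseteq> x ` W" using r(1) by blast
 qed
 have cont: "continuous_map (subtopology (top_of M) U) (ES n) x"
 proof (rule continuous_map_eq)
  show "continuous_map (subtopology (top_of M) U) (ES n) (\<lambda>q i. if i < n then x q i else 0)"
   unfolding continuous_map_componentwise_Euclidean_space
  proof (intro allI impI)
   fix i assume i: "i < n"
   show "continuous_map (subtopology (top_of M) U) euclideanreal (\<lambda>q. x q i)"
    unfolding continuous_map_atin
   proof
    fix p assume "p \<in> topspace (subtopology (top_of M) U)"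
    then have p: "p \<in> U" by auto
    show "limitin euclideanreal (\<lambda>q. x q i) (x p i) (atin (subtopology (top_of M) U) p)"
     unfolding limitin_canonical_iff
    proof (rule tendstoI)
     fix e :: real assume "e > 0"
     then have "eventually (\<lambda>q. \<forall>f\<in>{\<lambda>q. x q i}. \<bar>f q - f p\<bar> < e) (nh M p)"
      by (intro ev_close) (use x[OF p i] in auto)
     then have ev: "eventually (\<lambda>q. \<bar>x q i - x p i\<bar> < e) (nh M p)" by simp
     have pM: "p \<in> pts M" using Us p by blast
     obtain W where W: "open_in M W" "p \<in> W" "\<forall>q\<in>W. \<bar>x q i - x p i\<bar> < e"
      using ev unfolding ev_nh[OF pM] by blast
     have "openin (subtopology (top_of M) U) (U \<inter> W)"
      using W(1) by (simp add: openin_subtopology_Int2)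
     then show "eventually (\<lambda>q. dist (x q i) (x p i) < e) (atin (subtopology (top_of M) U) p)"
      unfolding eventually_atin using W p
      by (intro disjI2 exI[of _ "U \<inter> W"]) (auto simp: dist_real_def)
    qed
   qed
  qed
  fix q assume "q \<in> topspace (subtopology (top_of M) U)"
  then have "x q \<in> E n" using UE by auto
  then show "(\<lambda>i. if i < n then x q i else 0) = x q"
   by (auto simp: mem_E)
 qed
 have "homeomorphic_map (subtopology (top_of M) U) (subtopology (ES n) (x ` U)) x"
 proof (rule bijective_open_imp_homeomorphic_map)
  show "continuous_map (subtopology (top_of M) U) (subtopology (ES n) (x ` U)) x"
   using cont tsp by (auto simp: continuous_map_in_subtopology)
  show "open_map (subtopology (top_of M) U) (subtopology (ES n) (x ` U)) x"
   unfolding open_map_def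
  proof (intro allI impI)
   fix W assume "openin (subtopology (top_of M) U) W"
   then have W: "open_in M W" "W \<subseteq> U"
    using U by (auto simp: openin_open_subtopology)
   then show "openin (subtopology (ES n) (x ` U)) (x ` W)"
    using opn[OF W] xU by (auto simp: openin_open_subtopology)
  qed
 qed (use inj tsp in auto)
 moreover have "locally_smooth M U g \<longleftrightarrow> smooth_on n (x ` U) (g \<circ> inv_into U x)" for g
  unfolding locally_smooth_iff[OF U]
 proof
  assume g: "\<forall>p\<in>U. smooth_at M p g"
  show "smooth_on n (x ` U) (g \<circ> inv_into U x)"
  proof (rule smooth_on_local[OF xU])
   fix y assume "y \<in> x ` U"
   then obtain q where q: "q \<in> U" "y = x q" by blast
   obtain k where k: "k \<in> Cinf M" "eventually (\<lambda>z. g z = k z) (nh M q)"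
    using bspec[OF g q(1)] by (rule smooth_atE)
   then obtain W0 where W0: "open_in M W0" "q \<in> W0" "\<forall>z\<in>W0. g z = k z"
    using ev_nh[of q M "\<lambda>z. g z = k z"] Us q by blast
   define W where "W = W0 \<inter> U"
   have W: "open_in M W" "W \<subseteq> U" "q \<in> W" using W0 U q by (auto simp: W_def)
   have "smooth_on n (x ` W) (g \<circ> inv_into U x)"
   proof (rule smooth_on_cong[OF opn[OF W(1,2)] _ smooth_on_subset[OF xU opn[OF W(1,2)] _ f[OF k(1)]]])
    show "lf U x k z = (g \<circ> inv_into U x) z" if "z \<in> x ` W" for z
     using that W(2) W0(3) inj by (auto simp: lf_def W_def)
   qed (use W in blast)
   then show "\<exists>V. open_E n V \<and> y \<in> V \<and> smooth_on n V (g \<circ> inv_into U x)"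
    using opn[OF W(1,2)] W(3) q(2) by blast
  qed
 next
  assume g: "smooth_on n (x ` U) (g \<circ> inv_into U x)"
  show "\<forall>p\<in>U. smooth_at M p g"
  proof
   fix p assume p: "p \<in> U"
   have eq: "tup n (\<lambda>i. x q i) = x q" if "q \<in> U" for q
    by (rule tup_id[OF UE[OF that]])
   have "smooth_at M p (\<lambda>q. (g \<circ> inv_into U x) (tup n (\<lambda>i. x q i)))"
    by (rule sm_compose[OF M _ _ xU g]) (use x p Us eq in auto)
   moreover have "eventually (\<lambda>q. (g \<circ> inv_into U x) (tup n (\<lambda>i. x q i)) = g q) (nh M p)"
    by (rule ev_nhI[OF U p]) (use eq inj in auto)
   ultimately show "smooth_at M p g" by (rule sm_cong[rotated])
  qed
 qed
 ultimately show ?thesis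
  unfolding chart_def using U xU by blast
qed

lemma lf_restrict: "inj_on x U ==> W \<subseteq> U ==> y \<in> x ` W ==> lf W x f y = lf U x f y"
 by (metis (no_types, opaque_lifting) f_inv_into_f inj_on_subset inv_into_f_f inv_into_into lf_def subsetD)

lemma chart_open_image:
 assumes c: "chart n M U x" and W: "open_in M W" "W \<subseteq> U"
 shows "open_E n (x ` W)"
proof -
 have "homeomorphic_map (subtopology (top_of M) U) (subtopology (ES n) (x ` U)) x"
  using c by (simp add: chart_def)
 then have "open_map (subtopology (top_of M) U) (subtopology (ES n) (x ` U)) x"
  by (simp add: homeomorphic_eq_everything_map)
 moreover have "openin (subtopology (top_of M) U) W"
  using W chartD(1)[OF c] by (simp add: openin_open_subtopology)
 ultimately have "openin (subtopology (ES n) (x ` U)) (x ` W)"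
  by (simp add: open_map_def)
 then show ?thesis
  using chartD(2)[OF c] by (simp add: openin_open_subtopology)
qed

lemma chart_subset:
 assumes M: "diffspace M" and c: "chart n M U x" and W: "open_in M W" "W \<subseteq> U"
 shows "chart n M W x"
proof (rule chartI[OF M W(1)])
 show inj: "inj_on x W" using chartD(3)[OF c] W(2) by (rule inj_on_subset)
 show op: "open_E n (x ` W)" by (rule chart_open_image[OF c W])
 show "smooth_at M q (\<lambda>q. x q i)" if "q \<in> W" "i < n" for q i
  using chart_coord[OF c] that W by blast
 show "smooth_on n (x ` W) (lf W x f)" if f: "f \<in> Cinf M" for f
 proof (rule smooth_on_cong[OF op _ smooth_on_subset[OF chartD(2)[OF c] op _ chart_smooth[OF c]]])
  show "lf U x f y = lf W x f y" if "y \<in> x ` W" for y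
   using lf_restrict[OF chartD(3)[OF c] W(2) that] by simp
  show "x ` W \<subseteq> x ` U" using W(2) by blast
  show "smooth_at M q f" if "q \<in> U" for q
   by (rule sm_Cinf[OF f chart_sub[OF c that]])
 qed
qed

lemma chart_cong:
 assumes M: "diffspace M" and c: "chart n M U x" and eq: "!!q. q \<in> U ==> x q = y q"
 shows "chart n M U y"
proof -
 have img: "y ` U = x ` U" using eq by (simp cong: image_cong)
 have inv: "inv_into U y z = inv_into U x z" for z
  unfolding inv_into_def by (rule arg_cong[of _ _ Eps]) (use eq in auto)
 show ?thesis
 proof (rule chartI[OF M chartD(1)[OF c]])
  show "inj_on y U" using chartD(3)[OF c] eq by (simp cong: inj_on_cong)
  show "open_E n (y ` U)" using chartD(2)[OF c] img by simp
  show "smooth_at M q (\<lambda>q. y q i)" if "q \<in> U" "i < n" for q i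
  proof (rule sm_cong[OF _ chart_coord[OF c that]])
   show "eventually (\<lambda>q. x q i = y q i) (nh M q)"
    by (rule ev_nhI[OF chartD(1)[OF c] that(1)]) (simp add: eq)
  qed
  show "smooth_on n (y ` U) (lf U y f)" if f: "f \<in> Cinf M" for f
   using chart_smooth[OF c sm_Cinf[OF f chart_sub[OF c]]] by (simp add: img lf_def inv)
 qed
qed

lemma ev_chart: "chart n M U x ==> p \<in> U ==> (!!q. q \<in> U ==> P q) ==> eventually P (nh M p)"
 by (rule ev_nhI[OF chartD(1)])

text \<open>The way in which maps into manifolds are produced later: prescribe smooth coordinates
  and apply the inverse of a chart. The second fact says that the inverse is meaningful on a
  neighbourhood.\<close>

lemma chart_inv_smooth:
 assumes N: "diffspace N" and c: "chart n M U x" and p: "p \<in> pts N" and y: "tup n (\<lambda>i. y i p) \<in> x ` U"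
  and sm: "!!i. i < n ==> smooth_at N p (y i)"
 shows "smap_at N M p (\<lambda>q. inv_into U x (tup n (\<lambda>i. y i q)))"
  and "eventually (\<lambda>q. tup n (\<lambda>i. y i q) \<in> x ` U) (nh N p)"
proof -
 obtain e where e: "e > 0" "box_at n (tup n (\<lambda>i. y i p)) e \<subseteq> x ` U"
  using openE_box[OF chartD(2)[OF c] y] by blast
 have "eventually (\<lambda>q. \<forall>f\<in>y ` {..<n}. \<bar>f q - f p\<bar> < e) (nh N p)"
  by (rule ev_close) (use sm e(1) in auto)
 then show ev: "eventually (\<lambda>q. tup n (\<lambda>i. y i q) \<in> x ` U) (nh N p)"
 proof eventually_elim
  case (elim q)
  then have "tup n (\<lambda>i. y i q) \<in> box_at n (tup n (\<lambda>i. y i p)) e"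
   by (intro tup_box) auto
  then show ?case using e(2) by blast
 qed
 show "smap_at N M p (\<lambda>q. inv_into U x (tup n (\<lambda>i. y i q)))"
  unfolding smap_at_def
 proof (intro conjI ballI)
  show "eventually (\<lambda>q. inv_into U x (tup n (\<lambda>i. y i q)) \<in> pts M) (nh N p)"
   using ev by eventually_elim (auto intro: chart_sub[OF c] inv_into_into)
  fix f assume f: "f \<in> Cinf M"
  have "smooth_at N p (\<lambda>q. lf U x f (tup n (\<lambda>i. y i q)))"
   by (rule sm_compose[OF N p sm chartD(2)[OF c] chart_smooth[OF c sm_Cinf[OF f chart_sub[OF c]]] y])
  then show "smooth_at N p (\<lambda>q. f (inv_into U x (tup n (\<lambda>i. y i q))))"
   by (simp add: lf_def)
 qed (rule p)
qed

text \<open>The coordinate vector of the i-th coordinate at p, with the value 0 on non-smooth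
  functions that tangent vectors must have.\<close>

definition cvec :: "'a space => 'a set => ('a => nat => real) => nat => 'a => 'a tvec" where
 "cvec M U x i p = (\<lambda>f. if f \<in> Cinf M then pd i (lf U x f) (x p) else 0)"

lemma tv_chart:
 assumes M: "diffspace M" and c: "chart n M U x" and p: "p \<in> U" and v: "v \<in> TS M p"
  and f: "!!q. q \<in> U ==> smooth_at M q f"
 shows "tv M p v f = (\<Sum>i<n. pd i (lf U x f) (x p) * tv M p v (\<lambda>q. x q i))"
proof -
 have "tv M p v (\<lambda>q. lf U x f (tup n (\<lambda>i. x q i))) =
   (\<Sum>i<n. pd i (lf U x f) (tup n (\<lambda>i. x p i)) * tv M p v (\<lambda>q. x q i))"
  by (rule tv_chain[OF M chart_sub[OF c p] v chart_coord[OF c p] chartD(2)[OF c] chart_smooth[OF c f]])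
   (use p chart_tup[OF c p] in auto)
 moreover have "tv M p v f = tv M p v (\<lambda>q. lf U x f (tup n (\<lambda>i. x q i)))"
 proof (rule tv_cong[OF M chart_sub[OF c p] v _ f[OF p]])
  show "eventually (\<lambda>q. f q = lf U x f (tup n (\<lambda>i. x q i))) (nh M p)"
   by (rule ev_chart[OF c p]) (simp add: chart_tup[OF c] lf_apply[OF chartD(3)[OF c]])
 qed
 ultimately show ?thesis
  using chart_tup[OF c p] by simp
qed

lemma pd_lf_local:
 assumes c: "chart n M U x" and p: "p \<in> U" and i: "i < n" and ev: "eventually (\<lambda>q. f q = g q) (nh M p)"
 shows "pd i (lf U x f) (x p) = pd i (lf U x g) (x p)"
proof -
 obtain W0 where W0: "open_in M W0" "p \<in> W0" "\<forall>q\<in>W0. f q = g q"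
  using ev unfolding ev_nh[OF chart_sub[OF c p]] by blast
 have W: "open_in M (W0 \<inter> U)" "W0 \<inter> U \<subseteq> U" using W0 chartD(1)[OF c] by auto
 show ?thesis
 proof (rule pd_cong[OF chart_open_image[OF c W] _ i])
  show "x p \<in> x ` (W0 \<inter> U)" using p W0 by blast
  show "lf U x f y = lf U x g y" if "y \<in> x ` (W0 \<inter> U)" for y
   using that W0(3) lf_apply[OF chartD(3)[OF c]] by auto
 qed
qed

lemma cvec_tangent:
 assumes M: "diffspace M" and c: "chart n M U x" and p: "p \<in> U" and i: "i < n"
 shows "cvec M U x i p \<in> TS M p"
proof -
 have xp: "x p \<in> x ` U" using p by blast
 have D: "((\<lambda>t. lf U x f ((x p)(i := t))) has_real_derivative pd i (lf U x f) (x p)) (at (x p i))" if "f \<in> Cinf M" for f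
  by (rule smooth_on_deriv[OF chartD(2)[OF c] chart_smooth[OF c sm_Cinf[OF that chart_sub[OF c]]] i xp])
 have add: "pd i (lf U x (\<lambda>q. f q + g q)) (x p) = pd i (lf U x f) (x p) + pd i (lf U x g) (x p)"
  if "f \<in> Cinf M" "g \<in> Cinf M" for f g
  by (rule pdI) (use DERIV_add[OF D[OF that(1)] D[OF that(2)]] in "simp add: lf_def")
 have cm: "pd i (lf U x (\<lambda>q. k * f q)) (x p) = k * pd i (lf U x f) (x p)"
  if "f \<in> Cinf M" for f k
  by (rule pdI) (use DERIV_cmult[OF D[OF that(1)], of k] in "simp add: lf_def")
 have mu: "pd i (lf U x (\<lambda>q. f q * g q)) (x p) = pd i (lf U x f) (x p) * g p + f p * pd i (lf U x g) (x p)"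
  if "f \<in> Cinf M" "g \<in> Cinf M" for f g
 proof (rule pdI)
  have "((\<lambda>t. lf U x f ((x p)(i := t)) * lf U x g ((x p)(i := t))) has_real_derivative
   pd i (lf U x f) (x p) * lf U x g ((x p)(i := x p i)) + pd i (lf U x g) (x p) * lf U x f ((x p)(i := x p i))) (at (x p i))"
   by (rule DERIV_mult[OF D[OF that(1)] D[OF that(2)]])
  then show "((\<lambda>t. lf U x (\<lambda>q. f q * g q) ((x p)(i := t))) has_real_derivative
   pd i (lf U x f) (x p) * g p + f p * pd i (lf U x g) (x p)) (at (x p i))"
  proof -
   have "lf U x (\<lambda>q. f q * g q) = (\<lambda>y. lf U x f y * lf U x g y)"
    by (simp add: lf_def)
   then show ?thesis
    using \<open>(_ has_real_derivative _) _\<close> lf_apply[OF chartD(3)[OF c] p, of f] lf_apply[OF chartD(3)[OF c] p, of g]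
    by (simp add: mult.commute)
  qed
 qed
 show ?thesis
  unfolding tangent_space_def cvec_def
  using Cinf_add[OF M] Cinf_cmult[OF M] Cinf_mult[OF M] add cm mu by simp
qed

lemma tv_cvec:
 assumes M: "diffspace M" and c: "chart n M U x" and p: "p \<in> U" and i: "i < n" and f: "smooth_at M p f"
 shows "tv M p (cvec M U x i p) f = pd i (lf U x f) (x p)"
proof -
 obtain g where g: "g \<in> Cinf M" "eventually (\<lambda>q. f q = g q) (nh M p)"
  using f by (rule smooth_atE)
 have "tv M p (cvec M U x i p) f = cvec M U x i p g"
  by (rule tv_eq[OF M chart_sub[OF c p] cvec_tangent[OF M c p i] g])
 then show ?thesis
  using pd_lf_local[OF c p i g(2)] g(1) by (simp add: cvec_def)
qed

lemma pd_lf_coord: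
 assumes c: "chart n M U x" and p: "p \<in> U" and i: "i < n" 
 shows "pd i (lf U x (\<lambda>q. x q j)) (x p) = (if i = j then 1 else 0)"
proof -
 have "pd i (lf U x (\<lambda>q. x q j)) (x p) = pd i (\<lambda>y. y j) (x p)"
  by (rule pd_cong[OF chartD(2)[OF c] _ i]) (use p in "auto simp: lf_apply[OF chartD(3)[OF c]]")
 then show ?thesis by (simp add: pd_coord)
qed

lemma tangent_chart_eqI:
 assumes M: "diffspace M" and c: "chart n M U x" and p: "p \<in> U"
  and v: "v \<in> TS M p" and w: "w \<in> TS M p"
  and eq: "!!i. i < n ==> tv M p v (\<lambda>q. x q i) = tv M p w (\<lambda>q. x q i)"
 shows "v = w"
proof (rule tangent_eqI[OF v w])
 fix f assume f: "f \<in> Cinf M"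
 note s = sm_Cinf[OF f chart_sub[OF c]]
 show "v f = w f"
  using tv_chart[OF M c p v s] tv_chart[OF M c p w s] eq
   tv_Cinf[OF M chart_sub[OF c p] v f] tv_Cinf[OF M chart_sub[OF c p] w f] by simp
qed

lemma cvec_smooth:
 assumes M: "diffspace M" and c: "chart n M U y" and p: "p \<in> U" and i: "i < n" and f: "f \<in> Cinf M"
 shows "smooth_at M p (\<lambda>q. cvec M U y i q f)"
proof -
 have pf: "smooth_on n (y ` U) (pd i (lf U y f))"
  by (rule smooth_on_pd[OF chartD(2)[OF c] chart_smooth[OF c sm_Cinf[OF f chart_sub[OF c]]] i])
 have "smooth_at M p (\<lambda>q. pd i (lf U y f) (tup n (\<lambda>k. y q k)))"
  by (rule sm_compose[OF M chart_sub[OF c p] chart_coord[OF c p] chartD(2)[OF c] pf])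
   (use p chart_tup[OF c p] in auto)
 moreover have "eventually (\<lambda>q. pd i (lf U y f) (tup n (\<lambda>k. y q k)) = cvec M U y i q f) (nh M p)"
  by (rule ev_chart[OF c p]) (simp add: chart_tup[OF c] cvec_def f)
 ultimately show ?thesis by (rule sm_cong[rotated])
qed

text \<open>\<open>exchange\<close>, applied to the local expression of f. Both constructions of
  charts below rest on it.\<close>

lemma chart_exchange:
 assumes M: "diffspace M" and c: "chart n M U x" and p: "p \<in> U" and f: "smooth_at M p f"
  and i: "i < n" and nz: "pd i (lf U x f) (x p) ~= 0"
 shows "\<exists>W. p \<in> W \<and> W \<subseteq> U \<and> chart n M W (\<lambda>q. (x q)(i := f q))"
proof -
 have "eventually (\<lambda>q. smooth_at M q f) (nh M p)"
  using f by (rule sm_ev)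
 then obtain U0 where U0: "open_in M U0" "p \<in> U0" "\<forall>q\<in>U0. smooth_at M q f"
  unfolding ev_nh[OF chart_sub[OF c p]] by blast
 define U1 where "U1 = U0 \<inter> U"
 have U1: "open_in M U1" "U1 \<subseteq> U" "p \<in> U1" "!!q. q \<in> U1 ==> smooth_at M q f"
  using U0 chartD(1)[OF c] p by (auto simp: U1_def)
 have c1: "chart n M U1 x" by (rule chart_subset[OF M c U1(1,2)])
 note inj = chartD(3)[OF c1]
 let ?F = "lf U1 x f"
 have F: "smooth_on n (x ` U1) ?F" by (rule chart_smooth[OF c1 U1(4)])
 have "pd i ?F (x p) = pd i (lf U x f) (x p)"
 proof (rule pd_cong[OF chartD(2)[OF c1] _ i])
  show "x p \<in> x ` U1" using U1 by blast
  show "lf U1 x f y = lf U x f y" if "y \<in> x ` U1" for y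
   by (rule lf_restrict[OF chartD(3)[OF c] U1(2) that])
 qed
 then have nz1: "pd i ?F (x p) ~= 0" using nz by simp
 obtain B g where B: "open_E n B" "x p \<in> B" "B \<subseteq> x ` U1"
  "open_E n ((\<lambda>y. y(i := ?F y)) ` B)"
  "smooth_on n ((\<lambda>y. y(i := ?F y)) ` B) g" "\<forall>y\<in>B. g (y(i := ?F y)) = y i"
  using exchange[OF chartD(2)[OF c1] F _ i nz1] U1(3) by blast
 define W where "W = {q \<in> U1. x q \<in> B}"
 let ?y = "\<lambda>q. (x q)(i := f q)"
 have W: "open_in M W"
 proof (rule openin_ev)
  fix q assume q: "q \<in> W"
  have q1: "q \<in> U1" using q by (simp add: W_def)
  have "eventually (\<lambda>z. tup n (\<lambda>i. x z i) \<in> x ` {z \<in> U1. x z \<in> B}) (nh M q)"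
  proof -
   obtain e where e: "e > 0" "box_at n (x q) e \<subseteq> B"
    using openE_box[OF B(1)] q by (auto simp: W_def)
   have "eventually (\<lambda>z. \<forall>h\<in>(\<lambda>i z. x z i) ` {..<n}. \<bar>h z - h q\<bar> < e) (nh M q)"
    by (rule ev_close) (use chart_coord[OF c1 q1] e(1) in auto)
   then show ?thesis
   proof eventually_elim
    case (elim z)
    then have "tup n (\<lambda>i. x z i) \<in> box_at n (tup n (\<lambda>i. x q i)) e"
     by (intro tup_box) auto
    then have "tup n (\<lambda>i. x z i) \<in> B"
     using e(2) chart_tup[OF c1 q1] by auto
    then obtain z' where "z' \<in> U1" "tup n (\<lambda>i. x z i) = x z'" "x z' \<in> B"
     using B(3) by (metis imageE subsetD)
    then show ?case by auto
   qed
  qed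
  moreover have "eventually (\<lambda>z. z \<in> U1) (nh M q)"
   by (rule ev_chart[OF c1 q1])
  ultimately have "eventually (\<lambda>z. z \<in> W) (nh M q)"
  proof eventually_elim
   case (elim z)
   then show ?case using chart_tup[OF c1, of z] inj by (auto simp: W_def inj_on_def)
  qed
  then show "q \<in> pts M \<and> eventually (\<lambda>z. z \<in> W) (nh M q)" using chart_sub[OF c1 q1] by blast
 qed
 have xW: "x ` W = B" using B(3) by (auto simp: W_def)
 have yeq: "?y q = (\<lambda>y. y(i := ?F y)) (x q)" if "q \<in> U1" for q
  using lf_apply[OF inj that, of f] by simp
 have yW: "?y ` W = (\<lambda>y. y(i := ?F y)) ` B"
 proof -
  have "?y ` W = (\<lambda>q. (\<lambda>y. y(i := ?F y)) (x q)) ` W"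
   by (rule image_cong[OF refl]) (use yeq in "auto simp: W_def")
  then show ?thesis using xW by (auto simp: image_image)
 qed
 \<comment> \<open>The old coordinates are recovered from the new ones through g; injectivity and
   smooth local expressions follow from this.\<close>
 have rec: "tup n (\<lambda>k. if k = i then g (?y q) else ?y q k) = x q" if "q \<in> W" for q
 proof (rule E_eqI)
  show "x q \<in> E n" using that chart_E[OF c1] by (simp add: W_def)
  have "g (?y q) = x q i"
   using B(6) yeq[of q] that by (simp add: W_def)
  then show "tup n (\<lambda>k. if k = i then g (?y q) else ?y q k) k = x q k" if "k < n" for k
   using that by simp
 qed simp
 have injy: "inj_on ?y W"
 proof (rule inj_onI)
  fix q q' assume q: "q \<in> W" "q' \<in> W" "?y q = ?y q'"
  have "x q = x q'" using rec[OF q(1)] unfolding q(3) rec[OF q(2)] by (rule sym)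
  then show "q = q'" using inj q by (auto simp: W_def inj_on_def)
 qed
 have "chart n M W ?y"
 proof (rule chartI[OF M W injy])
  show op: "open_E n (?y ` W)" using B(4) yW by simp
  show "smooth_at M q (\<lambda>q. ((x q)(i := f q)) k)" if "q \<in> W" "k < n" for q k
   using chart_coord[OF c1 _ that(2)] U1(4) that by (cases "k = i") (auto simp: W_def)
  fix h assume h: "h \<in> Cinf M"
  have sh: "smooth_on n (x ` U1) (lf U1 x h)"
   by (rule chart_smooth[OF c1 sm_Cinf[OF h chart_sub[OF c1]]])
  have "smooth_on n (?y ` W) (\<lambda>z. lf U1 x h (tup n (\<lambda>k. if k = i then g z else z k)))"
  proof (rule smooth_on_compose[OF op chartD(2)[OF c1] sh])
   show "smooth_on n (?y ` W) (\<lambda>z. if k = i then g z else z k)" for k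
    by (cases "k = i") (use B(5) yW smooth_on_coord[OF op] in simp_all)
   show "tup n (\<lambda>k. if k = i then g z else z k) \<in> x ` U1" if "z \<in> ?y ` W" for z
    using that rec by (auto simp: W_def)
  qed
  then show "smooth_on n (?y ` W) (lf W ?y h)"
  proof (rule smooth_on_cong[OF op, rotated])
   fix z assume "z \<in> ?y ` W"
   then obtain q where q: "q \<in> W" "z = ?y q" by blast
   have "lf W ?y h z = h q" using lf_apply[OF injy q(1)] q(2) by blast
   moreover have "lf U1 x h (x q) = h q" using lf_apply[OF inj] q(1) by (simp add: W_def)
   ultimately show "lf U1 x h (tup n (\<lambda>k. if k = i then g z else z k)) = lf W ?y h z"
    unfolding q(2) rec[OF q(1)] by simp
  qed
 qed
 moreover have "p \<in> W" "W \<subseteq> U" using U1 B(2) by (auto simp: W_def)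
 ultimately show ?thesis by blast
qed

text \<open>Steinitz exchange: the coordinate vector of a coordinate still to be replaced is not 0,
  so some member of F has a nonzero derivative along it and can take its place.\<close>

lemma chart_of_separating:
 assumes M: "diffspace M" and c: "chart n M U x" and p: "p \<in> U"
  and F: "!!f. f \<in> F ==> smooth_at M p f"
  and sep: "!!v. v \<in> TS M p ==> (!!f. f \<in> F ==> tv M p v f = 0) ==> v = (\<lambda>f. 0)"
 shows "\<exists>\<kappa> W. (\<forall>i<n. \<kappa> i \<in> F) \<and> p \<in> W \<and> W \<subseteq> U \<and> chart n M W (\<lambda>q. tup n (\<lambda>i. \<kappa> i q))"
proof -
 have "\<exists>\<kappa> W. (\<forall>i<j. \<kappa> i \<in> F) \<and> p \<in> W \<and> W \<subseteq> U \<and> chart n M W (\<lambda>q. tup n (\<lambda>i. if i < j then \<kappa> i q else x q i))"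
  if "j \<le> n" for j
  using that
 proof (induction j)
  case 0
  have "chart n M U (\<lambda>q. tup n (\<lambda>i. x q i))"
   by (rule chart_cong[OF M c]) (simp add: chart_tup[OF c])
  then show ?case using p by (intro exI[of _ undefined] exI[of _ U]) simp
 next
  case (Suc j)
  then obtain \<kappa> W where IH: "\<forall>i<j. \<kappa> i \<in> F" "p \<in> W" "W \<subseteq> U"
   "chart n M W (\<lambda>q. tup n (\<lambda>i. if i < j then \<kappa> i q else x q i))" by auto
  let ?y = "\<lambda>q. tup n (\<lambda>i. if i < j then \<kappa> i q else x q i)"
  have j: "j < n" using Suc.prems by simp
  let ?v = "cvec M W ?y j p"
  have v: "?v \<in> TS M p" by (rule cvec_tangent[OF M IH(4,2) j])
  have one: "tv M p ?v (\<lambda>q. ?y q j) = 1"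
   using tv_cvec[OF M IH(4,2) j chart_coord[OF IH(4,2) j]] pd_lf_coord[OF IH(4,2) j, of j] by simp
  have "?v ~= (\<lambda>f. 0)"
  proof
   assume "?v = (\<lambda>f. 0)"
   from one[unfolded this] show False by (simp add: tv_def)
  qed
  then obtain f where f: "f \<in> F" "tv M p ?v f ~= 0"
   using sep[OF v] by blast
  have "pd j (lf W ?y f) (?y p) ~= 0"
   using f(2) tv_cvec[OF M IH(4,2) j F[OF f(1)]] by simp
  from chart_exchange[OF M IH(4,2) F[OF f(1)] j this]
  obtain V where V: "p \<in> V" "V \<subseteq> W" "chart n M V (\<lambda>q. (?y q)(j := f q))" by blast
  have "chart n M V (\<lambda>q. tup n (\<lambda>i. if i < Suc j then (\<kappa>(j := f)) i q else x q i))"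
   by (rule chart_cong[OF M V(3)]) (use j in "auto simp: tup_def fun_eq_iff")
  moreover have "\<forall>i<Suc j. (\<kappa>(j := f)) i \<in> F"
   using IH(1) f(1) by (simp add: less_Suc_eq)
  ultimately show ?case using V(1,2) IH(3) by (intro exI[of _ "\<kappa>(j := f)"] exI[of _ V]) auto
 qed
 from this[OF order_refl] obtain \<kappa> W where 1: "\<forall>i<n. \<kappa> i \<in> F" "p \<in> W" "W \<subseteq> U"
   "chart n M W (\<lambda>q. tup n (\<lambda>i. if i < n then \<kappa> i q else x q i))" by auto
 have "chart n M W (\<lambda>q. tup n (\<lambda>i. \<kappa> i q))"
  by (rule chart_cong[OF M 1(4)]) (auto simp: tup_def)
 then show ?thesis using 1 by blast
qed

text \<open>Steinitz exchange with prescribed functions. If \<open>u k\<close> had derivative 0 in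
  every position not yet taken, then \<open>w k\<close> would give 0 on it, as it gives 0 on the
  coordinates \<open>u j\<close> placed before. The positions are recorded because all other
  coordinates keep their old values, which preserves their homogeneity in
  \<open>hh_chart\<close>.\<close>

lemma chart_independent:
 assumes M: "diffspace M" and c: "chart n M U x" and p: "p \<in> U"
  and u: "!!j. j < m ==> smooth_at M p (u j)"
  and w: "!!j. j < m ==> w j \<in> TS M p"
   "!!i j. i < m ==> j < m ==> tv M p (w j) (u i) = (if i = j then 1 else 0)"
 shows "\<exists>(pos::nat => nat) W y. inj_on pos {..<m} \<and> pos ` {..<m} \<subseteq> {..<n} \<and> p \<in> W \<and> W \<subseteq> U \<and> chart n M W y \<and>
  (\<forall>q\<in>W. \<forall>j<m. y q (pos j) = u j q) \<and> (\<forall>q\<in>W. \<forall>i<n. i \<notin> pos ` {..<m} --> y q i = x q i)"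
proof -
 have "\<exists>(pos::nat => nat) W y. inj_on pos {..<k} \<and> pos ` {..<k} \<subseteq> {..<n} \<and> p \<in> W \<and> W \<subseteq> U \<and> chart n M W y \<and>
  (\<forall>q\<in>W. \<forall>j<k. y q (pos j) = u j q) \<and> (\<forall>q\<in>W. \<forall>i<n. i \<notin> pos ` {..<k} --> y q i = x q i)" if "k \<le> m" for k
  using that
 proof (induction k)
  case 0
  show ?case
   by (intro exI[of _ "\<lambda>_. 0"] exI[of _ U] exI[of _ x]) (use c p in simp)
 next
  case (Suc k)
  then obtain pos W y where IH: "inj_on pos {..<k}" "pos ` {..<k} \<subseteq> {..<n}" "p \<in> W" "W \<subseteq> U" "chart n M W y"
   "\<forall>q\<in>W. \<forall>j<k. y q (pos j) = u j q" "\<forall>q\<in>W. \<forall>i<n. i \<notin> pos ` {..<k} --> y q i = x q i"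
   by auto
  have k: "k < m" using Suc.prems by simp
  obtain i where i: "i < n" "i \<notin> pos ` {..<k}" "pd i (lf W y (u k)) (y p) ~= 0"
  proof (rule ccontr)
   assume "\<not> thesis"
   then have z: "pd i (lf W y (u k)) (y p) = 0" if "i < n" "i \<notin> pos ` {..<k}" for i
    using that \<open>!!i. i < n ==> i \<notin> pos ` {..<k} ==> pd i (lf W y (u k)) (y p) ~= 0 ==> thesis\<close> by blast
   obtain W0 where W0: "open_in M W0" "p \<in> W0" "\<forall>q\<in>W0. smooth_at M q (u k)"
    using sm_ev[OF u[OF k]] unfolding ev_nh[OF chart_sub[OF c p]] by blast
   define V where "V = W0 \<inter> W"
   have V: "open_in M V" "V \<subseteq> W" "p \<in> V" "!!q. q \<in> V ==> smooth_at M q (u k)"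
    using W0 IH(3) chartD(1)[OF IH(5)] by (auto simp: V_def)
   have cV: "chart n M V y" by (rule chart_subset[OF M IH(5) V(1,2)])
   have zV: "pd i (lf V y (u k)) (y p) = pd i (lf W y (u k)) (y p)" if "i < n" for i
   proof (rule pd_cong[OF chartD(2)[OF cV] _ that])
    show "y p \<in> y ` V" using V by blast
    show "lf V y (u k) z = lf W y (u k) z" if "z \<in> y ` V" for z
     by (rule lf_restrict[OF chartD(3)[OF IH(5)] V(2) that])
   qed
   have "tv M p (w k) (u k) = (\<Sum>i<n. pd i (lf V y (u k)) (y p) * tv M p (w k) (\<lambda>q. y q i))"
    by (rule tv_chart[OF M cV V(3) w(1)[OF k] V(4)])
   also have "\<dots> = 0"
   proof (rule sum.neutral, rule ballI)
    fix i assume "i \<in> {..<n}"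
    then have i: "i < n" by simp
    show "pd i (lf V y (u k)) (y p) * tv M p (w k) (\<lambda>q. y q i) = 0"
    proof (cases "i \<in> pos ` {..<k}")
     case True
     then obtain j where j: "j < k" "i = pos j" by blast
     have jm: "j < m" using j k by simp
     have "tv M p (w k) (\<lambda>q. y q i) = tv M p (w k) (u j)"
     proof (rule tv_cong[OF M chart_sub[OF c p] w(1)[OF k] _ chart_coord[OF IH(5,3) i]])
      show "eventually (\<lambda>q. y q i = u j q) (nh M p)"
       by (rule ev_chart[OF IH(5,3)]) (use IH(6) j in simp)
     qed
     then show ?thesis using w(2)[OF jm k] j by simp
    qed (use z[OF i] zV[OF i] in simp)
   qed
   finally show False using w(2)[OF k k] by simp
  qed
  from chart_exchange[OF M IH(5,3) u[OF k] i(1,3)]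
  obtain V where V: "p \<in> V" "V \<subseteq> W" "chart n M V (\<lambda>q. (y q)(i := u k q))" by blast
  let ?pos = "pos(k := i)"
  have img: "?pos ` {..<Suc k} = insert i (pos ` {..<k})"
   by (auto simp: lessThan_Suc)
  have ne: "pos j ~= i" if "j < k" for j using i(2) that by blast
  show ?case
  proof (intro exI[of _ ?pos] exI[of _ V] exI[of _ "\<lambda>q. (y q)(i := u k q)"] conjI V ballI allI impI)
   show "inj_on ?pos {..<Suc k}"
   proof (rule inj_onI)
    fix a b assume ab: "a \<in> {..<Suc k}" "b \<in> {..<Suc k}" "?pos a = ?pos b"
    then consider "a = k" "b = k" | "a = k" "b < k" | "a < k" "b = k" | "a < k" "b < k"
     by (auto simp: less_Suc_eq)
    then show "a = b"
     using ab(3) IH(1) ne[of a] ne[of b] by cases (auto simp: inj_on_def)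
   qed
   show "?pos ` {..<Suc k} \<subseteq> {..<n}" using img IH(2) i(1) by auto
   show "V \<subseteq> U" using V(2) IH(4) by blast
   show "((y q)(i := u k q)) (?pos j) = u j q" if "q \<in> V" "j < Suc k" for q j
    using that V(2) IH(6) ne by (auto simp: less_Suc_eq)
   show "((y q)(i := u k q)) l = x q l" if "q \<in> V" "l < n" "l \<notin> ?pos ` {..<Suc k}" for q l
   proof -
    have "l ~= i" "l \<notin> pos ` {..<k}" using that(3) unfolding img by auto
    then show ?thesis using that V(2) IH(7) by auto
   qed
  qed
 qed
 from this[OF order_refl] show ?thesis .
qed

text \<open>Lifts of the coordinate vectors of N are dual to the pulled-back coordinates, so these
  can be exchanged into any given chart at p.\<close>

lemma submersion_chart:
 assumes M: "diffspace M" and N: "diffspace N" and \<phi>: "submersion M N \<phi>"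
  and c: "chart n M U x" and p: "p \<in> U" and d: "chart m N V z" and pV: "\<phi> p \<in> V"
 shows "\<exists>(pos::nat => nat) W y. inj_on pos {..<m} \<and> pos ` {..<m} \<subseteq> {..<n} \<and> p \<in> W \<and> W \<subseteq> U \<and> \<phi> ` W \<subseteq> V \<and> chart n M W y \<and>
  (\<forall>q\<in>W. \<forall>j<m. y q (pos j) = z (\<phi> q) j) \<and> (\<forall>q\<in>W. \<forall>i<n. i \<notin> pos ` {..<m} --> y q i = x q i)"
proof -
 have pM: "p \<in> pts M" by (rule chart_sub[OF c p])
 have sm: "smooth_map M N \<phi>" using \<phi> by (simp add: submersion_def)
 note sp = smooth_mapD[OF sm pM]
 have u: "smooth_at M p (\<lambda>q. z (\<phi> q) j)" if "j < m" for j
  by (rule sm_pull[OF sp chart_coord[OF d pV that]])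
 have "\<exists>v\<in>TS M p. push M N p \<phi> v = cvec N V z j (\<phi> p)" if "j < m" for j
 proof -
  have "cvec N V z j (\<phi> p) \<in> TS N (\<phi> p)" by (rule cvec_tangent[OF N d pV that])
  then obtain v where v: "v \<in> TS M p" "tangent_map M N \<phi> (p, v) = (\<phi> p, cvec N V z j (\<phi> p))"
   using \<phi> pM unfolding submersion_def by blast
  then show ?thesis using tangent_map_push[OF M sm pM v(1)] by auto
 qed
 then obtain w where w: "!!j. j < m ==> w j \<in> TS M p" "!!j. j < m ==> push M N p \<phi> (w j) = cvec N V z j (\<phi> p)"
  by metis
 have d1: "tv M p (w j) (\<lambda>q. z (\<phi> q) i) = (if i = j then 1 else 0)" if "i < m" "j < m" for i j
 proof -
  have "tv M p (w j) (\<lambda>q. z (\<phi> q) i) = tv N (\<phi> p) (push M N p \<phi> (w j)) (\<lambda>y. z y i)"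
   by (rule tv_push[OF M N sp w(1)[OF that(2)] chart_coord[OF d pV that(1)], symmetric])
  also have "\<dots> = (if i = j then 1 else 0)"
   using tv_cvec[OF N d pV that(2) chart_coord[OF d pV that(1)]] pd_lf_coord[OF d pV that(2), of i] w(2)[OF that(2)]
   by auto
  finally show ?thesis .
 qed
 obtain U0 where U0: "open_in M U0" "p \<in> U0" "\<forall>q\<in>U0. \<phi> q \<in> V"
  using smap_at_cont[OF sp chartD(1)[OF d] pV] unfolding ev_nh[OF pM] by blast
 have U1: "open_in M (U0 \<inter> U)" "U0 \<inter> U \<subseteq> U" "p \<in> U0 \<inter> U"
  using U0 chartD(1)[OF c] p by auto
 have c1: "chart n M (U0 \<inter> U) x" by (rule chart_subset[OF M c U1(1,2)])
 have "\<exists>(pos::nat => nat) W y. inj_on pos {..<m} \<and> pos ` {..<m} \<subseteq> {..<n} \<and> p \<in> W \<and> W \<subseteq> U0 \<inter> U \<and> chart n M W y \<and>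
  (\<forall>q\<in>W. \<forall>j<m. y q (pos j) = z (\<phi> q) j) \<and> (\<forall>q\<in>W. \<forall>i<n. i \<notin> pos ` {..<m} --> y q i = x q i)"
  by (rule chart_independent[OF M c1 U1(3), of m "\<lambda>j q. z (\<phi> q) j" w, OF u w(1) d1])
 then obtain pos W y where "inj_on pos {..<m}" "pos ` {..<m} \<subseteq> {..<n}" "p \<in> W" "W \<subseteq> U0 \<inter> U" "chart n M W y"
  "\<forall>q\<in>W. \<forall>j<m. y q (pos j) = z (\<phi> q) j" "\<forall>q\<in>W. \<forall>i<n. i \<notin> pos ` {..<m} --> y q i = x q i"
  by (elim exE conjE)
 moreover have "\<phi> ` W \<subseteq> V" using \<open>W \<subseteq> U0 \<inter> U\<close> U0(3) by blast
 ultimately show ?thesis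
  by (intro exI[of _ pos] exI[of _ W] exI[of _ y]) auto
qed

lemma smap_at_comp':
 assumes "smap_at M N p \<phi>" "smooth_map N K \<psi>"
 shows "smap_at M K p (\<lambda>q. \<psi> (\<phi> q))"
 by (rule smap_at_comp[OF assms(1) smooth_mapD[OF assms(2) smap_at_img[OF assms(1)]]])

subsection \<open>Euclidean space as a space\<close>

text \<open>Euclidean space as a generated space, so that \<open>smooth_on\<close> can be proved
  with germs, through \<open>smooth_on_euI\<close>.\<close>

definition eu :: "nat => (nat => real) space" where
 "eu n = generated_space (E n) {\<lambda>x. x i |i. i < n}"

lemma pts_eu [simp]: "pts (eu n) = E n"
 by (simp add: eu_def)

lemma diffspace_eu [simp]: "diffspace (eu n)"
 by (simp add: eu_def diffspace_gen)

lemma coord_eu: "i < n ==> (\<lambda>x. x i) \<in> Cinf (eu n)"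
 unfolding eu_def by (rule generators_Cinf) blast

lemma openin_eu: "openin (top_of (eu n)) U \<longleftrightarrow> open_E n U"
proof
 assume U: "openin (top_of (eu n)) U"
 show "open_E n U"
  unfolding openE_iff
 proof (intro conjI ballI)
  show "U \<subseteq> E n" using openin_initial_sub[OF U] by simp
  fix x assume x: "x \<in> U"
  obtain I e where I: "finite I" "I \<subseteq> {\<lambda>x. x i |i. i < n}" "e > 0" "{q \<in> E n. \<forall>f\<in>I. \<bar>f q - f x\<bar> < e} \<subseteq> U"
   using initial_basis[OF U[unfolded eu_def top_of_gen] x] by (elim exE conjE)
  have "box_at n x e \<subseteq> {q \<in> E n. \<forall>f\<in>I. \<bar>f q - f x\<bar> < e}"
   using I(2) by (auto simp: box_at_def)
  then show "\<exists>e>0. box_at n x e \<subseteq> U" using I by blast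
 qed
next
 assume U: "open_E n U"
 show "openin (top_of (eu n)) U"
 proof (rule openin_ev)
  fix x assume x: "x \<in> U"
  have xE: "x \<in> pts (eu n)" using openE_sub[OF U x] by simp
  obtain e where e: "e > 0" "box_at n x e \<subseteq> U" using openE_box[OF U x] by blast
  have "eventually (\<lambda>q. \<forall>f\<in>(\<lambda>i x. x i) ` {..<n}. \<bar>f q - f x\<bar> < e) (nh (eu n) x)"
   by (rule ev_close) (use e(1) xE coord_eu in "auto intro!: sm_Cinf")
  then have "eventually (\<lambda>q. q \<in> U) (nh (eu n) x)"
   using ev_nh_pts[of "eu n" x]
  proof eventually_elim
   case (elim q)
   then have "q \<in> box_at n x e" by (auto simp: box_at_def)
   then show ?case using e(2) by blast
  qed
  then show "x \<in> pts (eu n) \<and> eventually (\<lambda>q. q \<in> U) (nh (eu n) x)" using xE by blast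
 qed
qed

lemma smooth_on_euI:
 assumes U: "open_E n U" and F: "!!x. x \<in> U ==> smooth_at (eu n) x F"
 shows "smooth_on n U F"
proof (rule smooth_on_local[OF U])
 fix x assume x: "x \<in> U"
 obtain W where W: "open_E n W" "x \<in> W" "rep {\<lambda>x. x i |i. i < n} W F"
  using sm_gen[OF F[OF x, unfolded eu_def]] unfolding eu_def[symmetric] openin_eu by blast
 obtain m c H where H: "\<forall>i<m. c i \<in> {\<lambda>x. x i |i. i < n}" "smooth_on m (E m) H" "\<forall>q\<in>W. F q = H (tup m (\<lambda>i. c i q))"
  using W(3) unfolding rep_def by blast
 have "smooth_on n W (\<lambda>q. H (tup m (\<lambda>i. c i q)))"
  by (rule smooth_on_compose[OF W(1) openin_E H(2)]) (use H(1) smooth_on_coord[OF W(1)] in auto)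
 then have "smooth_on n W F"
  by (rule smooth_on_cong[OF W(1), rotated]) (use H(3) in simp)
 then show "\<exists>V. open_E n V \<and> x \<in> V \<and> smooth_on n V F"
  using W by blast
qed

lemma ev_real_line:
 assumes "eventually P (nh real_line a)"
 shows "\<exists>d>0. \<forall>t. \<bar>t - a\<bar> < d --> P t"
proof -
 have a: "a \<in> pts real_line" by simp
 obtain W where W: "open_in real_line W" "a \<in> W" "\<forall>t\<in>W. P t"
  using assms unfolding ev_nh[OF a] by blast
 obtain I e where I: "finite I" "I \<subseteq> {\<lambda>t. t}" "e > 0" "{q \<in> UNIV. \<forall>f\<in>I. \<bar>f q - f a\<bar> < e} \<subseteq> W"
  using initial_basis[OF W(1)[unfolded real_line_def top_of_gen] W(2)] by (elim exE conjE)
 have "{q. \<bar>q - a\<bar> < e} \<subseteq> {q \<in> UNIV. \<forall>f\<in>I. \<bar>f q - f a\<bar> < e}" using I(2) by auto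
 then show ?thesis using W(3) I(3,4) by blast
qed

section \<open>Homogeneity structures and homogeneous charts\<close>

lemma homogeneity_joint:
 assumes H: "homogeneity_structure D h" and N: "diffspace N"
  and f: "smooth_at N p f" and \<phi>: "smap_at N D p \<phi>"
 shows "smap_at N D p (\<lambda>q. h (f q) (\<phi> q))"
proof -
 have s: "smooth_map (RL D) D (\<lambda>(t, p). h t p)"
  using H by (simp add: homogeneity_structure_def)
 have "smap_at N (RL D) p (\<lambda>q. (f q, \<phi> q))"
  by (rule smap_at_prod[OF N sm_real[OF N f] \<phi>])
 from smap_at_comp[OF this smooth_mapD[OF s]] show ?thesis
  using smap_at_img[OF \<phi>] by simp
qed

lemma homogeneity_map:
 assumes "homogeneity_structure D h" "diffspace D"
 shows "smooth_map D D (h t)"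
proof (rule smooth_mapI[OF assms(2)])
 show "smap_at D D p (h t)" if "p \<in> pts D" for p
  using homogeneity_joint[OF assms sm_const[OF assms(2) that] smap_at_id[OF that]] by simp
qed

lemma homogeneity_simps:
 assumes "homogeneity_structure D h" "p \<in> pts D"
 shows "h 1 p = p" "h t (h s p) = h (t * s) p"
 using assms by (simp_all add: homogeneity_structure_def)

lemma homogeneity_pts: "homogeneity_structure D h ==> diffspace D ==> p \<in> pts D ==> h t p \<in> pts D"
 using homogeneity_map[of D h t] by (auto simp: smooth_map_def)

lemma homogeneity_near_0:
 assumes H: "homogeneity_structure D h" and D: "diffspace D" and p: "p \<in> pts D"
  and U: "open_in D U" "h 0 p \<in> U"
 shows "\<exists>d>0. \<forall>t. \<bar>t\<bar> < d --> h t p \<in> U"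
proof -
 have "smap_at real_line D 0 (\<lambda>t. h t p)"
  by (rule homogeneity_joint[OF H diffspace_real _ smap_at_const[OF diffspace_real _ p]])
   (auto intro: sm_Cinf real_Cinf)
 from ev_real_line[OF smap_at_cont[OF this U]] show ?thesis by simp
qed

text \<open>As t tends to 0, \<open>h t p\<close> tends to \<open>h 0 p\<close>, so it lies in U for
  some nonzero t; the invariance of U under \<open>h (1 / t)\<close> brings it back to p.\<close>

lemma homogeneity_saturated:
 assumes H: "homogeneity_structure D h" and D: "diffspace D" and U: "open_in D U" "!!t. h t ` U \<subseteq> U"
  and p: "p \<in> pts D" "h 0 p \<in> U"
 shows "p \<in> U"
proof -
 obtain d where d: "d > 0" "\<forall>t. \<bar>t\<bar> < d --> h t p \<in> U"
  using homogeneity_near_0[OF H D p(1) U(1) p(2)] by blast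
 then have "h (d / 2) p \<in> U" by simp
 then have "h (2 / d) (h (d / 2) p) \<in> U" using U(2) by blast
 then show ?thesis using homogeneity_simps[OF H p(1)] d(1) by simp
qed

text \<open>Since \<open>h t\<close> contracts a neighbourhood of each point of S into U for small t, the chart can be
 transported from U along \<open>h (1 / t)\<close>.\<close>

lemma homogeneous_extension:
 assumes H: "homogeneity_structure D h" and D: "diffspace D" and c: "chart n D U \<xi>"
  and S: "S = {e \<in> pts D. h 0 e \<in> U}"
  and hom: "!!e t i. e \<in> S ==> i < n ==> \<xi> (h t e) i = t ^ w i * \<xi> e i"
  and E: "!!e. e \<in> S ==> \<xi> e \<in> E n"
 shows "homogeneous_chart n D h S \<xi> w"
proof -
 note hs = homogeneity_simps[OF H] and hp = homogeneity_pts[OF H D]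
 have Sp: "e \<in> pts D" if "e \<in> S" for e using that S by simp
 have hS: "h t e \<in> S" if "e \<in> S" for t e
  using that hs hp S by simp
 have op: "open_in D S"
 proof (rule openin_ev)
  fix e assume e: "e \<in> S"
  have "eventually (\<lambda>q. h 0 q \<in> U) (nh D e)"
   by (rule smap_at_cont[OF smooth_mapD[OF homogeneity_map[OF H D] Sp[OF e]] chartD(1)[OF c]]) (use e S in simp)
  then have "eventually (\<lambda>q. q \<in> S) (nh D e)" using ev_nh_pts[of D e] by eventually_elim (simp add: S)
  then show "e \<in> pts D \<and> eventually (\<lambda>q. q \<in> S) (nh D e)" using Sp[OF e] by blast
 qed
 have near: "\<exists>d>0. \<forall>t. \<bar>t\<bar> < d --> h t e \<in> U" if "e \<in> S" for e
  by (rule homogeneity_near_0[OF H D Sp[OF that] chartD(1)[OF c]]) (use that S in simp)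
 have inv: "h (1 / t) (h t e) = e" if "e \<in> pts D" "t ~= 0" for e t
  using hs that by simp
 have inj: "inj_on \<xi> S"
 proof (rule inj_onI)
  fix e e' assume e: "e \<in> S" "e' \<in> S" "\<xi> e = \<xi> e'"
  obtain d d' where d: "d > 0" "\<forall>t. \<bar>t\<bar> < d --> h t e \<in> U" "d' > 0" "\<forall>t. \<bar>t\<bar> < d' --> h t e' \<in> U"
   using near e(1,2) by metis
  define t where "t = min d d' / 2"
  have t: "t ~= 0" "h t e \<in> U" "h t e' \<in> U" using d by (auto simp: t_def)
  have "\<xi> (h t e) = \<xi> (h t e')"
   by (rule E_eqI[OF chart_E[OF c t(2)] chart_E[OF c t(3)]]) (use hom e in simp)
  then have *: "h t e = h t e'"
   by (rule inj_onD[OF chartD(3)[OF c] _ t(2,3)])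
  show "e = e'"
   using inv[OF Sp[OF e(1)] t(1)] unfolding * inv[OF Sp[OF e(2)] t(1)] by (rule sym)
 qed
 \<comment> \<open>Homogeneity of \<xi> is known on S, so the given chart is first cut down to
   S.\<close>
 define U2 where "U2 = U \<inter> S"
 have U2: "open_in D U2" "U2 \<subseteq> U" using op chartD(1)[OF c] by (auto simp: U2_def)
 have c2: "chart n D U2 \<xi>" by (rule chart_subset[OF D c U2])
 have smth: "smooth_map D D (h t)" for t by (rule homogeneity_map[OF H D])
 have loc: "\<exists>t. t ~= 0 \<and> h t e \<in> U2" if "e \<in> S" for e
 proof -
  obtain d where "d > 0" "\<forall>t. \<bar>t\<bar> < d --> h t e \<in> U" using near[OF \<open>e \<in> S\<close>] by blast
  then show ?thesis using hS[OF that] by (intro exI[of _ "d / 2"]) (auto simp: U2_def)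
 qed
 have scale: "\<exists>V. open_E n V \<and> \<xi> e \<in> V \<and> V \<subseteq> \<xi> ` S \<and>
   (\<forall>f\<in>Cinf D. smooth_on n V (lf S \<xi> f))" if e: "e \<in> S" for e
 proof -
  \<comment> \<open>Around \<open>\<xi> e\<close> the inverse of \<xi> is: scale the coordinates by
    the powers of t, apply the inverse chart on U2, then apply \<open>h (1 / t)\<close>.\<close>
  obtain t where t: "t ~= 0" "h t e \<in> U2" using loc[OF e] by blast
  let ?y = "\<lambda>i z. t ^ w i * z i"
  have eq: "tup n (\<lambda>i. ?y i (\<xi> e)) = \<xi> (h t e)"
   by (rule E_eqI[OF tup_in_E E[OF hS[OF e]]]) (use hom[OF e] in simp)
  have sy: "smooth_at (eu n) y (?y i)" if "y \<in> E n" "i < n" for y i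
   by (rule sm_cmult[OF diffspace_eu]) (use that in "auto intro: sm_Cinf coord_eu")
  let ?inv = "\<lambda>z. inv_into U2 \<xi> (tup n (\<lambda>i. ?y i z))"
  have xe: "\<xi> e \<in> pts (eu n)" using E[OF e] by simp
  have ev: "eventually (\<lambda>z. tup n (\<lambda>i. ?y i z) \<in> \<xi> ` U2) (nh (eu n) (\<xi> e))"
   by (rule chart_inv_smooth(2)[OF diffspace_eu c2 xe]) (use t(2) eq sy E[OF e] in auto)
  obtain V where V: "open_E n V" "\<xi> e \<in> V" "\<forall>z\<in>V. tup n (\<lambda>i. ?y i z) \<in> \<xi> ` U2"
   using ev unfolding ev_nh[OF xe] openin_eu by blast
  have pre: "h (1 / t) (?inv z) \<in> S \<and> \<xi> (h (1 / t) (?inv z)) = z" if z: "z \<in> V" for z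
  proof -
   have zE: "z \<in> E n" by (rule openE_sub[OF V(1) z])
   have i: "?inv z \<in> U2" "\<xi> (?inv z) = tup n (\<lambda>i. ?y i z)"
    using V(3) z by (auto intro: inv_into_into simp: f_inv_into_f)
   then have iS: "?inv z \<in> S" by (simp add: U2_def)
   have "\<xi> (h (1 / t) (?inv z)) = z"
    by (rule E_eqI[OF E[OF hS[OF iS]] zE]) (use hom[OF iS, of _ "1 / t"] i(2) t(1) in "simp add: power_divide")
   then show ?thesis using hS[OF iS] by blast
  qed
  have "smooth_on n V (lf S \<xi> f)" if f: "f \<in> Cinf D" for f
  proof (rule smooth_on_cong[OF V(1)])
   show "f (h (1 / t) (?inv z)) = lf S \<xi> f z" if "z \<in> V" for z
    using lf_apply[OF inj, of "h (1 / t) (?inv z)" f] pre[OF that] by simp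
   show "smooth_on n V (\<lambda>z. f (h (1 / t) (?inv z)))"
   proof (rule smooth_on_euI[OF V(1)])
    fix z assume z: "z \<in> V"
    have zE: "z \<in> pts (eu n)" using openE_sub[OF V(1) z] by simp
    have si: "smap_at (eu n) D z ?inv"
     by (rule chart_inv_smooth(1)[OF diffspace_eu c2 zE]) (use V(3) z sy zE in auto)
    have "smap_at (eu n) D z (\<lambda>z. h (1 / t) (?inv z))"
     by (rule smap_at_comp'[OF si smth])
    then show "smooth_at (eu n) z (\<lambda>z. f (h (1 / t) (?inv z)))"
     using f by (simp add: smap_at_def)
   qed
  qed
  moreover have "V \<subseteq> \<xi> ` S"
  proof
   fix z assume "z \<in> V"
   from pre[OF this] show "z \<in> \<xi> ` S"
    by (intro image_eqI[of _ _ "h (1 / t) (?inv z)"]) auto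
  qed
  ultimately show ?thesis using V(1,2) by (intro exI[of _ V]) simp
 qed
 have opim: "open_E n (\<xi> ` S)"
  by (subst openin_subopen) (use scale in blast)
 have "chart n D S \<xi>"
 proof (rule chartI[OF D op inj opim])
  fix e i assume e: "e \<in> S" and i: "i < n"
  obtain t where t: "t ~= 0" "h t e \<in> U2" using loc[OF e] by blast
  have "smooth_at D e (\<lambda>q. \<xi> (h t q) i)"
   by (rule sm_pull[OF smooth_mapD[OF smth Sp[OF e]] chart_coord[OF c2 t(2) i]])
  then have "smooth_at D e (\<lambda>q. (1 / t ^ w i) * \<xi> (h t q) i)"
   by (rule sm_cmult[OF D])
  moreover have "eventually (\<lambda>q. (1 / t ^ w i) * \<xi> (h t q) i = \<xi> q i) (nh D e)"
   by (rule ev_nhI[OF op e]) (use hom i t(1) in simp)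
  ultimately show "smooth_at D e (\<lambda>q. \<xi> q i)" by (rule sm_cong[rotated])
 next
  fix f assume f: "f \<in> Cinf D"
  show "smooth_on n (\<xi> ` S) (lf S \<xi> f)"
  proof (rule smooth_on_local[OF opim])
   fix y assume "y \<in> \<xi> ` S"
   then show "\<exists>V. open_E n V \<and> y \<in> V \<and> smooth_on n V (lf S \<xi> f)"
    using scale f by blast
  qed
 qed
 then show ?thesis
  unfolding homogeneous_chart_def using hS hom by auto
qed

section \<open>Lie groupoids and their Lie algebroids\<close>

lemma tangent_sum:
 "finite J ==> (!!j. j \<in> J ==> v j \<in> TS M p) ==> (\<lambda>f. \<Sum>j\<in>J. c j * v j f) \<in> TS M p"
proof (induction J rule: finite_induct)
 case empty
 then show ?case using tangent_zero by simp
next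
 case (insert a J)
 then show ?case
  using tangent_add[OF tangent_scale, of "v a" M p "\<lambda>f. \<Sum>j\<in>J. c j * v j f" "c a"] by simp
qed

lemma tv_scale: "tv M p (\<lambda>f. c * v f) g = c * tv M p v g"
 by (simp add: tv_def)

lemma tv_lincomb: "tv M p (\<lambda>f. \<Sum>j\<in>J. c j * v j f) g = (\<Sum>j\<in>J. c j * tv M p (v j) g)"
 by (simp add: tv_def)

locale lie_gpd =
 fixes G :: "('g, 'b) groupoid" and n m :: nat
 assumes LG: "lie_groupoid G" and mnA: "manifold n (arrows G)" and mnO: "manifold m (objects G)"
begin

abbreviation "Ar \<equiv> arrows G"
abbreviation "Ob \<equiv> objects G"
abbreviation "sr \<equiv> src G"
abbreviation "tg \<equiv> tgt G"
abbreviation "un \<equiv> ident G"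
abbreviation "mu \<equiv> groupoid.mult G"
abbreviation "A \<equiv> lie_alg G"
abbreviation "LP \<equiv> lie_pts G"

lemma dAr [simp]: "diffspace Ar" by (rule manifold_diffspace[OF mnA])
lemma dOb [simp]: "diffspace Ob" by (rule manifold_diffspace[OF mnO])
lemma dA [simp]: "diffspace A" by (simp add: lie_alg_def)

lemma subm: "submersion Ar Ob sr" "submersion Ar Ob tg"
 using LG by (simp_all add: lie_groupoid_def)

lemma smaps: "smooth_map Ar Ob sr" "smooth_map Ar Ob tg" "smooth_map Ob Ar un"
 "smooth_map (subspace_of (prod_space Ar Ar) (composable G)) Ar (\<lambda>(g, g'). mu g g')"
 using LG by (simp_all add: lie_groupoid_def submersion_def)

lemma sr_pts [simp]: "g \<in> pts Ar ==> sr g \<in> pts Ob"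
 and tg_pts [simp]: "g \<in> pts Ar ==> tg g \<in> pts Ob"
 and un_pts [simp]: "b \<in> pts Ob ==> un b \<in> pts Ar"
 using smaps by (auto simp: smooth_map_def)

lemma sr_un [simp]: "b \<in> pts Ob ==> sr (un b) = b"
 and tg_un [simp]: "b \<in> pts Ob ==> tg (un b) = b"
 using LG by (simp_all add: lie_groupoid_def)

lemma composable_iff: "(g, a) \<in> composable G \<longleftrightarrow> g \<in> pts Ar \<and> a \<in> pts Ar \<and> sr g = tg a"
 by (simp add: composable_def)

lemma mu_pts [simp]: "(g, a) \<in> composable G ==> mu g a \<in> pts Ar"
 using smaps(4) by (auto simp: smooth_map_def)

lemma sr_mu [simp]: "(g, a) \<in> composable G ==> sr (mu g a) = sr a"
 and tg_mu [simp]: "(g, a) \<in> composable G ==> tg (mu g a) = tg g"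
 using LG unfolding lie_groupoid_def by blast+

lemma mu_assoc: "(g, a) \<in> composable G ==> (a, b) \<in> composable G ==> mu (mu g a) b = mu g (mu a b)"
 using LG unfolding lie_groupoid_def by blast

lemma mu_un: "g \<in> pts Ar ==> mu g (un (sr g)) = g" "g \<in> pts Ar ==> mu (un (tg g)) g = g"
 using LG by (simp_all add: lie_groupoid_def)

lemma sr_at: "g \<in> pts Ar ==> smap_at Ar Ob g sr"
 and tg_at: "g \<in> pts Ar ==> smap_at Ar Ob g tg"
 and un_at: "b \<in> pts Ob ==> smap_at Ob Ar b un"
 by (rule smooth_mapD[OF smaps(1)] smooth_mapD[OF smaps(2)] smooth_mapD[OF smaps(3)], assumption)+

lemma mu_at:
 assumes N: "diffspace N" and "smap_at N Ar p \<phi>" "smap_at N Ar p \<psi>"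
  and ev: "eventually (\<lambda>q. sr (\<phi> q) = tg (\<psi> q)) (nh N p)"
 shows "smap_at N Ar p (\<lambda>q. mu (\<phi> q) (\<psi> q))"
proof -
 have "eventually (\<lambda>q. \<phi> q \<in> pts Ar) (nh N p)" "eventually (\<lambda>q. \<psi> q \<in> pts Ar) (nh N p)"
  using assms(2,3) by (auto simp: smap_at_def)
 then have "eventually (\<lambda>q. (\<phi> q, \<psi> q) \<in> composable G) (nh N p)"
  using ev by eventually_elim (simp add: composable_iff)
 from smap_at_subspace[OF N smap_at_prod[OF N assms(2,3)] this]
 have "smap_at N (subspace_of (prod_space Ar Ar) (composable G)) p (\<lambda>q. (\<phi> q, \<psi> q))" .
 from smap_at_comp'[OF this smaps(4)] show ?thesis by simp
qed

lemma pts_TB: "pts (tangent_bundle M) = {(p, v). p \<in> pts M \<and> v \<in> TS M p}"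
 by (simp add: tangent_bundle_def)

lemma lie_pts_iff: "(p, v) \<in> LP \<longleftrightarrow> p \<in> un ` pts Ob \<and> v \<in> TS Ar p \<and> (\<forall>f\<in>Cinf Ob. v (\<lambda>q. f (sr q)) = 0)"
 unfolding lie_pts_def pts_TB by (auto simp: tangent_map_def o_def fun_eq_iff)

lemma pts_A [simp]: "pts A = LP"
 by (simp add: lie_alg_def)

lemma lie_ptsD:
 assumes "e \<in> LP"
 shows "fst e \<in> pts Ar" "sr (fst e) \<in> pts Ob" "un (sr (fst e)) = fst e" "snd e \<in> TS Ar (fst e)"
  "f \<in> Cinf Ob ==> snd e (\<lambda>q. f (sr q)) = 0"
 using assms lie_pts_iff[of "fst e" "snd e"] by auto

lemma lie_pts_TB: "LP \<subseteq> pts (tangent_bundle Ar)"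
 by (auto simp: lie_pts_def)

lemma A_smoothI:
 assumes N: "diffspace N" and p: "p \<in> pts N" and ev: "eventually (\<lambda>q. \<phi> q \<in> LP) (nh N p)"
  and 1: "!!f. f \<in> Cinf Ar ==> smooth_at N p (\<lambda>q. f (fst (\<phi> q)))"
  and 2: "!!f. f \<in> Cinf Ar ==> smooth_at N p (\<lambda>q. snd (\<phi> q) f)"
 shows "smap_at N A p \<phi>"
 unfolding lie_alg_def
proof (rule smap_at_subspace[OF N _ ev])
 show "smap_at N (tangent_bundle Ar) p \<phi>"
  unfolding tangent_bundle_def
 proof (rule smap_at_gen[OF N p])
  show "eventually (\<lambda>q. \<phi> q \<in> {(p, v). p \<in> pts Ar \<and> v \<in> TS Ar p}) (nh N p)"
   using ev by (rule eventually_mono) (use lie_pts_TB in "auto simp: pts_TB")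
 qed (use 1 2 in "auto simp: case_prod_unfold")
qed

lemma Cinf_A_fst: "f \<in> Cinf Ar ==> (\<lambda>e. f (fst e)) \<in> Cinf A"
 unfolding lie_alg_def subspace_of_def tangent_bundle_def
 by (intro generators_Cinf) (auto simp: o_def)

lemma Cinf_A_snd: "f \<in> Cinf Ar ==> (\<lambda>e. snd e f) \<in> Cinf A"
 unfolding lie_alg_def subspace_of_def tangent_bundle_def
 by (intro generators_Cinf) (auto simp: case_prod_unfold)

lemma A_fst_at: "e \<in> LP ==> smap_at A Ar e fst"
 unfolding smap_at_def
 by (intro conjI ballI sm_Cinf Cinf_A_fst ev_ptsI) (auto dest: lie_ptsD)

lemma A_tv_at:
 assumes e: "e \<in> LP" and f: "smooth_at Ar (fst e) f"
 shows "smooth_at A e (\<lambda>e. tv Ar (fst e) (snd e) f)"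
proof -
 obtain g where g: "g \<in> Cinf Ar" "eventually (\<lambda>q. f q = g q) (nh Ar (fst e))"
  using f by (rule smooth_atE)
 have "eventually (\<lambda>q'. eventually (\<lambda>q. f q = g q) (nh Ar (fst q'))) (nh A e)"
  by (rule smap_at_ev[OF A_fst_at[OF e] ev_nh_ev[OF g(2)]])
 then have "eventually (\<lambda>q'. snd q' g = tv Ar (fst q') (snd q') f) (nh A e)"
  using ev_nh_pts[of A e]
 proof eventually_elim
  case (elim q')
  then have "q' \<in> LP" by simp
  from tv_eq[OF dAr lie_ptsD(1,4)[OF this] g(1) elim(1)] show ?case by simp
 qed
 then show ?thesis
  by (rule sm_cong) (use Cinf_A_snd[OF g(1)] e in "auto intro: sm_Cinf")
qed

lemma lie_kill:
 assumes e: "e \<in> LP" and f: "smooth_at Ob (sr (fst e)) f"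
 shows "tv Ar (fst e) (snd e) (\<lambda>q. f (sr q)) = 0"
proof -
 note d = lie_ptsD[OF e]
 obtain g where g: "g \<in> Cinf Ob" "eventually (\<lambda>q. f q = g q) (nh Ob (sr (fst e)))"
  using f by (rule smooth_atE)
 have "tv Ar (fst e) (snd e) (\<lambda>q. f (sr q)) = snd e (\<lambda>q. g (sr q))"
 proof (rule tv_eq[OF dAr d(1,4)])
  show "(\<lambda>q. g (sr q)) \<in> Cinf Ar"
   by (rule smooth_map_Cinf[OF smaps(1) g(1)])
  show "eventually (\<lambda>q. f (sr q) = g (sr q)) (nh Ar (fst e))"
   by (rule smap_at_ev[OF sr_at[OF d(1)] g(2)])
 qed
 then show ?thesis using d(5)[OF g(1)] by simp
qed

subsection \<open>Charts of the Lie algebroid\<close>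

text \<open>In adapted coordinates the positions \<open>pos\<close> carry the pullbacks of base coordinates by the source
 map. They remain base coordinates \<open>axi\<close> of the Lie algebroid, whose fibre coordinates are the
 components of a vector at the other positions \<open>fpos\<close>.\<close>

definition adapted :: "'g set => ('g => nat => real) => 'b set => ('b => nat => real) => (nat => nat) => bool" where
 "adapted U y N z pos \<longleftrightarrow> chart n Ar U y \<and> chart m Ob N z \<and> sr ` U \<subseteq> N \<and> inj_on pos {..<m} \<and>
  pos ` {..<m} \<subseteq> {..<n} \<and> (\<forall>q\<in>U. \<forall>j<m. y q (pos j) = z (sr q) j)"

definition axi :: "('g => nat => real) => (nat => nat) => 'g \<times> 'g tvec => nat => real" where
 "axi y pos e = tup n (\<lambda>i. if i \<in> pos ` {..<m} then y (fst e) i else tv Ar (fst e) (snd e) (\<lambda>q. y q i))"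

definition adom :: "'g set => ('g \<times> 'g tvec) set" where
 "adom U = {e \<in> LP. fst e \<in> U}"

definition fpos :: "(nat => nat) => nat set" where
 "fpos pos = {..<n} - pos ` {..<m}"

definition avec :: "'g set => ('g => nat => real) => (nat => nat) => (nat => real) => 'g => 'g tvec" where
 "avec U y pos c p = (\<lambda>f. \<Sum>i\<in>fpos pos. c i * cvec Ar U y i p f)"

lemma adD:
 assumes "adapted U y N z pos"
 shows "chart n Ar U y" "chart m Ob N z" "sr ` U \<subseteq> N" "inj_on pos {..<m}" "pos ` {..<m} \<subseteq> {..<n}"
 "q \<in> U ==> j < m ==> y q (pos j) = z (sr q) j"
 using assms by (auto simp: adapted_def)

context
 fixes U y N z pos
 assumes ad: "adapted U y N z pos"
begin

lemmas adD' = adD[OF ad]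

lemma avec_tangent: "p \<in> U ==> avec U y pos c p \<in> TS Ar p"
 unfolding avec_def by (rule tangent_sum) (auto simp: fpos_def intro!: cvec_tangent[OF dAr adD'(1)])

lemma tv_cvec_y: "p \<in> U ==> i < n ==> k < n ==> tv Ar p (cvec Ar U y i p) (\<lambda>q. y q k) = (if i = k then 1 else 0)"
 using tv_cvec[OF dAr adD'(1) _ _ chart_coord[OF adD'(1)]] pd_lf_coord[OF adD'(1)] by simp

lemma tv_avec_y:
 assumes "p \<in> U" "k < n"
 shows "tv Ar p (avec U y pos c p) (\<lambda>q. y q k) = (if k \<in> fpos pos then c k else 0)"
proof -
 have "tv Ar p (avec U y pos c p) (\<lambda>q. y q k) = (\<Sum>i\<in>fpos pos. if i = k then c i else 0)"
  unfolding avec_def tv_lincomb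
  by (rule sum.cong[OF refl]) (use assms in "auto simp: fpos_def tv_cvec_y")
 then show ?thesis by (simp add: fpos_def)
qed

text \<open>The coordinate line in a fibre position leaves all base coordinates fixed, so it runs
  inside the source fibre of p, where k vanishes.\<close>

lemma cvec_fibre:
 assumes p: "p \<in> U" and i: "i \<in> fpos pos" and k: "smooth_at Ar p k" 
  and eq: "eventually (\<lambda>q. sr q = sr p --> k q = 0) (nh Ar p)"
 shows "tv Ar p (cvec Ar U y i p) k = 0"
proof -
 have i': "i < n" using i by (simp add: fpos_def)
 obtain W0 where W0: "open_in Ar W0" "p \<in> W0" "\<forall>q\<in>W0. sr q = sr p --> k q = 0"
  using eq unfolding ev_nh[OF chart_sub[OF adD'(1) p]] by blast
 have W: "open_in Ar (W0 \<inter> U)" "W0 \<inter> U \<subseteq> U" using W0 chartD(1)[OF adD'(1)] by auto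
 have op: "open_E n (y ` (W0 \<inter> U))" by (rule chart_open_image[OF adD'(1) W])
 have yp: "y p \<in> y ` (W0 \<inter> U)" using W0 p by blast
 have "((\<lambda>t. lf U y k ((y p)(i := t))) has_real_derivative 0) (at (y p i))"
 proof (rule DERIV_cong_ev[THEN iffD2, OF refl _ refl DERIV_const])
  show "eventually (\<lambda>t. lf U y k ((y p)(i := t)) = 0) (nhds (y p i))"
   using eventually_upd[OF op yp i']
  proof eventually_elim
   case (elim t)
   then obtain q where q: "q \<in> W0" "q \<in> U" "(y p)(i := t) = y q" by auto
   have sN: "sr q \<in> N" "sr p \<in> N" using adD'(3) q(2) p by auto
   have "z (sr q) = z (sr p)"
   proof (rule E_eqI[OF chart_E[OF adD'(2) sN(1)] chart_E[OF adD'(2) sN(2)]])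
    fix j assume j: "j < m"
    have "pos j ~= i" using i j by (auto simp: fpos_def)
    then have "y q (pos j) = y p (pos j)" using q(3) by (metis fun_upd_other)
    then show "z (sr q) j = z (sr p) j" using adD'(6)[OF q(2) j] adD'(6)[OF p j] by simp
   qed
   then have "sr q = sr p" using chartD(3)[OF adD'(2)] sN by (simp add: inj_on_def)
   then have "k q = 0" using W0(3) q(1) by simp
   then show ?case using q(3) lf_apply[OF chartD(3)[OF adD'(1)] q(2), of k] by simp
  qed
 qed
 then have "pd i (lf U y k) (y p) = 0" by (rule pdI)
 then show ?thesis using tv_cvec[OF dAr adD'(1) p i' k] by simp
qed

lemma cvec_kill:
 assumes p: "p \<in> U" and i: "i \<in> fpos pos" and f: "f \<in> Cinf Ob"
 shows "cvec Ar U y i p (\<lambda>q. f (sr q)) = 0"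
proof -
 have i': "i < n" using i by (simp add: fpos_def)
 have pA: "p \<in> pts Ar" by (rule chart_sub[OF adD'(1) p])
 have v: "cvec Ar U y i p \<in> TS Ar p" by (rule cvec_tangent[OF dAr adD'(1) p i'])
 have fs: "(\<lambda>q. f (sr q)) \<in> Cinf Ar"
  by (rule smooth_map_Cinf[OF smaps(1) f])
 note s = sm_Cinf[OF fs pA] sm_const[OF dAr pA, of "f (sr p)"]
 have "tv Ar p (cvec Ar U y i p) (\<lambda>q. f (sr q) - f (sr p)) = 0"
  by (rule cvec_fibre[OF p i sm_diff[OF dAr s]]) simp
 then show ?thesis
  using tv_diff[OF dAr pA v s] tv_const[OF dAr pA v, of "f (sr p)"] tv_Cinf[OF dAr pA v fs] by simp
qed

lemma avec_lie: "b \<in> pts Ob ==> un b \<in> U ==> (un b, avec U y pos c (un b)) \<in> LP"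
 unfolding lie_pts_iff using avec_tangent cvec_kill by (auto simp: avec_def)

lemma axi_E: "axi y pos e \<in> E n"
 by (simp add: axi_def)

lemma axi_nth: "i < n ==> axi y pos e i = (if i \<in> pos ` {..<m} then y (fst e) i else tv Ar (fst e) (snd e) (\<lambda>q. y q i))"
 by (simp add: axi_def)

text \<open>The coordinates at the positions \<open>pos\<close> are pullbacks by the source map,
  which a vector of the Lie algebroid kills; only the fibre components remain.\<close>

lemma lie_recon:
 assumes "e \<in> adom U"
 shows "snd e = avec U y pos (axi y pos e) (fst e)"
proof (rule tangent_chart_eqI[OF dAr adD'(1)])
 have e: "e \<in> LP" "fst e \<in> U" using assms by (auto simp: adom_def)
 show "fst e \<in> U" by (rule e)
 show "snd e \<in> TS Ar (fst e)" by (rule lie_ptsD[OF e(1)])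
 show "avec U y pos (axi y pos e) (fst e) \<in> TS Ar (fst e)" by (rule avec_tangent[OF e(2)])
 fix i assume i: "i < n"
 show "tv Ar (fst e) (snd e) (\<lambda>q. y q i) = tv Ar (fst e) (avec U y pos (axi y pos e) (fst e)) (\<lambda>q. y q i)"
 proof (cases "i \<in> fpos pos")
  case True
  then show ?thesis using tv_avec_y[OF e(2) i] axi_nth[OF i] by (auto simp: fpos_def)
 next
  case False
  then obtain j where j: "j < m" "i = pos j" using i by (auto simp: fpos_def)
  have sN: "sr (fst e) \<in> N" using adD'(3) e(2) by blast
  have "tv Ar (fst e) (snd e) (\<lambda>q. y q i) = tv Ar (fst e) (snd e) (\<lambda>q. z (sr q) j)"
   by (rule tv_cong[OF dAr lie_ptsD(1,4)[OF e(1)] _ chart_coord[OF adD'(1) e(2) i]])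
    (rule ev_chart[OF adD'(1) e(2)], use adD'(6) j in simp)
  also have "\<dots> = 0" by (rule lie_kill[OF e(1) chart_coord[OF adD'(2) sN j(1)]])
  finally show ?thesis using tv_avec_y[OF e(2) i] False by simp
 qed
qed

text \<open>The inverse of \<open>axi\<close>. The entries at \<open>pos\<close> give the base
  point; the whole of c serves as tuple of coefficients, since \<open>avec\<close> reads the fibre
  positions only.\<close>

definition ainv :: "(nat => real) => 'g \<times> 'g tvec" where
 "ainv c = (let p = un (inv_into N z (tup m (\<lambda>j. c (pos j)))) in (p, avec U y pos c p))"

lemma A_chart: "chart n A (adom U) (axi y pos)"
proof -
 \<comment> \<open>The base points whose unit lies in U; a point of N may fail to have this
   property.\<close>
 define N' where "N' = {b \<in> N. un b \<in> U}"
 have opN': "open_in Ob N'"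
 proof (rule openin_ev)
  fix b assume b: "b \<in> N'"
  have bO: "b \<in> pts Ob" using b chart_sub[OF adD'(2)] by (auto simp: N'_def)
  have "eventually (\<lambda>b. un b \<in> U) (nh Ob b)"
   by (rule smap_at_cont[OF un_at[OF bO] chartD(1)[OF adD'(1)]]) (use b in "simp add: N'_def")
  moreover have "eventually (\<lambda>b. b \<in> N) (nh Ob b)"
   by (rule ev_chart[OF adD'(2)]) (use b in "auto simp: N'_def")
  ultimately have "eventually (\<lambda>b. b \<in> N') (nh Ob b)"
   by eventually_elim (simp add: N'_def)
  then show "b \<in> pts Ob \<and> eventually (\<lambda>b. b \<in> N') (nh Ob b)" using bO by blast
 qed
 have opA: "open_in A (adom U)"
 proof (rule openin_ev)
  fix e assume e: "e \<in> adom U"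
  have "eventually (\<lambda>e. fst e \<in> U) (nh A e)"
   by (rule smap_at_cont[OF A_fst_at chartD(1)[OF adD'(1)]]) (use e in "auto simp: adom_def")
  then have "eventually (\<lambda>e. e \<in> adom U) (nh A e)"
   using ev_nh_pts[of A e] by eventually_elim (simp add: adom_def)
  then show "e \<in> pts A \<and> eventually (\<lambda>e. e \<in> adom U) (nh A e)" using e by (simp add: adom_def)
 qed
 \<comment> \<open>The image of the chart: base coordinates in an open set, fibre coordinates
   arbitrary.\<close>
 let ?V = "{c \<in> E n. tup m (\<lambda>j. c (pos j)) \<in> z ` N'}"
 have opzN: "open_E m (z ` N')"
  by (rule chart_open_image[OF adD'(2) opN']) (auto simp: N'_def)
 have opV: "open_E n ?V"
  unfolding openE_iff
 proof (intro conjI ballI)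
  fix c assume c: "c \<in> ?V"
  obtain r where r: "r > 0" "box_at m (tup m (\<lambda>j. c (pos j))) r \<subseteq> z ` N'"
   using openE_box[OF opzN] c by blast
  have "box_at n c r \<subseteq> ?V"
  proof
   fix d assume d: "d \<in> box_at n c r"
   have "tup m (\<lambda>j. d (pos j)) \<in> box_at m (tup m (\<lambda>j. c (pos j))) r"
    by (rule tup_box) (use d adD'(5) in "auto simp: box_at_def")
   then show "d \<in> ?V" using r(2) d by (auto simp: box_at_def)
  qed
  then show "\<exists>e>0. box_at n c e \<subseteq> ?V" using r(1) by blast
 qed blast
 have tupy: "tup m (\<lambda>j. axi y pos e (pos j)) = z (sr (fst e))" if "e \<in> adom U" for e
 proof -
  have eU: "fst e \<in> U" using that by (simp add: adom_def)
  have "tup m (\<lambda>j. axi y pos e (pos j)) = tup m (z (sr (fst e)))"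
  proof (rule tup_cong)
   fix j assume j: "j < m"
   then have "pos j < n" using adD'(5) by auto
   then show "axi y pos e (pos j) = z (sr (fst e)) j"
    using axi_nth[of "pos j" e] adD'(6)[OF eU j] j by simp
  qed
  moreover have "sr (fst e) \<in> N" using adD'(3) eU by blast
  ultimately show ?thesis using chart_tup[OF adD'(2)] by simp
 qed
 have sN: "sr (fst e) \<in> N'" if "e \<in> adom U" for e
  using that adD'(3) lie_ptsD(3)[of e] by (auto simp: adom_def N'_def)
 have inv1: "ainv (axi y pos e) = e" if e: "e \<in> adom U" for e
 proof -
  have "inv_into N z (tup m (\<lambda>j. axi y pos e (pos j))) = sr (fst e)"
   unfolding tupy[OF e] by (rule inv_into_f_f[OF chartD(3)[OF adD'(2)]]) (use sN[OF e] in "simp add: N'_def")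
  then have "un (inv_into N z (tup m (\<lambda>j. axi y pos e (pos j)))) = fst e"
   using lie_ptsD(3)[of e] e by (simp add: adom_def)
  then show ?thesis
   using lie_recon[OF e] by (simp add: ainv_def Let_def prod_eq_iff)
 qed
 have inv2: "ainv c \<in> adom U \<and> axi y pos (ainv c) = c" if c: "c \<in> ?V" for c
 proof -
  obtain b where b: "b \<in> N'" "tup m (\<lambda>j. c (pos j)) = z b" using c by blast
  have bN: "b \<in> N" "un b \<in> U" using b by (auto simp: N'_def)
  have bO: "b \<in> pts Ob" by (rule chart_sub[OF adD'(2) bN(1)])
  have a: "ainv c = (un b, avec U y pos c (un b))"
   using b bN chartD(3)[OF adD'(2)] by (simp add: ainv_def Let_def)
  have "axi y pos (ainv c) = c"
  proof (rule E_eqI[OF axi_E])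
   show "c \<in> E n" using c by simp
   fix i assume i: "i < n"
   show "axi y pos (ainv c) i = c i"
   proof (cases "i \<in> fpos pos")
    case True
    then show ?thesis using axi_nth[OF i] tv_avec_y[OF bN(2) i] a by (auto simp: fpos_def)
   next
    case False
    then obtain j where j: "j < m" "i = pos j" using i by (auto simp: fpos_def)
    have "axi y pos (ainv c) i = z b j"
     using axi_nth[OF i] adD'(6)[OF bN(2) j(1)] a j bO by simp
    also have "\<dots> = c (pos j)" using b(2)[symmetric] j(1) by simp
    finally show ?thesis using j by simp
   qed
  qed
  moreover have "ainv c \<in> adom U"
   using avec_lie[OF bO bN(2)] bN a by (simp add: adom_def)
  ultimately show ?thesis by blast
 qed
 have img: "axi y pos ` adom U = ?V"
 proof
  show "axi y pos ` adom U \<subseteq> ?V" using axi_E tupy sN by auto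
  show "?V \<subseteq> axi y pos ` adom U"
  proof
   fix c assume "c \<in> ?V"
   from inv2[OF this] show "c \<in> axi y pos ` adom U"
    by (intro image_eqI[of _ _ "ainv c"]) auto
  qed
 qed
 have inj: "inj_on (axi y pos) (adom U)"
  by (rule inj_on_inverseI[where f = "axi y pos" and g = ainv]) (rule inv1)
 have sm_inv: "smap_at (eu n) A c ainv" if c: "c \<in> ?V" for c
 proof (rule A_smoothI)
  show cE: "c \<in> pts (eu n)" using c by simp
  have evV: "eventually (\<lambda>c. c \<in> ?V) (nh (eu n) c)"
   by (rule ev_nhI[of _ ?V]) (use opV c openin_eu in auto)
  then show "eventually (\<lambda>c. ainv c \<in> LP) (nh (eu n) c)"
   by eventually_elim (use inv2 in "auto simp: adom_def")
  have sc: "smooth_at (eu n) c (\<lambda>c. c i)" if "i < n" for i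
   by (rule sm_Cinf[OF coord_eu[OF that] cE])
  have "smap_at (eu n) Ob c (\<lambda>c. inv_into N z (tup m (\<lambda>j. c (pos j))))"
  proof (rule chart_inv_smooth(1)[OF diffspace_eu adD'(2) cE])
   show "tup m (\<lambda>j. c (pos j)) \<in> z ` N" using c by (auto simp: N'_def)
   show "smooth_at (eu n) c (\<lambda>c. c (pos i))" if "i < m" for i
    by (rule sc) (use adD'(5) that in auto)
  qed
  from smap_at_comp'[OF this smaps(3)]
  have fst: "smap_at (eu n) Ar c (\<lambda>c. fst (ainv c))"
   by (simp add: ainv_def Let_def)
  show "smooth_at (eu n) c (\<lambda>c. f (fst (ainv c)))" if "f \<in> Cinf Ar" for f
   using fst that by (simp add: smap_at_def)
  fix f assume f: "f \<in> Cinf Ar"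
  have cU: "fst (ainv c) \<in> U" using inv2[OF c] by (simp add: adom_def)
  have "smooth_at (eu n) c (\<lambda>c. \<Sum>i\<in>fpos pos. c i * cvec Ar U y i (fst (ainv c)) f)"
  proof (rule sm_sum[OF diffspace_eu cE], rule sm_mult[OF diffspace_eu])
   fix i assume "i \<in> fpos pos"
   then have i: "i < n" by (simp add: fpos_def)
   show "smooth_at (eu n) c (\<lambda>c. c i)" by (rule sc[OF i])
   show "smooth_at (eu n) c (\<lambda>c. cvec Ar U y i (fst (ainv c)) f)"
    by (rule sm_pull[where \<phi> = "\<lambda>c. fst (ainv c)" and p = c, OF fst cvec_smooth[OF dAr adD'(1) cU i f]])
  qed
  then show "smooth_at (eu n) c (\<lambda>c. snd (ainv c) f)"
   by (simp add: ainv_def Let_def avec_def)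
 qed simp
 show ?thesis
 proof (rule chartI[OF dA opA inj])
  show "open_E n (axi y pos ` adom U)" using opV img by simp
  show "smooth_at A e (\<lambda>e. axi y pos e i)" if e: "e \<in> adom U" and i: "i < n" for e i
  proof (cases "i \<in> pos ` {..<m}")
   case True
   have "smooth_at A e (\<lambda>e. y (fst e) i)"
    by (rule sm_pull[OF A_fst_at chart_coord[OF adD'(1) _ i]]) (use e in "auto simp: adom_def")
   then show ?thesis using True by (simp add: axi_nth[OF i])
  next
   case False
   have "smooth_at A e (\<lambda>e. tv Ar (fst e) (snd e) (\<lambda>q. y q i))"
    by (rule A_tv_at[OF _ chart_coord[OF adD'(1) _ i]]) (use e in "auto simp: adom_def")
   then show ?thesis using False by (simp add: axi_nth[OF i])
  qed
  fix f assume f: "f \<in> Cinf A"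
  show "smooth_on n (axi y pos ` adom U) (lf (adom U) (axi y pos) f)"
   unfolding img
  proof (rule smooth_on_cong[OF opV])
   show "f (ainv c) = lf (adom U) (axi y pos) f c" if "c \<in> ?V" for c
    using lf_apply[OF inj, of "ainv c" f] inv2[OF that] by simp
   show "smooth_on n ?V (\<lambda>c. f (ainv c))"
    by (rule smooth_on_euI[OF opV]) (use sm_inv f in "auto simp: smap_at_def")
  qed
 qed
qed

end

end

section \<open>Second countability and the Hausdorff property\<close>

lemma second_countable_countable_cover:
 assumes "countable \<U>" "!!U. U \<in> \<U> ==> openin X U \<and> second_countable (subtopology X U)" "topspace X \<subseteq> \<Union>\<U>"
 shows "second_countable X"
proof -
 have "\<forall>U\<in>\<U>. \<exists>\<B>. countable \<B> \<and> (\<forall>V\<in>\<B>. openin (subtopology X U) V) \<and>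
   (\<forall>W x. openin (subtopology X U) W \<and> x \<in> W --> (\<exists>V\<in>\<B>. x \<in> V \<and> V \<subseteq> W))"
  using assms(2) unfolding second_countable_def by blast
 then obtain \<B> where \<B>: "!!U. U \<in> \<U> ==> countable (\<B> U)" "!!U V. U \<in> \<U> ==> V \<in> \<B> U ==> openin (subtopology X U) V"
  "!!U W x. U \<in> \<U> ==> openin (subtopology X U) W ==> x \<in> W ==> \<exists>V\<in>\<B> U. x \<in> V \<and> V \<subseteq> W"
  by metis
 show ?thesis
  unfolding second_countable_def
 proof (intro exI[of _ "\<Union>(\<B> ` \<U>)"] conjI ballI allI impI)
  show "countable (\<Union>(\<B> ` \<U>))" using assms(1) \<B>(1) by blast
  show "openin X V" if V: "V \<in> \<Union>(\<B> ` \<U>)" for V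
  proof -
   obtain U where U: "U \<in> \<U>" "V \<in> \<B> U" using V by blast
   then have "openin (subtopology X U) V" by (rule \<B>(2))
   then show ?thesis using assms(2)[OF U(1)] by (simp add: openin_open_subtopology)
  qed
  fix W x assume W: "openin X W \<and> x \<in> W"
  then obtain U where U: "U \<in> \<U>" "x \<in> U" using assms(3) openin_subset by blast
  have "openin (subtopology X U) (U \<inter> W)" using W by (simp add: openin_subtopology_Int2)
  then obtain V where "V \<in> \<B> U" "x \<in> V" "V \<subseteq> U \<inter> W"
   using \<B>(3)[OF U(1), of "U \<inter> W" x] U W by blast
  then show "\<exists>V\<in>\<Union>(\<B> ` \<U>). x \<in> V \<and> V \<subseteq> W" using U by blast
 qed
qed

lemma second_countable_Euclidean_space: "second_countable (ES n)"
proof -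
 have "second_countable (euclidean :: (nat => real) topology)"
 proof -
  obtain B :: "(nat => real) set set" where B: "countable B" "topological_basis B"
   using ex_countable_basis by blast
  show ?thesis
   unfolding second_countable_def
  proof (intro exI[of _ B] conjI ballI allI impI)
   show "openin euclidean V" if "V \<in> B" for V
    using topological_basis_open[OF B(2) that] by simp
   fix U :: "(nat => real) set" and x assume "openin euclidean U \<and> x \<in> U"
   then show "\<exists>V\<in>B. x \<in> V \<and> V \<subseteq> U"
    using topological_basisE[OF B(2), of U x] by (metis open_openin)
  qed (rule B)
 qed
 then show ?thesis
  by (subst Euclidean_space_eq) (rule second_countable_subtopology)
qed

lemma chart_second_countable:
 assumes "chart n M U x"
 shows "second_countable (subtopology (top_of M) U)"
proof -
 have "homeomorphic_map (subtopology (top_of M) U) (subtopology (ES n) (x ` U)) x"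
  using assms by (simp add: chart_def)
 then have "subtopology (ES n) (x ` U) homeomorphic_space subtopology (top_of M) U"
  using homeomorphic_map_imp_homeomorphic_space homeomorphic_space_sym by blast
 then obtain f where "homeomorphic_map (subtopology (ES n) (x ` U)) (subtopology (top_of M) U) f"
  using homeomorphic_space by blast
 then have f: "continuous_map (subtopology (ES n) (x ` U)) (subtopology (top_of M) U) f"
  "open_map (subtopology (ES n) (x ` U)) (subtopology (top_of M) U) f"
  "f ` topspace (subtopology (ES n) (x ` U)) = topspace (subtopology (top_of M) U)"
  by (auto simp: homeomorphic_eq_everything_map)
 show ?thesis
  by (rule second_countable_open_map_image[OF f second_countable_subtopology[OF second_countable_Euclidean_space]])
qed

lemma Hausdorff_initial:
 assumes "!!p q. p \<in> S ==> q \<in> S ==> p ~= q ==> \<exists>f\<in>C. f p ~= f q"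
 shows "Hausdorff_space (initial_topology S C)"
 unfolding Hausdorff_space_def topspace_initial
proof (intro allI impI)
 fix p q assume pq: "p \<in> S \<and> q \<in> S \<and> p ~= q"
 then obtain f where f: "f \<in> C" "f p ~= f q" using assms by blast
 obtain V W where VW: "open V" "open W" "f p \<in> V" "f q \<in> W" "V \<inter> W = {}"
  using hausdorff[OF f(2)] by blast
 have "openin (initial_topology S C) {a \<in> topspace (initial_topology S C). f a \<in> V}" if "open V" for V
  by (rule openin_continuous_map_preimage[OF continuous_map_initial[OF f(1)]]) (use that in simp)
 from this[OF VW(1)] this[OF VW(2)]
 show "\<exists>U V. openin (initial_topology S C) U \<and> openin (initial_topology S C) V \<and> p \<in> U \<and> q \<in> V \<and> disjnt U V"
  using VW(3-5) pq
  by (intro exI[of _ "{a \<in> topspace (initial_topology S C). f a \<in> V}"] exI[of _ "{a \<in> topspace (initial_topology S C). f a \<in> W}"])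
   (auto simp: disjnt_def)
qed

text \<open>The topology is initial for \<open>Cinf M\<close>: if no smooth function told p and q
  apart, every neighbourhood of p would contain q.\<close>

lemma manifold_separates:
 assumes M: "manifold n M" and pq: "p \<in> pts M" "q \<in> pts M" "p ~= q"
 shows "\<exists>f\<in>Cinf M. f p ~= f q"
proof (rule ccontr)
 assume *: "\<not> ?thesis"
 have "Hausdorff_space (top_of M)" using M by (simp add: manifold_def)
 then obtain U V where UV: "open_in M U" "open_in M V" "p \<in> U" "q \<in> V" "disjnt U V"
  unfolding Hausdorff_space_def topspace_initial using pq by blast
 obtain I e where I: "finite I" "I \<subseteq> Cinf M" "e > 0" "{z \<in> pts M. \<forall>f\<in>I. \<bar>f z - f p\<bar> < e} \<subseteq> U"
  using initial_basis[OF UV(1,3)] by (elim exE conjE)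
 have "q \<in> {z \<in> pts M. \<forall>f\<in>I. \<bar>f z - f p\<bar> < e}"
  using * I pq by fastforce
 then show False using I(4) UV(4,5) by (auto simp: disjnt_def)
qed

context lie_gpd
begin

lemma adapted_exists:
 assumes "chart n Ar U0 x" "p \<in> U0" "chart m Ob N z" "sr p \<in> N"
 shows "\<exists>pos U y. adapted U y N z pos \<and> p \<in> U \<and> U \<subseteq> U0 \<and> (\<forall>q\<in>U. \<forall>i<n. i \<notin> pos ` {..<m} --> y q i = x q i)"
proof -
 obtain pos W y where *: "inj_on pos {..<m}" "pos ` {..<m} \<subseteq> {..<n}" "p \<in> W" "W \<subseteq> U0" "sr ` W \<subseteq> N" "chart n Ar W y"
  "\<forall>q\<in>W. \<forall>j<m. y q (pos j) = z (sr q) j" "\<forall>q\<in>W. \<forall>i<n. i \<notin> pos ` {..<m} --> y q i = x q i"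
  using submersion_chart[OF dAr dOb subm(1) assms] by (elim exE conjE)
 then have "adapted W y N z pos" using assms(3) by (simp add: adapted_def)
 then show ?thesis using * by (intro exI[of _ pos] exI[of _ W] exI[of _ y]) simp
qed

lemma charts_at:
 "p \<in> pts Ar ==> \<exists>U x. p \<in> U \<and> chart n Ar U x"
 "b \<in> pts Ob ==> \<exists>U x. b \<in> U \<and> chart m Ob U x"
 using mnA mnO unfolding manifold_def by blast+

lemma adapted_at:
 assumes "p \<in> pts Ar"
 shows "\<exists>U y N z pos. adapted U y N z pos \<and> p \<in> U"
proof -
 obtain U0 x where 1: "p \<in> U0" "chart n Ar U0 x" using charts_at(1)[OF assms] by blast
 obtain N z where 2: "sr p \<in> N" "chart m Ob N z" using charts_at(2)[OF sr_pts[OF assms]] by blast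
 obtain pos U y where "adapted U y N z pos" "p \<in> U"
  using adapted_exists[OF 1(2,1) 2(2,1)] by (elim exE conjE)
 then show ?thesis by blast
qed

lemma A_chart_at:
 assumes "e \<in> LP"
 shows "\<exists>U y N z pos. adapted U y N z pos \<and> e \<in> adom U"
proof -
 obtain U y N z pos where "adapted U y N z pos" "fst e \<in> U"
  using adapted_at[OF lie_ptsD(1)[OF assms]] by (elim exE conjE)
 then show ?thesis using assms unfolding adom_def by blast
qed

text \<open>Points are separated by functions of the base arrow and by values of vectors on
  functions. For second countability, the arrows form a Lindelof space, so countably many adapted
  domains cover them, and the charts of the Lie algebroid over these domains suffice.\<close>

lemma manifold_A: "manifold n A"
 unfolding manifold_def
proof (intro conjI allI ballI)
 have op: "open_in A (pts A)" by (rule openin_initial_self)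
 show "f \<in> Cinf A \<longleftrightarrow> locally_smooth A (pts A) f" for f
  unfolding locally_smooth_iff[OF op] by (rule diffspace_Cinf_iff[OF dA])
 show "Hausdorff_space (top_of A)"
 proof (rule Hausdorff_initial)
  fix e e' assume e: "e \<in> pts A" "e' \<in> pts A" "e ~= e'"
  then have ee: "e \<in> LP" "e' \<in> LP" by simp_all
  show "\<exists>f\<in>Cinf A. f e ~= f e'"
  proof (cases "fst e = fst e'")
   case False
   then obtain f where "f \<in> Cinf Ar" "f (fst e) ~= f (fst e')"
    using manifold_separates[OF mnA lie_ptsD(1)[OF ee(1)] lie_ptsD(1)[OF ee(2)]] by blast
   then show ?thesis using Cinf_A_fst by (intro bexI[of _ "\<lambda>e. f (fst e)"])
  next
   case True
   then have "snd e ~= snd e'" using e(3) by (simp add: prod_eq_iff)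
   then obtain f where f: "f \<in> Cinf Ar" "snd e f ~= snd e' f"
    using tangent_eqI[OF lie_ptsD(4)[OF ee(1)], of "snd e'"] lie_ptsD(4)[OF ee(2)] True by auto
   then show ?thesis using Cinf_A_snd by (intro bexI[of _ "\<lambda>e. snd e f"])
  qed
 qed
 show "\<exists>U x. e \<in> U \<and> chart n A U x" if "e \<in> pts A" for e
 proof -
  obtain U y N z pos where "adapted U y N z pos" "e \<in> adom U"
   using A_chart_at[of e] \<open>e \<in> pts A\<close> by auto
  then show ?thesis using A_chart by blast
 qed
 show "second_countable (top_of A)"
 proof -
  define \<V> where "\<V> = {U. \<exists>y N z pos. adapted U y N z pos}"
  have "second_countable (top_of Ar)" using mnA by (simp add: manifold_def)
  then have "Lindelof_space (top_of Ar)" by (rule second_countable_imp_Lindelof_space)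
  moreover have "open_in Ar U" if "U \<in> \<V>" for U
   using that chartD(1)[OF adD(1)] unfolding \<V>_def by blast
  moreover have "\<Union>\<V> = topspace (top_of Ar)"
  proof
   show "\<Union>\<V> \<subseteq> topspace (top_of Ar)"
    using calculation(2) openin_subset by blast
   show "topspace (top_of Ar) \<subseteq> \<Union>\<V>"
    using adapted_at unfolding \<V>_def by auto
  qed
  ultimately obtain \<W> where \<W>: "countable \<W>" "\<W> \<subseteq> \<V>" "\<Union>\<W> = topspace (top_of Ar)"
   unfolding Lindelof_space_def by metis
  show ?thesis
  proof (rule second_countable_countable_cover[of "adom ` \<W>"])
   show "countable (adom ` \<W>)" using \<W>(1) by blast
   show "open_in A V \<and> second_countable (subtopology (top_of A) V)" if V: "V \<in> adom ` \<W>" for V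
   proof -
    obtain U y N z pos where "V = adom U" "adapted U y N z pos"
     using V \<W>(2) unfolding \<V>_def by blast
    then have "chart n A V (axi y pos)" using A_chart by blast
    then show ?thesis using chartD(1) chart_second_countable by blast
   qed
   show "topspace (top_of A) \<subseteq> \<Union> (adom ` \<W>)"
   proof
    fix e assume "e \<in> topspace (top_of A)"
    then have e: "e \<in> LP" by simp
    then have "fst e \<in> topspace (top_of Ar)" using lie_ptsD(1) by simp
    then obtain U where "U \<in> \<W>" "fst e \<in> U" using \<W>(3) by blast
    then show "e \<in> \<Union> (adom ` \<W>)" using e by (auto simp: adom_def)
   qed
  qed
 qed
qed

lemma lie_scale_simps [simp]: "fst (lie_scale s e) = fst e" "snd (lie_scale s e) f = s * snd e f"
 by (simp_all add: lie_scale_def case_prod_unfold)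

lemma lie_scale_pts: "e \<in> LP ==> lie_scale s e \<in> LP"
 using lie_pts_iff[of "fst e" "snd e"] tangent_scale[of "snd e" Ar "fst e" s]
 by (simp add: lie_scale_def case_prod_unfold lie_pts_iff)

lemma homogeneity_scale: "homogeneity_structure A lie_scale"
 unfolding homogeneity_structure_def
proof (intro conjI ballI allI)
 show "smooth_map (RL A) A (\<lambda>(t, e). lie_scale t e)"
 proof (rule smooth_mapI[OF diffspace_prod])
  fix te assume te: "te \<in> pts (RL A)"
  then have te': "te \<in> pts real_line \<times> pts A" by simp
  show "smap_at (RL A) A te (\<lambda>(t, e). lie_scale t e)"
  proof (rule A_smoothI[OF diffspace_prod te])
   show "eventually (\<lambda>te. (case te of (t, e) => lie_scale t e) \<in> LP) (nh (RL A) te)"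
    by (rule ev_ptsI) (auto intro: lie_scale_pts)
   show "smooth_at (RL A) te (\<lambda>te. f (fst (case te of (t, e) => lie_scale t e)))" if "f \<in> Cinf Ar" for f
    using sm_Cinf[OF snd_Cinf[OF Cinf_A_fst[OF that]] te] by (simp add: case_prod_unfold)
   show "smooth_at (RL A) te (\<lambda>te. snd (case te of (t, e) => lie_scale t e) f)" if "f \<in> Cinf Ar" for f
    using sm_mult[OF diffspace_prod sm_Cinf[OF fst_Cinf[OF real_Cinf] te] sm_Cinf[OF snd_Cinf[OF Cinf_A_snd[OF that]] te]]
    by (simp add: case_prod_unfold)
  qed
 qed
qed (auto simp: lie_scale_def mult.assoc)

lemma lie_scale_chart:
 assumes ad: "adapted U y N z pos"
 shows "homogeneous_chart n A lie_scale (adom U) (axi y pos) (\<lambda>i. if i \<in> pos ` {..<m} then 0 else 1)"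
 unfolding homogeneous_chart_def
proof (intro conjI allI impI ballI)
 show "chart n A (adom U) (axi y pos)" by (rule A_chart[OF ad])
 show "lie_scale t ` adom U \<subseteq> adom U" for t
  using lie_scale_pts by (auto simp: adom_def)
 fix i t e assume "i < n" "e \<in> adom U"
 then show "axi y pos (lie_scale t e) i = t ^ (if i \<in> pos ` {..<m} then 0 else 1) * axi y pos e i"
  by (simp add: axi_def) (simp add: lie_scale_def tv_scale case_prod_unfold)
qed

lemma graded_bundle_scale: "graded_bundle 1 A lie_scale"
 unfolding graded_bundle_def
proof (intro conjI homogeneity_scale exI[of _ n] manifold_A ballI)
 fix e assume "e \<in> pts A"
 then obtain U y N z pos where "adapted U y N z pos" "e \<in> adom U"
  using A_chart_at[of e] by auto
 then show "\<exists>U x w. e \<in> U \<and> homogeneous_chart n A lie_scale U x w \<and> (\<forall>i<n. w i \<le> 1)"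
  using lie_scale_chart by (intro exI[of _ "adom U"] exI[of _ "axi y pos"] exI[of _ "\<lambda>i. if i \<in> pos ` {..<m} then 0 else 1"]) auto
qed

end

subsection \<open>The lifted homogeneity structure\<close>

text \<open>Parameter version of differentiation, with function, base point and vector all varying
  smoothly. It yields the smoothness of the lifted action, of right-invariant extensions and of
  families of forms.\<close>

lemma sm_tv:
 assumes M: "diffspace M" and N: "diffspace N" and P: "diffspace P"
  and a: "smap_at P M p a" and \<phi>: "smap_at P N p \<phi>" and K: "smooth_at (prod_space M N) (a p, \<phi> p) K"
  and v: "eventually (\<lambda>q. v q \<in> TS N (\<phi> q)) (nh P p)" "!!f. f \<in> Cinf N ==> smooth_at P p (\<lambda>q. v q f)"
 shows "smooth_at P p (\<lambda>q. tv N (\<phi> q) (v q) (\<lambda>z. K (a q, z)))"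
  and "eventually (\<lambda>q. smooth_at N (\<phi> q) (\<lambda>z. K (a q, z))) (nh P p)"
proof -
 obtain r d k U V where PD: "open_in M U" "a p \<in> U" "open_in N V" "\<phi> p \<in> V"
   "\<forall>j<(r::nat). d j \<in> Cinf N \<and> k j \<in> Cinf (prod_space M N)"
   "\<forall>a\<in>U. \<forall>b\<in>V. smooth_at N b (\<lambda>z. K (a, z)) \<and>
    (\<forall>v\<in>TS N b. tv N b v (\<lambda>z. K (a, z)) = (\<Sum>j<r. k j (a, b) * v (d j)))"
  using partial_deriv[OF M N K] by (elim exE conjE)
 note ev = smap_at_cont[OF a PD(1,2)] smap_at_cont[OF \<phi> PD(3,4)]
 show "eventually (\<lambda>q. smooth_at N (\<phi> q) (\<lambda>z. K (a q, z))) (nh P p)"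
  using ev by eventually_elim (use PD(6) in blast)
 have "smooth_at P p (\<lambda>q. \<Sum>j<r. k j (a q, \<phi> q) * v q (d j))"
 proof (rule sm_sum[OF P smap_at_pts[OF a]], rule sm_mult[OF P])
  fix j assume "j \<in> {..<r}"
  then show "smooth_at P p (\<lambda>q. k j (a q, \<phi> q))" "smooth_at P p (\<lambda>q. v q (d j))"
   using PD(5) v(2) smap_at_prod[OF P a \<phi>] by (simp_all add: smap_at_def)
 qed
 moreover have "eventually (\<lambda>q. (\<Sum>j<r. k j (a q, \<phi> q) * v q (d j)) = tv N (\<phi> q) (v q) (\<lambda>z. K (a q, z))) (nh P p)"
  using ev v(1) by eventually_elim (use PD(6) in simp)
 ultimately show "smooth_at P p (\<lambda>q. tv N (\<phi> q) (v q) (\<lambda>z. K (a q, z)))" by (rule sm_cong[rotated])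
qed

locale wlie_gpd = lie_gpd G n m for G :: "('g, 'b) groupoid" and n m +
 fixes h :: "real => 'g => 'g" and k :: nat
 assumes hs: "homogeneity_structure (arrows G) h"
  and hch: "\<forall>p\<in>pts (arrows G). \<exists>U x w. p \<in> U \<and> homogeneous_chart n (arrows G) h U x w \<and> (\<forall>i<n. w i \<le> k)"
  and hm: "!!t. groupoid_morphism G G (h t) (\<lambda>b. src G (h t (ident G b)))"
begin

definition "hb t b = sr (h t (un b))"

lemma h_map: "smooth_map Ar Ar (h t)"
 by (rule homogeneity_map[OF hs dAr])

lemma h_at: "p \<in> pts Ar ==> smap_at Ar Ar p (h t)"
 by (rule smooth_mapD[OF h_map])

lemma h_pts [simp]: "p \<in> pts Ar ==> h t p \<in> pts Ar"
 by (rule homogeneity_pts[OF hs dAr])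

lemma h_simps: "p \<in> pts Ar ==> h 1 p = p" "p \<in> pts Ar ==> h t (h s p) = h (t * s) p"
 by (rule homogeneity_simps[OF hs], assumption)+

lemma hb_map: "smooth_map Ob Ob (hb t)"
 using hm[of t] unfolding groupoid_morphism_def hb_def[abs_def] by simp

lemma h_mor:
 "g \<in> pts Ar ==> sr (h t g) = hb t (sr g)" "g \<in> pts Ar ==> tg (h t g) = hb t (tg g)"
 "b \<in> pts Ob ==> h t (un b) = un (hb t b)"
 "(g, a) \<in> composable G ==> h t (mu g a) = mu (h t g) (h t a)"
proof -
 note gm = hm[of t, unfolded groupoid_morphism_def, folded hb_def]
 show "g \<in> pts Ar ==> sr (h t g) = hb t (sr g)" "g \<in> pts Ar ==> tg (h t g) = hb t (tg g)"
  "b \<in> pts Ob ==> h t (un b) = un (hb t b)"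
  using gm by simp_all
 have "\<forall>(g, g')\<in>composable G. h t (mu g g') = mu (h t g) (h t g')"
  using gm by (elim conjE)
 then show "(g, a) \<in> composable G ==> h t (mu g a) = mu (h t g) (h t a)"
  by fast
qed

lemma hb_pts [simp]: "b \<in> pts Ob ==> hb t b \<in> pts Ob"
 by (simp add: hb_def)

abbreviation "hh t \<equiv> lie_map G G (h t)"

lemma hh_eq: "e \<in> LP ==> hh t e = (h t (fst e), push Ar Ar (fst e) (h t) (snd e))"
 using tangent_map_push[OF dAr h_map, of "fst e" "snd e" t] lie_ptsD[of e] by (simp add: lie_map_def)

lemma hh_snd: "e \<in> LP ==> f \<in> Cinf Ar ==> snd (hh t e) f = tv Ar (fst e) (snd e) (\<lambda>q. f (h t q))"
 by (simp add: hh_eq push_def)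

lemma hh_fst: "e \<in> LP ==> fst (hh t e) = h t (fst e)"
 by (simp add: hh_eq)

lemma hh_tv:
 assumes e: "e \<in> LP" and f: "smooth_at Ar (h t (fst e)) f"
 shows "tv Ar (h t (fst e)) (snd (hh t e)) f = tv Ar (fst e) (snd e) (\<lambda>q. f (h t q))"
 using tv_push[OF dAr dAr h_at lie_ptsD(4)[OF e] f] lie_ptsD(1)[OF e] e by (simp add: hh_eq)

lemma hh_pts: 
 assumes e: "e \<in> LP"
 shows "hh t e \<in> LP"
proof -
 note d = lie_ptsD[OF e]
 have "push Ar Ar (fst e) (h t) (snd e) (\<lambda>q. f (sr q)) = 0" if f: "f \<in> Cinf Ob" for f
 proof -
  have fs: "(\<lambda>q. f (sr q)) \<in> Cinf Ar"
   by (rule smooth_map_Cinf[OF smaps(1) f])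
  have fb: "(\<lambda>b. f (hb t b)) \<in> Cinf Ob"
   by (rule smooth_map_Cinf[OF hb_map f])
  have "push Ar Ar (fst e) (h t) (snd e) (\<lambda>q. f (sr q)) = tv Ar (fst e) (snd e) (\<lambda>q. f (sr (h t q)))"
   using fs by (simp add: push_def)
  also have "\<dots> = tv Ar (fst e) (snd e) (\<lambda>q. f (hb t (sr q)))"
  proof (rule tv_cong[OF dAr d(1,4)])
   show "eventually (\<lambda>q. f (sr (h t q)) = f (hb t (sr q))) (nh Ar (fst e))"
    by (rule ev_ptsI) (simp add: h_mor)
   show "smooth_at Ar (fst e) (\<lambda>q. f (sr (h t q)))"
    using smap_at_comp'[OF h_at[OF d(1)] smaps(1)] f by (simp add: smap_at_def)
  qed
  also have "\<dots> = 0"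
   by (rule lie_kill[OF e sm_Cinf[OF fb d(2)]])
  finally show ?thesis .
 qed
 moreover have "push Ar Ar (fst e) (h t) (snd e) \<in> TS Ar (h t (fst e))"
  by (rule push_tangent[OF dAr dAr h_at[OF d(1)] d(4)])
 moreover have "h t (fst e) = un (hb t (sr (fst e)))"
  using h_mor(3)[OF d(2), of t] d(3) by simp
 ultimately show ?thesis
  using hh_eq[OF e] lie_pts_iff d(2) by auto
qed

lemma hh_smooth: "smooth_map (RL A) A (\<lambda>(t, e). hh t e)"
proof (rule smooth_mapI[OF diffspace_prod])
 let ?P = "RL A"
 fix te assume te: "te \<in> pts ?P"
 obtain t0 e0 where te0: "te = (t0, e0)" by (cases te)
 have e0: "e0 \<in> LP" using te te0 by simp
 note d = lie_ptsD[OF e0]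
 have tez: "te \<in> pts real_line \<times> pts A" using te by simp
 have s_t: "smooth_at ?P te fst"
  using sm_Cinf[OF fst_Cinf[OF real_Cinf] te] .
 have s_e: "smap_at ?P A te snd" by (rule smap_at_snd[OF tez])
 have s_p: "smap_at ?P Ar te (\<lambda>z. fst (snd z))"
  by (rule smap_at_comp[where \<phi> = snd and p = te, OF s_e A_fst_at]) (simp add: te0 e0)
 show "smap_at ?P A te (\<lambda>(t, e). hh t e)"
 proof (rule A_smoothI[OF diffspace_prod te])
  show "eventually (\<lambda>te. (case te of (t, e) => hh t e) \<in> LP) (nh ?P te)"
   by (rule ev_ptsI) (auto intro: hh_pts)
  fix f assume f: "f \<in> Cinf Ar"
  have "smooth_at ?P te (\<lambda>z. f (h (fst z) (fst (snd z))))"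
   using homogeneity_joint[OF hs diffspace_prod s_t s_p] f by (simp add: smap_at_def)
  then show "smooth_at ?P te (\<lambda>te. f (fst (case te of (t, e) => hh t e)))"
   by (rule sm_cong[rotated]) (rule ev_ptsI, auto simp: hh_fst)
  have z: "(t0, fst e0) \<in> pts (RL Ar)" "(t0, fst e0) \<in> pts real_line \<times> pts Ar"
   using d(1) by auto
  have K: "smooth_at (RL Ar) (fst te, fst (snd te)) (\<lambda>z. f (h (fst z) (snd z)))"
   using homogeneity_joint[OF hs diffspace_prod sm_Cinf[OF fst_Cinf[OF real_Cinf] z(1)] smap_at_snd[OF z(2)]] f
   by (simp add: smap_at_def te0)
  have "smooth_at ?P te (\<lambda>te. tv Ar (fst (snd te)) (snd (snd te)) (\<lambda>q. f (h (fst (fst te, q)) (snd (fst te, q)))))"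
  proof (rule sm_tv(1)[OF diffspace_real dAr diffspace_prod sm_real[OF diffspace_prod s_t] s_p K])
   show "eventually (\<lambda>q. snd (snd q) \<in> TS Ar (fst (snd q))) (nh ?P te)"
    by (rule ev_ptsI) (auto dest: lie_ptsD(4))
   show "smooth_at ?P te (\<lambda>q. snd (snd q) g)" if "g \<in> Cinf Ar" for g
    by (rule sm_Cinf[OF snd_Cinf[OF Cinf_A_snd[OF that]] te])
  qed
  then show "smooth_at ?P te (\<lambda>te. snd (case te of (t, e) => hh t e) f)"
   by (rule sm_cong[rotated]) (rule ev_ptsI, auto simp: hh_snd[OF _ f])
 qed
qed

lemma hh_eqI:
 assumes "e \<in> LP" "e' \<in> LP" "fst e = fst e'" "!!f. f \<in> Cinf Ar ==> snd e f = snd e' f"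
 shows "e = e'"
 using tangent_eqI[OF lie_ptsD(4)[OF assms(1)], of "snd e'"] lie_ptsD(4)[OF assms(2)] assms(3,4)
 by (simp add: prod_eq_iff)

lemma hh_1:
 assumes e: "e \<in> LP"
 shows "hh 1 e = e"
proof (rule hh_eqI[OF hh_pts[OF e] e])
 note d = lie_ptsD[OF e]
 show "fst (hh 1 e) = fst e" using hh_fst[OF e] h_simps(1)[OF d(1)] by simp
 fix f assume f: "f \<in> Cinf Ar"
 have "tv Ar (fst e) (snd e) (\<lambda>q. f (h 1 q)) = snd e f"
  by (rule tv_eq[OF dAr d(1,4) f]) (auto intro!: ev_ptsI simp: h_simps)
 then show "snd (hh 1 e) f = snd e f" using hh_snd[OF e f] by simp
qed

lemma hh_hh:
 assumes e: "e \<in> LP"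
 shows "hh t (hh s e) = hh (t * s) e"
proof (rule hh_eqI[OF hh_pts[OF hh_pts[OF e]] hh_pts[OF e]])
 note d = lie_ptsD[OF e] and e' = hh_pts[OF e, of s]
 show "fst (hh t (hh s e)) = fst (hh (t * s) e)"
  using hh_fst[OF e] hh_fst[OF e'] h_simps(2)[OF d(1)] by simp
 fix f assume f: "f \<in> Cinf Ar"
 have ft: "(\<lambda>q. f (h t q)) \<in> Cinf Ar"
  by (rule smooth_map_Cinf[OF h_map[of t] f])
 have "snd (hh t (hh s e)) f = tv Ar (h s (fst e)) (snd (hh s e)) (\<lambda>q. f (h t q))"
  using hh_snd[OF e' f] hh_fst[OF e] by simp
 also have "\<dots> = tv Ar (fst e) (snd e) (\<lambda>q. f (h t (h s q)))"
  by (rule hh_tv[OF e sm_Cinf[OF ft]]) (simp add: d)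
 also have "\<dots> = tv Ar (fst e) (snd e) (\<lambda>q. f (h (t * s) q))"
 proof (rule tv_cong[OF dAr d(1,4)])
  show "eventually (\<lambda>q. f (h t (h s q)) = f (h (t * s) q)) (nh Ar (fst e))"
   by (rule ev_ptsI) (simp add: h_simps)
  show "smooth_at Ar (fst e) (\<lambda>q. f (h t (h s q)))"
   by (rule sm_pull[OF h_at[OF d(1)] sm_Cinf[OF ft]]) (simp add: d)
 qed
 finally show "snd (hh t (hh s e)) f = snd (hh (t * s) e) f"
  using hh_snd[OF e f] by simp
qed

lemma homogeneity_hh: "homogeneity_structure A hh"
 unfolding homogeneity_structure_def using hh_smooth hh_1 hh_hh by simp

lemma hh_scale:
 assumes e: "e \<in> LP"
 shows "hh t (lie_scale s e) = lie_scale s (hh t e)"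
proof (rule hh_eqI[OF hh_pts[OF lie_scale_pts[OF e]] lie_scale_pts[OF hh_pts[OF e]]])
 show "fst (hh t (lie_scale s e)) = fst (lie_scale s (hh t e))"
  using hh_fst[OF e] hh_fst[OF lie_scale_pts[OF e]] by simp
 have "snd (lie_scale s e) = (\<lambda>f. s * snd e f)" by (simp add: lie_scale_def case_prod_unfold)
 then show "snd (hh t (lie_scale s e)) f = snd (lie_scale s (hh t e)) f" if "f \<in> Cinf Ar" for f
  using hh_snd[OF e that] hh_snd[OF lie_scale_pts[OF e] that] by (simp add: tv_scale)
qed

text \<open>A homogeneous chart is invariant under \<open>hh 0\<close>, so one around e0 must
  contain the limit of e0. The coordinates are therefore selected at that limit, and the homogeneity
  of x carries them back to e0.\<close>

lemma hh_chart:
 assumes e0: "e0 \<in> LP"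
 shows "\<exists>S \<xi> w. e0 \<in> S \<and> homogeneous_chart n A hh S \<xi> w \<and> (\<forall>i<n. w i \<le> k)"
proof -
 note d0 = lie_ptsD[OF e0]
 obtain U0 x w where U0: "fst e0 \<in> U0" "homogeneous_chart n Ar h U0 x w" "\<forall>i<n. w i \<le> k"
  using hch d0(1) by blast
 have c0: "chart n Ar U0 x" and hU0: "!!t. h t ` U0 \<subseteq> U0"
  and hx: "!!i t q. i < n ==> q \<in> U0 ==> x (h t q) i = t ^ w i * x q i"
  using U0(2) by (auto simp: homogeneous_chart_def)
 define b0 where "b0 = hb 0 (sr (fst e0))"
 have b0: "b0 \<in> pts Ob" using d0(2) by (simp add: b0_def)
 have ub0: "un b0 = h 0 (fst e0)"
  using h_mor(3)[OF d0(2), of 0] d0(3) by (simp add: b0_def)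
 have ub0U: "un b0 \<in> U0" using hU0[of 0] U0(1) ub0 by auto
 obtain N0 z0 where N0: "b0 \<in> N0" "chart m Ob N0 z0" using charts_at(2)[OF b0] by blast
 \<comment> \<open>Restrictions of the coordinates to the units. They separate tangent vectors of
   the base, because x is a chart and \<open>un\<close> has the smooth left inverse
   \<open>sr\<close>.\<close>
 define F where "F = (\<lambda>i b. x (un b) i) ` {..<n}"
 have "\<exists>\<kappa> N. (\<forall>j<m. \<kappa> j \<in> F) \<and> b0 \<in> N \<and> N \<subseteq> N0 \<and> chart m Ob N (\<lambda>b. tup m (\<lambda>j. \<kappa> j b))"
 proof (rule chart_of_separating[OF dOb N0(2,1)])
  show "smooth_at Ob b0 f" if f: "f \<in> F" for f
  proof -
   obtain i where i: "i < n" "f = (\<lambda>b. x (un b) i)" using f by (auto simp: F_def)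
   show ?thesis unfolding i(2) by (rule sm_pull[OF un_at[OF b0] chart_coord[OF c0 ub0U i(1)]])
  qed
  fix v assume v: "v \<in> TS Ob b0" and z: "!!f. f \<in> F ==> tv Ob b0 v f = 0"
  have vp: "push Ob Ar b0 un v \<in> TS Ar (un b0)"
   by (rule push_tangent[OF dOb dAr un_at[OF b0] v])
  have "push Ob Ar b0 un v = (\<lambda>f. 0)"
  proof (rule tangent_chart_eqI[OF dAr c0 ub0U vp tangent_zero])
   fix i assume i: "i < n"
   show "tv Ar (un b0) (push Ob Ar b0 un v) (\<lambda>q. x q i) = tv Ar (un b0) (\<lambda>f. 0) (\<lambda>q. x q i)"
    using tv_push[OF dOb dAr un_at[OF b0] v chart_coord[OF c0 ub0U i]] z[of "\<lambda>b. x (un b) i"] i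
    by (auto simp: F_def tv_def)
  qed
  then have pz: "tv Ob b0 v (\<lambda>b. f (un b)) = 0" if "f \<in> Cinf Ar" for f
   using that by (metis push_def)
  show "v = (\<lambda>f. 0)"
  proof (rule tangent_eqI[OF v tangent_zero])
   fix f assume f: "f \<in> Cinf Ob"
   have fs: "(\<lambda>q. f (sr q)) \<in> Cinf Ar"
    by (rule smooth_map_Cinf[OF smaps(1) f])
   have "tv Ob b0 v (\<lambda>b. f (sr (un b))) = v f"
    by (rule tv_eq[OF dOb b0 v f]) (auto intro!: ev_ptsI)
   then show "v f = 0" using pz[OF fs] by simp
  qed
 qed
 then obtain \<kappa> N where N: "\<forall>j<m. \<kappa> j \<in> F" "b0 \<in> N" "chart m Ob N (\<lambda>b. tup m (\<lambda>j. \<kappa> j b))"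
  by (elim exE conjE)
 let ?z = "\<lambda>b. tup m (\<lambda>j. \<kappa> j b)"
 have "\<forall>j. \<exists>i. j < m --> i < n \<and> \<kappa> j = (\<lambda>b. x (un b) i)"
  using N(1) by (auto simp: F_def)
 then obtain \<iota> where \<iota>: "!!j. j < m ==> \<iota> j < n" "!!j. j < m ==> \<kappa> j = (\<lambda>b. x (un b) (\<iota> j))"
  by metis
 have "sr (un b0) \<in> N" using N(2) b0 by simp
 \<comment> \<open>In the new chart the coordinates at \<open>pos\<close> are pullbacks by the
   source map, while all others are still the homogeneous ones of x.\<close>
 from adapted_exists[OF c0 ub0U N(3) this]
 obtain pos U y where U: "adapted U y N ?z pos" "un b0 \<in> U" "U \<subseteq> U0"
  "\<forall>q\<in>U. \<forall>i<n. i \<notin> pos ` {..<m} --> y q i = x q i"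
  by (elim exE conjE)
 note D = adD[OF U(1)]
 define jj where "jj = inv_into {..<m} pos"
 have jj: "jj (pos j) = j" if "j < m" for j
  using D(4) that by (simp add: jj_def)
 \<comment> \<open>The same coordinates, written through x: it is homogeneous on all of U0, whereas
   y is given on the smaller U, which need not be invariant.\<close>
 define \<xi> where "\<xi> e = tup n (\<lambda>i. if i \<in> pos ` {..<m} then x (fst e) (\<iota> (jj i)) else tv Ar (fst e) (snd e) (\<lambda>q. x q i))"
  for e :: "'g \<times> 'g tvec"
 define w' where "w' i = (if i \<in> pos ` {..<m} then w (\<iota> (jj i)) else w i)" for i
 have \<xi>U: "axi y pos e = \<xi> e" if e: "e \<in> adom U" for e
 proof -
  have el: "e \<in> LP" "fst e \<in> U" using e by (auto simp: adom_def)
  note d = lie_ptsD[OF el(1)]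
  show ?thesis
   unfolding axi_def \<xi>_def
  proof (rule tup_cong)
   fix i assume i: "i < n"
   show "(if i \<in> pos ` {..<m} then y (fst e) i else tv Ar (fst e) (snd e) (\<lambda>q. y q i)) =
    (if i \<in> pos ` {..<m} then x (fst e) (\<iota> (jj i)) else tv Ar (fst e) (snd e) (\<lambda>q. x q i))"
   proof (cases "i \<in> pos ` {..<m}")
    case True
    then obtain j where j: "j < m" "i = pos j" by blast
    have "y (fst e) i = x (fst e) (\<iota> j)"
     using D(6)[OF el(2) j(1)] j \<iota>(2)[OF j(1)] d(3) by simp
    then show ?thesis using True jj[OF j(1)] j(2) by simp
   next
    case False
    have "tv Ar (fst e) (snd e) (\<lambda>q. y q i) = tv Ar (fst e) (snd e) (\<lambda>q. x q i)"
     by (rule tv_cong[OF dAr d(1,4) _ chart_coord[OF D(1) el(2) i]])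
      (rule ev_chart[OF D(1) el(2)], use U(4) i False in simp)
    then show ?thesis using False by simp
   qed
  qed
 qed
 have c: "chart n A (adom U) \<xi>"
  by (rule chart_cong[OF dA A_chart[OF U(1)] \<xi>U])
 define S where "S = {e \<in> pts A. hh 0 e \<in> adom U}"
 \<comment> \<open>U0 is invariant and contains the limit \<open>h 0 (fst e)\<close>, hence
   \<open>fst e\<close> itself.\<close>
 have SU0: "fst e \<in> U0" if "e \<in> S" for e
 proof (rule homogeneity_saturated[OF hs dAr chartD(1)[OF c0] hU0])
  have e: "e \<in> LP" using that by (simp add: S_def)
  show "fst e \<in> pts Ar" by (rule lie_ptsD(1)[OF e])
  show "h 0 (fst e) \<in> U0" using that U(3) hh_fst[OF e, of 0] by (auto simp: S_def adom_def)
 qed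
 have "homogeneous_chart n A hh S \<xi> w'"
 proof (rule homogeneous_extension[OF homogeneity_hh dA c S_def])
  show "\<xi> e \<in> E n" for e by (simp add: \<xi>_def)
  fix e t i assume e: "e \<in> S" and i: "i < n"
  have el: "e \<in> LP" using e by (simp add: S_def)
  note d = lie_ptsD[OF el] and eU = SU0[OF e]
  show "\<xi> (hh t e) i = t ^ w' i * \<xi> e i"
  proof (cases "i \<in> pos ` {..<m}")
   case True
   then obtain j where j: "j < m" "i = pos j" by blast
   then show ?thesis
    using True i hx[OF \<iota>(1)[OF j(1)] eU] jj[OF j(1)] by (simp add: \<xi>_def w'_def hh_fst[OF el])
  next
   case False
   have hU: "h t (fst e) \<in> U0" using hU0 eU by blast
   have "tv Ar (h t (fst e)) (snd (hh t e)) (\<lambda>q. x q i) = tv Ar (fst e) (snd e) (\<lambda>q. x (h t q) i)"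
    by (rule hh_tv[OF el chart_coord[OF c0 hU i]])
   also have "\<dots> = tv Ar (fst e) (snd e) (\<lambda>q. t ^ w i * x q i)"
   proof (rule tv_cong[OF dAr d(1,4)])
    show "eventually (\<lambda>q. x (h t q) i = t ^ w i * x q i) (nh Ar (fst e))"
     by (rule ev_chart[OF c0 eU]) (rule hx[OF i])
    show "smooth_at Ar (fst e) (\<lambda>q. x (h t q) i)"
     by (rule sm_pull[OF h_at[OF d(1)] chart_coord[OF c0 hU i]])
   qed
   also have "\<dots> = t ^ w i * tv Ar (fst e) (snd e) (\<lambda>q. x q i)"
    by (rule tv_cmult[OF dAr d(1,4) chart_coord[OF c0 eU i]])
   finally show ?thesis using False i by (simp add: \<xi>_def w'_def hh_fst[OF el])
  qed
 qed
 moreover have "e0 \<in> S"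
  using e0 hh_pts[OF e0, of 0] hh_fst[OF e0, of 0] ub0 U(2) by (simp add: S_def adom_def)
 moreover have "w' i \<le> k" if "i < n" for i
 proof (cases "i \<in> pos ` {..<m}")
  case True
  then obtain j where "j < m" "i = pos j" by blast
  then show ?thesis using True U0(3) \<iota>(1)[of j] jj[of j] by (simp add: w'_def)
 qed (use U0(3) that in "simp add: w'_def")
 ultimately show ?thesis by blast
qed

lemma gl_bundle_A: "gl_bundle (k + 1) A hh lie_scale"
 unfolding gl_bundle_def graded_bundle_def
 using homogeneity_hh manifold_A hh_chart hh_scale graded_bundle_scale
 by (auto simp: graded_bundle_def)

end

section \<open>Right-invariant vector fields\<close>

lemma vector_field_iff:
 assumes M: "diffspace M"
 shows "vector_field M X \<longleftrightarrow> (\<forall>p\<in>pts M. X p \<in> TS M p) \<and> (\<forall>f\<in>Cinf M. (\<lambda>p. X p f) \<in> Cinf M) \<and>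
  (\<forall>p. p \<notin> pts M --> X p = (\<lambda>f. 0))"
proof
 assume X: "vector_field M X"
 then have sm: "smooth_map M (tangent_bundle M) (\<lambda>p. (p, X p))" by (simp add: vector_field_def)
 have "(\<lambda>p. X p f) \<in> Cinf M" if f: "f \<in> Cinf M" for f
 proof -
  have "(\<lambda>(p, v). v f) \<in> Cinf (tangent_bundle M)"
   unfolding tangent_bundle_def by (rule generators_Cinf) (use f in auto)
  then have "(\<lambda>(p, v). v f) \<circ> (\<lambda>p. (p, X p)) \<in> Cinf M"
   using sm unfolding smooth_map_def by blast
  then show ?thesis by (simp add: o_def)
 qed
 then show "(\<forall>p\<in>pts M. X p \<in> TS M p) \<and> (\<forall>f\<in>Cinf M. (\<lambda>p. X p f) \<in> Cinf M) \<and>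
  (\<forall>p. p \<notin> pts M --> X p = (\<lambda>f. 0))"
  using sm X by (auto simp: smooth_map_def tangent_bundle_def vector_field_def)
next
 assume X: "(\<forall>p\<in>pts M. X p \<in> TS M p) \<and> (\<forall>f\<in>Cinf M. (\<lambda>p. X p f) \<in> Cinf M) \<and>
  (\<forall>p. p \<notin> pts M --> X p = (\<lambda>f. 0))"
 have "smooth_map M (tangent_bundle M) (\<lambda>p. (p, X p))"
 proof (rule smooth_mapI[OF M])
  fix p assume p: "p \<in> pts M"
  show "smap_at M (tangent_bundle M) p (\<lambda>p. (p, X p))"
   unfolding tangent_bundle_def
  proof (rule smap_at_gen[OF M p])
   show "eventually (\<lambda>q. (q, X q) \<in> {(p, v). p \<in> pts M \<and> v \<in> TS M p}) (nh M p)"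
    by (rule ev_ptsI) (use X in auto)
  qed (use X p in "auto simp: case_prod_unfold intro!: sm_Cinf")
 qed
 then show "vector_field M X" using X by (simp add: vector_field_def)
qed

context lie_gpd
begin

text \<open>In adapted coordinates f - g vanishes along the fibre directions, and only these occur
  in a vector of the Lie algebroid. Hence a function given on a source fibre may be extended to the
  arrows in any smooth way.\<close>

lemma lie_fibre:
 assumes e: "e \<in> LP" and f: "smooth_at Ar (fst e) f" and g: "smooth_at Ar (fst e) g"
  and eq: "eventually (\<lambda>q. sr q = sr (fst e) --> f q = g q) (nh Ar (fst e))"
 shows "tv Ar (fst e) (snd e) f = tv Ar (fst e) (snd e) g"
proof -
 note d = lie_ptsD[OF e]
 obtain U y N z pos where ad: "adapted U y N z pos" "e \<in> adom U"
  using A_chart_at[OF e] by (elim exE conjE)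
 note D = adD[OF ad(1)]
 have eU: "fst e \<in> U" using ad(2) by (simp add: adom_def)
 let ?p = "fst e"
 define k where "k q = f q - g q" for q
 have k: "smooth_at Ar ?p k" unfolding k_def[abs_def] by (rule sm_diff[OF dAr f g])
 have zero: "tv Ar ?p (cvec Ar U y i ?p) k = 0" if "i \<in> fpos pos" for i
  by (rule cvec_fibre[OF ad(1) eU that k]) (use eq in "auto simp: k_def elim: eventually_mono")
 have "tv Ar ?p (snd e) k = 0"
  unfolding lie_recon[OF ad] avec_def tv_lincomb using zero by simp
 then show ?thesis
  using tv_diff[OF dAr d(1,4) f g] by (simp add: k_def[abs_def])
qed

subsection \<open>Local sections of the target map\<close>

text \<open>In a chart adapted to the target map, replace the target coordinates of a by those of b
  and keep the rest. The use of \<tau> is that \<open>mu g (\<tau> a (sr g))\<close> makes sense for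
  g near the source fibre over \<open>tg a\<close> and equals \<open>mu g a\<close> on that
  fibre.\<close>

lemma target_section:
 assumes a0: "a0 \<in> pts Ar"
 shows "\<exists>\<tau>. smap_at (prod_space Ar Ob) Ar (a0, tg a0) (\<lambda>(a, b). \<tau> a b) \<and>
  eventually (\<lambda>(a, b). tg (\<tau> a b) = b) (nh (prod_space Ar Ob) (a0, tg a0)) \<and>
  eventually (\<lambda>a. \<tau> a (tg a) = a) (nh Ar a0) \<and>
  (\<exists>N. open_in Ob N \<and> tg a0 \<in> N \<and> (\<forall>b\<in>N. smap_at Ob Ar b (\<tau> a0) \<and> tg (\<tau> a0 b) = b))"
proof -
 obtain U0 x where x: "a0 \<in> U0" "chart n Ar U0 x" using charts_at(1)[OF a0] by blast
 obtain N0 z where z: "tg a0 \<in> N0" "chart m Ob N0 z" using charts_at(2)[OF tg_pts[OF a0]] by blast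
 obtain pos W y where Y: "inj_on pos {..<m}" "pos ` {..<m} \<subseteq> {..<n}" "a0 \<in> W" "tg ` W \<subseteq> N0" "chart n Ar W y"
  "\<forall>q\<in>W. \<forall>j<m. y q (pos j) = z (tg q) j"
  using submersion_chart[OF dAr dOb subm(2) x(2,1) z(2,1)] by (elim exE conjE)
 define jj where "jj = inv_into {..<m} pos"
 have jj: "jj (pos j) = j" if "j < m" for j using Y(1) that by (simp add: jj_def)
 have jjm: "jj i < m" if "i \<in> pos ` {..<m}" for i using that jj by auto
 let ?c = "\<lambda>i a b. if i \<in> pos ` {..<m} then z b (jj i) else y a i"
 define \<tau> where "\<tau> a b = inv_into W y (tup n (\<lambda>i. ?c i a b))" for a b
 have diag: "tup n (\<lambda>i. ?c i a (tg a)) = y a" if a: "a \<in> W" for a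
 proof (rule E_eqI[OF tup_in_E chart_E[OF Y(5) a]])
  fix i assume i: "i < n"
  show "tup n (\<lambda>i. ?c i a (tg a)) i = y a i"
  proof (cases "i \<in> pos ` {..<m}")
   case True
   then obtain j where j: "j < m" "i = pos j" by blast
   then show ?thesis using i Y(6) a jj[OF j(1)] by simp
  qed (use i in simp)
 qed
 have tgt: "tg (\<tau> a b) = b" if b: "b \<in> N0" and t: "tup n (\<lambda>i. ?c i a b) \<in> y ` W" for a b
 proof -
  have \<tau>: "\<tau> a b \<in> W" "y (\<tau> a b) = tup n (\<lambda>i. ?c i a b)"
   using t by (auto simp: \<tau>_def inv_into_into f_inv_into_f)
  have tN: "tg (\<tau> a b) \<in> N0" using Y(4) \<tau>(1) by blast
  have "z (tg (\<tau> a b)) = z b"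
  proof (rule E_eqI[OF chart_E[OF z(2) tN] chart_E[OF z(2) b]])
   fix j assume j: "j < m"
   have "pos j < n" using Y(2) j by auto
   have "z (tg (\<tau> a b)) j = y (\<tau> a b) (pos j)" using Y(6) \<tau>(1) j by simp
   also have "\<dots> = z b j" unfolding \<tau>(2) using j \<open>pos j < n\<close> jj[OF j] by simp
   finally show "z (tg (\<tau> a b)) j = z b j" .
  qed
  then show ?thesis using chartD(3)[OF z(2)] b tN by (simp add: inj_on_def)
 qed
 let ?P = "prod_space Ar Ob"
 have p0: "(a0, tg a0) \<in> pts ?P" "(a0, tg a0) \<in> pts Ar \<times> pts Ob" using a0 by auto
 have sc: "smooth_at ?P (a0, tg a0) (\<lambda>p. ?c i (fst p) (snd p))" if i: "i < n" for i
 proof (cases "i \<in> pos ` {..<m}")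
  case True
  have "smooth_at ?P (a0, tg a0) (\<lambda>p. z (snd p) (jj i))"
   by (rule sm_pull[OF smap_at_snd[OF p0(2)]]) (use chart_coord[OF z(2,1) jjm[OF True]] in simp)
  then show ?thesis using True by simp
 next
  case False
  have "smooth_at ?P (a0, tg a0) (\<lambda>p. y (fst p) i)"
   by (rule sm_pull[OF smap_at_fst[OF p0(2)]]) (use chart_coord[OF Y(5,3) i] in simp)
  then show ?thesis using False by simp
 qed
 have im: "tup n (\<lambda>i. ?c i (fst (a0, tg a0)) (snd (a0, tg a0))) \<in> y ` W"
  unfolding fst_conv snd_conv diag[OF Y(3)] using Y(3) by (rule imageI)
 note inv = chart_inv_smooth[where y = "\<lambda>i p. ?c i (fst p) (snd p)" and p = "(a0, tg a0)", OF diffspace_prod Y(5) p0(1) im sc]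
 have 1: "smap_at ?P Ar (a0, tg a0) (\<lambda>(a, b). \<tau> a b)"
  using inv(1) by (simp add: \<tau>_def case_prod_unfold)
 have "eventually (\<lambda>p. snd p \<in> N0) (nh ?P (a0, tg a0))"
  by (rule smap_at_cont[OF smap_at_snd[OF p0(2)] chartD(1)[OF z(2)]]) (use z(1) in simp)
 moreover have "eventually (\<lambda>p. tup n (\<lambda>i. ?c i (fst p) (snd p)) \<in> y ` W) (nh ?P (a0, tg a0))"
  by (rule inv(2))
 ultimately have 2: "eventually (\<lambda>(a, b). tg (\<tau> a b) = b) (nh ?P (a0, tg a0))"
  by eventually_elim (use tgt in "auto simp: case_prod_unfold")
 have 3: "eventually (\<lambda>a. \<tau> a (tg a) = a) (nh Ar a0)"
  by (rule ev_chart[OF Y(5,3)]) (use diag chartD(3)[OF Y(5)] in "simp add: \<tau>_def")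
 have c0: "smooth_at Ob b (\<lambda>b. ?c i a0 b)" if "b \<in> N0" "i < n" for b i
  using chart_coord[OF z(2) that(1) jjm] sm_const[OF dOb chart_sub[OF z(2) that(1)]]
  by (cases "i \<in> pos ` {..<m}") simp_all
 have "eventually (\<lambda>b. tup n (\<lambda>i. ?c i a0 b) \<in> y ` W) (nh Ob (tg a0))"
  by (rule chart_inv_smooth(2)[where y = "\<lambda>i b. ?c i a0 b", OF dOb Y(5) tg_pts[OF a0] im[unfolded fst_conv snd_conv] c0[OF z(1)]])
 moreover have "eventually (\<lambda>b. b \<in> N0) (nh Ob (tg a0))" by (rule ev_chart[OF z(2,1)])
 ultimately have "eventually (\<lambda>b. b \<in> N0 \<and> tup n (\<lambda>i. ?c i a0 b) \<in> y ` W) (nh Ob (tg a0))"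
  by eventually_elim simp
 then obtain N where N: "open_in Ob N" "tg a0 \<in> N" "\<forall>b\<in>N. b \<in> N0 \<and> tup n (\<lambda>i. ?c i a0 b) \<in> y ` W"
  unfolding ev_nh[OF tg_pts[OF a0]] by blast
 have 4: "smap_at Ob Ar b (\<tau> a0) \<and> tg (\<tau> a0 b) = b" if b: "b \<in> N" for b
 proof
  have bN: "b \<in> N0" "tup n (\<lambda>i. ?c i a0 b) \<in> y ` W" using N(3) b by auto
  show "tg (\<tau> a0 b) = b" by (rule tgt[OF bN])
  show "smap_at Ob Ar b (\<tau> a0)"
   unfolding \<tau>_def[abs_def]
   by (rule chart_inv_smooth(1)[where y = "\<lambda>i b. ?c i a0 b", OF dOb Y(5) chart_sub[OF z(2) bN(1)] bN(2) c0[OF bN(1)]])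
 qed
 show ?thesis
  by (intro exI[of _ \<tau>] conjI exI[of _ N]) (use 1 2 3 4 N in auto)
qed

text \<open>The last clause of \<open>right_invariant\<close> has content only for those f that have
  an extension f'. Every f has one: extend along a section of the target map and cut off in the
  base.\<close>

lemma right_translate_global:
 assumes a: "a \<in> pts Ar" and f: "f \<in> Cinf Ar"
 shows "\<exists>f'\<in>Cinf Ar. \<forall>g. (g, a) \<in> composable G --> f' g = f (mu g a)"
proof -
 obtain \<tau> N where \<tau>: "eventually (\<lambda>a. \<tau> a (tg a) = a) (nh Ar a)" "open_in Ob N" "tg a \<in> N"
  "\<forall>b\<in>N. smap_at Ob Ar b (\<tau> a) \<and> tg (\<tau> a b) = b"
  using target_section[OF a] by (elim exE conjE)
 obtain \<rho> W' where \<rho>: "\<rho> \<in> Cinf Ob" "eventually (\<lambda>q. \<rho> q = 1) (nh Ob (tg a))" "open_in Ob W'"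
  "N \<union> W' = pts Ob" "\<forall>q\<in>W'. \<rho> q = 0"
  using bump[OF dOb \<tau>(2,3)] by (elim bexE exE conjE)
 define F where "F g = (if sr g \<in> N then \<rho> (sr g) * f (mu g (\<tau> a (sr g))) else 0)" for g
 have "F \<in> Cinf Ar"
 proof (rule CinfI[OF dAr])
  fix g assume g: "g \<in> pts Ar"
  show "smooth_at Ar g F"
  proof (cases "sr g \<in> N")
   case True
   have ev: "eventually (\<lambda>g. sr g \<in> N) (nh Ar g)"
    by (rule smap_at_cont[OF sr_at[OF g] \<tau>(2) True])
   have st: "smap_at Ar Ar g (\<lambda>g. \<tau> a (sr g))"
    by (rule smap_at_comp[OF sr_at[OF g]]) (use \<tau>(4) True in blast)
   have "smap_at Ar Ar g (\<lambda>g. mu g (\<tau> a (sr g)))"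
   proof (rule mu_at[OF dAr smap_at_id[OF g] st])
    show "eventually (\<lambda>g. sr g = tg (\<tau> a (sr g))) (nh Ar g)"
     using ev by eventually_elim (use \<tau>(4) in simp)
   qed
   then have "smooth_at Ar g (\<lambda>g. f (mu g (\<tau> a (sr g))))"
    using f by (simp add: smap_at_def)
   moreover have "smooth_at Ar g (\<lambda>g. \<rho> (sr g))"
    using sr_at[OF g] \<rho>(1) by (simp add: smap_at_def)
   ultimately have "smooth_at Ar g (\<lambda>g. \<rho> (sr g) * f (mu g (\<tau> a (sr g))))"
    by (intro sm_mult[OF dAr])
   moreover have "eventually (\<lambda>g. \<rho> (sr g) * f (mu g (\<tau> a (sr g))) = F g) (nh Ar g)"
    using ev by eventually_elim (simp add: F_def)
   ultimately show ?thesis by (rule sm_cong[rotated])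
  next
   case False
   then have "sr g \<in> W'" using \<rho>(4) sr_pts[OF g] by blast
   then have "eventually (\<lambda>g. sr g \<in> W') (nh Ar g)"
    by (rule smap_at_cont[OF sr_at[OF g] \<rho>(3)])
   then have "eventually (\<lambda>g. 0 = F g) (nh Ar g)"
    by eventually_elim (use \<rho>(5) in "simp add: F_def")
   then show ?thesis by (rule sm_cong[OF _ sm_const[OF dAr g]])
  qed
 qed
 moreover have "F g = f (mu g a)" if "(g, a) \<in> composable G" for g
 proof -
  have s: "sr g = tg a" using that by (simp add: composable_iff)
  have "\<rho> (tg a) = 1" by (rule ev_nh_self[OF \<rho>(2) tg_pts[OF a]])
  moreover have "\<tau> a (tg a) = a" by (rule ev_nh_self[OF \<tau>(1) a])
  ultimately show ?thesis using s \<tau>(3) by (simp add: F_def)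
 qed
 ultimately show ?thesis by blast
qed

text \<open>The extensions for all a near a0 at once, as one smooth function K of both arguments;
  this gives the smooth dependence of right-invariant extensions on a.\<close>

lemma right_translate_family:
 assumes a0: "a0 \<in> pts Ar" and f: "f \<in> Cinf Ar"
 shows "\<exists>K. smooth_at (prod_space Ar Ar) (a0, un (tg a0)) K \<and>
  eventually (\<lambda>a. \<forall>g. sr g = tg a --> K (a, g) = f (mu g a)) (nh Ar a0)"
proof -
 obtain \<tau> where \<tau>: "smap_at (prod_space Ar Ob) Ar (a0, tg a0) (\<lambda>(a, b). \<tau> a b)"
  "eventually (\<lambda>(a, b). tg (\<tau> a b) = b) (nh (prod_space Ar Ob) (a0, tg a0))"
  "eventually (\<lambda>a. \<tau> a (tg a) = a) (nh Ar a0)"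
  using target_section[OF a0] by (elim exE conjE)
 let ?P = "prod_space Ar Ar" and ?p = "(a0, un (tg a0))"
 have pz: "?p \<in> pts Ar \<times> pts Ar" "?p \<in> pts ?P" using a0 by auto
 define K where "K z = f (mu (snd z) (\<tau> (fst z) (sr (snd z))))" for z
 have s2: "smap_at ?P (prod_space Ar Ob) ?p (\<lambda>z. (fst z, sr (snd z)))"
  by (rule smap_at_prod[OF diffspace_prod smap_at_fst[OF pz(1)] smap_at_comp'[OF smap_at_snd[OF pz(1)] smaps(1)]])
 have eqp: "(fst ?p, sr (snd ?p)) = (a0, tg a0)" using a0 by simp
 have "smap_at ?P Ar ?p (\<lambda>z. (\<lambda>(a, b). \<tau> a b) (fst z, sr (snd z)))"
  by (rule smap_at_comp[where \<phi> = "\<lambda>z. (fst z, sr (snd z))", OF s2]) (unfold eqp, rule \<tau>(1))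
 then have s3: "smap_at ?P Ar ?p (\<lambda>z. \<tau> (fst z) (sr (snd z)))" by simp
 have "eventually (\<lambda>z. (\<lambda>(a, b). tg (\<tau> a b) = b) (fst z, sr (snd z))) (nh ?P ?p)"
  by (rule smap_at_ev[where \<phi> = "\<lambda>z. (fst z, sr (snd z))", OF s2]) (unfold eqp, rule \<tau>(2))
 then have "eventually (\<lambda>z. sr (snd z) = tg (\<tau> (fst z) (sr (snd z)))) (nh ?P ?p)"
  by eventually_elim simp
 from mu_at[OF diffspace_prod smap_at_snd[OF pz(1)] s3 this]
 have "smooth_at ?P ?p K" using f by (simp add: smap_at_def K_def[abs_def])
 moreover have "eventually (\<lambda>a. \<forall>g. sr g = tg a --> K (a, g) = f (mu g a)) (nh Ar a0)"
  using \<tau>(3) by eventually_elim (simp add: K_def)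
 ultimately show ?thesis by blast
qed

end

section \<open>Right-invariant fields and their extension from the units\<close>

context lie_gpd
begin

definition "RI = {X. right_invariant G X}"

lemma RI_iff: "X \<in> RI \<longleftrightarrow> (\<forall>p\<in>pts Ar. X p \<in> TS Ar p) \<and> (\<forall>f\<in>Cinf Ar. (\<lambda>p. X p f) \<in> Cinf Ar) \<and>
  (\<forall>p. p \<notin> pts Ar --> X p = (\<lambda>f. 0)) \<and>
  (\<forall>g\<in>pts Ar. \<forall>f\<in>Cinf Ob. X g (\<lambda>q. f (sr q)) = 0) \<and>
  (\<forall>a\<in>pts Ar. \<forall>f\<in>Cinf Ar. \<forall>f'\<in>Cinf Ar. (\<forall>g. (g, a) \<in> composable G --> f' g = f (mu g a)) -->
    (\<forall>g. (g, a) \<in> composable G --> X g f' = X (mu g a) f))"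
 unfolding RI_def right_invariant_def vector_field_iff[OF dAr] by (simp add: o_def conj_assoc)

lemma RI_D:
 assumes "X \<in> RI"
 shows "p \<in> pts Ar ==> X p \<in> TS Ar p" "f \<in> Cinf Ar ==> (\<lambda>p. X p f) \<in> Cinf Ar"
  "p \<notin> pts Ar ==> X p = (\<lambda>f. 0)" "g \<in> pts Ar ==> u \<in> Cinf Ob ==> X g (\<lambda>q. u (sr q)) = 0"
  "f \<in> Cinf Ar ==> f' \<in> Cinf Ar ==> (!!g. (g, a) \<in> composable G ==> f' g = f (mu g a)) ==>
   (g, a) \<in> composable G ==> X g f' = X (mu g a) f"
proof -
 note * = assms[unfolded RI_iff]
 show "p \<in> pts Ar ==> X p \<in> TS Ar p" "f \<in> Cinf Ar ==> (\<lambda>p. X p f) \<in> Cinf Ar"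
  "p \<notin> pts Ar ==> X p = (\<lambda>f. 0)" "g \<in> pts Ar ==> u \<in> Cinf Ob ==> X g (\<lambda>q. u (sr q)) = 0"
  using * by simp_all
 assume f: "f \<in> Cinf Ar" "f' \<in> Cinf Ar" "!!g. (g, a) \<in> composable G ==> f' g = f (mu g a)" and g: "(g, a) \<in> composable G"
 have a: "a \<in> pts Ar" using g by (simp add: composable_iff)
 have "(\<forall>g. (g, a) \<in> composable G --> f' g = f (mu g a)) --> (\<forall>g. (g, a) \<in> composable G --> X g f' = X (mu g a) f)"
  using * a f(1,2) by blast
 then show "X g f' = X (mu g a) f" using f(3) g by blast
qed

lemma RI_lie: "X \<in> RI ==> b \<in> pts Ob ==> (un b, X (un b)) \<in> LP"
 unfolding lie_pts_iff using RI_D(1,4)[of X] by simp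

lemma un_composable: "a \<in> pts Ar ==> (un (tg a), a) \<in> composable G"
 by (simp add: composable_iff)

text \<open>Right invariance at the unit over \<open>tg a\<close> expresses the value at a through
  the value at that unit.\<close>

lemma RI_eqI:
 assumes X: "X \<in> RI" and Y: "Y \<in> RI" and eq: "!!b. b \<in> pts Ob ==> X (un b) = Y (un b)"
 shows "X = Y"
proof
 fix a
 show "X a = Y a"
 proof (cases "a \<in> pts Ar")
  case True
  show ?thesis
  proof (rule tangent_eqI[OF RI_D(1)[OF X True] RI_D(1)[OF Y True]])
   fix f assume f: "f \<in> Cinf Ar"
   obtain f' where f': "f' \<in> Cinf Ar" "!!g. (g, a) \<in> composable G ==> f' g = f (mu g a)"
    using right_translate_global[OF True f] by blast
   have "Z (un (tg a)) f' = Z a f" if "Z \<in> RI" for Z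
    using RI_D(5)[OF that f f' un_composable[OF True]] mu_un(2)[OF True] by simp
   from this[OF X] this[OF Y] show "X a f = Y a f" using eq[OF tg_pts[OF True]] by simp
  qed
 qed (simp add: RI_D(3)[OF X] RI_D(3)[OF Y])
qed

lemma lie_sectionsD:
 assumes "\<sigma> \<in> lie_sections G"
 shows "smooth_map Ob A \<sigma>" "b \<in> pts Ob ==> \<sigma> b \<in> LP" "b \<in> pts Ob ==> fst (\<sigma> b) = un b"
  "f \<in> Cinf Ar ==> (\<lambda>b. snd (\<sigma> b) f) \<in> Cinf Ob"
proof -
 show s: "smooth_map Ob A \<sigma>" and "b \<in> pts Ob ==> fst (\<sigma> b) = un b"
  using assms by (simp_all add: lie_sections_def)
 show "b \<in> pts Ob ==> \<sigma> b \<in> LP"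
  using s by (auto simp: smooth_map_def)
 show "f \<in> Cinf Ar ==> (\<lambda>b. snd (\<sigma> b) f) \<in> Cinf Ob"
  using s Cinf_A_snd[of f] by (auto simp: smooth_map_def o_def)
qed

lemma lie_sectionsI:
 assumes "!!b. b \<in> pts Ob ==> \<sigma> b \<in> LP" "!!b. b \<in> pts Ob ==> fst (\<sigma> b) = un b"
  "!!f. f \<in> Cinf Ar ==> (\<lambda>b. snd (\<sigma> b) f) \<in> Cinf Ob"
 shows "\<sigma> \<in> lie_sections G"
 unfolding lie_sections_def
proof (intro CollectI conjI ballI assms(2) smooth_mapI[OF dOb] A_smoothI[OF dOb])
 fix b assume b: "b \<in> pts Ob"
 show "b \<in> pts Ob" by (rule b)
 show "eventually (\<lambda>b. \<sigma> b \<in> LP) (nh Ob b)"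
  by (rule ev_ptsI[OF assms(1)])
 show "smooth_at Ob b (\<lambda>b. snd (\<sigma> b) f)" if "f \<in> Cinf Ar" for f
  by (rule sm_Cinf[OF assms(3)[OF that] b])
 fix f assume f: "f \<in> Cinf Ar"
 have "smooth_at Ob b (\<lambda>b. f (un b))"
  using un_at[OF b] f by (simp add: smap_at_def)
 then show "smooth_at Ob b (\<lambda>b. f (fst (\<sigma> b)))"
  by (rule sm_cong[rotated]) (rule ev_ptsI, simp add: assms(2))
qed

lemma RI_section:
 assumes X: "X \<in> RI"
 shows "(\<lambda>b. (un b, X (un b))) \<in> lie_sections G"
proof (rule lie_sectionsI)
 show "(un b, X (un b)) \<in> LP" if "b \<in> pts Ob" for b by (rule RI_lie[OF X that])
 show "(\<lambda>b. snd (un b, X (un b)) f) \<in> Cinf Ob" if "f \<in> Cinf Ar" for f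
  using smaps(3) RI_D(2)[OF X that] by (auto simp: smooth_map_def o_def)
qed simp

text \<open>The vector over \<open>tg a\<close>, moved to a by right translation. By
  \<open>rix_eq\<close> every extension of the translated function yields the same value.\<close>

definition rix :: "('b => 'g \<times> 'g tvec) => 'g => 'g tvec" where
 "rix \<sigma> a f = (if a \<in> pts Ar \<and> f \<in> Cinf Ar then tv Ar (un (tg a)) (snd (\<sigma> (tg a)))
  (SOME f'. f' \<in> Cinf Ar \<and> (\<forall>g. (g, a) \<in> composable G --> f' g = f (mu g a))) else 0)"

context
 fixes \<sigma> assumes \<sigma>: "\<sigma> \<in> lie_sections G"
begin

lemma rix_eq:
 assumes a: "a \<in> pts Ar" and f: "f \<in> Cinf Ar" and k: "smooth_at Ar (un (tg a)) k"
  "eventually (\<lambda>g. sr g = tg a --> k g = f (mu g a)) (nh Ar (un (tg a)))"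
 shows "rix \<sigma> a f = tv Ar (un (tg a)) (snd (\<sigma> (tg a))) k"
proof -
 let ?f' = "SOME f'. f' \<in> Cinf Ar \<and> (\<forall>g. (g, a) \<in> composable G --> f' g = f (mu g a))"
 obtain f0 where "f0 \<in> Cinf Ar \<and> (\<forall>g. (g, a) \<in> composable G --> f0 g = f (mu g a))"
  using right_translate_global[OF a f] by blast
 then have f': "?f' \<in> Cinf Ar \<and> (\<forall>g. (g, a) \<in> composable G --> ?f' g = f (mu g a))"
  by (rule someI[where x = f0])
 have b: "tg a \<in> pts Ob" using a by simp
 note e = lie_sectionsD(2,3)[OF \<sigma> b]
 have "tv Ar (fst (\<sigma> (tg a))) (snd (\<sigma> (tg a))) ?f' = tv Ar (fst (\<sigma> (tg a))) (snd (\<sigma> (tg a))) k"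
 proof (rule lie_fibre[OF e(1)])
  show "smooth_at Ar (fst (\<sigma> (tg a))) ?f'"
   by (rule sm_Cinf) (use f' e(2) b in simp_all)
  show "smooth_at Ar (fst (\<sigma> (tg a))) k" using k(1) e(2) by simp
  show "eventually (\<lambda>q. sr q = sr (fst (\<sigma> (tg a))) --> ?f' q = k q) (nh Ar (fst (\<sigma> (tg a))))"
   using k(2) ev_nh_pts[of Ar "un (tg a)"] unfolding e(2)
  proof eventually_elim
   case (elim q)
   show ?case
   proof
    assume "sr q = sr (un (tg a))"
    then have s: "sr q = tg a" using b by simp
    then have "(q, a) \<in> composable G" using elim(2) a by (simp add: composable_iff)
    then show "?f' q = k q" using f' elim(1) s by simp
   qed
  qed
 qed
 then show ?thesis using a f e(2) by (simp add: rix_def)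
qed

lemma rix_unique:
 assumes a: "a \<in> pts Ar" and f: "f \<in> Cinf Ar" and f': "f' \<in> Cinf Ar" "!!g. (g, a) \<in> composable G ==> f' g = f (mu g a)"
 shows "rix \<sigma> a f = snd (\<sigma> (tg a)) f'"
proof -
 note e = lie_sectionsD(2,3)[OF \<sigma> tg_pts[OF a]]
 have t: "snd (\<sigma> (tg a)) \<in> TS Ar (un (tg a))" using lie_ptsD(4)[OF e(1)] e(2) by simp
 have up: "un (tg a) \<in> pts Ar" using a by simp
 have "rix \<sigma> a f = tv Ar (un (tg a)) (snd (\<sigma> (tg a))) f'"
  by (rule rix_eq[OF a f sm_Cinf[OF f'(1) up]])
   (rule ev_ptsI, use f'(2) a in "simp add: composable_iff")
 also have "\<dots> = snd (\<sigma> (tg a)) f'" by (rule tv_Cinf[OF dAr up t f'(1)])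
 finally show ?thesis .
qed

lemma rix_global:
 assumes a: "a \<in> pts Ar" and f: "f \<in> Cinf Ar"
 obtains f' where "f' \<in> Cinf Ar" "!!g. (g, a) \<in> composable G ==> f' g = f (mu g a)" "rix \<sigma> a f = snd (\<sigma> (tg a)) f'"
 using right_translate_global[OF a f] rix_unique[OF a f] by blast

lemma rix_tangent:
 assumes a: "a \<in> pts Ar"
 shows "rix \<sigma> a \<in> TS Ar a"
proof -
 note e = lie_sectionsD(2,3)[OF \<sigma> tg_pts[OF a]]
 have t: "snd (\<sigma> (tg a)) \<in> TS Ar (un (tg a))" using lie_ptsD(4)[OF e(1)] e(2) by simp
 show ?thesis
  unfolding tangent_space_def
 proof (intro CollectI conjI allI impI ballI)
  show "rix \<sigma> a f = 0" if "f \<notin> Cinf Ar" for f using that by (simp add: rix_def)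
  fix f assume f: "f \<in> Cinf Ar"
  obtain f' where f': "f' \<in> Cinf Ar" "!!g. (g, a) \<in> composable G ==> f' g = f (mu g a)" "rix \<sigma> a f = snd (\<sigma> (tg a)) f'"
   using rix_global[OF a f] by blast
  show "rix \<sigma> a (\<lambda>q. c * f q) = c * rix \<sigma> a f" for c
   using rix_unique[OF a Cinf_cmult[OF dAr f] Cinf_cmult[OF dAr f'(1)], of c c] f'(2,3) tvecD(3)[OF t f'(1), of c] by simp
  fix g assume g: "g \<in> Cinf Ar"
  obtain g' where g': "g' \<in> Cinf Ar" "!!q. (q, a) \<in> composable G ==> g' q = g (mu q a)" "rix \<sigma> a g = snd (\<sigma> (tg a)) g'"
   using rix_global[OF a g] by blast
  show "rix \<sigma> a (\<lambda>q. f q + g q) = rix \<sigma> a f + rix \<sigma> a g"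
   using rix_unique[OF a Cinf_add[OF dAr f g] Cinf_add[OF dAr f'(1) g'(1)]] f'(2,3) g'(2,3) tvecD(2)[OF t f'(1) g'(1)] by simp
  have "f' (un (tg a)) = f a" "g' (un (tg a)) = g a"
   using f'(2) g'(2) un_composable[OF a] mu_un(2)[OF a] by simp_all
  then show "rix \<sigma> a (\<lambda>q. f q * g q) = rix \<sigma> a f * g a + f a * rix \<sigma> a g"
   using rix_unique[OF a Cinf_mult[OF dAr f g] Cinf_mult[OF dAr f'(1) g'(1)]] f'(2,3) g'(2,3) tvecD(4)[OF t f'(1) g'(1)] by simp
 qed
qed

lemma rix_Cinf:
 assumes f: "f \<in> Cinf Ar"
 shows "(\<lambda>a. rix \<sigma> a f) \<in> Cinf Ar"
proof (rule CinfI[OF dAr])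
 fix a0 assume a0: "a0 \<in> pts Ar"
 obtain K where K: "smooth_at (prod_space Ar Ar) (a0, un (tg a0)) K"
  "eventually (\<lambda>a. \<forall>g. sr g = tg a --> K (a, g) = f (mu g a)) (nh Ar a0)"
  using right_translate_family[OF a0 f] by (elim exE conjE)
 have ut: "smap_at Ar Ar a0 (\<lambda>a. un (tg a))"
  by (rule smap_at_comp'[OF tg_at[OF a0] smaps(3)])
 have t: "snd (\<sigma> (tg a)) \<in> TS Ar (un (tg a))" if "a \<in> pts Ar" for a
  using lie_ptsD(4)[OF lie_sectionsD(2)[OF \<sigma>]] lie_sectionsD(3)[OF \<sigma>] tg_pts[OF that] by metis
 note tv = sm_tv[where a = "\<lambda>a. a" and v = "\<lambda>a. snd (\<sigma> (tg a))" and K = K, OF dAr dAr dAr smap_at_id[OF a0] ut K(1)]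
 have v: "eventually (\<lambda>a. snd (\<sigma> (tg a)) \<in> TS Ar (un (tg a))) (nh Ar a0)"
  by (rule ev_ptsI[OF t])
 have vs: "smooth_at Ar a0 (\<lambda>a. snd (\<sigma> (tg a)) u)" if "u \<in> Cinf Ar" for u
  by (rule sm_pull[OF tg_at[OF a0] sm_Cinf[OF lie_sectionsD(4)[OF \<sigma> that] tg_pts[OF a0]]])
 have "eventually (\<lambda>a. smooth_at Ar (un (tg a)) (\<lambda>z. K (a, z))) (nh Ar a0)" by (rule tv(2)[OF v vs])
 with K(2) ev_nh_pts[of Ar a0]
 have "eventually (\<lambda>a. tv Ar (un (tg a)) (snd (\<sigma> (tg a))) (\<lambda>z. K (a, z)) = rix \<sigma> a f) (nh Ar a0)"
 proof eventually_elim
  case (elim a)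
  have "rix \<sigma> a f = tv Ar (un (tg a)) (snd (\<sigma> (tg a))) (\<lambda>z. K (a, z))"
   by (rule rix_eq[OF elim(2) f elim(3)]) (rule always_eventually, use elim(1) in simp)
  then show ?case by simp
 qed
 then show "smooth_at Ar a0 (\<lambda>a. rix \<sigma> a f)" by (rule sm_cong[OF _ tv(1)[OF v vs]])
qed

lemma rix_un:
 assumes b: "b \<in> pts Ob"
 shows "rix \<sigma> (un b) = snd (\<sigma> b)"
proof (rule tangent_eqI)
 note e = lie_sectionsD(2,3)[OF \<sigma> b]
 show "rix \<sigma> (un b) \<in> TS Ar (un b)" by (rule rix_tangent) (use b in simp)
 show "snd (\<sigma> b) \<in> TS Ar (un b)" using lie_ptsD(4)[OF e(1)] e(2) by simp
 fix f assume f: "f \<in> Cinf Ar"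
 have "rix \<sigma> (un b) f = snd (\<sigma> (tg (un b))) f"
 proof (rule rix_unique[OF _ f f])
  show "f g = f (mu g (un b))" if "(g, un b) \<in> composable G" for g
   using that mu_un(1)[of g] b by (simp add: composable_iff)
 qed (use b in simp)
 then show "rix \<sigma> (un b) f = snd (\<sigma> b) f" using b by simp
qed

lemma rix_RI: "rix \<sigma> \<in> RI"
 unfolding RI_iff
proof (intro conjI ballI allI impI)
 show "rix \<sigma> a \<in> TS Ar a" if "a \<in> pts Ar" for a by (rule rix_tangent[OF that])
 show "(\<lambda>a. rix \<sigma> a f) \<in> Cinf Ar" if "f \<in> Cinf Ar" for f by (rule rix_Cinf[OF that])
 show "rix \<sigma> a = (\<lambda>f. 0)" if "a \<notin> pts Ar" for a using that by (simp add: rix_def[abs_def])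
 show "rix \<sigma> a (\<lambda>q. f (sr q)) = 0" if a: "a \<in> pts Ar" and f: "f \<in> Cinf Ob" for a f
 proof -
  have fs: "(\<lambda>q. f (sr q)) \<in> Cinf Ar" by (rule smooth_map_Cinf[OF smaps(1) f])
  note e = lie_sectionsD(2,3)[OF \<sigma> tg_pts[OF a]]
  have t: "snd (\<sigma> (tg a)) \<in> TS Ar (un (tg a))" using lie_ptsD(4)[OF e(1)] e(2) by simp
  have up: "un (tg a) \<in> pts Ar" using a by simp
  have "rix \<sigma> a (\<lambda>q. f (sr q)) = snd (\<sigma> (tg a)) (\<lambda>q. f (sr a))"
   by (rule rix_unique[OF a fs Cinf_const[OF dAr]]) simp
  also have "\<dots> = 0"
   using tv_const[OF dAr up t] tv_Cinf[OF dAr up t Cinf_const[OF dAr]] by simp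
  finally show ?thesis .
 qed
 fix a f f' g
 assume a: "a \<in> pts Ar" and f: "f \<in> Cinf Ar" and f': "f' \<in> Cinf Ar"
  and eq: "\<forall>g. (g, a) \<in> composable G --> f' g = f (mu g a)" and g: "(g, a) \<in> composable G"
 have gA: "g \<in> pts Ar" using g by (simp add: composable_iff)
 \<comment> \<open>Translating by g after a translation by a is translating by
   \<open>mu g a\<close>; so the extension f2 found for f' and g also serves f and
   \<open>mu g a\<close>.\<close>
 obtain f2 where f2: "f2 \<in> Cinf Ar" "!!q. (q, g) \<in> composable G ==> f2 q = f' (mu q g)" "rix \<sigma> g f' = snd (\<sigma> (tg g)) f2"
  using rix_global[OF gA f'] by blast
 have "rix \<sigma> (mu g a) f = snd (\<sigma> (tg (mu g a))) f2"
 proof (rule rix_unique[OF mu_pts[OF g] f f2(1)])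
  fix q assume q: "(q, mu g a) \<in> composable G"
  then have qg: "(q, g) \<in> composable G" using g gA by (simp add: composable_iff)
  then have "(mu q g, a) \<in> composable G" using g mu_pts[OF qg] sr_mu[OF qg] by (simp add: composable_iff)
  then show "f2 q = f (mu q (mu g a))" using f2(2)[OF qg] eq mu_assoc[OF qg g] by simp
 qed
 then show "rix \<sigma> g f' = rix \<sigma> (mu g a) f" using f2(3) tg_mu[OF g] by simp
qed

lemma right_invariant_extension_eq: "right_invariant_extension G \<sigma> = rix \<sigma>"
 unfolding right_invariant_extension_def
proof (rule the_equality)
 show "right_invariant G (rix \<sigma>) \<and> (\<forall>b\<in>pts Ob. rix \<sigma> (un b) = snd (\<sigma> b))"
  using rix_RI rix_un by (simp add: RI_def)
 show "X = rix \<sigma>" if "right_invariant G X \<and> (\<forall>b\<in>pts Ob. X (un b) = snd (\<sigma> b))" for X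
  by (rule RI_eqI[OF _ rix_RI]) (use that rix_un in "auto simp: RI_def")
qed

end

end

section \<open>Cartan calculus of Lie-Rinehart algebras\<close>

text \<open>Forms of all degrees are functions of lists of sections, so that contraction with a section
 is partial application and the Lie derivative and the differential are defined by recursion
 on the list, via Cartan's formulas \<open>[L X, i Y] = i [X, Y]\<close> and \<open>L Y = i Y d + d i Y\<close>.\<close>

definition ins :: "'x => ('x list => 'r) => 'x list => 'r" where
 "ins X W = (\<lambda>Ys. W (X # Ys))"

lemma ins_apply [simp]: "ins X W Ys = W (X # Ys)"
 by (simp add: ins_def)

definition bar :: "('x list => 'r::comm_ring_1) => 'x list => 'r" where
 "bar W = (\<lambda>Ys. (-1) ^ length Ys * W Ys)"

lemma bar_apply [simp]: "bar W Ys = (-1) ^ length Ys * W Ys"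
 by (simp add: bar_def)

text \<open>The exterior product, defined through the rule that contraction is an antiderivation;
  \<open>bar\<close> is the sign of the degree. The agreement with the sum over shuffles is
  \<open>wd_shuffles\<close>.\<close>

fun wd :: "('x list => 'r::comm_ring_1) => ('x list => 'r) => 'x list => 'r" where
 "wd W T [] = W [] * T []"
| "wd W T (Y # Ys) = wd (ins Y W) T Ys + wd (bar W) (ins Y T) Ys"

text \<open>The laws are relative to carriers C and L, because smooth functions and right-invariant
  fields are proper subsets of their types.\<close>

locale lie_rinehart =
 fixes C :: "'r::comm_ring_1 set" and L :: "'x::ab_group_add set"
  and D :: "'x => 'r => 'r" and br :: "'x => 'x => 'x" and sm :: "'r => 'x => 'x"
 assumes C_0: "0 \<in> C" and C_add: "f \<in> C ==> g \<in> C ==> f + g \<in> C" and C_mult: "f \<in> C ==> g \<in> C ==> f * g \<in> C"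
  and C_minus: "f \<in> C ==> - f \<in> C"
  and L_add: "X \<in> L ==> Y \<in> L ==> X + Y \<in> L" and L_minus: "X \<in> L ==> - X \<in> L"
  and L_br: "X \<in> L ==> Y \<in> L ==> br X Y \<in> L" and L_sm: "f \<in> C ==> X \<in> L ==> sm f X \<in> L"
  and D_C: "X \<in> L ==> f \<in> C ==> D X f \<in> C"
  and D_add: "X \<in> L ==> f \<in> C ==> g \<in> C ==> D X (f + g) = D X f + D X g"
  and D_mult: "X \<in> L ==> f \<in> C ==> g \<in> C ==> D X (f * g) = D X f * g + f * D X g"
  and D_plus: "X \<in> L ==> Y \<in> L ==> f \<in> C ==> D (X + Y) f = D X f + D Y f"
  and D_sm: "X \<in> L ==> f \<in> C ==> g \<in> C ==> D (sm f X) g = f * D X g"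
  and D_br: "X \<in> L ==> Y \<in> L ==> f \<in> C ==> D (br X Y) f = D X (D Y f) - D Y (D X f)"
  and br_plus: "X \<in> L ==> Y \<in> L ==> Z \<in> L ==> br X (Y + Z) = br X Y + br X Z"
  and br_anti: "X \<in> L ==> Y \<in> L ==> br X Y = - br Y X"
  and br_self: "X \<in> L ==> br X X = 0"
  and br_sm: "X \<in> L ==> Y \<in> L ==> f \<in> C ==> br X (sm f Y) = sm f (br X Y) + sm (D X f) Y"
  and jacobi: "X \<in> L ==> Y \<in> L ==> Z \<in> L ==> br X (br Y Z) = br (br X Y) Z + br Y (br X Z)"
begin

lemma D_0: "X \<in> L ==> D X 0 = 0"
 using D_add[OF _ C_0 C_0, of X] by simp

lemma D_minus: "X \<in> L ==> f \<in> C ==> D X (- f) = - D X f"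
 using D_add[of X f "- f"] C_minus D_0 by (simp add: eq_neg_iff_add_eq_0 add.commute)

lemma C_diff: "f \<in> C ==> g \<in> C ==> f - g \<in> C"
 using C_add[of f "- g"] C_minus by simp

lemma D_diff: "X \<in> L ==> f \<in> C ==> g \<in> C ==> D X (f - g) = D X f - D X g"
 using D_add[of X f "- g"] D_minus[of X g] C_minus by simp

definition cochain :: "('x list => 'r) => bool" where
 "cochain W \<longleftrightarrow> (\<forall>Xs. set Xs \<subseteq> L --> W Xs \<in> C)"

text \<open>Alternation is demanded for neighbouring arguments, the shape that induction along the
  list can deliver; \<open>form_not_distinct\<close> gives the general case.\<close>

definition form :: "('x list => 'r) => bool" where
 "form W \<longleftrightarrow> cochain W \<and>
  (\<forall>Xs Ys A B. set Xs \<subseteq> L \<and> set Ys \<subseteq> L \<and> A \<in> L \<and> B \<in> L --> W (Xs @ (A + B) # Ys) = W (Xs @ A # Ys) + W (Xs @ B # Ys)) \<and>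
  (\<forall>Xs Ys A f. set Xs \<subseteq> L \<and> set Ys \<subseteq> L \<and> A \<in> L \<and> f \<in> C --> W (Xs @ sm f A # Ys) = f * W (Xs @ A # Ys)) \<and>
  (\<forall>Xs Ys A. set Xs \<subseteq> L \<and> set Ys \<subseteq> L \<and> A \<in> L --> W (Xs @ A # A # Ys) = 0)"

lemma cochainD: "cochain W ==> set Xs \<subseteq> L ==> W Xs \<in> C"
 by (simp add: cochain_def)

lemma formD:
 assumes "form W"
 shows "cochain W"
  "set Xs \<subseteq> L ==> set Ys \<subseteq> L ==> A \<in> L ==> B \<in> L ==> W (Xs @ (A + B) # Ys) = W (Xs @ A # Ys) + W (Xs @ B # Ys)"
  "set Xs \<subseteq> L ==> set Ys \<subseteq> L ==> A \<in> L ==> f \<in> C ==> W (Xs @ sm f A # Ys) = f * W (Xs @ A # Ys)"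
  "set Xs \<subseteq> L ==> set Ys \<subseteq> L ==> A \<in> L ==> W (Xs @ A # A # Ys) = 0"
 using assms unfolding form_def by blast+

lemma formI:
 assumes "cochain W"
  "!!Xs Ys A B. set Xs \<subseteq> L ==> set Ys \<subseteq> L ==> A \<in> L ==> B \<in> L ==> W (Xs @ (A + B) # Ys) = W (Xs @ A # Ys) + W (Xs @ B # Ys)"
  "!!Xs Ys A f. set Xs \<subseteq> L ==> set Ys \<subseteq> L ==> A \<in> L ==> f \<in> C ==> W (Xs @ sm f A # Ys) = f * W (Xs @ A # Ys)"
  "!!Xs Ys A. set Xs \<subseteq> L ==> set Ys \<subseteq> L ==> A \<in> L ==> W (Xs @ A # A # Ys) = 0"
 shows "form W"
 using assms unfolding form_def by blast

lemma form_hd: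
 assumes "form W" "set Ys \<subseteq> L"
 shows "A \<in> L ==> B \<in> L ==> W ((A + B) # Ys) = W (A # Ys) + W (B # Ys)"
  "A \<in> L ==> f \<in> C ==> W (sm f A # Ys) = f * W (A # Ys)"
  "A \<in> L ==> W (A # A # Ys) = 0"
 using formD(2)[OF assms(1), of "[]" Ys A B] formD(3)[OF assms(1), of "[]" Ys A f]
  formD(4)[OF assms(1), of "[]" Ys A] assms(2) by simp_all

lemma form_zero: 
 assumes "form W" "set Ys \<subseteq> L" "A \<in> L"
 shows "W (0 # Ys) = 0"
proof -
 have 0: "0 \<in> L" using L_add[OF assms(3) L_minus[OF assms(3)]] by simp
 show ?thesis using form_hd(1)[OF assms(1,2) 0 0] by simp
qed

lemma form_minus:
 assumes "form W" "set Ys \<subseteq> L" "A \<in> L"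
 shows "W ((- A) # Ys) = - W (A # Ys)"
 using form_hd(1)[OF assms L_minus[OF assms(3)]] form_zero[OF assms]
 by (simp add: eq_neg_iff_add_eq_0 add.commute)

lemma form_swap:
 assumes "form W" "set Ys \<subseteq> L" "A \<in> L" "B \<in> L"
 shows "W (A # B # Ys) = - W (B # A # Ys)"
proof -
 have "W ((A + B) # (A + B) # Ys) = 0"
  by (rule form_hd(3)[OF assms(1,2) L_add[OF assms(3,4)]])
 moreover have "W ((A + B) # (A + B) # Ys) = W (A # (A + B) # Ys) + W (B # (A + B) # Ys)"
  by (rule form_hd(1)) (use assms L_add in auto)
 moreover have "W (Z # (A + B) # Ys) = W (Z # A # Ys) + W (Z # B # Ys)" if "Z \<in> L" for Z
  using formD(2)[OF assms(1), of "[Z]" Ys A B] assms that by simp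
 ultimately show ?thesis
  using form_hd(3)[OF assms(1,2,3)] form_hd(3)[OF assms(1,2,4)] assms(3,4)
  by (simp add: eq_neg_iff_add_eq_0)
qed

lemma cochain_ins: "cochain W ==> X \<in> L ==> cochain (ins X W)"
 by (simp add: cochain_def)

lemma form_ins:
 assumes "form W" "X \<in> L"
 shows "form (ins X W)"
proof (rule formI)
 fix Xs Ys A B f assume *: "set Xs \<subseteq> L" "set Ys \<subseteq> L" "A \<in> L"
 show "ins X W (Xs @ (A + B) # Ys) = ins X W (Xs @ A # Ys) + ins X W (Xs @ B # Ys)" if "B \<in> L"
  using formD(2)[OF assms(1), of "X # Xs"] * that assms(2) by simp
 show "ins X W (Xs @ sm f A # Ys) = f * ins X W (Xs @ A # Ys)" if "f \<in> C"
  using formD(3)[OF assms(1), of "X # Xs"] * that assms(2) by simp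
 show "ins X W (Xs @ A # A # Ys) = 0"
  using formD(4)[OF assms(1), of "X # Xs"] * assms(2) by simp
qed (rule cochain_ins[OF formD(1)[OF assms(1)] assms(2)])

fun Lie :: "'x => ('x list => 'r) => 'x list => 'r" where
 "Lie X W [] = D X (W [])"
| "Lie X W (Y # Ys) = Lie X (ins Y W) Ys - W (br X Y # Ys)"

fun ed :: "('x list => 'r) => 'x list => 'r" where
 "ed W [] = 0"
| "ed W (Y # Ys) = Lie Y W Ys - ed (ins Y W) Ys"

lemma Lie_cong:
 assumes "X \<in> L"
 shows "set Ys \<subseteq> L ==> (!!Zs. set Zs \<subseteq> L ==> length Zs = length Ys ==> W Zs = T Zs) ==> Lie X W Ys = Lie X T Ys"
proof (induction Ys arbitrary: W T)
 case (Cons Y Ys)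
 have "Lie X (ins Y W) Ys = Lie X (ins Y T) Ys"
  by (rule Cons.IH) (use Cons.prems in auto)
 then show ?case using Cons.prems L_br[OF assms, of Y] by simp
qed simp

text \<open>The differential on a list sees only lists shorter by one. So a factor that depends on
  the degree can be treated as a constant, and the parity of the homological vector field can be
  read off.\<close>

lemma ed_cong:
 "set Ys \<subseteq> L ==> (!!Zs. set Zs \<subseteq> L ==> Suc (length Zs) = length Ys ==> W Zs = T Zs) ==> ed W Ys = ed T Ys"
proof (induction Ys arbitrary: W T)
 case (Cons Y Ys)
 have "ed (ins Y W) Ys = ed (ins Y T) Ys"
  by (rule Cons.IH) (use Cons.prems in auto)
 moreover have "Lie Y W Ys = Lie Y T Ys"
  by (rule Lie_cong) (use Cons.prems in auto)
 ultimately show ?case by simp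
qed simp

lemma Lie_C: "X \<in> L ==> cochain W ==> set Ys \<subseteq> L ==> Lie X W Ys \<in> C"
proof (induction Ys arbitrary: W)
 case Nil
 then show ?case by (simp add: D_C cochain_def)
next
 case (Cons Y Ys)
 then have "Lie X (ins Y W) Ys \<in> C" by (intro Cons.IH cochain_ins) auto
 then show ?case using Cons.prems L_br[of X Y] by (auto intro!: C_diff cochainD[of W])
qed

lemma cochain_Lie: "X \<in> L ==> cochain W ==> cochain (Lie X W)"
 using Lie_C by (simp add: cochain_def)

lemma cochain_ed: "cochain W ==> cochain (ed W)"
proof -
 have "set Ys \<subseteq> L ==> cochain W ==> ed W Ys \<in> C" for Ys
 proof (induction Ys arbitrary: W)
  case (Cons Y Ys)
  then show ?case using Lie_C[of Y W Ys] cochain_ins[of W Y] by (auto intro!: C_diff)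
 qed (simp add: C_0)
 then show "cochain W ==> cochain (ed W)" by (simp add: cochain_def)
qed

lemma Lie_smult:
 "X \<in> L ==> cochain W ==> f \<in> C ==> set Ys \<subseteq> L ==> Lie X (\<lambda>Zs. f * W Zs) Ys = f * Lie X W Ys + D X f * W Ys"
proof (induction Ys arbitrary: W)
 case Nil
 then show ?case by (simp add: D_mult cochain_def)
next
 case (Cons Y Ys)
 have "Lie X (\<lambda>Zs. f * ins Y W Zs) Ys = f * Lie X (ins Y W) Ys + D X f * ins Y W Ys"
  by (rule Cons.IH; (rule cochain_ins)?; use Cons.prems in simp)
 moreover have "ins Y (\<lambda>Zs. f * W Zs) = (\<lambda>Zs. f * ins Y W Zs)" by (simp add: ins_def)
 ultimately show ?case by (simp add: algebra_simps)
qed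

lemma cochain_neg: "cochain W ==> cochain (\<lambda>Zs. - W Zs)"
 and cochain_add: "cochain W ==> cochain T ==> cochain (\<lambda>Zs. W Zs + T Zs)"
 and cochain_smult: "cochain W ==> f \<in> C ==> cochain (\<lambda>Zs. f * W Zs)"
 by (simp_all add: cochain_def C_minus C_add C_diff C_mult)

lemma Lie_diff:
 "X \<in> L ==> cochain W ==> cochain T ==> set Ys \<subseteq> L ==> Lie X (\<lambda>Zs. W Zs - T Zs) Ys = Lie X W Ys - Lie X T Ys"
proof (induction Ys arbitrary: W T)
 case Nil
 then show ?case by (simp add: D_diff cochain_def)
next
 case (Cons Y Ys)
 have "Lie X (\<lambda>Zs. ins Y W Zs - ins Y T Zs) Ys = Lie X (ins Y W) Ys - Lie X (ins Y T) Ys"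
  by (rule Cons.IH; (rule cochain_ins)?; use Cons.prems in simp)
 moreover have "ins Y (\<lambda>Zs. W Zs - T Zs) = (\<lambda>Zs. ins Y W Zs - ins Y T Zs)" by (simp add: ins_def)
 ultimately show ?case by simp
qed

lemma cochain_0: "cochain (\<lambda>Zs. 0)"
 by (simp add: cochain_def C_0)

lemma Lie_0: "X \<in> L ==> set Ys \<subseteq> L ==> Lie X (\<lambda>Zs. 0) Ys = 0"
 using Lie_diff[OF _ cochain_0 cochain_0, of X Ys] by simp

lemma Lie_neg: "X \<in> L ==> cochain W ==> set Ys \<subseteq> L ==> Lie X (\<lambda>Zs. - W Zs) Ys = - Lie X W Ys"
 using Lie_diff[OF _ cochain_0, of X W Ys] Lie_0[of X Ys] by simp

lemma Lie_add:
 "X \<in> L ==> cochain W ==> cochain T ==> set Ys \<subseteq> L ==> Lie X (\<lambda>Zs. W Zs + T Zs) Ys = Lie X W Ys + Lie X T Ys"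
 using Lie_diff[of X W "\<lambda>Zs. - T Zs" Ys] Lie_neg[of X T Ys] cochain_neg[of T] by simp

lemma ed_diff:
 "cochain W ==> cochain T ==> set Ys \<subseteq> L ==> ed (\<lambda>Zs. W Zs - T Zs) Ys = ed W Ys - ed T Ys"
proof (induction Ys arbitrary: W T)
 case (Cons Y Ys)
 have "ed (\<lambda>Zs. ins Y W Zs - ins Y T Zs) Ys = ed (ins Y W) Ys - ed (ins Y T) Ys"
  by (rule Cons.IH; (rule cochain_ins)?; use Cons.prems in simp)
 moreover have "ins Y (\<lambda>Zs. W Zs - T Zs) = (\<lambda>Zs. ins Y W Zs - ins Y T Zs)" by (simp add: ins_def)
 ultimately show ?case using Lie_diff[of Y W T Ys] Cons.prems by simp
qed simp

lemma ed_0: "set Ys \<subseteq> L ==> ed (\<lambda>Zs. 0) Ys = 0"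
 using ed_diff[OF cochain_0 cochain_0, of Ys] by simp

lemma ed_neg: "cochain W ==> set Ys \<subseteq> L ==> ed (\<lambda>Zs. - W Zs) Ys = - ed W Ys"
 using ed_diff[OF cochain_0, of W Ys] ed_0[of Ys] by simp

lemma ed_add:
 "cochain W ==> cochain T ==> set Ys \<subseteq> L ==> ed (\<lambda>Zs. W Zs + T Zs) Ys = ed W Ys + ed T Ys"
 using ed_diff[of W "\<lambda>Zs. - T Zs" Ys] ed_neg[of T Ys] cochain_neg[of T] by simp

lemma form_Lie:
 assumes "form W" "X \<in> L"
 shows "form (Lie X W)"
proof (rule formI)
 show "cochain (Lie X W)" by (rule cochain_Lie[OF assms(2) formD(1)[OF assms(1)]])
 fix Xs Ys A B f assume Ys: "set Ys \<subseteq> L" and A: "A \<in> L" and "set Xs \<subseteq> L"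
 then show "Lie X W (Xs @ (A + B) # Ys) = Lie X W (Xs @ A # Ys) + Lie X W (Xs @ B # Ys)" if B: "B \<in> L"
  using assms(1)
 proof (induction Xs arbitrary: W)
  case Nil
  note c = cochain_ins[OF formD(1)[OF Nil(4)]]
  have "Lie X (ins (A + B) W) Ys = Lie X (\<lambda>Zs. ins A W Zs + ins B W Zs) Ys"
   by (rule Lie_cong[OF assms(2) Ys]) (simp add: form_hd(1)[OF Nil(4) _ A B])
  also have "\<dots> = Lie X (ins A W) Ys + Lie X (ins B W) Ys"
   by (rule Lie_add[OF assms(2) c[OF A] c[OF B] Ys])
  finally show ?case
   using form_hd(1)[OF Nil(4) Ys L_br[OF assms(2) A] L_br[OF assms(2) B]] br_plus[OF assms(2) A B] by simp
 next
  case (Cons Z Xs)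
  have Z: "Z \<in> L" "set Xs \<subseteq> L" using Cons.prems by auto
  have "Lie X (ins Z W) (Xs @ (A + B) # Ys) = Lie X (ins Z W) (Xs @ A # Ys) + Lie X (ins Z W) (Xs @ B # Ys)"
   by (rule Cons.IH[OF Ys A Z(2) form_ins[OF Cons.prems(4) Z(1)]])
  then show ?case
   using formD(2)[OF Cons.prems(4), of "br X Z # Xs" Ys A B] L_br[OF assms(2) Z(1)] Z Ys A B by simp
 qed
 from \<open>set Ys \<subseteq> L\<close> \<open>A \<in> L\<close> \<open>set Xs \<subseteq> L\<close>
 show "Lie X W (Xs @ sm f A # Ys) = f * Lie X W (Xs @ A # Ys)" if f: "f \<in> C"
  using assms(1)
 proof (induction Xs arbitrary: W)
  case Nil
  have "Lie X (ins (sm f A) W) Ys = Lie X (\<lambda>Zs. f * ins A W Zs) Ys"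
   by (rule Lie_cong[OF assms(2) Ys]) (simp add: form_hd(2)[OF Nil(4) _ A f])
  also have "\<dots> = f * Lie X (ins A W) Ys + D X f * ins A W Ys"
   by (rule Lie_smult[OF assms(2) cochain_ins[OF formD(1)[OF Nil(4)] A] f Ys])
  finally have 1: "Lie X (ins (sm f A) W) Ys = f * Lie X (ins A W) Ys + D X f * W (A # Ys)" by simp
  \<comment> \<open>The bracket contributes the same term \<open>D X f * W (A # Ys)\<close> as the
    Leibniz rule above, and the two cancel.\<close>
  have "W (br X (sm f A) # Ys) = W (sm f (br X A) # Ys) + W (sm (D X f) A # Ys)"
   unfolding br_sm[OF assms(2) A f]
   by (rule form_hd(1)[OF Nil(4) Ys]) (use L_sm L_br D_C assms(2) A f in auto)
  also have "\<dots> = f * W (br X A # Ys) + D X f * W (A # Ys)"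
   using form_hd(2)[OF Nil(4) Ys L_br[OF assms(2) A] f] form_hd(2)[OF Nil(4) Ys A D_C[OF assms(2) f]] by simp
  finally show ?case using 1 by (simp add: algebra_simps)
 next
  case (Cons Z Xs)
  have Z: "Z \<in> L" "set Xs \<subseteq> L" using Cons.prems by auto
  have "Lie X (ins Z W) (Xs @ sm f A # Ys) = f * Lie X (ins Z W) (Xs @ A # Ys)"
   by (rule Cons.IH[OF Ys A Z(2) form_ins[OF Cons.prems(4) Z(1)]])
  then show ?case
   using formD(3)[OF Cons.prems(4), of "br X Z # Xs" Ys A f] L_br[OF assms(2) Z(1)] Z Ys A f
   by (simp add: algebra_simps)
 qed
 from \<open>set Ys \<subseteq> L\<close> \<open>A \<in> L\<close> \<open>set Xs \<subseteq> L\<close>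
 show "Lie X W (Xs @ A # A # Ys) = 0"
  using assms(1)
 proof (induction Xs arbitrary: W)
  case Nil
  have "Lie X (ins A (ins A W)) Ys = Lie X (\<lambda>Zs. 0) Ys"
   by (rule Lie_cong[OF assms(2) Ys]) (simp add: form_hd(3)[OF Nil(4) _ A])
  then show ?case
   using Lie_0[OF assms(2) Ys] form_swap[OF Nil(4) Ys A L_br[OF assms(2) A]] by simp
 next
  case (Cons Z Xs)
  have Z: "Z \<in> L" "set Xs \<subseteq> L" using Cons.prems by auto
  have "Lie X (ins Z W) (Xs @ A # A # Ys) = 0"
   by (rule Cons.IH[OF Ys A Z(2) form_ins[OF Cons.prems(4) Z(1)]])
  then show ?case
   using formD(4)[OF Cons.prems(4), of "br X Z # Xs" Ys A] L_br[OF assms(2) Z(1)] Z Ys A by simp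
 qed
qed

text \<open>The two expressions for the wedge product of the differential of f with a form which arise
 from the failure of function linearity of \<open>L X\<close> and of the differential.\<close>

fun TT :: "'r => 'x => ('x list => 'r) => 'x list => 'r" where
 "TT f X W [] = 0"
| "TT f X W (Y # Ys) = TT f X (ins Y W) Ys + D Y f * W (X # Ys)"

fun SS :: "'r => ('x list => 'r) => 'x list => 'r" where
 "SS f W [] = 0"
| "SS f W (Y # Ys) = D Y f * W Ys - SS f (ins Y W) Ys"

lemma SS_neg: "set Ys \<subseteq> L ==> (!!Zs. set Zs \<subseteq> L ==> W Zs = - T Zs) ==> SS f W Ys = - SS f T Ys"
proof (induction Ys arbitrary: W T)
 case (Cons Y Ys)
 have "SS f (ins Y W) Ys = - SS f (ins Y T) Ys"
  by (rule Cons.IH) (use Cons.prems in auto)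
 then show ?case using Cons.prems by simp
qed simp

text \<open>Exchanging X with the next argument of the form produces the alternating signs of
  SS.\<close>

lemma TT_SS: "form W ==> X \<in> L ==> set Ys \<subseteq> L ==> TT f X W Ys = SS f (ins X W) Ys"
proof (induction Ys arbitrary: W)
 case (Cons Y Ys)
 have Y: "Y \<in> L" "set Ys \<subseteq> L" using Cons.prems by auto
 have "TT f X (ins Y W) Ys = SS f (ins X (ins Y W)) Ys"
  by (rule Cons.IH[OF form_ins[OF Cons.prems(1) Y(1)] Cons.prems(2) Y(2)])
 also have "\<dots> = - SS f (ins Y (ins X W)) Ys"
  by (rule SS_neg[OF Y(2)]) (simp add: form_swap[OF Cons.prems(1) _ Y(1) Cons.prems(2)])
 finally show ?case
  using SS.simps(2)[of f "ins X W" Y Ys] ins_apply[of X W Ys] by (simp del: ins_apply SS.simps)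
qed simp

lemma Lie_sm:
 "form W ==> X \<in> L ==> f \<in> C ==> set Ys \<subseteq> L ==> Lie (sm f X) W Ys = f * Lie X W Ys + TT f X W Ys"
proof (induction Ys arbitrary: W)
 case Nil
 then show ?case by (simp add: D_sm formD(1) cochainD)
next
 case (Cons Y Ys)
 have Y: "Y \<in> L" "set Ys \<subseteq> L" using Cons.prems by auto
 have f: "f \<in> C" "X \<in> L" using Cons.prems by auto
 note W = Cons.prems(1)
 have IH: "Lie (sm f X) (ins Y W) Ys = f * Lie X (ins Y W) Ys + TT f X (ins Y W) Ys"
  by (rule Cons.IH[OF form_ins[OF W Y(1)] f(2,1) Y(2)])
 have "W (br (sm f X) Y # Ys) = - W (br Y (sm f X) # Ys)"
  using form_minus[OF W Y(2) L_br[OF Y(1) L_sm[OF f]]] br_anti[OF L_sm[OF f] Y(1)] by simp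
 also have "W (br Y (sm f X) # Ys) = W (sm f (br Y X) # Ys) + W (sm (D Y f) X # Ys)"
  unfolding br_sm[OF Y(1) f(2,1)]
  by (rule form_hd(1)[OF W Y(2)]) (use L_sm L_br D_C Y f in auto)
 also have "W (sm f (br Y X) # Ys) = f * W (br Y X # Ys)"
  by (rule form_hd(2)[OF W Y(2) L_br[OF Y(1) f(2)] f(1)])
 also have "W (br Y X # Ys) = - W (br X Y # Ys)"
  using form_minus[OF W Y(2) L_br[OF f(2) Y(1)]] br_anti[OF Y(1) f(2)] by simp
 also have "W (sm (D Y f) X # Ys) = D Y f * W (X # Ys)"
  by (rule form_hd(2)[OF W Y(2) f(2) D_C[OF Y(1) f(1)]])
 finally show ?case using IH by (simp add: algebra_simps)
qed

lemma ed_smult: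
 "cochain W ==> f \<in> C ==> set Ys \<subseteq> L ==> ed (\<lambda>Zs. f * W Zs) Ys = f * ed W Ys + SS f W Ys"
proof (induction Ys arbitrary: W)
 case (Cons Y Ys)
 have Y: "Y \<in> L" "set Ys \<subseteq> L" using Cons.prems by auto
 have "ed (\<lambda>Zs. f * ins Y W Zs) Ys = f * ed (ins Y W) Ys + SS f (ins Y W) Ys"
  by (rule Cons.IH[OF cochain_ins[OF Cons.prems(1) Y(1)] Cons.prems(2) Y(2)])
 moreover have "ins Y (\<lambda>Zs. f * W Zs) = (\<lambda>Zs. f * ins Y W Zs)" by (simp add: ins_def)
 ultimately show ?case
  using Lie_smult[OF Y(1) Cons.prems(1,2) Y(2)] by (simp add: algebra_simps)
qed simp

text \<open>The defect \<open>SS\<close> involves only the derivatives of k. In the application k is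
  a real constant.\<close>

lemma ed_const:
 assumes "!!X. X \<in> L ==> D X k = 0" "k \<in> C" "cochain W" "set Ys \<subseteq> L"
 shows "ed (\<lambda>Zs. k * W Zs) Ys = k * ed W Ys"
proof -
 have "set Ys \<subseteq> L ==> SS k W Ys = 0" for Ys W
  by (induction Ys arbitrary: W) (simp_all add: assms(1))
 then show ?thesis using ed_smult[OF assms(3,2,4)] assms(4) by simp
qed

lemma Lie_plus:
 "form W ==> X \<in> L ==> X' \<in> L ==> set Ys \<subseteq> L ==> Lie (X + X') W Ys = Lie X W Ys + Lie X' W Ys"
proof (induction Ys arbitrary: W)
 case Nil
 then show ?case by (simp add: D_plus formD(1) cochainD)
next
 case (Cons Y Ys)
 have Y: "Y \<in> L" "set Ys \<subseteq> L" and X: "X \<in> L" "X' \<in> L" and W: "form W" using Cons.prems by auto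
 have "br (X + X') Y = br X Y + br X' Y"
  using br_anti[OF L_add[OF X] Y(1)] br_plus[OF Y(1) X] br_anti[OF X(1) Y(1)] br_anti[OF X(2) Y(1)] by simp
 then have "W (br (X + X') Y # Ys) = W (br X Y # Ys) + W (br X' Y # Ys)"
  using form_hd(1)[OF W Y(2) L_br[OF X(1) Y(1)] L_br[OF X(2) Y(1)]] by simp
 then show ?case using Cons.IH[OF form_ins[OF W Y(1)] X Y(2)] by (simp del: ins_apply add: algebra_simps)
qed

lemma form_ed:
 assumes "form W"
 shows "form (ed W)"
proof (rule formI)
 show "cochain (ed W)" by (rule cochain_ed[OF formD(1)[OF assms(1)]])
 fix Xs Ys A B f assume Ys: "set Ys \<subseteq> L" and A: "A \<in> L" and "set Xs \<subseteq> L"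
 then show "ed W (Xs @ (A + B) # Ys) = ed W (Xs @ A # Ys) + ed W (Xs @ B # Ys)" if B: "B \<in> L"
  using assms(1)
 proof (induction Xs arbitrary: W)
  case Nil
  note c = cochain_ins[OF formD(1)[OF Nil(4)]]
  have "ed (ins (A + B) W) Ys = ed (\<lambda>Zs. ins A W Zs + ins B W Zs) Ys"
   by (rule ed_cong[OF Ys]) (simp add: form_hd(1)[OF Nil(4) _ A B])
  also have "\<dots> = ed (ins A W) Ys + ed (ins B W) Ys"
   by (rule ed_add[OF c[OF A] c[OF B] Ys])
  finally show ?case using Lie_plus[OF Nil(4) A B Ys] by simp
 next
  case (Cons Z Xs)
  have Z: "Z \<in> L" "set Xs \<subseteq> L" using Cons.prems by auto
  have "ed (ins Z W) (Xs @ (A + B) # Ys) = ed (ins Z W) (Xs @ A # Ys) + ed (ins Z W) (Xs @ B # Ys)"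
   by (rule Cons.IH[OF Ys A Z(2) form_ins[OF Cons.prems(4) Z(1)]])
  then show ?case
   using formD(2)[OF form_Lie[OF Cons.prems(4) Z(1)] Z(2) Ys A B] by simp
 qed
 from \<open>set Ys \<subseteq> L\<close> \<open>A \<in> L\<close> \<open>set Xs \<subseteq> L\<close>
 show "ed W (Xs @ sm f A # Ys) = f * ed W (Xs @ A # Ys)" if f: "f \<in> C"
  using assms(1)
 proof (induction Xs arbitrary: W)
  case Nil
  have "ed (ins (sm f A) W) Ys = ed (\<lambda>Zs. f * ins A W Zs) Ys"
   by (rule ed_cong[OF Ys]) (simp add: form_hd(2)[OF Nil(4) _ A f])
  also have "\<dots> = f * ed (ins A W) Ys + SS f (ins A W) Ys"
   by (rule ed_smult[OF cochain_ins[OF formD(1)[OF Nil(4)] A] f Ys])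
  \<comment> \<open>The defects of function linearity in \<open>Lie_sm\<close> and
    \<open>ed_smult\<close> cancel by \<open>TT_SS\<close>.\<close>
  finally show ?case
   using Lie_sm[OF Nil(4) A f Ys] TT_SS[OF Nil(4) A Ys, of f] by (simp add: algebra_simps)
 next
  case (Cons Z Xs)
  have Z: "Z \<in> L" "set Xs \<subseteq> L" using Cons.prems by auto
  have "ed (ins Z W) (Xs @ sm f A # Ys) = f * ed (ins Z W) (Xs @ A # Ys)"
   by (rule Cons.IH[OF Ys A Z(2) form_ins[OF Cons.prems(4) Z(1)]])
  then show ?case
   using formD(3)[OF form_Lie[OF Cons.prems(4) Z(1)] Z(2) Ys A f] by (simp add: algebra_simps)
 qed
 from \<open>set Ys \<subseteq> L\<close> \<open>A \<in> L\<close> \<open>set Xs \<subseteq> L\<close>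
 show "ed W (Xs @ A # A # Ys) = 0"
  using assms(1)
 proof (induction Xs arbitrary: W)
  case Nil
  have "ed (ins A (ins A W)) Ys = ed (\<lambda>Zs. 0) Ys"
   by (rule ed_cong[OF Ys]) (simp add: form_hd(3)[OF Nil(4) _ A])
  then show ?case
   using ed_0[OF Ys] form_zero[OF Nil(4) Ys A] br_self[OF A] by simp
 next
  case (Cons Z Xs)
  have Z: "Z \<in> L" "set Xs \<subseteq> L" using Cons.prems by auto
  have "ed (ins Z W) (Xs @ A # A # Ys) = 0"
   by (rule Cons.IH[OF Ys A Z(2) form_ins[OF Cons.prems(4) Z(1)]])
  then show ?case
   using formD(4)[OF form_Lie[OF Cons.prems(4) Z(1)] Z(2) Ys A] by simp
 qed
qed

text \<open>In the expansion of the two iterated derivatives the mixed terms are symmetric in X and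
  Y and drop out; the double brackets match by the Jacobi identity.\<close>

lemma Lie_br:
 "form W ==> X \<in> L ==> Y \<in> L ==> set Zs \<subseteq> L ==>
  Lie (br X Y) W Zs = Lie X (Lie Y W) Zs - Lie Y (Lie X W) Zs"
proof (induction Zs arbitrary: W)
 case Nil
 then show ?case by (simp add: D_br formD(1) cochainD)
next
 case (Cons Z Zs)
 have Z: "Z \<in> L" "set Zs \<subseteq> L" and X: "X \<in> L" "Y \<in> L" and W: "form W" using Cons.prems by auto
 have expand: "Lie P (Lie Q W) (Z # Zs) =
   Lie P (Lie Q (ins Z W)) Zs - Lie P (ins (br Q Z) W) Zs - Lie Q (ins (br P Z) W) Zs + W (br Q (br P Z) # Zs)"
  if P: "P \<in> L" "Q \<in> L" for P Q
 proof -
  have c: "cochain (Lie Q (ins Z W))" "cochain (ins (br Q Z) W)"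
   using cochain_Lie[OF P(2) cochain_ins[OF formD(1)[OF W] Z(1)]] cochain_ins[OF formD(1)[OF W] L_br[OF P(2) Z(1)]] .
  have "ins Z (Lie Q W) = (\<lambda>Us. Lie Q (ins Z W) Us - ins (br Q Z) W Us)"
   by (simp add: ins_def)
  then have "Lie P (ins Z (Lie Q W)) Zs = Lie P (Lie Q (ins Z W)) Zs - Lie P (ins (br Q Z) W) Zs"
   using Lie_diff[OF P(1) c Z(2)] by simp
  then show ?thesis by simp
 qed
 have IH: "Lie (br X Y) (ins Z W) Zs = Lie X (Lie Y (ins Z W)) Zs - Lie Y (Lie X (ins Z W)) Zs"
  by (rule Cons.IH[OF form_ins[OF W Z(1)] X Z(2)])
 have "W (br X (br Y Z) # Zs) = W (br (br X Y) Z # Zs) + W (br Y (br X Z) # Zs)"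
  unfolding jacobi[OF X Z(1)] by (rule form_hd(1)[OF W Z(2)]) (use L_br X Z in auto)
 then show ?case
  unfolding expand[OF X] expand[OF X(2,1)] Lie.simps(2)[of "br X Y"] IH
  by (simp del: Lie.simps ins_apply add: algebra_simps)
qed

lemma Lie_ed:
 "form W ==> X \<in> L ==> set Zs \<subseteq> L ==> Lie X (ed W) Zs = ed (Lie X W) Zs"
proof (induction Zs arbitrary: W)
 case Nil
 then show ?case by (simp add: D_0)
next
 case (Cons Z Zs)
 have Z: "Z \<in> L" "set Zs \<subseteq> L" and X: "X \<in> L" and W: "form W" using Cons.prems by auto
 note cW = formD(1)[OF W]
 have "ins Z (ed W) = (\<lambda>Us. Lie Z W Us - ed (ins Z W) Us)" by (simp add: ins_def)
 then have 1: "Lie X (ins Z (ed W)) Zs = Lie X (Lie Z W) Zs - Lie X (ed (ins Z W)) Zs"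
  using Lie_diff[OF X cochain_Lie[OF Z(1) cW] cochain_ed[OF cochain_ins[OF cW Z(1)]] Z(2)] by simp
 have "ins Z (Lie X W) = (\<lambda>Us. Lie X (ins Z W) Us - ins (br X Z) W Us)" by (simp add: ins_def)
 then have 2: "ed (ins Z (Lie X W)) Zs = ed (Lie X (ins Z W)) Zs - ed (ins (br X Z) W) Zs"
  using ed_diff[OF cochain_Lie[OF X cochain_ins[OF cW Z(1)]] cochain_ins[OF cW L_br[OF X Z(1)]] Z(2)] by simp
 have "Lie X (ed W) (Z # Zs) = Lie X (Lie Z W) Zs - Lie X (ed (ins Z W)) Zs - Lie (br X Z) W Zs + ed (ins (br X Z) W) Zs"
  using 1 by simp
 also have "\<dots> = Lie Z (Lie X W) Zs - ed (Lie X (ins Z W)) Zs + ed (ins (br X Z) W) Zs"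
  using Lie_br[OF W X Z] Cons.IH[OF form_ins[OF W Z(1)] X Z(2)] by (simp del: ins_apply)
 also have "\<dots> = ed (Lie X W) (Z # Zs)" using 2 by simp
 finally show ?case .
qed

text \<open>Since \<open>Lie Z\<close> commutes with the differential, Cartan's formula turns the
  square of the differential of W, contracted with Z, into the square of the differential of
  \<open>ins Z W\<close> on a shorter list.\<close>

lemma ed_ed: "form W ==> set Zs \<subseteq> L ==> ed (ed W) Zs = 0"
proof (induction Zs arbitrary: W)
 case (Cons Z Zs)
 have Z: "Z \<in> L" "set Zs \<subseteq> L" and W: "form W" using Cons.prems by auto
 note cW = formD(1)[OF W]
 have "ins Z (ed W) = (\<lambda>Us. Lie Z W Us - ed (ins Z W) Us)" by (simp add: ins_def)
 then have "ed (ins Z (ed W)) Zs = ed (Lie Z W) Zs - ed (ed (ins Z W)) Zs"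
  using ed_diff[OF cochain_Lie[OF Z(1) cW] cochain_ed[OF cochain_ins[OF cW Z(1)]] Z(2)] by simp
 then show ?case
  using Lie_ed[OF W Z] Cons.IH[OF form_ins[OF W Z(1)] Z(2)] by simp
qed simp

end

subsection \<open>The wedge product\<close>

lemma bar_add: "bar (\<lambda>Zs. W Zs + T Zs) = (\<lambda>Zs. bar W Zs + bar T Zs)"
 and bar_neg: "bar (\<lambda>Zs. - W Zs) = (\<lambda>Zs. - bar W Zs)"
 and bar_smult: "bar (\<lambda>Zs. f * W Zs) = (\<lambda>Zs. f * bar W Zs)"
 by (simp_all add: bar_def fun_eq_iff algebra_simps)

lemma bar_bar: "bar (bar W) = W"
 by (simp add: bar_def fun_eq_iff mult.assoc[symmetric])

lemma ins_bar: "ins Y (bar W) = (\<lambda>Zs. - bar (ins Y W) Zs)"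
 by (simp add: bar_def fun_eq_iff)

lemma ins_wd: "ins Y (wd W T) = (\<lambda>Zs. wd (ins Y W) T Zs + wd (bar W) (ins Y T) Zs)"
 by (simp add: fun_eq_iff)

lemma ins_add: "ins Y (\<lambda>Zs. W Zs + T Zs) = (\<lambda>Zs. ins Y W Zs + ins Y T Zs)"
 and ins_neg: "ins Y (\<lambda>Zs. - W Zs) = (\<lambda>Zs. - ins Y W Zs)"
 and ins_smult: "ins Y (\<lambda>Zs. f * W Zs) = (\<lambda>Zs. f * ins Y W Zs)"
 by (simp_all add: fun_eq_iff)

lemma wd_add_left: "wd (\<lambda>Zs. W Zs + W' Zs) T Ys = wd W T Ys + wd W' T Ys"
proof (induction Ys arbitrary: W W' T)
 case (Cons Y Ys)
 show ?case unfolding wd.simps bar_add ins_add Cons.IH by (simp del: ins_apply bar_apply add: algebra_simps)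
qed (simp add: algebra_simps)

lemma wd_add_right: "wd W (\<lambda>Zs. T Zs + T' Zs) Ys = wd W T Ys + wd W T' Ys"
proof (induction Ys arbitrary: W T T')
 case (Cons Y Ys)
 show ?case unfolding wd.simps ins_add Cons.IH by (simp del: ins_apply bar_apply add: algebra_simps)
qed (simp add: algebra_simps)

lemma wd_neg_left: "wd (\<lambda>Zs. - W Zs) T Ys = - wd W T Ys"
proof (induction Ys arbitrary: W T)
 case (Cons Y Ys)
 show ?case unfolding wd.simps bar_neg ins_neg Cons.IH by (simp del: ins_apply bar_apply)
qed simp

lemma wd_neg_right: "wd W (\<lambda>Zs. - T Zs) Ys = - wd W T Ys"
proof (induction Ys arbitrary: W T)
 case (Cons Y Ys)
 show ?case unfolding wd.simps ins_neg Cons.IH by (simp del: ins_apply bar_apply)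
qed simp

lemma wd_smult_left: "wd (\<lambda>Zs. f * W Zs) T Ys = f * wd W T Ys"
proof (induction Ys arbitrary: W T)
 case (Cons Y Ys)
 show ?case unfolding wd.simps bar_smult ins_smult Cons.IH by (simp del: ins_apply bar_apply add: algebra_simps)
qed (simp add: algebra_simps)

lemma wd_smult_right: "wd W (\<lambda>Zs. f * T Zs) Ys = f * wd W T Ys"
proof (induction Ys arbitrary: W T)
 case (Cons Y Ys)
 show ?case unfolding wd.simps ins_smult Cons.IH by (simp del: ins_apply bar_apply add: algebra_simps)
qed (simp add: algebra_simps)

lemma wd_diff_left: "wd (\<lambda>Zs. W Zs - W' Zs) T Ys = wd W T Ys - wd W' T Ys"
 using wd_add_left[of W "\<lambda>Zs. - W' Zs" T Ys] wd_neg_left[of W' T Ys] by simp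

lemma wd_diff_right: "wd W (\<lambda>Zs. T Zs - T' Zs) Ys = wd W T Ys - wd W T' Ys"
 using wd_add_right[of W T "\<lambda>Zs. - T' Zs" Ys] wd_neg_right[of W T' Ys] by simp

lemma wd_0_left: "wd (\<lambda>Zs. 0) T Ys = 0"
 using wd_smult_left[of 0 "\<lambda>Zs. 0" T Ys] by simp

lemma wd_0_right: "wd W (\<lambda>Zs. 0) Ys = 0"
 using wd_smult_right[of W 0 "\<lambda>Zs. 0" Ys] by simp

context lie_rinehart
begin

lemma wd_cong:
 "set Ys \<subseteq> L ==> (!!Zs. set Zs \<subseteq> L ==> W Zs = W' Zs) ==> (!!Zs. set Zs \<subseteq> L ==> T Zs = T' Zs) ==> wd W T Ys = wd W' T' Ys"
proof (induction Ys arbitrary: W W' T T')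
 case (Cons Y Ys)
 have "wd (ins Y W) T Ys = wd (ins Y W') T' Ys" "wd (bar W) (ins Y T) Ys = wd (bar W') (ins Y T') Ys"
  by (rule Cons.IH; use Cons.prems in simp)+
 then show ?case by simp
qed simp

lemma sign_C: "f \<in> C ==> (-1) ^ n * f \<in> C"
 by (cases "even n") (simp_all add: C_minus)

lemma cochain_bar: "cochain W ==> cochain (bar W)"
 by (simp add: cochain_def sign_C)

lemma cochain_wd: "cochain W ==> cochain T ==> cochain (wd W T)"
proof -
 have "set Ys \<subseteq> L ==> cochain W ==> cochain T ==> wd W T Ys \<in> C" for Ys
 proof (induction Ys arbitrary: W T)
  case Nil
  then show ?case by (simp add: cochain_def C_mult)
 next
  case (Cons Y Ys)
  have Y: "Y \<in> L" "set Ys \<subseteq> L" using Cons.prems by auto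
  show ?case
   unfolding wd.simps
   by (rule C_add[OF Cons.IH[OF Y(2) cochain_ins[OF Cons.prems(2) Y(1)] Cons.prems(3)]
     Cons.IH[OF Y(2) cochain_bar[OF Cons.prems(2)] cochain_ins[OF Cons.prems(3) Y(1)]]])
 qed
 then show "cochain W ==> cochain T ==> cochain (wd W T)" by (simp add: cochain_def)
qed

lemma form_bar:
 assumes "form W"
 shows "form (bar W)"
 by (rule formI[OF cochain_bar[OF formD(1)[OF assms]]])
  (simp_all add: formD(2,3,4)[OF assms] algebra_simps)

lemma form_wd:
 assumes "form W" "form T"
 shows "form (wd W T)"
proof (rule formI)
 show "cochain (wd W T)" by (rule cochain_wd[OF formD(1)[OF assms(1)] formD(1)[OF assms(2)]])
 fix Xs Ys A B f assume Ys: "set Ys \<subseteq> L" and A: "A \<in> L" and "set Xs \<subseteq> L"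
 then show "wd W T (Xs @ (A + B) # Ys) = wd W T (Xs @ A # Ys) + wd W T (Xs @ B # Ys)" if B: "B \<in> L"
  using assms
 proof (induction Xs arbitrary: W T)
  case Nil
  have "wd (ins (A + B) W) T Ys = wd (\<lambda>Zs. ins A W Zs + ins B W Zs) T Ys"
   by (rule wd_cong[OF Ys]) (simp_all add: form_hd(1)[OF Nil(4) _ A B])
  moreover have "wd (bar W) (ins (A + B) T) Ys = wd (bar W) (\<lambda>Zs. ins A T Zs + ins B T Zs) Ys"
   by (rule wd_cong[OF Ys]) (simp_all add: form_hd(1)[OF Nil(5) _ A B])
  ultimately show ?case unfolding append_Nil wd.simps wd_add_left wd_add_right by (simp del: ins_apply bar_apply)
 next
  case (Cons Z Xs)
  have Z: "Z \<in> L" "set Xs \<subseteq> L" using Cons.prems by auto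
  show ?case
   unfolding append_Cons wd.simps
    Cons.IH[OF Ys A Z(2) form_ins[OF Cons.prems(4) Z(1)] Cons.prems(5)]
    Cons.IH[OF Ys A Z(2) form_bar[OF Cons.prems(4)] form_ins[OF Cons.prems(5) Z(1)]]
   by (simp del: ins_apply bar_apply add: algebra_simps)
 qed
 from \<open>set Ys \<subseteq> L\<close> \<open>A \<in> L\<close> \<open>set Xs \<subseteq> L\<close>
 show "wd W T (Xs @ sm f A # Ys) = f * wd W T (Xs @ A # Ys)" if f: "f \<in> C"
  using assms
 proof (induction Xs arbitrary: W T)
  case Nil
  have "wd (ins (sm f A) W) T Ys = wd (\<lambda>Zs. f * ins A W Zs) T Ys"
   by (rule wd_cong[OF Ys]) (simp_all add: form_hd(2)[OF Nil(4) _ A f])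
  moreover have "wd (bar W) (ins (sm f A) T) Ys = wd (bar W) (\<lambda>Zs. f * ins A T Zs) Ys"
   by (rule wd_cong[OF Ys]) (simp_all add: form_hd(2)[OF Nil(5) _ A f])
  ultimately show ?case unfolding append_Nil wd.simps wd_smult_left wd_smult_right by (simp del: ins_apply bar_apply add: algebra_simps)
 next
  case (Cons Z Xs)
  have Z: "Z \<in> L" "set Xs \<subseteq> L" using Cons.prems by auto
  show ?case
   unfolding append_Cons wd.simps
    Cons.IH[OF Ys A Z(2) form_ins[OF Cons.prems(4) Z(1)] Cons.prems(5)]
    Cons.IH[OF Ys A Z(2) form_bar[OF Cons.prems(4)] form_ins[OF Cons.prems(5) Z(1)]]
   by (simp del: ins_apply bar_apply add: algebra_simps)
 qed
 from \<open>set Ys \<subseteq> L\<close> \<open>A \<in> L\<close> \<open>set Xs \<subseteq> L\<close>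
 show "wd W T (Xs @ A # A # Ys) = 0"
  using assms
 proof (induction Xs arbitrary: W T)
  case Nil
  have "wd (ins A (ins A W)) T Ys = wd (\<lambda>Zs. 0) T Ys"
   by (rule wd_cong[OF Ys]) (simp_all add: form_hd(3)[OF Nil(4) _ A])
  moreover have "wd W (ins A (ins A T)) Ys = wd W (\<lambda>Zs. 0) Ys"
   by (rule wd_cong[OF Ys]) (simp_all add: form_hd(3)[OF Nil(5) _ A])
  \<comment> \<open>The two mixed terms cancel, because contraction anticommutes with
    \<open>bar\<close>.\<close>
  ultimately show ?case
   unfolding append_Nil wd.simps ins_bar bar_bar wd_neg_left wd_0_left wd_0_right
   by (simp del: ins_apply bar_apply)
 next
  case (Cons Z Xs)
  have Z: "Z \<in> L" "set Xs \<subseteq> L" using Cons.prems by auto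
  show ?case
   unfolding append_Cons wd.simps
    Cons.IH[OF Ys A Z(2) form_ins[OF Cons.prems(4) Z(1)] Cons.prems(5)]
    Cons.IH[OF Ys A Z(2) form_bar[OF Cons.prems(4)] form_ins[OF Cons.prems(5) Z(1)]]
   by simp
 qed
qed

lemma Lie_bar: "X \<in> L ==> cochain W ==> set Ys \<subseteq> L ==> Lie X (bar W) Ys = bar (Lie X W) Ys"
proof (induction Ys arbitrary: W)
 case (Cons Y Ys)
 have Y: "Y \<in> L" "set Ys \<subseteq> L" using Cons.prems by auto
 have c: "cochain (ins Y W)" by (rule cochain_ins[OF Cons.prems(2) Y(1)])
 have "Lie X (ins Y (bar W)) Ys = - bar (Lie X (ins Y W)) Ys"
  unfolding ins_bar Lie_neg[OF Cons.prems(1) cochain_bar[OF c] Y(2)] Cons.IH[OF Cons.prems(1) c Y(2)] ..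
 then show ?case unfolding Lie.simps bar_apply by (simp del: ins_apply add: algebra_simps)
qed simp

lemma ed_bar: "cochain W ==> set Ys \<subseteq> L ==> ed (bar W) Ys = - bar (ed W) Ys"
proof (induction Ys arbitrary: W)
 case (Cons Y Ys)
 have Y: "Y \<in> L" "set Ys \<subseteq> L" using Cons.prems by auto
 have c: "cochain (ins Y W)" by (rule cochain_ins[OF Cons.prems(1) Y(1)])
 have "ed (ins Y (bar W)) Ys = bar (ed (ins Y W)) Ys"
  unfolding ins_bar ed_neg[OF cochain_bar[OF c] Y(2)] Cons.IH[OF c Y(2)] by simp
 then show ?case
  using Lie_bar[OF Y(1) Cons.prems(1) Y(2)] unfolding ed.simps bar_apply by (simp del: ins_apply add: algebra_simps)
qed simp

lemma Lie_wd:
 "X \<in> L ==> cochain W ==> cochain T ==> set Ys \<subseteq> L ==> Lie X (wd W T) Ys = wd (Lie X W) T Ys + wd W (Lie X T) Ys"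
proof (induction Ys arbitrary: W T)
 case Nil
 then show ?case by (simp add: D_mult cochain_def)
next
 case (Cons Y Ys)
 have Y: "Y \<in> L" "set Ys \<subseteq> L" and X: "X \<in> L" and W: "cochain W" and T: "cochain T" using Cons.prems by auto
 note c = cochain_ins[OF W Y(1)] cochain_ins[OF T Y(1)] cochain_bar[OF W]
 have 1: "Lie X (ins Y (wd W T)) Ys = wd (Lie X (ins Y W)) T Ys + wd (ins Y W) (Lie X T) Ys +
   (wd (Lie X (bar W)) (ins Y T) Ys + wd (bar W) (Lie X (ins Y T)) Ys)"
  unfolding ins_wd Lie_add[OF X cochain_wd[OF c(1) T] cochain_wd[OF c(3,2)] Y(2)]
   Cons.IH[OF X c(1) T Y(2)] Cons.IH[OF X c(3,2) Y(2)] ..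
 have 2: "wd (Lie X (bar W)) (ins Y T) Ys = wd (bar (Lie X W)) (ins Y T) Ys"
  by (rule wd_cong[OF Y(2)]) (simp_all del: bar_apply ins_apply add: Lie_bar[OF X W])
 have L: "ins Y (Lie X V) = (\<lambda>Zs. Lie X (ins Y V) Zs - ins (br X Y) V Zs)" for V
  by (simp add: fun_eq_iff)
 show ?case
  unfolding Lie.simps 1 2 wd.simps L wd_diff_left wd_diff_right
  by (simp del: ins_apply bar_apply add: algebra_simps)
qed

text \<open>After contraction with Y, Cartan's formula reduces the signed Leibniz rule to the
  unsigned one for Lie derivatives and to the claim for shorter lists.\<close>

lemma ed_wd:
 "cochain W ==> cochain T ==> set Ys \<subseteq> L ==> ed (wd W T) Ys = wd (ed W) T Ys + wd (bar W) (ed T) Ys"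
proof (induction Ys arbitrary: W T)
 case (Cons Y Ys)
 have Y: "Y \<in> L" "set Ys \<subseteq> L" and W: "cochain W" and T: "cochain T" using Cons.prems by auto
 note c = cochain_ins[OF W Y(1)] cochain_ins[OF T Y(1)] cochain_bar[OF W]
 have 1: "ed (ins Y (wd W T)) Ys = wd (ed (ins Y W)) T Ys + wd (bar (ins Y W)) (ed T) Ys +
   (wd (ed (bar W)) (ins Y T) Ys + wd W (ed (ins Y T)) Ys)"
  unfolding ins_wd ed_add[OF cochain_wd[OF c(1) T] cochain_wd[OF c(3,2)] Y(2)]
   Cons.IH[OF c(1) T Y(2)] Cons.IH[OF c(3,2) Y(2)] bar_bar ..
 have 2: "wd (ed (bar W)) (ins Y T) Ys = wd (\<lambda>Zs. - bar (ed W) Zs) (ins Y T) Ys"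
  by (rule wd_cong[OF Y(2)]) (simp_all del: bar_apply ins_apply add: ed_bar[OF W])
 have L: "ins Y (ed V) = (\<lambda>Zs. Lie Y V Zs - ed (ins Y V) Zs)" for V
  by (simp add: fun_eq_iff)
 show ?case
  unfolding ed.simps 1 2 wd.simps L wd_diff_left wd_diff_right wd_neg_left ins_bar bar_bar
   Lie_wd[OF Y(1) W T Y(2)]
  by (simp del: ins_apply bar_apply add: algebra_simps)
qed simp

subsection \<open>Cartan's formula, naturality and scalars\<close>

lemma nths_Cons_simps:
 "nths (Y # Ys) (- {0}) = Ys" "nths (Y # Ys) (- {Suc i}) = Y # nths Ys (- {i})"
 "nths (Y # Ys) (- {0, Suc j}) = nths Ys (- {j})" "nths (Y # Ys) (- {Suc i, Suc j}) = Y # nths Ys (- {i, j})"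
proof -
 have "{j. Suc j \<in> - {0}} = UNIV" "{j. Suc j \<in> - {Suc i}} = - {i}" "{k. Suc k \<in> - {0, Suc j}} = - {j}"
  "{k. Suc k \<in> - {Suc i, Suc j}} = - {i, j}" by auto
 then show "nths (Y # Ys) (- {0}) = Ys" "nths (Y # Ys) (- {Suc i}) = Y # nths Ys (- {i})"
  "nths (Y # Ys) (- {0, Suc j}) = nths Ys (- {j})" "nths (Y # Ys) (- {Suc i, Suc j}) = Y # nths Ys (- {i, j})"
  by (simp_all add: nths_Cons nths_all)
qed

lemma Lie_expand:
 "form W ==> X \<in> L ==> set Ys \<subseteq> L ==>
  Lie X W Ys = D X (W Ys) - (\<Sum>j<length Ys. (-1) ^ j * W (br X (Ys ! j) # nths Ys (- {j})))"
proof (induction Ys arbitrary: W)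
 case (Cons Z Zs)
 have Z: "Z \<in> L" "set Zs \<subseteq> L" and X: "X \<in> L" and W: "form W" using Cons.prems by auto
 have sw: "W (Z # br X (Zs ! j) # nths Zs (- {j})) = - W (br X (Zs ! j) # Z # nths Zs (- {j}))" if "j < length Zs" for j
  by (rule form_swap[OF W _ Z(1) L_br[OF X]]) (use Z that set_nths_subset[of Zs] in "auto simp: subset_iff")
 have "(\<Sum>j<length (Z # Zs). (-1) ^ j * W (br X ((Z # Zs) ! j) # nths (Z # Zs) (- {j}))) =
   W (br X Z # Zs) + (\<Sum>j<length Zs. - ((-1) ^ j * W (br X (Zs ! j) # Z # nths Zs (- {j}))))"
  by (simp add: sum.lessThan_Suc_shift nths_Cons_simps del: sum.lessThan_Suc)
 also have "\<dots> = W (br X Z # Zs) + (\<Sum>j<length Zs. (-1) ^ j * ins Z W (br X (Zs ! j) # nths Zs (- {j})))"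
  by (intro arg_cong2[where f = "(+)"] sum.cong refl) (simp add: sw)
 finally show ?case
  using Cons.IH[OF form_ins[OF W Z(1)] X Z(2)] by (simp add: ins_def)
qed simp

text \<open>The link from the recursion to the closed expression in \<open>cartan_formula\<close>.
  Moving the bracket to the front, past the contracted argument, costs the sign that fits the
  shifted indices.\<close>

lemma ed_expand:
 "form W ==> set Ys \<subseteq> L ==>
  ed W Ys = (\<Sum>i<length Ys. (-1) ^ i * D (Ys ! i) (W (nths Ys (- {i})))) +
   (\<Sum>j<length Ys. \<Sum>i<j. (-1) ^ (i + j) * W (br (Ys ! i) (Ys ! j) # nths Ys (- {i, j})))"
proof (induction Ys arbitrary: W)
 case (Cons Z Zs)
 have Z: "Z \<in> L" "set Zs \<subseteq> L" and W: "form W" using Cons.prems by auto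
 have sw: "W (Z # br (Zs ! i) (Zs ! j) # nths Zs (- {i, j})) = - W (br (Zs ! i) (Zs ! j) # Z # nths Zs (- {i, j}))"
  if "j < length Zs" "i < j" for i j
  by (rule form_swap[OF W _ Z(1) L_br]) (use Z that set_nths_subset[of Zs] in "auto simp: subset_iff")
 have 1: "(\<Sum>i<length (Z # Zs). (-1) ^ i * D ((Z # Zs) ! i) (W (nths (Z # Zs) (- {i})))) =
   D Z (W Zs) - (\<Sum>i<length Zs. (-1) ^ i * D (Zs ! i) (ins Z W (nths Zs (- {i}))))"
  by (simp add: sum.lessThan_Suc_shift nths_Cons_simps sum_negf del: sum.lessThan_Suc)
 have "(\<Sum>j<length (Z # Zs). \<Sum>i<j. (-1) ^ (i + j) * W (br ((Z # Zs) ! i) ((Z # Zs) ! j) # nths (Z # Zs) (- {i, j}))) =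
   (\<Sum>j<length Zs. - ((-1) ^ j * W (br Z (Zs ! j) # nths Zs (- {j}))) +
    (\<Sum>i<j. (-1) ^ (i + j) * W (br (Zs ! i) (Zs ! j) # Z # nths Zs (- {i, j}))))"
  by (simp add: sum.lessThan_Suc_shift nths_Cons_simps del: sum.lessThan_Suc)
 also have "\<dots> = (\<Sum>j<length Zs. - ((-1) ^ j * W (br Z (Zs ! j) # nths Zs (- {j}))) -
    (\<Sum>i<j. (-1) ^ (i + j) * ins Z W (br (Zs ! i) (Zs ! j) # nths Zs (- {i, j}))))"
  by (rule sum.cong[OF refl]) (simp add: sw sum_negf)
 also have "\<dots> = - (\<Sum>j<length Zs. (-1) ^ j * W (br Z (Zs ! j) # nths Zs (- {j}))) -
    (\<Sum>j<length Zs. \<Sum>i<j. (-1) ^ (i + j) * ins Z W (br (Zs ! i) (Zs ! j) # nths Zs (- {i, j})))"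
  by (simp add: sum_subtractf sum_negf)
 finally have 2: "(\<Sum>j<length (Z # Zs). \<Sum>i<j. (-1) ^ (i + j) * W (br ((Z # Zs) ! i) ((Z # Zs) ! j) # nths (Z # Zs) (- {i, j}))) = \<dots>" .
 show ?case
  unfolding 1 2 ed.simps Lie_expand[OF W Z] Cons.IH[OF form_ins[OF W Z(1)] Z(2)]
  by (simp del: ins_apply bar_apply)
qed simp

lemma Lie_natural:
 assumes P: "!!X. X \<in> L ==> P X \<in> L" "!!X Y. X \<in> L ==> Y \<in> L ==> P (br X Y) = br (P X) (P Y)"
  and c: "!!X f. X \<in> L ==> f \<in> C ==> D X (c f) = c (D (P X) f)" "!!f g. c (f - g) = c f - c g"
  and X: "X \<in> L"
 shows "cochain W ==> set Ys \<subseteq> L ==> Lie X (\<lambda>Zs. c (W (map P Zs))) Ys = c (Lie (P X) W (map P Ys))"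
proof (induction Ys arbitrary: W)
 case Nil
 then show ?case by (simp add: c(1)[OF X] cochain_def)
next
 case (Cons Y Ys)
 have Y: "Y \<in> L" "set Ys \<subseteq> L" using Cons.prems by auto
 have "ins Y (\<lambda>Zs. c (W (map P Zs))) = (\<lambda>Zs. c (ins (P Y) W (map P Zs)))" by (simp add: fun_eq_iff)
 then show ?case
  using Cons.IH[OF cochain_ins[OF Cons.prems(1) P(1)[OF Y(1)]] Y(2)] P(2)[OF X Y(1)]
  by (simp del: ins_apply add: c(2))
qed

text \<open>The model is an isomorphism: P pushes sections forward, c pulls functions back, and they
  respect brackets and anchors.\<close>

lemma ed_natural:
 assumes P: "!!X. X \<in> L ==> P X \<in> L" "!!X Y. X \<in> L ==> Y \<in> L ==> P (br X Y) = br (P X) (P Y)"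
  and c: "!!X f. X \<in> L ==> f \<in> C ==> D X (c f) = c (D (P X) f)" "!!f g. c (f - g) = c f - c g"
 shows "cochain W ==> set Ys \<subseteq> L ==> ed (\<lambda>Zs. c (W (map P Zs))) Ys = c (ed W (map P Ys))"
proof (induction Ys arbitrary: W)
 case Nil
 have "c 0 = 0" using c(2)[of 0 0] by simp
 then show ?case by simp
next
 case (Cons Y Ys)
 have Y: "Y \<in> L" "set Ys \<subseteq> L" using Cons.prems by auto
 have "ins Y (\<lambda>Zs. c (W (map P Zs))) = (\<lambda>Zs. c (ins (P Y) W (map P Zs)))" by (simp add: fun_eq_iff)
 then show ?case
  using Cons.IH[OF cochain_ins[OF Cons.prems(1) P(1)[OF Y(1)]] Y(2)]
   Lie_natural[OF P c Y(1) Cons.prems(1) Y(2)]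
  by (simp del: ins_apply add: c(2))
qed

end

section \<open>The Lie-Rinehart algebra of right-invariant vector fields\<close>

lemma tangent_0:
 assumes "v \<in> TS M p" "diffspace M"
 shows "v (\<lambda>q. 0) = 0"
 using tvecD(3)[OF assms(1) Cinf_const[OF assms(2)], of 0 0] by simp

lemma tangent_diff:
 assumes v: "v \<in> TS M p" "diffspace M" and f: "f \<in> Cinf M" and g: "g \<in> Cinf M"
 shows "v (\<lambda>q. f q - g q) = v f - v g"
 using tvecD(2)[OF v(1) Cinf_diff[OF v(2) f g] g] by simp

context lie_gpd
begin

text \<open>Normalising functions to 0 off the points turns the identities of a Lie-Rinehart algebra
  into equalities of total functions.\<close>

definition "CO = {f \<in> Cinf Ob. \<forall>b. b \<notin> pts Ob --> f b = 0}"

definition anch :: "('g => 'g tvec) => ('b => real) => 'b => real" where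
 "anch X f b = (if b \<in> pts Ob then X (un b) (\<lambda>q. f (tg q)) else 0)"

text \<open>Functions act through the target map, since \<open>tg (mu g a) = tg g\<close> makes
  their pullbacks invariant under right translation.\<close>

definition smul :: "('b => real) => ('g => 'g tvec) => 'g => 'g tvec" where
 "smul f X p g = f (tg p) * X p g"

abbreviation "bra \<equiv> vf_bracket Ar"

lemma COD: "f \<in> CO ==> f \<in> Cinf Ob" "f \<in> CO ==> b \<notin> pts Ob ==> f b = 0"
 by (simp_all add: CO_def)

lemma COI: "f \<in> Cinf Ob ==> (\<lambda>b. if b \<in> pts Ob then f b else 0) \<in> CO"
 unfolding CO_def by (auto intro: Cinf_cong[OF dOb])

lemma tg_Cinf: "f \<in> Cinf Ob ==> (\<lambda>q. f (tg q)) \<in> Cinf Ar"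
 using smaps(2) by (auto simp: smooth_map_def o_def)

lemma un_Cinf: "f \<in> Cinf Ar ==> (\<lambda>b. f (un b)) \<in> Cinf Ob"
 using smaps(3) by (auto simp: smooth_map_def o_def)

lemma RI_cong:
 assumes X: "X \<in> RI" and f: "f \<in> Cinf Ar" and eq: "!!q. q \<in> pts Ar ==> f q = g q"
 shows "X p f = X p g"
proof (cases "p \<in> pts Ar")
 case True
 show ?thesis
  by (rule tangent_local[OF dAr True RI_D(1)[OF X True] f Cinf_cong[OF dAr f eq] ev_ptsI[OF eq]])
qed (simp add: RI_D(3)[OF X])

lemma RI_tg:
 assumes X: "X \<in> RI" and f: "f \<in> Cinf Ob" and a: "a \<in> pts Ar"
 shows "X a (\<lambda>q. f (tg q)) = anch X f (tg a)"
 using RI_D(5)[OF X tg_Cinf[OF f] tg_Cinf[OF f] _ un_composable[OF a]] a mu_un(2)[OF a]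
 by (simp add: anch_def)

lemma anch_CO:
 assumes "X \<in> RI" "f \<in> CO"
 shows "anch X f \<in> CO"
 unfolding anch_def[abs_def] by (rule COI[OF un_Cinf]) (rule RI_D(2)[OF assms(1) tg_Cinf[OF COD(1)[OF assms(2)]]])

lemma RI_add:
 assumes "X \<in> RI" "Y \<in> RI"
 shows "X + Y \<in> RI"
 unfolding RI_iff
proof (intro conjI ballI allI impI)
 fix a g u u' assume "a \<in> pts Ar" and u: "u \<in> Cinf Ar" "u' \<in> Cinf Ar"
  "\<forall>g. (g, a) \<in> composable G --> u' g = u (mu g a)" and g: "(g, a) \<in> composable G"
 show "(X + Y) g u' = (X + Y) (mu g a) u"
  using RI_D(5)[OF assms(1) u(1,2) _ g] RI_D(5)[OF assms(2) u(1,2) _ g] u(3) by simp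
next
 show "(X + Y) p \<in> TS Ar p" if "p \<in> pts Ar" for p
  unfolding plus_fun_def by (rule tangent_add[OF RI_D(1)[OF assms(1) that] RI_D(1)[OF assms(2) that]])
 show "(\<lambda>p. (X + Y) p f) \<in> Cinf Ar" if "f \<in> Cinf Ar" for f
  unfolding plus_fun_apply by (rule Cinf_add[OF dAr RI_D(2)[OF assms(1) that] RI_D(2)[OF assms(2) that]])
 show "(X + Y) g (\<lambda>q. f (sr q)) = 0" if "g \<in> pts Ar" "f \<in> Cinf Ob" for g f
  using RI_D(4)[OF assms(1) that] RI_D(4)[OF assms(2) that] by simp
 show "(X + Y) p = (\<lambda>f. 0)" if "p \<notin> pts Ar" for p
  using RI_D(3)[OF assms(1) that] RI_D(3)[OF assms(2) that] by (simp add: fun_eq_iff)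
qed

lemma RI_smul:
 assumes X: "X \<in> RI" and f: "f \<in> Cinf Ob"
 shows "smul f X \<in> RI"
 unfolding RI_iff
proof (intro conjI ballI allI impI)
 fix a g u u' assume "a \<in> pts Ar" and u: "u \<in> Cinf Ar" "u' \<in> Cinf Ar"
  "\<forall>g. (g, a) \<in> composable G --> u' g = u (mu g a)" and g: "(g, a) \<in> composable G"
 show "smul f X g u' = smul f X (mu g a) u"
  using RI_D(5)[OF X u(1,2) _ g] u(3) tg_mu[OF g] by (simp add: smul_def)
next
 show "smul f X p \<in> TS Ar p" if "p \<in> pts Ar" for p
  using tangent_scale[OF RI_D(1)[OF X that], of "f (tg p)"] by (simp add: smul_def[abs_def])
 show "(\<lambda>p. smul f X p u) \<in> Cinf Ar" if "u \<in> Cinf Ar" for u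
  unfolding smul_def by (intro Cinf_mult[OF dAr tg_Cinf[OF f] RI_D(2)[OF X that]])
qed (simp_all add: smul_def[abs_def] RI_D(3,4)[OF X])

lemma RI_minus: "X \<in> RI ==> - X \<in> RI"
 using RI_smul[of X "\<lambda>b. -1"] Cinf_const[OF dOb] by (simp add: smul_def[abs_def] fun_Compl_def)

lemma RI_br:
 assumes X: "X \<in> RI" and Y: "Y \<in> RI"
 shows "bra X Y \<in> RI"
 unfolding RI_iff
proof (intro conjI ballI allI impI)
 fix p assume p: "p \<in> pts Ar"
 note v = RI_D(1)[OF X p] and w = RI_D(1)[OF Y p] and Xs = RI_D(2)[OF X] and Ys = RI_D(2)[OF Y]
 show "bra X Y p \<in> TS Ar p"
  unfolding tangent_space_def
 proof (intro CollectI conjI allI impI ballI)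
  show "bra X Y p f = 0" if "f \<notin> Cinf Ar" for f using that by (simp add: vf_bracket_def)
  fix f assume f: "f \<in> Cinf Ar"
  have c: "Z p (\<lambda>q. Z' q (\<lambda>r. c * f r)) = c * Z p (\<lambda>q. Z' q f)" if Z: "Z \<in> RI" "Z' \<in> RI" for Z Z' c
  proof -
   have "Z p (\<lambda>q. c * Z' q f) = Z p (\<lambda>q. Z' q (\<lambda>r. c * f r))"
    by (rule RI_cong[OF Z(1) Cinf_cmult[OF dAr RI_D(2)[OF Z(2) f]]]) (simp add: tvecD(3)[OF RI_D(1)[OF Z(2)] f])
   then show ?thesis using tvecD(3)[OF RI_D(1)[OF Z(1) p] RI_D(2)[OF Z(2) f]] by simp
  qed
  show "bra X Y p (\<lambda>q. c * f q) = c * bra X Y p f" for c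
   using f p c[OF X Y] c[OF Y X] Cinf_cmult[OF dAr f] by (simp add: vf_bracket_def right_diff_distrib)
  fix g assume g: "g \<in> Cinf Ar"
  have a: "Z p (\<lambda>q. Z' q (\<lambda>r. f r + g r)) = Z p (\<lambda>q. Z' q f) + Z p (\<lambda>q. Z' q g)" if Z: "Z \<in> RI" "Z' \<in> RI" for Z Z'
  proof -
   note fg = RI_D(2)[OF Z(2) f] RI_D(2)[OF Z(2) g]
   have "Z p (\<lambda>q. Z' q f + Z' q g) = Z p (\<lambda>q. Z' q (\<lambda>r. f r + g r))"
    by (rule RI_cong[OF Z(1) Cinf_add[OF dAr fg]]) (simp add: tvecD(2)[OF RI_D(1)[OF Z(2)] f g])
   then show ?thesis using tvecD(2)[OF RI_D(1)[OF Z(1) p] fg] by simp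
  qed
  show "bra X Y p (\<lambda>q. f q + g q) = bra X Y p f + bra X Y p g"
   using f g p a[OF X Y] a[OF Y X] Cinf_add[OF dAr f g] by (simp add: vf_bracket_def)
  \<comment> \<open>The mixed terms \<open>Z' p f * Z p g\<close> and \<open>Z p f * Z' p g\<close>
    are symmetric in Z and Z', so they disappear from the bracket.\<close>
  have m: "Z p (\<lambda>q. Z' q (\<lambda>r. f r * g r)) = Z p (\<lambda>q. Z' q f) * g p + Z' p f * Z p g + (Z p f * Z' p g + f p * Z p (\<lambda>q. Z' q g))"
   if Z: "Z \<in> RI" "Z' \<in> RI" for Z Z'
  proof -
   note fg = RI_D(2)[OF Z(2) f] RI_D(2)[OF Z(2) g]
   note m = Cinf_mult[OF dAr fg(1) g] Cinf_mult[OF dAr f fg(2)]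
   note t = RI_D(1)[OF Z(1) p]
   have "Z p (\<lambda>q. Z' q f * g q + f q * Z' q g) = Z p (\<lambda>q. Z' q (\<lambda>r. f r * g r))"
    by (rule RI_cong[OF Z(1) Cinf_add[OF dAr m]]) (simp add: tvecD(4)[OF RI_D(1)[OF Z(2)] f g])
   then show ?thesis using tvecD(2)[OF t m] tvecD(4)[OF t fg(1) g] tvecD(4)[OF t f fg(2)] by simp
  qed
  show "bra X Y p (\<lambda>q. f q * g q) = bra X Y p f * g p + f p * bra X Y p g"
   using f g p m[OF X Y] m[OF Y X] Cinf_mult[OF dAr f g] by (simp add: vf_bracket_def algebra_simps)
 qed
 show "bra X Y p (\<lambda>q. f (sr q)) = 0" if f: "f \<in> Cinf Ob" for f
 proof -
  have fs: "(\<lambda>q. f (sr q)) \<in> Cinf Ar" by (rule smooth_map_Cinf[OF smaps(1) f])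
  have "Z p (\<lambda>q. Z' q (\<lambda>q. f (sr q))) = 0" if Z: "Z \<in> RI" "Z' \<in> RI" for Z Z'
   using RI_cong[OF Z(1) RI_D(2)[OF Z(2) fs], of "\<lambda>q. 0" p] RI_D(4)[OF Z(2) _ f] tangent_0[OF RI_D(1)[OF Z(1) p] dAr] by simp
  from this[OF X Y] this[OF Y X] show ?thesis by (simp add: vf_bracket_def)
 qed
next
 show "(\<lambda>p. bra X Y p f) \<in> Cinf Ar" if f: "f \<in> Cinf Ar" for f
  by (rule Cinf_cong[OF dAr Cinf_diff[OF dAr RI_D(2)[OF X RI_D(2)[OF Y f]] RI_D(2)[OF Y RI_D(2)[OF X f]]]])
   (simp add: vf_bracket_def f)
 fix a f f' g assume "a \<in> pts Ar" and f: "f \<in> Cinf Ar" "f' \<in> Cinf Ar"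
  "\<forall>g. (g, a) \<in> composable G --> f' g = f (mu g a)" and g: "(g, a) \<in> composable G"
 \<comment> \<open>Right invariance of Z' says that \<open>\<lambda>q. Z' q f'\<close> is again the
   right translate of \<open>\<lambda>q. Z' q f\<close>, so the right invariance of Z applies to
   this pair.\<close>
 have "Z g (\<lambda>q. Z' q f') = Z (mu g a) (\<lambda>q. Z' q f)" if Z: "Z \<in> RI" "Z' \<in> RI" for Z Z'
  by (rule RI_D(5)[OF Z(1) RI_D(2)[OF Z(2) f(1)] RI_D(2)[OF Z(2) f(2)] RI_D(5)[OF Z(2) f(1,2)] g]) (use f(3) in blast)+
 from this[OF X Y] this[OF Y X] show "bra X Y g f' = bra X Y (mu g a) f"
  using f mu_pts[OF g] g by (simp add: vf_bracket_def composable_iff)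
qed (simp add: vf_bracket_def fun_eq_iff)

lemma RI_0: "0 \<in> RI"
 by (simp add: RI_iff zero_fun_def tangent_zero Cinf_const)

lemma bra_eq: "X \<in> RI ==> Y \<in> RI ==> f \<in> Cinf Ar ==> bra X Y p f = X p (\<lambda>q. Y q f) - Y p (\<lambda>q. X q f)"
 by (simp add: vf_bracket_def RI_D(3))

lemma RI_diff:
 assumes "X \<in> RI" "f \<in> Cinf Ar" "g \<in> Cinf Ar"
 shows "X p (\<lambda>q. f q - g q) = X p f - X p g"
proof (cases "p \<in> pts Ar")
 case True
 show ?thesis by (rule tangent_diff[OF RI_D(1)[OF assms(1) True] dAr assms(2,3)])
qed (simp add: RI_D(3)[OF assms(1)])

lemma RI_ext: "X \<in> RI ==> Y \<in> RI ==> (!!p f. p \<in> pts Ar ==> f \<in> Cinf Ar ==> X p f = Y p f) ==> X = Y"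
 by (rule RI_eqI, assumption+) (rule tangent_eqI[OF RI_D(1) RI_D(1)], simp_all)

sublocale LR: lie_rinehart CO RI anch bra smul
proof
 fix X Y Z :: "'g => 'g tvec" and f g :: "'b => real"
 show "0 \<in> CO" "f \<in> CO ==> g \<in> CO ==> f + g \<in> CO" "f \<in> CO ==> g \<in> CO ==> f * g \<in> CO" "f \<in> CO ==> - f \<in> CO"
  using Cinf_const[OF dOb] Cinf_cmult[OF dOb, of f "-1"]
  by (auto simp: CO_def zero_fun_def plus_fun_def times_fun_def fun_Compl_def Cinf_add Cinf_mult)
 show "X \<in> RI ==> Y \<in> RI ==> X + Y \<in> RI" "X \<in> RI ==> - X \<in> RI" "X \<in> RI ==> Y \<in> RI ==> bra X Y \<in> RI"
  "f \<in> CO ==> X \<in> RI ==> smul f X \<in> RI" "X \<in> RI ==> f \<in> CO ==> anch X f \<in> CO"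
  by (simp_all add: RI_add RI_minus RI_br RI_smul COD anch_CO)
 show "anch X (f + g) = anch X f + anch X g" if "X \<in> RI" "f \<in> CO" "g \<in> CO"
  using tvecD(2)[OF RI_D(1)[OF that(1) un_pts] tg_Cinf tg_Cinf] that by (auto simp: anch_def COD)
 show "anch X (f * g) = anch X f * g + f * anch X g" if "X \<in> RI" "f \<in> CO" "g \<in> CO"
  using tvecD(4)[OF RI_D(1)[OF that(1) un_pts] tg_Cinf tg_Cinf] that by (auto simp: anch_def COD)
 show "anch (X + Y) f = anch X f + anch Y f" "anch (smul f X) g = f * anch X g"
  by (auto simp: anch_def smul_def)
 show "anch (bra X Y) f = anch X (anch Y f) - anch Y (anch X f)" if X: "X \<in> RI" and Y: "Y \<in> RI" and "f \<in> CO"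
 proof
  fix b
  have f: "f \<in> Cinf Ob" by (rule COD(1)[OF that(3)])
  \<comment> \<open>By right invariance the inner derivative is again a pullback by the target map,
    so that anchors can be iterated.\<close>
  have "Z p (\<lambda>q. Z' q (\<lambda>r. f (tg r))) = Z p (\<lambda>q. anch Z' f (tg q))" if "Z \<in> RI" "Z' \<in> RI" for Z Z' p
   by (rule RI_cong[OF that(1) RI_D(2)[OF that(2) tg_Cinf[OF f]]]) (rule RI_tg[OF that(2) f])
  from this[OF X Y] this[OF Y X]
  show "anch (bra X Y) f b = (anch X (anch Y f) - anch Y (anch X f)) b"
   by (simp add: anch_def[of "bra X Y"] anch_def[of _ "anch _ _"] bra_eq[OF X Y tg_Cinf[OF f]])
 qed
 have plus: "X p (\<lambda>q. (Y + Z) q u) = X p (\<lambda>q. Y q u) + X p (\<lambda>q. Z q u)"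
  if "X \<in> RI" "Y \<in> RI" "Z \<in> RI" "u \<in> Cinf Ar" "p \<in> pts Ar" for p u
  unfolding plus_fun_apply by (rule tvecD(2)[OF RI_D(1)[OF that(1,5)] RI_D(2)[OF that(2,4)] RI_D(2)[OF that(3,4)]])
 show "bra X (Y + Z) = bra X Y + bra X Z" if "X \<in> RI" "Y \<in> RI" "Z \<in> RI"
  by (rule RI_ext) (use that plus[OF that] in "auto simp: bra_eq RI_add RI_br")
 show "bra X Y = - bra Y X" "bra X X = 0"
  by (simp_all add: fun_eq_iff vf_bracket_def)
 show "bra X (smul f Y) = smul f (bra X Y) + smul (anch X f) Y" if X: "X \<in> RI" and Y: "Y \<in> RI" and "f \<in> CO"
 proof (rule RI_ext)
  have f: "f \<in> Cinf Ob" by (rule COD(1)[OF that(3)])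
  show "bra X (smul f Y) \<in> RI" by (rule RI_br[OF X RI_smul[OF Y f]])
  show "smul f (bra X Y) + smul (anch X f) Y \<in> RI"
   by (intro RI_add RI_smul RI_br X Y f COD(1)[OF anch_CO[OF X that(3)]])
  fix p u assume p: "p \<in> pts Ar" and u: "u \<in> Cinf Ar"
  have "X p (\<lambda>q. f (tg q) * Y q u) = X p (\<lambda>q. f (tg q)) * Y p u + f (tg p) * X p (\<lambda>q. Y q u)"
   by (rule tvecD(4)[OF RI_D(1)[OF X p] tg_Cinf[OF f] RI_D(2)[OF Y u]])
  then show "bra X (smul f Y) p u = (smul f (bra X Y) + smul (anch X f) Y) p u"
   unfolding plus_fun_apply smul_def[of _ "bra X Y"] bra_eq[OF X RI_smul[OF Y f] u] bra_eq[OF X Y u]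
   by (simp add: smul_def RI_tg[OF X f p] algebra_simps)
 qed
 show "bra X (bra Y Z) = bra (bra X Y) Z + bra Y (bra X Z)" if X: "X \<in> RI" and Y: "Y \<in> RI" and Z: "Z \<in> RI"
 proof (rule RI_ext)
  show "bra X (bra Y Z) \<in> RI" "bra (bra X Y) Z + bra Y (bra X Z) \<in> RI"
   by (intro RI_add RI_br X Y Z)+
  fix p u assume p: "p \<in> pts Ar" and u: "u \<in> Cinf Ar"
  show "bra X (bra Y Z) p u = (bra (bra X Y) Z + bra Y (bra X Z)) p u"
   using u by (simp add: bra_eq RI_diff[OF X] RI_diff[OF Y] RI_diff[OF Z] X Y Z RI_br RI_D(2)[OF X] RI_D(2)[OF Y] RI_D(2)[OF Z])
 qed
qed

text \<open>A local frame consisting of globally defined right-invariant fields. The coefficients of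
  v are its values on global functions \<open>Y i\<close>, a form in which they are visibly smooth
  in any smooth family of vectors.\<close>

lemma frame:
 assumes b0: "b0 \<in> pts Ob"
 shows "\<exists>(I :: nat set) e Y. finite I \<and> (\<forall>i\<in>I. e i \<in> RI \<and> Y i \<in> Cinf Ar) \<and>
  eventually (\<lambda>b. \<forall>v. (un b, v) \<in> LP --> v = (\<lambda>f. \<Sum>i\<in>I. v (Y i) * e i (un b) f)) (nh Ob b0)"
proof -
 obtain U y N z pos where ad: "adapted U y N z pos" and pU: "un b0 \<in> U"
  using adapted_at[OF un_pts[OF b0]] by (elim exE conjE)
 note D = adD[OF ad]
 have evU: "eventually (\<lambda>b. un b \<in> U) (nh Ob b0)"
  by (rule smap_at_cont[OF un_at[OF b0] chartD(1)[OF D(1)] pU])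
 then obtain N' where N': "open_in Ob N'" "b0 \<in> N'" "\<forall>b\<in>N'. un b \<in> U"
  unfolding ev_nh[OF b0] by blast
 obtain \<rho> W' where \<rho>: "\<rho> \<in> Cinf Ob" "eventually (\<lambda>q. \<rho> q = 1) (nh Ob b0)" "open_in Ob W'"
  "N' \<union> W' = pts Ob" "\<forall>q\<in>W'. \<rho> q = 0"
  using bump[OF dOb N'(1,2)] by (elim bexE exE conjE)
 \<comment> \<open>Coordinate vectors, cut off in the base; the value is set to 0 where the unit
   leaves U and \<open>cvec\<close> has no meaning.\<close>
 define \<sigma> where "\<sigma> i b = (un b, \<lambda>f. if un b \<in> U then \<rho> b * cvec Ar U y i (un b) f else 0)" for i b
 have \<sigma>: "\<sigma> i \<in> lie_sections G" if i: "i \<in> fpos pos" for i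
 proof (rule lie_sectionsI)
  have i': "i < n" using i by (simp add: fpos_def)
  fix b assume b: "b \<in> pts Ob"
  show "\<sigma> i b \<in> LP"
   using b cvec_kill[OF ad _ i] tangent_zero tangent_scale[OF cvec_tangent[OF dAr D(1) _ i']]
   by (cases "un b \<in> U") (auto simp: \<sigma>_def lie_pts_iff)
  show "fst (\<sigma> i b) = un b" by (simp add: \<sigma>_def)
 next
  fix f assume f: "f \<in> Cinf Ar"
  show "(\<lambda>b. snd (\<sigma> i b) f) \<in> Cinf Ob"
  proof (rule CinfI[OF dOb])
   fix b assume b: "b \<in> pts Ob"
   consider "b \<in> N'" | "b \<in> W'" using b \<rho>(4) by blast
   then show "smooth_at Ob b (\<lambda>b. snd (\<sigma> i b) f)"
   proof cases
    case 1
    have "smooth_at Ob b (\<lambda>b. \<rho> b * cvec Ar U y i (un b) f)"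
     by (intro sm_mult[OF dOb] sm_Cinf[OF \<rho>(1) b] sm_pull[where \<phi> = un, OF un_at[OF b]]
       cvec_smooth[OF dAr D(1) _ _ f]) (use 1 N'(3) i in "auto simp: fpos_def")
    then show ?thesis
     by (rule sm_cong[rotated]) (rule ev_nhI[OF N'(1) 1], use N'(3) in "simp add: \<sigma>_def")
   next
    case 2
    show ?thesis
     by (rule sm_cong[OF ev_nhI[OF \<rho>(3) 2] sm_const[OF dOb b]]) (use \<rho>(5) in "simp add: \<sigma>_def")
   qed
  qed
 qed
 have "\<exists>Y. Y \<in> Cinf Ar \<and> eventually (\<lambda>q. y q i = Y q) (nh Ar (un b0))" if "i \<in> fpos pos" for i
  using chart_coord[OF D(1) pU, of i] that by (auto simp: fpos_def elim!: smooth_atE)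
 then obtain Y where Y: "!!i. i \<in> fpos pos ==> Y i \<in> Cinf Ar"
  "!!i. i \<in> fpos pos ==> eventually (\<lambda>q. y q i = Y i q) (nh Ar (un b0))" by metis
 have fin: "finite (fpos pos)" by (simp add: fpos_def)
 have "eventually (\<lambda>q. \<forall>i\<in>fpos pos. y q i = Y i q) (nh Ar (un b0))"
  by (rule eventually_ball_finite[OF fin]) (use Y(2) in blast)
 from smap_at_ev[OF un_at[OF b0] ev_nh_ev[OF this]]
 have "eventually (\<lambda>b. eventually (\<lambda>q. \<forall>i\<in>fpos pos. y q i = Y i q) (nh Ar (un b))) (nh Ob b0)" .
 then have "eventually (\<lambda>b. \<forall>v. (un b, v) \<in> LP --> v = (\<lambda>f. \<Sum>i\<in>fpos pos. v (Y i) * rix (\<sigma> i) (un b) f)) (nh Ob b0)"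
  using evU \<rho>(2) ev_nh_pts[of Ob b0]
 proof eventually_elim
  case (elim b)
  show ?case
  proof (intro allI impI)
   fix v assume v: "(un b, v) \<in> LP"
   have e: "(un b, v) \<in> adom U" using v elim(2) by (simp add: adom_def)
   have up: "un b \<in> pts Ar" using elim(4) by simp
   have tv: "v \<in> TS Ar (un b)" using lie_ptsD(4)[OF v] by simp
   have "tv Ar (un b) v (\<lambda>q. y q i) = v (Y i)" if "i \<in> fpos pos" for i
    by (rule tv_eq[OF dAr up tv Y(1)[OF that]]) (use elim(1) that in "auto elim: eventually_mono")
   then have a: "axi y pos (un b, v) i = v (Y i)" if "i \<in> fpos pos" for i
    using that axi_nth[OF ad, of i "(un b, v)"] by (simp add: fpos_def)
   have s: "rix (\<sigma> i) (un b) = cvec Ar U y i (un b)" if "i \<in> fpos pos" for i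
    using rix_un[OF \<sigma>[OF that] elim(4)] elim(2,3) by (simp add: \<sigma>_def)
   have "v = avec U y pos (axi y pos (un b, v)) (un b)" using lie_recon[OF ad e] by simp
   also have "\<dots> = (\<lambda>f. \<Sum>i\<in>fpos pos. v (Y i) * rix (\<sigma> i) (un b) f)"
    unfolding avec_def by (intro ext sum.cong refl) (simp add: a s)
   finally show "v = (\<lambda>f. \<Sum>i\<in>fpos pos. v (Y i) * rix (\<sigma> i) (un b) f)" .
  qed
 qed
 moreover have "\<forall>i\<in>fpos pos. rix (\<sigma> i) \<in> RI \<and> Y i \<in> Cinf Ar"
  using Y(1) rix_RI[OF \<sigma>] by blast
 ultimately show ?thesis
  by (intro exI[of _ "fpos pos"] exI[of _ "\<lambda>i. rix (\<sigma> i)"] exI[of _ Y] conjI fin)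
qed

section \<open>Extension of single vectors and tensoriality of forms\<close>

lemma sum_fun_apply: "(\<Sum>i\<in>I. F i) x = (\<Sum>i\<in>I. F i x)"
 by (induction I rule: infinite_finite_induct) simp_all

lemma RI_sum: "(!!i. i \<in> I ==> X i \<in> RI) ==> (\<Sum>i\<in>I. X i) \<in> RI"
 by (induction I rule: infinite_finite_induct) (simp_all add: RI_0 RI_add)

text \<open>Since the value at a single unit is prescribed, a combination of frame fields with
  constant coefficients does it.\<close>

lemma RI_extend:
 assumes e: "e \<in> LP"
 shows "\<exists>X\<in>RI. X (fst e) = snd e"
proof -
 define b where "b = sr (fst e)"
 have b: "b \<in> pts Ob" "un b = fst e" using lie_ptsD(2,3)[OF e] by (simp_all add: b_def)
 obtain I :: "nat set" and B Y where F: "finite I" "\<forall>i\<in>I. B i \<in> RI \<and> Y i \<in> Cinf Ar"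
  "eventually (\<lambda>b. \<forall>v. (un b, v) \<in> LP --> v = (\<lambda>f. \<Sum>i\<in>I. v (Y i) * B i (un b) f)) (nh Ob b)"
  using frame[OF b(1)] by (elim exE conjE)
 let ?X = "\<Sum>i\<in>I. smul (\<lambda>b. snd e (Y i)) (B i)"
 have "(un b, snd e) \<in> LP" using e b(2) by simp
 then have "snd e = (\<lambda>f. \<Sum>i\<in>I. snd e (Y i) * B i (un b) f)"
  by (rule ev_nh_self[OF F(3) b(1), rule_format])
 moreover have "?X (fst e) = (\<lambda>f. \<Sum>i\<in>I. snd e (Y i) * B i (un b) f)"
  by (simp only: fun_eq_iff sum_fun_apply smul_def b(2)) simp
 moreover have "?X \<in> RI"
 proof (rule RI_sum)
  show "smul (\<lambda>b. snd e (Y i)) (B i) \<in> RI" if "i \<in> I" for i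
   by (rule RI_smul[OF _ Cinf_const[OF dOb]]) (use F(2) that in blast)
 qed
 ultimately show ?thesis by (intro bexI[of _ ?X]) simp_all
qed

lemma form_sum:
 assumes W: "LR.form W" and Ys: "set Ys \<subseteq> RI" and fin: "finite I"
  and e: "!!i. i \<in> I ==> B i \<in> RI" and f: "!!i. i \<in> I ==> f i \<in> CO"
 shows "W ((\<Sum>i\<in>I. smul (f i) (B i)) # Ys) = (\<Sum>i\<in>I. f i * W (B i # Ys))"
 using fin e f
proof (induction I)
 case empty
 show ?case unfolding sum.empty by (rule LR.form_zero[OF W Ys RI_0])
next
 case (insert i I)
 have i: "B i \<in> RI" "f i \<in> CO" and I: "!!j. j \<in> I ==> B j \<in> RI" "!!j. j \<in> I ==> f j \<in> CO"
  using insert.prems by auto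
 have "W ((smul (f i) (B i) + (\<Sum>i\<in>I. smul (f i) (B i))) # Ys) = W (smul (f i) (B i) # Ys) + W ((\<Sum>i\<in>I. smul (f i) (B i)) # Ys)"
  by (rule LR.form_hd(1)[OF W Ys RI_smul[OF i(1) COD(1)[OF i(2)]] RI_sum[OF RI_smul[OF I(1) COD(1)[OF I(2)]]]])
 moreover have "W ((\<Sum>i\<in>I. smul (f i) (B i)) # Ys) = (\<Sum>i\<in>I. f i * W (B i # Ys))" by (rule insert.IH[OF I])
 ultimately show ?case
  by (simp only: sum.insert[OF insert.hyps(1,2)] LR.form_hd(2)[OF W Ys i])
qed

text \<open>With a cut-off r that is 1 at b0, X is r' X plus a combination of frame fields whose
  coefficients \<open>c i\<close> vanish at b0 together with X; r' vanishes there as well. Function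
  linearity makes every term 0 at b0.\<close>

lemma form_tensorial:
 assumes b0: "b0 \<in> pts Ob" and W: "LR.form W" and Ys: "set Ys \<subseteq> RI" and X: "X \<in> RI" "X (un b0) = (\<lambda>f. 0)"
 shows "W (X # Ys) b0 = 0"
proof -
 obtain I :: "nat set" and B Y where F: "finite I" "\<forall>i\<in>I. B i \<in> RI \<and> Y i \<in> Cinf Ar"
  "eventually (\<lambda>b. \<forall>v. (un b, v) \<in> LP --> v = (\<lambda>f. \<Sum>i\<in>I. v (Y i) * B i (un b) f)) (nh Ob b0)"
  using frame[OF b0] by (elim exE conjE)
 obtain N' where N': "open_in Ob N'" "b0 \<in> N'" "\<forall>b\<in>N'. \<forall>v. (un b, v) \<in> LP --> v = (\<lambda>f. \<Sum>i\<in>I. v (Y i) * B i (un b) f)"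
  using F(3) unfolding ev_nh[OF b0] by blast
 obtain \<rho> W' where \<rho>: "\<rho> \<in> Cinf Ob" "eventually (\<lambda>q. \<rho> q = 1) (nh Ob b0)"
  "N' \<union> W' = pts Ob" "\<forall>q\<in>W'. \<rho> q = 0"
  using bump[OF dOb N'(1,2)] by (elim bexE exE conjE)
 define r where "r b = (if b \<in> pts Ob then \<rho> b else 0)" for b
 define r' where "r' b = (if b \<in> pts Ob then 1 - \<rho> b else 0)" for b
 define c where "c i b = (if b \<in> pts Ob then \<rho> b * X (un b) (Y i) else 0)" for i b
 have r: "r \<in> CO" "r' \<in> CO" unfolding r_def[abs_def] r'_def[abs_def]
  by (intro COI \<rho>(1) Cinf_diff[OF dOb] Cinf_const[OF dOb])+
 have c: "c i \<in> CO" if "i \<in> I" for i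
  unfolding c_def[abs_def] by (intro COI Cinf_mult[OF dOb] \<rho>(1) un_Cinf[where f = "\<lambda>p. X p (Y i)"] RI_D(2)[OF X(1)]) (use F(2) that in blast)
 have S: "(\<Sum>i\<in>I. smul (c i) (B i)) \<in> RI" by (intro RI_sum RI_smul COD c) (use F(2) in blast)
 have "smul r X = (\<Sum>i\<in>I. smul (c i) (B i))"
 proof (rule RI_eqI[OF RI_smul[OF X(1) COD(1)[OF r(1)]] S])
  fix b assume b: "b \<in> pts Ob"
  show "smul r X (un b) = (\<Sum>i\<in>I. smul (c i) (B i)) (un b)"
  proof (cases "b \<in> N'")
   case True
   have "(un b, X (un b)) \<in> LP --> X (un b) = (\<lambda>f. \<Sum>i\<in>I. X (un b) (Y i) * B i (un b) f)"
    using N'(3) True by blast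
   then have *: "X (un b) f = (\<Sum>i\<in>I. X (un b) (Y i) * B i (un b) f)" for f
    using RI_lie[OF X(1) b] by metis
   have "r b * X (un b) f = (\<Sum>i\<in>I. c i b * B i (un b) f)" for f
    by (subst *) (simp add: r_def c_def b sum_distrib_left mult.assoc)
   then show ?thesis using b by (simp add: fun_eq_iff sum_fun_apply smul_def)
  next
   case False
   then have "\<rho> b = 0" using \<rho>(3,4) b by blast
   then show ?thesis using b by (simp add: fun_eq_iff sum_fun_apply smul_def r_def c_def)
  qed
 qed
 moreover have "smul r' X + smul r X = X"
  by (rule RI_ext[OF RI_add[OF RI_smul RI_smul] X(1)]) (use r X in "auto simp: COD smul_def r_def r'_def algebra_simps")
 ultimately have "W (X # Ys) = W ((smul r' X + (\<Sum>i\<in>I. smul (c i) (B i))) # Ys)" by simp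
 also have "\<dots> = W (smul r' X # Ys) + W ((\<Sum>i\<in>I. smul (c i) (B i)) # Ys)"
  by (rule LR.form_hd(1)[OF W Ys RI_smul[OF X(1) COD(1)[OF r(2)]] S])
 also have "\<dots> = r' * W (X # Ys) + (\<Sum>i\<in>I. c i * W (B i # Ys))"
  using LR.form_hd(2)[OF W Ys X(1) r(2)] form_sum[OF W Ys F(1) _ c, of B] F(2) by simp
 finally have "W (X # Ys) b0 = (r' * W (X # Ys) + (\<Sum>i\<in>I. c i * W (B i # Ys))) b0" by simp
 moreover have "r' b0 = 0" "!!i. c i b0 = 0"
  using ev_nh_self[OF \<rho>(2) b0] X(2) by (simp_all add: r'_def c_def)
 ultimately show ?thesis by (simp add: sum_fun_apply)
qed

lemma form_local:
 assumes b: "b \<in> pts Ob"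
 shows "LR.form W ==> set Xs \<subseteq> RI ==> set Ys \<subseteq> RI ==> map (\<lambda>X. X (un b)) Xs = map (\<lambda>X. X (un b)) Ys ==> W Xs b = W Ys b"
proof (induction Xs arbitrary: W Ys)
 case (Cons X Xs)
 then obtain Y Zs where Ys: "Ys = Y # Zs" "X (un b) = Y (un b)" "map (\<lambda>X. X (un b)) Xs = map (\<lambda>X. X (un b)) Zs"
  by (cases Ys) auto
 have R: "X \<in> RI" "Y \<in> RI" "set Xs \<subseteq> RI" "set Zs \<subseteq> RI" using Cons.prems Ys(1) by auto
 have d: "X + - Y \<in> RI" by (rule RI_add[OF R(1) RI_minus[OF R(2)]])
 have "W ((X + - Y) # Xs) b = 0"
  by (rule form_tensorial[OF b Cons.prems(1) R(3) d]) (simp add: Ys(2) fun_eq_iff)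
 moreover have "W ((X + - Y) # Xs) = W (X # Xs) + - W (Y # Xs)"
  using LR.form_hd(1)[OF Cons.prems(1) R(3,1) RI_minus[OF R(2)]] LR.form_minus[OF Cons.prems(1) R(3,2)] by (simp only:)
 ultimately have "W (X # Xs) b = W (Y # Xs) b" by simp
 also have "\<dots> = W (Y # Zs) b"
  using Cons.IH[OF LR.form_ins[OF Cons.prems(1) R(2)] R(3,4) Ys(3)] by simp
 finally show ?case using Ys(1) by simp
qed simp

end

section \<open>Superfunctions and forms\<close>

context lie_rinehart
begin

lemma form_repeated: "form W ==> set Zs \<subseteq> L ==> X \<in> set Zs ==> W (X # Zs) = 0"
proof (induction Zs arbitrary: W)
 case (Cons Y Ys)
 then have Y: "Y \<in> L" "set Ys \<subseteq> L" "X \<in> L" by auto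
 show ?case
 proof (cases "X = Y")
  case True
  then show ?thesis using form_hd(3)[OF Cons.prems(1) Y(2,1)] by simp
 next
  case False
  then have "W (Y # X # Ys) = 0"
   using Cons.IH[OF form_ins[OF Cons.prems(1) Y(1)] Y(2)] Cons.prems(3) by simp
  then show ?thesis using form_swap[OF Cons.prems(1) Y(2,3,1)] by simp
 qed
qed simp

lemma form_not_distinct: "form W ==> set Xs \<subseteq> L ==> \<not> distinct Xs ==> W Xs = 0"
proof (induction Xs arbitrary: W)
 case (Cons X Xs)
 then show ?case
  using form_repeated[of W Xs X] Cons.IH[OF form_ins[of W X]] by (cases "X \<in> set Xs") auto
qed simp

lemma form_update:
 assumes W: "form W" and Xs: "set Xs \<subseteq> L" and i: "i < length Xs"
 shows "A \<in> L ==> B \<in> L ==> W (Xs[i := A + B]) = W (Xs[i := A]) + W (Xs[i := B])"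
  "A \<in> L ==> f \<in> C ==> W (Xs[i := sm f A]) = f * W (Xs[i := A])"
 using formD(2,3)[OF W, of "take i Xs" "drop (Suc i) Xs"] set_take_subset[of i Xs] set_drop_subset[of "Suc i" Xs] Xs i
 by (simp_all add: upd_conv_take_nth_drop)

end

lemma real_line_limit:
 assumes k: "smooth_at real_line 0 k" and d: "d > 0" and eq: "!!t. t ~= 0 ==> \<bar>t\<bar> < d ==> k t = c"
 shows "k 0 = c"
proof (rule ccontr)
 assume ne: "k 0 ~= c"
 have "eventually (\<lambda>q. \<forall>f\<in>{k}. \<bar>f q - f 0\<bar> < \<bar>c - k 0\<bar>) (nh real_line 0)"
  by (rule ev_close) (use k ne in auto)
 from ev_real_line[OF this] obtain e where e: "e > 0" "\<forall>t. \<bar>t\<bar> < e --> \<bar>k t - k 0\<bar> < \<bar>c - k 0\<bar>" by auto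
 define t where "t = min d e / 2"
 have "t ~= 0" "\<bar>t\<bar> < d" "\<bar>t\<bar> < e" using d e(1) by (auto simp: t_def min_def)
 then show False using eq[of t] e(2) by auto
qed

section \<open>Zero section, fibres and addition in the Lie algebroid\<close>

context lie_gpd
begin

definition zer :: "'b => 'g \<times> 'g tvec" where "zer b = (un b, \<lambda>f. 0)"

definition val :: "('g => 'g tvec) => 'b => 'g \<times> 'g tvec" where "val X b = (un b, X (un b))"

abbreviation "VB \<equiv> vb_base A lie_scale"
abbreviation "VF \<equiv> vb_fibre A lie_scale"
abbreviation "SF \<equiv> superfunctions A lie_scale"

lemma lie_scale_0: "lie_scale 0 e = (fst e, \<lambda>f. 0)"
 by (simp add: lie_scale_def case_prod_unfold)

lemma zer_lie: "b \<in> pts Ob ==> zer b \<in> LP"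
 by (simp add: zer_def lie_pts_iff tangent_zero)

lemma val_lie: "X \<in> RI ==> b \<in> pts Ob ==> val X b \<in> LP"
 unfolding val_def by (rule RI_lie)

lemma VB_iff: "\<beta> \<in> VB \<longleftrightarrow> (\<exists>b\<in>pts Ob. \<beta> = zer b)"
proof
 assume "\<beta> \<in> VB"
 then obtain e where e: "e \<in> LP" "\<beta> = lie_scale 0 e" by (auto simp: vb_base_def)
 then show "\<exists>b\<in>pts Ob. \<beta> = zer b"
  using lie_ptsD(2,3)[OF e(1)] by (intro bexI[of _ "sr (fst e)"]) (simp_all add: lie_scale_0 zer_def)
next
 assume "\<exists>b\<in>pts Ob. \<beta> = zer b"
 then obtain b where b: "b \<in> pts Ob" "\<beta> = zer b" by blast
 then have "\<beta> = lie_scale 0 (zer b)" by (simp add: lie_scale_0 zer_def)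
 then show "\<beta> \<in> VB" using zer_lie[OF b(1)] by (simp add: vb_base_def)
qed

lemma VF_iff: "e \<in> VF (zer b) \<longleftrightarrow> e \<in> LP \<and> fst e = un b"
 by (simp add: vb_fibre_def lie_scale_0 zer_def)

lemma lie_add:
 assumes "u \<in> LP" "v \<in> LP" "fst u = fst v"
 shows "(fst u, \<lambda>g. snd u g + snd v g) \<in> LP"
proof -
 have "(fst u, snd u) \<in> LP" using assms(1) by simp
 moreover have "(fst u, snd v) \<in> LP" using assms(2) unfolding assms(3) by simp
 ultimately show ?thesis unfolding lie_pts_iff using tangent_add by auto
qed

text \<open>All that is known of f is smoothness and weight 1. By Hadamard's lemma f (t e) / t is a
  sum of fibre coordinates of e with coefficients taken at t e. It does not depend on t, and as t
  tends to 0 the coefficients become those at the zero vector; so f is linear in the fibre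
  coordinates.\<close>

lemma linear_function_add:
 assumes f: "f \<in> linear_functions A lie_scale" and u: "u \<in> LP" and v: "v \<in> LP" and uv: "fst u = fst v"
 shows "f (fst u, \<lambda>g. snd u g + snd v g) = f u + f v"
proof -
 obtain U y N z pos where ad: "adapted U y N z pos" and uU: "u \<in> adom U"
  using A_chart_at[OF u] by (elim exE conjE)
 note c = A_chart[OF ad]
 let ?x = "axi y pos" and ?w = "\<lambda>i. if i \<in> pos ` {..<m} then 0 else 1 :: nat"
 define z0 where "z0 = lie_scale 0 u"
 have hom: "homogeneous_chart n A lie_scale (adom U) ?x ?w" by (rule lie_scale_chart[OF ad])
 have xs: "?x (lie_scale t e) i = t ^ ?w i * ?x e i" "lie_scale t e \<in> adom U" if "e \<in> adom U" "i < n" for t e i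
  using hom that unfolding homogeneous_chart_def by (blast, blast)
 have sU: "lie_scale t e \<in> adom U" if "e \<in> adom U" for t e
  using hom that unfolding homogeneous_chart_def by blast
 have oU: "z0 \<in> adom U" unfolding z0_def by (rule sU[OF uU])
 have fC: "f \<in> Cinf A" and fl: "!!t e. e \<in> LP ==> f (lie_scale t e) = t * f e"
  using f by (simp_all add: linear_functions_def)
 have V: "open_E n (?x ` adom U)" by (rule chartD(2)[OF c])
 have F: "smooth_on n (?x ` adom U) (lf (adom U) ?x f)"
  by (rule chart_smooth[OF c]) (rule sm_Cinf[OF fC chart_sub[OF c]])
 obtain \<epsilon> where \<epsilon>: "\<epsilon> > 0" "box_at n (?x z0) \<epsilon> \<subseteq> ?x ` adom U"
  using V oU unfolding openE_iff by blast
 obtain q where q: "\<forall>j<n. smooth_on n (box_at n (?x z0) \<epsilon>) (q j)"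
  "\<forall>Y\<in>box_at n (?x z0) \<epsilon>. lf (adom U) ?x f Y = lf (adom U) ?x f (?x z0) + (\<Sum>j<n. (Y j - ?x z0 j) * q j Y)"
  using hadamard[OF chart_E[OF c oU] \<epsilon>(1) smooth_on_subset[OF V openin_box_at \<epsilon>(2) F]] by blast
 have key: "f e = (\<Sum>j\<in>fpos pos. ?x e j * q j (?x z0))" if e: "e \<in> adom U" and eo: "lie_scale 0 e = z0" for e
 proof -
  have el: "e \<in> LP" using e by (simp add: adom_def)
  let ?\<gamma> = "\<lambda>t. lie_scale t e"
  have \<gamma>: "smap_at real_line A 0 ?\<gamma>"
   by (rule homogeneity_joint[OF homogeneity_scale diffspace_real sm_Cinf[OF real_Cinf] smap_at_const[OF diffspace_real]])
    (use el in simp_all)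
  have xo: "?x z0 \<in> box_at n (?x z0) \<epsilon>"
   using chart_E[OF c oU] \<epsilon>(1) by (simp add: box_at_def)
  have Q: "smooth_at A z0 (\<lambda>e. q j (tup n (?x e)))" if "j < n" for j
   by (rule sm_compose[OF dA chart_sub[OF c oU] chart_coord[OF c oU] openin_box_at])
    (use q(1) that xo chart_tup[OF c oU] in auto)
  have k: "smooth_at real_line 0 (\<lambda>t. \<Sum>j\<in>fpos pos. ?x e j * q j (tup n (?x (?\<gamma> t))))"
  proof (rule sm_sum[OF diffspace_real], simp)
   fix j assume "j \<in> fpos pos"
   then have "j < n" by (simp add: fpos_def)
   show "smooth_at real_line 0 (\<lambda>t. ?x e j * q j (tup n (?x (?\<gamma> t))))"
    by (rule sm_cmult[OF diffspace_real sm_pull[where \<phi> = ?\<gamma>, OF \<gamma>]]) (use Q[OF \<open>j < n\<close>] eo in simp)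
  qed
  have "eventually (\<lambda>e. ?x e \<in> box_at n (?x z0) \<epsilon>) (nh A z0)"
  proof -
   have "eventually (\<lambda>e. \<forall>g\<in>(\<lambda>i e. ?x e i) ` {..<n}. \<bar>g e - g z0\<bar> < \<epsilon>) (nh A z0)"
    by (rule ev_close) (use chart_coord[OF c oU] \<epsilon>(1) in auto)
   moreover have "eventually (\<lambda>e. e \<in> adom U) (nh A z0)" by (rule ev_chart[OF c oU])
   ultimately show ?thesis
    by eventually_elim (use chart_E[OF c] chart_E[OF c oU] in "auto simp: box_at_def")
  qed
  from smap_at_ev[where \<phi> = ?\<gamma>, OF \<gamma>, of "\<lambda>e. ?x e \<in> box_at n (?x z0) \<epsilon>"] this eo
  have "eventually (\<lambda>t. ?x (?\<gamma> t) \<in> box_at n (?x z0) \<epsilon>) (nh real_line 0)" by simp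
  from ev_real_line[OF this] obtain d where d: "d > 0" "\<forall>t. \<bar>t\<bar> < d --> ?x (?\<gamma> t) \<in> box_at n (?x z0) \<epsilon>" by auto
  have "(\<Sum>j\<in>fpos pos. ?x e j * q j (tup n (?x (?\<gamma> t)))) = f e" if t: "t ~= 0" "\<bar>t\<bar> < d" for t
  proof -
   have f0: "lf (adom U) ?x f (?x z0) = 0"
    using lf_apply[OF chartD(3)[OF c] oU, of f] fl[OF el, of 0] eo by simp
   have d0: "?x (?\<gamma> t) j - ?x z0 j = (if j \<in> fpos pos then t * ?x e j else 0)" if "j < n" for j
    using xs(1)[OF e that, of t] xs(1)[OF e that, of 0] eo that by (simp add: fpos_def)
   have "t * f e = lf (adom U) ?x f (?x (?\<gamma> t))"
    using lf_apply[OF chartD(3)[OF c] sU[OF e], of f t] fl[OF el] by simp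
   also have "\<dots> = (\<Sum>j<n. (if j \<in> fpos pos then t * ?x e j else 0) * q j (?x (?\<gamma> t)))"
    using q(2) d(2) t(2) f0 d0 by simp
   also have "\<dots> = (\<Sum>j\<in>fpos pos. (t * ?x e j) * q j (?x (?\<gamma> t)))"
    by (rule sum.mono_neutral_cong_right) (auto simp: fpos_def)
   also have "\<dots> = t * (\<Sum>j\<in>fpos pos. ?x e j * q j (?x (?\<gamma> t)))"
    by (simp add: sum_distrib_left mult.assoc)
   finally show ?thesis using t(1) chart_tup[OF c sU[OF e]] by simp
  qed
  from real_line_limit[OF k d(1) this] show ?thesis using eo chart_tup[OF c oU] by simp
 qed
 define s where "s = (fst u, \<lambda>g. snd u g + snd v g)"
 have S: "s \<in> adom U" "v \<in> adom U" "fst s = fst u"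
  using uU lie_add[OF u v uv] v uv by (simp_all add: adom_def s_def)
 have "?x s j = ?x u j + ?x v j" if "j \<in> fpos pos" for j
  using that axi_nth[OF ad, of j] uv by (simp add: fpos_def s_def tv_def)
 then have "(\<Sum>j\<in>fpos pos. ?x s j * q j (?x z0)) = f u + f v"
  using key[OF uU] key[OF S(2)] uv by (simp add: z0_def lie_scale_0 algebra_simps sum.distrib)
 then show ?thesis using key[OF S(1)] S(3) by (simp add: z0_def lie_scale_0 s_def)
qed

lemma vb_add_eq:
 assumes u: "u \<in> LP" and v: "v \<in> LP" and uv: "fst u = fst v"
 shows "vb_add A lie_scale u v = (fst u, \<lambda>g. snd u g + snd v g)"
 unfolding vb_add_def
proof (rule the_equality)
 show "(fst u, \<lambda>g. snd u g + snd v g) \<in> VF (lie_scale 0 u) \<and>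
   (\<forall>f\<in>linear_functions A lie_scale. f (fst u, \<lambda>g. snd u g + snd v g) = f u + f v)"
  using lie_add[OF assms] linear_function_add[OF _ assms] by (simp add: vb_fibre_def lie_scale_0)
 fix e assume e: "e \<in> VF (lie_scale 0 u) \<and> (\<forall>f\<in>linear_functions A lie_scale. f e = f u + f v)"
 then have el: "e \<in> LP" "fst e = fst u" by (simp_all add: vb_fibre_def lie_scale_0)
 have "snd e = (\<lambda>g. snd u g + snd v g)"
 proof (rule tangent_eqI)
  show "snd e \<in> TS Ar (fst u)" using lie_ptsD(4)[OF el(1)] el(2) by simp
  show "(\<lambda>g. snd u g + snd v g) \<in> TS Ar (fst u)"
   using lie_ptsD(4)[OF lie_add[OF assms]] by simp
  fix g assume "g \<in> Cinf Ar"
  \<comment> \<open>Uniqueness: evaluation of a vector on a fixed g has weight 1, and these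
    evaluations determine the vector.\<close>
  then have "(\<lambda>e. snd e g) \<in> linear_functions A lie_scale"
   using Cinf_A_snd by (simp add: linear_functions_def)
  from bspec[OF conjunct2[OF e] this] show "snd e g = snd u g + snd v g" .
 qed
 then show "e = (fst u, \<lambda>g. snd u g + snd v g)" using el(2) by (simp add: prod_eq_iff)
qed

section \<open>The correspondence of superfunctions and forms\<close>

definition ev :: "('g \<times> 'g tvec) sfun => ('g => 'g tvec) list => 'b => real" where
 "ev \<omega> Xs b = (if b \<in> pts Ob then \<omega> (zer b) (map (\<lambda>X. val X b) Xs) else 0)"

abbreviation "FP p \<equiv> fibre_power A lie_scale p"

lemma FP_pts: "z \<in> pts (FP p) \<longleftrightarrow> (\<exists>b\<in>pts Ob. fst z = zer b \<and> set (snd z) \<subseteq> VF (zer b) \<and> length (snd z) = p)"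
 unfolding fibre_power_def by (auto simp: VB_iff)

lemma dFP [simp]: "diffspace (FP p)"
 unfolding fibre_power_def by (rule diffspace_gen)

text \<open>The generators of a fibre power look at the base point and at single entries of the
  list, so these are tested one by one.\<close>

lemma FP_I:
 assumes N: "diffspace N" and p: "p \<in> pts N"
  and b: "eventually (\<lambda>q. b q \<in> pts Ob) (nh N p)" "smap_at N Ob p b"
  and es: "eventually (\<lambda>q. set (es q) \<subseteq> VF (zer (b q)) \<and> length (es q) = r) (nh N p)"
  and i: "!!i f. i < r ==> f \<in> Cinf A ==> smooth_at N p (\<lambda>q. f (es q ! i))"
 shows "smap_at N (FP r) p (\<lambda>q. (zer (b q), es q))"
 unfolding fibre_power_def
proof (rule smap_at_gen[OF N p])
 show "eventually (\<lambda>q. (zer (b q), es q) \<in> {(b, es). b \<in> VB \<and> set es \<subseteq> VF b \<and> length es = r}) (nh N p)"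
  using b(1) es by eventually_elim (auto simp: VB_iff)
 have z: "smooth_at N p (\<lambda>q. f (zer (b q)))" if f: "f \<in> Cinf A" for f
 proof -
  \<comment> \<open>The zero section is smooth as the restriction of the right-invariant field 0 to
    the units.\<close>
  have "val 0 = zer" by (simp add: val_def zer_def fun_eq_iff)
  then have "smooth_map Ob A zer"
   using lie_sectionsD(1)[OF RI_section[OF RI_0]] unfolding val_def[abs_def] by simp
  from smap_at_comp'[OF b(2) this] show ?thesis using f by (simp add: smap_at_def)
 qed
 show "smooth_at N p (\<lambda>q. c (zer (b q), es q))"
  if "c \<in> {f \<circ> fst |f. f \<in> Cinf A} \<union> {\<lambda>(b, es). f (es ! i) |f i. f \<in> Cinf A \<and> i < r}" for c
  using that z i by auto
qed

lemma ev_CO: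
 assumes \<omega>: "!!p. (\<lambda>(b, es). \<omega> b es) \<in> Cinf (FP p)" and Xs: "set Xs \<subseteq> RI"
 shows "ev \<omega> Xs \<in> CO"
proof -
 have "(\<lambda>b. \<omega> (zer b) (map (\<lambda>X. val X b) Xs)) \<in> Cinf Ob"
 proof (rule CinfI[OF dOb])
  fix b assume b: "b \<in> pts Ob"
  have "smap_at Ob (FP (length Xs)) b (\<lambda>b. (zer b, map (\<lambda>X. val X b) Xs))"
  proof (rule FP_I[OF dOb b ev_nh_pts smap_at_id[OF b]])
   show "eventually (\<lambda>b. set (map (\<lambda>X. val X b) Xs) \<subseteq> VF (zer b) \<and> length (map (\<lambda>X. val X b) Xs) = length Xs) (nh Ob b)"
    by (rule ev_ptsI) (use Xs val_lie in "auto simp: VF_iff val_def")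
   fix i f assume i: "i < length Xs" and f: "f \<in> Cinf A"
   have "Xs ! i \<in> RI" using Xs i by auto
   then have "smap_at Ob A b (val (Xs ! i))"
    unfolding val_def[abs_def] by (rule smooth_mapD[OF lie_sectionsD(1)[OF RI_section] b])
   then show "smooth_at Ob b (\<lambda>b. f (map (\<lambda>X. val X b) Xs ! i))"
    using f i by (simp add: smap_at_def)
  qed
  then show "smooth_at Ob b (\<lambda>b. \<omega> (zer b) (map (\<lambda>X. val X b) Xs))"
   using \<omega>[of "length Xs"] by (auto simp: smap_at_def)
 qed
 then show ?thesis unfolding ev_def[abs_def] by (rule COI)
qed

lemma SF_D:
 assumes "\<omega> \<in> SF"
 shows "\<not> (b \<in> VB \<and> set es \<subseteq> VF b) ==> \<omega> b es = 0" "(\<lambda>(b, es). \<omega> b es) \<in> Cinf (FP p)"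
  "b \<in> VB ==> set es \<subseteq> VF b ==> i < length es ==> u \<in> VF b ==> v \<in> VF b ==>
   \<omega> b (es[i := vb_add A lie_scale u v]) = \<omega> b (es[i := u]) + \<omega> b (es[i := v])"
  "b \<in> VB ==> set es \<subseteq> VF b ==> i < length es ==> u \<in> VF b ==> \<omega> b (es[i := lie_scale t u]) = t * \<omega> b (es[i := u])"
  "b \<in> VB ==> set es \<subseteq> VF b ==> i < length es ==> j < length es ==> i ~= j ==> es ! i = es ! j ==> \<omega> b es = 0"
proof -
 note * = assms[unfolded superfunctions_def, THEN CollectD]
 show "\<not> (b \<in> VB \<and> set es \<subseteq> VF b) ==> \<omega> b es = 0" "(\<lambda>(b, es). \<omega> b es) \<in> Cinf (FP p)"
  using *[THEN conjunct1, rule_format, of b es] *[THEN conjunct2, THEN conjunct1, rule_format, of p] by blast+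
 note ** = *[THEN conjunct2, THEN conjunct2, rule_format, of b es]
 show "b \<in> VB ==> set es \<subseteq> VF b ==> i < length es ==> u \<in> VF b ==> v \<in> VF b ==>
   \<omega> b (es[i := vb_add A lie_scale u v]) = \<omega> b (es[i := u]) + \<omega> b (es[i := v])"
  using ** by blast
 show "b \<in> VB ==> set es \<subseteq> VF b ==> i < length es ==> u \<in> VF b ==> \<omega> b (es[i := lie_scale t u]) = t * \<omega> b (es[i := u])"
  using ** by blast
 show "b \<in> VB ==> set es \<subseteq> VF b ==> i < length es ==> j < length es ==> i ~= j ==> es ! i = es ! j ==> \<omega> b es = 0"
  using ** by blast
qed

lemma val_VF: "X \<in> RI ==> b \<in> pts Ob ==> val X b \<in> VF (zer b)"
 using val_lie by (simp add: VF_iff val_def)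

lemma val_add: "X \<in> RI ==> Y \<in> RI ==> b \<in> pts Ob ==> val (X + Y) b = vb_add A lie_scale (val X b) (val Y b)"
 using vb_add_eq[OF val_lie[of X b] val_lie[of Y b]] by (simp add: val_def plus_fun_def)

lemma val_smul: "b \<in> pts Ob ==> val (smul f X) b = lie_scale (f b) (val X b)"
 by (simp add: val_def smul_def[abs_def] lie_scale_def)

lemma ev_form:
 assumes \<omega>: "\<omega> \<in> SF"
 shows "LR.form (ev \<omega>)"
proof (rule LR.formI)
 show "LR.cochain (ev \<omega>)" unfolding LR.cochain_def using ev_CO[OF SF_D(2)[OF \<omega>]] by blast
 fix Xs Ys X Y f assume Xs: "set Xs \<subseteq> RI" and Ys: "set Ys \<subseteq> RI" and X: "X \<in> RI"
 let ?es = "\<lambda>Z b. map (\<lambda>X. val X b) (Xs @ Z # Ys)"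
 have es: "zer b \<in> VB" "set (?es X b) \<subseteq> VF (zer b)" "length Xs < length (?es X b)" if "b \<in> pts Ob" for b
  using that Xs Ys X val_VF by (auto simp: VB_iff)
 have upd: "?es Z b = (?es X b)[length Xs := val Z b]" for Z b
  using list_update_length[of "map (\<lambda>X. val X b) Xs"] by simp
 show "ev \<omega> (Xs @ (X + Y) # Ys) = ev \<omega> (Xs @ X # Ys) + ev \<omega> (Xs @ Y # Ys)" if Y: "Y \<in> RI"
 proof
  fix b
  show "ev \<omega> (Xs @ (X + Y) # Ys) b = (ev \<omega> (Xs @ X # Ys) + ev \<omega> (Xs @ Y # Ys)) b"
  proof (cases "b \<in> pts Ob")
   case True
   show ?thesis
    using SF_D(3)[OF \<omega> es[OF True] val_VF[OF X True] val_VF[OF Y True]] True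
    unfolding plus_fun_apply ev_def upd[where Z = "X + Y"] upd[where Z = Y] upd[where Z = X, symmetric] val_add[OF X Y True] by simp
  qed (simp add: ev_def)
 qed
 show "ev \<omega> (Xs @ smul f X # Ys) = f * ev \<omega> (Xs @ X # Ys)"
 proof
  fix b
  show "ev \<omega> (Xs @ smul f X # Ys) b = (f * ev \<omega> (Xs @ X # Ys)) b"
   using SF_D(4)[OF \<omega> es val_VF[OF X]]
   unfolding times_fun_apply ev_def upd[where Z = "smul f X"] upd[where Z = X, symmetric] by (simp add: val_smul)
 qed
 show "ev \<omega> (Xs @ X # X # Ys) = 0"
 proof
  fix b
  let ?l = "map (\<lambda>X. val X b) (Xs @ X # X # Ys)"
  show "ev \<omega> (Xs @ X # X # Ys) b = 0 b"
  proof (cases "b \<in> pts Ob")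
   case True
   have "\<omega> (zer b) ?l = 0"
    by (rule SF_D(5)[OF \<omega> es(1)[OF True], of _ "length Xs" "Suc (length Xs)"])
     (use True Xs Ys X val_VF in "auto simp: nth_append")
   then show ?thesis by (simp add: ev_def)
  qed (simp add: ev_def)
 qed
qed

definition rext :: "'g \<times> 'g tvec => 'g => 'g tvec" where
 "rext e = (SOME X. X \<in> RI \<and> X (fst e) = snd e)"

lemma rext:
 assumes "e \<in> LP"
 shows "rext e \<in> RI \<and> rext e (fst e) = snd e"
proof -
 have "\<exists>X. X \<in> RI \<and> X (fst e) = snd e" using RI_extend[OF assms] by blast
 from someI_ex[OF this] show ?thesis by (simp only: rext_def)
qed

text \<open>The inverse of \<open>ev\<close>: by tensoriality the value of a form at b does not depend on the extension of
 the vectors over b to right-invariant vector fields.\<close>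

definition sfo :: "(('g => 'g tvec) list => 'b => real) => ('g \<times> 'g tvec) sfun" where
 "sfo W \<beta> es = (if \<beta> \<in> VB \<and> set es \<subseteq> VF \<beta> then W (map rext es) (sr (fst \<beta>)) else 0)"

lemma rext_RI: "set es \<subseteq> VF (zer b) ==> set (map rext es) \<subseteq> RI"
 using rext VF_iff by auto

lemma val_rext: "e \<in> VF (zer b) ==> val (rext e) b = e"
 using rext[of e] VF_iff[of e b] by (simp add: val_def prod_eq_iff)

lemma map_val_rext: "set es \<subseteq> VF (zer b) ==> map (\<lambda>X. val X b) (map rext es) = es"
 unfolding map_map o_def by (rule map_idI) (use val_rext in blast)

lemma sfo_val:
 assumes W: "LR.form W" and b: "b \<in> pts Ob" and Xs: "set Xs \<subseteq> RI"
 shows "sfo W (zer b) (map (\<lambda>X. val X b) Xs) = W Xs b"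
proof -
 let ?es = "map (\<lambda>X. val X b) Xs"
 have es: "set ?es \<subseteq> VF (zer b)" using Xs b val_VF by auto
 have "rext (val X b) (un b) = X (un b)" if "X \<in> set Xs" for X
  using rext[OF val_lie[OF _ b], of X] that Xs by (auto simp: val_def)
 then have "W (map rext ?es) b = W Xs b"
  by (intro form_local[OF b W rext_RI[OF es] Xs]) simp
 moreover have "zer b \<in> VB" "sr (fst (zer b)) = b" using b by (auto simp: VB_iff zer_def)
 ultimately show ?thesis using es by (simp add: sfo_def)
qed

lemma ev_sfo:
 assumes "LR.form W" "set Xs \<subseteq> RI"
 shows "ev (sfo W) Xs = W Xs"
proof
 fix b
 show "ev (sfo W) Xs b = W Xs b"
  using sfo_val[OF assms(1) _ assms(2)] COD(2)[OF LR.cochainD[OF LR.formD(1)[OF assms(1)] assms(2)]]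
  by (simp add: ev_def)
qed

lemma sf_eqI:
 assumes "!!b es. \<not> (b \<in> VB \<and> set es \<subseteq> VF b) ==> \<omega> b es = 0" "!!b es. \<not> (b \<in> VB \<and> set es \<subseteq> VF b) ==> \<eta> b es = 0"
  and eq: "!!Xs b. set Xs \<subseteq> RI ==> b \<in> pts Ob ==> ev \<omega> Xs b = ev \<eta> Xs b"
 shows "\<omega> = \<eta>"
proof (intro ext)
 fix \<beta> es
 show "\<omega> \<beta> es = \<eta> \<beta> es"
 proof (cases "\<beta> \<in> VB \<and> set es \<subseteq> VF \<beta>")
  case True
  then obtain b where b: "b \<in> pts Ob" "\<beta> = zer b" "set es \<subseteq> VF (zer b)" by (auto simp: VB_iff)
  show ?thesis
   using eq[OF rext_RI[OF b(3)] b(1)] b(1,2) unfolding ev_def map_val_rext[OF b(3)] by simp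
 qed (use assms(1,2) in simp)
qed

text \<open>The first vector is extended with constant coefficients in the frame, and by
  tensoriality \<open>sfo\<close> may be computed with this extension. It lowers the degree in
  \<open>sfo_smooth\<close>.\<close>

lemma sfo_step:
 assumes W: "LR.form W" and b: "b \<in> pts Ob" and e: "e \<in> VF (zer b)" and es: "set es \<subseteq> VF (zer b)"
  and I: "finite I" "!!i. i \<in> I ==> B i \<in> RI" and eq: "snd e = (\<lambda>f. \<Sum>i\<in>I. c i * B i (un b) f)"
 shows "sfo W (zer b) (e # es) = (\<Sum>i\<in>I. c i * sfo (ins (B i) W) (zer b) es)"
proof -
 let ?k = "\<lambda>i b. if b \<in> pts Ob then c i else 0"
 let ?X = "\<Sum>i\<in>I. smul (?k i) (B i)"
 have k: "?k i \<in> CO" for i by (rule COI[OF Cinf_const[OF dOb]])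
 have X: "?X \<in> RI" by (rule RI_sum[OF RI_smul[OF I(2) COD(1)[OF k]]])
 have eX: "e = val ?X b"
  using e eq b by (simp add: val_def VF_iff prod_eq_iff fun_eq_iff sum_fun_apply smul_def)
 have L: "set (?X # map rext es) \<subseteq> RI" using X rext_RI[OF es] by simp
 have "sfo W (zer b) (map (\<lambda>X. val X b) (?X # map rext es)) = W (?X # map rext es) b"
  by (rule sfo_val[OF W b L])
 moreover have "map (\<lambda>X. val X b) (?X # map rext es) = e # es"
  unfolding list.map(2) map_val_rext[OF es] eX[symmetric] ..
 ultimately have "sfo W (zer b) (e # es) = W (?X # map rext es) b" by simp
 also have "\<dots> = (\<Sum>i\<in>I. ?k i * W (B i # map rext es)) b"
  by (rule arg_cong[where f = "\<lambda>F. F b"], rule form_sum[OF W rext_RI[OF es] I k])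
 also have "\<dots> = (\<Sum>i\<in>I. c i * sfo (ins (B i) W) (zer b) es)"
 proof -
  have "sfo (ins (B i) W) (zer b) es = ins (B i) W (map rext es) b" if "i \<in> I" for i
   using sfo_val[OF LR.form_ins[OF W I(2)[OF that]] b rext_RI[OF es]] unfolding map_val_rext[OF es] .
  then show ?thesis using b by (simp add: sum_fun_apply)
 qed
 finally show ?thesis .
qed

lemma FP_base: 
 assumes "z \<in> pts (FP p)"
 shows "smap_at (FP p) Ob z (\<lambda>z. sr (fst (fst z)))"
 unfolding smap_at_def
proof (intro conjI ballI assms)
 show "eventually (\<lambda>z. sr (fst (fst z)) \<in> pts Ob) (nh (FP p) z)"
  by (rule ev_ptsI) (auto simp: FP_pts zer_def)
 fix f assume f: "f \<in> Cinf Ob"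
 have "(\<lambda>q. f (sr q)) \<in> Cinf Ar" by (rule smooth_map_Cinf[OF smaps(1) f])
 then have "(\<lambda>e. f (sr (fst e))) \<in> Cinf A" by (rule Cinf_A_fst)
 then have "(\<lambda>e. f (sr (fst e))) \<circ> fst \<in> Cinf (FP p)"
  unfolding fibre_power_def by (intro generators_Cinf) blast
 then show "smooth_at (FP p) z (\<lambda>z. f (sr (fst (fst z))))"
  using sm_Cinf[OF _ assms] by (simp add: o_def)
qed

lemma FP_nth: "i < p ==> f \<in> Cinf A ==> (\<lambda>z. f (snd z ! i)) \<in> Cinf (FP p)"
 unfolding fibre_power_def by (rule generators_Cinf) (auto simp: case_prod_unfold)

lemma FP_tl:
 assumes z: "z \<in> pts (FP (Suc p))"
 shows "smap_at (FP (Suc p)) (FP p) z (\<lambda>z. (fst z, tl (snd z)))"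
proof -
 have pt: "eventually (\<lambda>z. z \<in> pts (FP (Suc p))) (nh (FP (Suc p)) z)" by (rule ev_nh_pts)
 have "smap_at (FP (Suc p)) (FP p) z (\<lambda>z. (zer (sr (fst (fst z))), tl (snd z)))"
 proof (rule FP_I[OF dFP z _ FP_base[OF z]])
  show "eventually (\<lambda>z. sr (fst (fst z)) \<in> pts Ob) (nh (FP (Suc p)) z)"
   using pt by eventually_elim (auto simp: FP_pts zer_def)
  show "eventually (\<lambda>q. set (tl (snd q)) \<subseteq> VF (zer (sr (fst (fst q)))) \<and> length (tl (snd q)) = p) (nh (FP (Suc p)) z)"
   using pt
  proof eventually_elim
   case (elim q)
   then obtain b where "b \<in> pts Ob" "fst q = zer b" "set (snd q) \<subseteq> VF (zer b)" "length (snd q) = Suc p"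
    by (auto simp: FP_pts)
   moreover from this have "sr (fst (fst q)) = b" by (simp add: zer_def)
   moreover have "set (tl (snd q)) \<subseteq> set (snd q)" by (cases "snd q") auto
   ultimately show ?case by auto
  qed
  fix i f assume i: "i < p" and f: "f \<in> Cinf A"
  have "smooth_at (FP (Suc p)) z (\<lambda>z. f (snd z ! Suc i))"
   by (rule sm_Cinf[OF FP_nth[OF _ f] z]) (use i in simp)
  moreover have "eventually (\<lambda>z. f (snd z ! Suc i) = f (tl (snd z) ! i)) (nh (FP (Suc p)) z)"
   using pt by eventually_elim (use i in "auto simp: FP_pts nth_tl")
  ultimately show "smooth_at (FP (Suc p)) z (\<lambda>q. f (tl (snd q) ! i))" by (rule sm_cong[rotated])
 qed
 moreover have "eventually (\<lambda>z. (zer (sr (fst (fst z))), tl (snd z)) = (fst z, tl (snd z))) (nh (FP (Suc p)) z)"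
  using pt by eventually_elim (auto simp: FP_pts zer_def)
 ultimately show ?thesis by (rule smap_at_cong[rotated])
qed

text \<open>Induction on the degree. The chosen extensions \<open>rext\<close> need not depend
  smoothly on the vector; so the first argument is expanded in a frame, where its coefficients are
  smooth, and what is left is the form \<open>ins (B i) W\<close> of lower degree.\<close>

lemma sfo_smooth: "LR.form W ==> (\<lambda>(b, es). sfo W b es) \<in> Cinf (FP p)"
proof (induction p arbitrary: W)
 case 0
 have W: "W [] \<in> Cinf Ob" by (rule COD(1)[OF LR.cochainD[OF LR.formD(1)[OF 0]]]) simp
 show ?case
 proof (rule CinfI[OF dFP])
  fix z assume z: "z \<in> pts (FP 0)"
  have "smooth_at (FP 0) z (\<lambda>z. W [] (sr (fst (fst z))))"
   using FP_base[OF z] W by (simp add: smap_at_def)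
  moreover have "eventually (\<lambda>z. W [] (sr (fst (fst z))) = (\<lambda>(b, es). sfo W b es) z) (nh (FP 0) z)"
   by (rule ev_ptsI) (auto simp: FP_pts sfo_def VB_iff)
  ultimately show "smooth_at (FP 0) z (\<lambda>(b, es). sfo W b es)" by (rule sm_cong[rotated])
 qed
next
 case (Suc p)
 show ?case
 proof (rule CinfI[OF dFP])
  fix z assume z: "z \<in> pts (FP (Suc p))"
  let ?b = "\<lambda>z :: ('g \<times> 'g tvec) \<times> ('g \<times> 'g tvec) list. sr (fst (fst z))"
  have b0: "?b z \<in> pts Ob" using z by (auto simp: FP_pts zer_def)
  obtain I :: "nat set" and B Y where F: "finite I" "\<forall>i\<in>I. B i \<in> RI \<and> Y i \<in> Cinf Ar"
   "eventually (\<lambda>b. \<forall>v. (un b, v) \<in> LP --> v = (\<lambda>f. \<Sum>i\<in>I. v (Y i) * B i (un b) f)) (nh Ob (?b z))"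
   using frame[OF b0] by (elim exE conjE)
  let ?R = "\<lambda>z. \<Sum>i\<in>I. snd (snd z ! 0) (Y i) * (\<lambda>(b, es). sfo (ins (B i) W) b es) (fst z, tl (snd z))"
  have "smooth_at (FP (Suc p)) z ?R"
  proof (rule sm_sum[OF dFP z])
   fix i assume "i \<in> I"
   then have i: "B i \<in> RI" "Y i \<in> Cinf Ar" using F(2) by auto
   have "smooth_at (FP (Suc p)) z (\<lambda>z. (\<lambda>(b, es). sfo (ins (B i) W) b es) (fst z, tl (snd z)))"
    by (rule sm_pull[where \<phi> = "\<lambda>z. (fst z, tl (snd z))", OF FP_tl[OF z] sm_Cinf[OF Suc.IH[OF LR.form_ins[OF Suc.prems i(1)]]]])
     (rule smap_at_img[where \<phi> = "\<lambda>z. (fst z, tl (snd z))", OF FP_tl[OF z]])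
   moreover have "smooth_at (FP (Suc p)) z (\<lambda>z. snd (snd z ! 0) (Y i))"
    by (rule sm_Cinf[OF FP_nth[OF _ Cinf_A_snd[OF i(2)]] z]) simp
   ultimately show "smooth_at (FP (Suc p)) z (\<lambda>z. snd (snd z ! 0) (Y i) * (\<lambda>(b, es). sfo (ins (B i) W) b es) (fst z, tl (snd z)))"
    by (intro sm_mult[OF dFP])
  qed
  moreover have "eventually (\<lambda>z. ?R z = (\<lambda>(b, es). sfo W b es) z) (nh (FP (Suc p)) z)"
   using smap_at_ev[where \<phi> = ?b, OF FP_base[OF z] F(3)] ev_nh_pts
  proof eventually_elim
   case (elim z)
   obtain b where b: "b \<in> pts Ob" "fst z = zer b" "set (snd z) \<subseteq> VF (zer b)" "length (snd z) = Suc p"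
    using elim(2) unfolding FP_pts by blast
   then obtain e es where es: "snd z = e # es" by (cases "snd z") auto
   have bz: "?b z = b" using b(1,2) by (simp add: zer_def)
   have e: "e \<in> VF (zer b)" "set es \<subseteq> VF (zer b)" using b(3) es by auto
   then have el: "e \<in> LP" "(un b, snd e) = e" by (simp_all add: VF_iff prod_eq_iff)
   have "(un b, snd e) \<in> LP" unfolding el(2) by (rule el(1))
   then have dec: "snd e = (\<lambda>f. \<Sum>i\<in>I. snd e (Y i) * B i (un b) f)"
    by (rule elim(1)[unfolded bz, rule_format])
   have "sfo W (zer b) (e # es) = (\<Sum>i\<in>I. snd e (Y i) * sfo (ins (B i) W) (zer b) es)"
    by (rule sfo_step[where B = B and c = "\<lambda>i. snd e (Y i)", OF Suc.prems b(1) e F(1)]) (use F(2) in blast, rule dec)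
   then show ?case by (simp add: es b(2) case_prod_unfold)
  qed
  ultimately show "smooth_at (FP (Suc p)) z (\<lambda>(b, es). sfo W b es)" by (rule sm_cong[rotated])
 qed
qed

lemma sfo_SF:
 assumes W: "LR.form W"
 shows "sfo W \<in> SF"
 unfolding superfunctions_def
proof (intro CollectI conjI allI ballI impI)
 show "sfo W b es = 0" if "\<not> (b \<in> VB \<and> set es \<subseteq> VF b)" for b es using that by (simp only: sfo_def if_False)
 show "(\<lambda>(b, es). sfo W b es) \<in> Cinf (FP p)" for p by (rule sfo_smooth[OF W])
 fix \<beta> es i assume "\<beta> \<in> VB" and es: "set es \<subseteq> VF \<beta>" and i: "i < length es"
 then obtain b where b: "b \<in> pts Ob" "\<beta> = zer b" by (auto simp: VB_iff)
 note es = es[unfolded b(2)]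
 note R = rext_RI[OF es]
 have i': "i < length (map rext es)" using i by simp
 have upd: "sfo W \<beta> (es[i := val X b]) = W ((map rext es)[i := X]) b" if X: "X \<in> RI" for X
 proof -
  have "set ((map rext es)[i := X]) \<subseteq> RI" using R X set_update_subset_insert[of "map rext es" i X] by blast
  from sfo_val[OF W b(1) this] show ?thesis unfolding b(2) map_update map_val_rext[OF es] .
 qed
 fix u assume u: "u \<in> VF \<beta>"
 have eu: "rext u \<in> RI" "val (rext u) b = u" using rext val_rext u VF_iff b(2) by auto
 show "sfo W \<beta> (es[i := lie_scale t u]) = t * sfo W \<beta> (es[i := u])" for t
 proof -
  let ?k = "\<lambda>b. if b \<in> pts Ob then t else 0"
  have k: "?k \<in> CO" by (rule COI[OF Cinf_const[OF dOb]])
  have "lie_scale t u = val (smul ?k (rext u)) b" using val_smul[OF b(1), of ?k "rext u"] b(1) eu(2) by simp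
  then have "sfo W \<beta> (es[i := lie_scale t u]) = W ((map rext es)[i := smul ?k (rext u)]) b"
   using upd[OF RI_smul[OF eu(1) COD(1)[OF k]]] by simp
  also have "\<dots> = (?k * W ((map rext es)[i := rext u])) b"
   by (rule arg_cong[where f = "\<lambda>F. F b"], rule LR.form_update(2)[OF W R i' eu(1) k])
  finally show ?thesis using upd[OF eu(1)] eu(2) b(1) by simp
 qed
 fix v assume v: "v \<in> VF \<beta>"
 have ev: "rext v \<in> RI" "val (rext v) b = v" using rext val_rext v VF_iff b(2) by auto
 have "sfo W \<beta> (es[i := vb_add A lie_scale u v]) = W ((map rext es)[i := rext u + rext v]) b"
  using upd[OF RI_add[OF eu(1) ev(1)]] val_add[OF eu(1) ev(1) b(1)] eu(2) ev(2) by simp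
 also have "\<dots> = (W ((map rext es)[i := rext u]) + W ((map rext es)[i := rext v])) b"
  by (rule arg_cong[where f = "\<lambda>F. F b"], rule LR.form_update(1)[OF W R i' eu(1) ev(1)])
 finally show "sfo W \<beta> (es[i := vb_add A lie_scale u v]) = sfo W \<beta> (es[i := u]) + sfo W \<beta> (es[i := v])"
  using upd[OF eu(1)] upd[OF ev(1)] eu(2) ev(2) by simp
next
 fix \<beta> es i j assume "\<beta> \<in> VB" and es: "set es \<subseteq> VF \<beta>" and ij: "i < length es" "j < length es" "i ~= j \<and> es ! i = es ! j"
 then obtain b where b: "b \<in> pts Ob" "\<beta> = zer b" by (auto simp: VB_iff)
 have "\<not> distinct (map rext es)" using ij nth_eq_iff_index_eq[of "map rext es" i j] by auto
 then have "W (map rext es) = 0"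
  using LR.form_not_distinct[OF W rext_RI] es b(2) by blast
 then show "sfo W \<beta> es = 0" by (simp add: sfo_def)
qed

subsection \<open>The differential\<close>

lemma sf_eval_ev:
 assumes "set \<sigma>s \<subseteq> lie_sections G" "b \<in> pts Ob"
 shows "sf_eval G \<omega> \<sigma>s b = ev \<omega> (map rix \<sigma>s) b"
proof -
 have "\<sigma> b = val (rix \<sigma>) b" if "\<sigma> \<in> set \<sigma>s" for \<sigma>
  using that assms rix_un[of \<sigma> b] lie_sectionsD(3)[of \<sigma> b] by (auto simp: val_def prod_eq_iff)
 then show ?thesis using assms(2) by (simp add: sf_eval_def ev_def zer_def cong: map_cong)
qed

lemma sign_apply: "((- 1 :: 'c => real) ^ i) b = (- 1) ^ i"
 by (induction i) simp_all

lemma cartan_ed: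
 assumes W: "LR.form (ev \<omega>)" and \<sigma>s: "set \<sigma>s \<subseteq> lie_sections G" and b: "b \<in> pts Ob"
 shows "cartan_formula G \<omega> \<sigma>s b = LR.ed (ev \<omega>) (map rix \<sigma>s) b"
proof -
 have R: "set (map rix \<sigma>s) \<subseteq> RI" using \<sigma>s rix_RI by auto
 have sub: "set (nths \<sigma>s J) \<subseteq> lie_sections G" for J using \<sigma>s set_nths_subset[of \<sigma>s J] by blast
 have s: "\<sigma>s ! i \<in> lie_sections G" "rix (\<sigma>s ! i) \<in> RI" if "i < length \<sigma>s" for i
  using \<sigma>s nth_mem[OF that] rix_RI by (blast, blast)
 have 1: "snd (lie_anchor G ((\<sigma>s ! i) b)) (sf_eval G \<omega> (nths \<sigma>s (- {i}))) =
   anch (map rix \<sigma>s ! i) (ev \<omega> (nths (map rix \<sigma>s) (- {i}))) b" if i: "i < length \<sigma>s" for i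
 proof -
  let ?\<tau> = "nths \<sigma>s (- {i})"
  have e: "ev \<omega> (map rix ?\<tau>) \<in> CO"
   by (rule LR.cochainD[OF LR.formD(1)[OF W]]) (use sub rix_RI in auto)
  have sC: "sf_eval G \<omega> ?\<tau> \<in> Cinf Ob"
   by (rule Cinf_cong[OF dOb COD(1)[OF e]]) (rule sf_eval_ev[OF sub, symmetric])
  have "snd (lie_anchor G ((\<sigma>s ! i) b)) (sf_eval G \<omega> ?\<tau>) = snd ((\<sigma>s ! i) b) (\<lambda>q. sf_eval G \<omega> ?\<tau> (tg q))"
   using sC by (simp add: lie_anchor_def tangent_map_def case_prod_unfold o_def)
  also have "\<dots> = rix (\<sigma>s ! i) (un b) (\<lambda>q. sf_eval G \<omega> ?\<tau> (tg q))"
   using rix_un[OF s(1)[OF i] b] by simp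
  also have "\<dots> = rix (\<sigma>s ! i) (un b) (\<lambda>q. ev \<omega> (map rix ?\<tau>) (tg q))"
   by (rule RI_cong[OF s(2)[OF i] tg_Cinf[OF sC]]) (simp add: sf_eval_ev[OF sub])
  finally show ?thesis using i b by (simp add: anch_def nths_map)
 qed
 have 2: "sf_eval G \<omega> (lie_bracket G (\<sigma>s ! i) (\<sigma>s ! j) # nths \<sigma>s (- {i, j})) b =
   ev \<omega> (bra (map rix \<sigma>s ! i) (map rix \<sigma>s ! j) # nths (map rix \<sigma>s) (- {i, j})) b"
  if ij: "i < length \<sigma>s" "j < length \<sigma>s" for i j
 proof -
  have "sf_eval G \<omega> (nths \<sigma>s (- {i, j})) b = ev \<omega> (map rix (nths \<sigma>s (- {i, j}))) b"
   by (rule sf_eval_ev[OF sub b])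
  have "\<sigma> b = val (rix \<sigma>) b" if "\<sigma> \<in> set (nths \<sigma>s (- {i, j}))" for \<sigma>
   using that sub[of "- {i, j}"] b rix_un[of \<sigma> b] lie_sectionsD(3)[of \<sigma> b] by (auto simp: val_def prod_eq_iff)
  then have m: "map (\<lambda>\<sigma>. \<sigma> b) (nths \<sigma>s (- {i, j})) = map (\<lambda>X. val X b) (nths (map rix \<sigma>s) (- {i, j}))"
   by (simp add: nths_map)
  have "lie_bracket G (\<sigma>s ! i) (\<sigma>s ! j) b = val (bra (map rix \<sigma>s ! i) (map rix \<sigma>s ! j)) b"
   using ij s by (simp add: lie_bracket_def val_def right_invariant_extension_eq)
  then show ?thesis using b m by (simp add: sf_eval_def ev_def zer_def)
 qed
 show ?thesis
  unfolding LR.ed_expand[OF W R] cartan_formula_def plus_fun_apply sum_fun_apply times_fun_apply sign_apply length_map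
  by (intro arg_cong2[where f = "(+)"] sum.cong refl) (use 1 2 in auto)
qed

text \<open>Cartan's formula on sections determines a superfunction: every right-invariant field
  restricts to a section, and every list of vectors over a point is a list of values of such
  fields.\<close>

lemma lie_diff:
 assumes W: "LR.form (ev \<omega>)"
 shows "lie_differential G \<omega> = sfo (LR.ed (ev \<omega>))"
 unfolding lie_differential_def
proof (rule the_equality)
 have F: "LR.form (LR.ed (ev \<omega>))" by (rule LR.form_ed[OF W])
 have SFS: "sfo (LR.ed (ev \<omega>)) \<in> SF" by (rule sfo_SF[OF F])
 show "sfo (LR.ed (ev \<omega>)) \<in> SF \<and> (\<forall>\<sigma>s b. set \<sigma>s \<subseteq> lie_sections G \<and> b \<in> pts Ob -->
   sf_eval G (sfo (LR.ed (ev \<omega>))) \<sigma>s b = cartan_formula G \<omega> \<sigma>s b)"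
 proof (intro conjI SFS allI impI)
  fix \<sigma>s b assume *: "set \<sigma>s \<subseteq> lie_sections G \<and> b \<in> pts Ob"
  have "set (map rix \<sigma>s) \<subseteq> RI" using * rix_RI by auto
  then show "sf_eval G (sfo (LR.ed (ev \<omega>))) \<sigma>s b = cartan_formula G \<omega> \<sigma>s b"
   using sf_eval_ev[of \<sigma>s b] cartan_ed[OF W, of \<sigma>s b] ev_sfo[OF F] * by simp
 qed
 fix \<eta> assume \<eta>: "\<eta> \<in> SF \<and> (\<forall>\<sigma>s b. set \<sigma>s \<subseteq> lie_sections G \<and> b \<in> pts Ob -->
   sf_eval G \<eta> \<sigma>s b = cartan_formula G \<omega> \<sigma>s b)"
 show "\<eta> = sfo (LR.ed (ev \<omega>))"
 proof (rule sf_eqI)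
  show "\<eta> b es = 0" if "\<not> (b \<in> VB \<and> set es \<subseteq> VF b)" for b es by (rule SF_D(1)[OF _ that]) (use \<eta> in blast)
  show "sfo (LR.ed (ev \<omega>)) b es = 0" if "\<not> (b \<in> VB \<and> set es \<subseteq> VF b)" for b es by (rule SF_D(1)[OF SFS that])
  fix Xs b assume Xs: "set Xs \<subseteq> RI" and b: "b \<in> pts Ob"
  have s: "set (map val Xs) \<subseteq> lie_sections G"
   using Xs RI_section by (auto simp: val_def[abs_def])
  have r: "map rix (map val Xs) = Xs"
  proof (rule nth_equalityI)
   fix i assume "i < length (map rix (map val Xs))"
   then have i: "i < length Xs" "Xs ! i \<in> RI" "val (Xs ! i) \<in> lie_sections G" using Xs s by auto
   have "rix (val (Xs ! i)) = Xs ! i"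
    by (rule RI_eqI[OF rix_RI[OF i(3)] i(2)]) (simp add: rix_un[OF i(3)], simp add: val_def)
   then show "map rix (map val Xs) ! i = Xs ! i" using i by simp
  qed simp
  have "ev \<eta> Xs b = cartan_formula G \<omega> (map val Xs) b"
   using \<eta> s b sf_eval_ev[OF s b, of \<eta>] unfolding r by simp
  also have "\<dots> = LR.ed (ev \<omega>) Xs b" using cartan_ed[OF W s b] unfolding r .
  finally show "ev \<eta> Xs b = ev (sfo (LR.ed (ev \<omega>))) Xs b" using ev_sfo[OF F Xs] by simp
 qed
qed

end

section \<open>The exterior product\<close>

text \<open>The inversions of the shuffle that moves the arguments at the positions in I to the
  front.\<close>

definition crossings :: "nat => nat set => (nat \<times> nat) set" where
 "crossings n I = {(i, j). i \<in> I \<and> j \<in> {..<n} - I \<and> j < i}"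

text \<open>Split the subsets I by whether they contain position 0. If so, this position takes part
  in no crossing; if not, every element of I crosses it, which accounts for the sign
  \<open>bar\<close>.\<close>

lemma wd_shuffles:
 fixes w t :: "'d list => real"
 shows "(\<Sum>I\<in>Pow {..<length es}. (-1) ^ card (crossings (length es) I) * w (nths es I) * t (nths es (- I))) = wd w t es"
proof (induction es arbitrary: w t)
 case (Cons e es)
 let ?n = "length es" and ?S = "\<lambda>J. Suc ` J" and ?Z = "\<lambda>J. insert 0 (Suc ` J)" and ?p = "\<lambda>(i, j). (Suc i, Suc j)"
 let ?F = "\<lambda>I. (-1) ^ card (crossings (Suc ?n) I) * w (nths (e # es) I) * t (nths (e # es) (- I))"
 have P: "Pow {..<Suc ?n} = ?S ` Pow {..<?n} \<union> ?Z ` Pow {..<?n}"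
  by (simp only: lessThan_Suc_eq_insert_0 Pow_insert image_Pow_surj[OF refl, symmetric] image_image Un_commute)
 have inj: "inj_on ?S (Pow {..<?n})" "inj_on ?Z (Pow {..<?n})"
  by (auto intro!: inj_onI simp: inj_image_eq_iff)
 have disj: "?S ` Pow {..<?n} \<inter> ?Z ` Pow {..<?n} = {}" by auto
 have fin: "finite (crossings ?n J)" if "J \<subseteq> {..<?n}" for J
  by (rule finite_subset[of _ "{..<?n} \<times> {..<?n}"]) (use that in "auto simp: crossings_def")
 have ip: "card (?p ` K) = card K" for K :: "(nat \<times> nat) set"
  by (rule card_image) (auto intro!: inj_onI)
 have S: "?F (?S J) = (-1) ^ card (crossings ?n J) * bar w (nths es J) * ins e t (nths es (- J))" if J: "J \<subseteq> {..<?n}" for J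
 proof -
  have "crossings (Suc ?n) (?S J) = ?p ` crossings ?n J \<union> (\<lambda>i. (Suc i, 0)) ` J"
   using J by (auto simp: crossings_def image_iff less_Suc_eq_0_disj)
  moreover have "finite J" using J finite_subset by blast
  moreover have "?p ` crossings ?n J \<inter> (\<lambda>i. (Suc i, 0)) ` J = {}" by auto
  ultimately have c: "card (crossings (Suc ?n) (?S J)) = card (crossings ?n J) + card J"
   using fin[OF J] by (simp add: card_Un_disjoint ip card_image inj_on_def)
  have "{i. i < ?n \<and> i \<in> J} = J" using J by auto
  then have l: "length (nths es J) = card J" by (simp add: length_nths)
  have "{j. Suc j \<in> ?S J} = J" "{j. Suc j \<in> - ?S J} = - J" by auto
  then show ?thesis unfolding c by (simp add: nths_Cons l power_add)
 qed
 have Z: "?F (?Z J) = (-1) ^ card (crossings ?n J) * ins e w (nths es J) * t (nths es (- J))" if J: "J \<subseteq> {..<?n}" for J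
 proof -
  have "crossings (Suc ?n) (?Z J) = ?p ` crossings ?n J"
   using J by (auto simp: crossings_def image_iff less_Suc_eq_0_disj)
  then have c: "card (crossings (Suc ?n) (?Z J)) = card (crossings ?n J)"
   by (simp only: ip)
  have "{j. Suc j \<in> ?Z J} = J" "{j. Suc j \<in> - ?Z J} = - J" by auto
  then show ?thesis unfolding c by (simp add: nths_Cons)
 qed
 have "(\<Sum>I\<in>Pow {..<Suc ?n}. ?F I) = (\<Sum>J\<in>Pow {..<?n}. ?F (?S J)) + (\<Sum>J\<in>Pow {..<?n}. ?F (?Z J))"
  unfolding P by (subst sum.union_disjoint) (simp_all add: disj sum.reindex[OF inj(1)] sum.reindex[OF inj(2)])
 also have "\<dots> = wd (bar w) (ins e t) es + wd (ins e w) t es"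
  unfolding Cons.IH[symmetric] by (intro arg_cong2[where f = "(+)"] sum.cong refl S Z) auto
 finally show ?case by (simp del: ins_apply bar_apply)
qed (simp add: crossings_def)

lemma wedge_wd: "wedge \<omega> \<eta> b es = wd (\<omega> b) (\<eta> b) es"
 using wd_shuffles[of es "\<omega> b" "\<eta> b"] by (simp add: wedge_def crossings_def)

lemma wd_apply:
 fixes W T :: "'x list => 'c => 'r::comm_ring_1"
 shows "wd W T Xs b = wd (\<lambda>Zs. W Zs b) (\<lambda>Zs. T Zs b) Xs"
proof (induction Xs arbitrary: W T)
 case (Cons X Xs)
 have "(\<lambda>Zs. bar W Zs b) = bar (\<lambda>Zs. W Zs b)"
 proof
  fix Zs
  have "((- 1 :: 'c => 'r) ^ i) b = (- 1) ^ i" for i by (induction i) simp_all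
  then show "bar W Zs b = bar (\<lambda>Zs. W Zs b) Zs" by simp
 qed
 then show ?case using Cons[of "ins X W" T] Cons[of "bar W" "ins X T"] by (simp add: ins_def del: bar_apply)
qed simp

lemma wd_map: "wd w t (map f Xs) = wd (\<lambda>Zs. w (map f Zs)) (\<lambda>Zs. t (map f Zs)) Xs"
proof (induction Xs arbitrary: w t)
 case (Cons X Xs)
 have "bar (\<lambda>Zs. w (map f Zs)) = (\<lambda>Zs. bar w (map f Zs))" by (simp add: fun_eq_iff)
 then show ?case using Cons[of "ins (f X) w" t] Cons[of "bar w" "ins (f X) t"] by (simp add: ins_def del: bar_apply)
qed simp

section \<open>The homological vector field\<close>

context lie_rinehart
begin

lemma form_add: "form W ==> form T ==> form (\<lambda>Zs. W Zs + T Zs)"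
 by (rule formI[OF cochain_add[OF formD(1) formD(1)]]) (simp_all add: formD(2-4) algebra_simps)

lemma form_map_sm:
 assumes "k \<in> C"
 shows "form W ==> set Xs \<subseteq> L ==> W (map (sm k) Xs) = k ^ length Xs * W Xs"
proof (induction Xs arbitrary: W)
 case (Cons X Xs)
 have X: "X \<in> L" "set Xs \<subseteq> L" "set (map (sm k) Xs) \<subseteq> L" using Cons.prems L_sm[OF assms] by auto
 have "W (sm k X # map (sm k) Xs) = k * W (X # map (sm k) Xs)"
  by (rule form_hd(2)[OF Cons.prems(1) X(3,1) assms])
 then show ?case using Cons.IH[OF form_ins[OF Cons.prems(1) X(1)] X(2)] by (simp add: mult.assoc)
qed simp

lemma form_cong:
 assumes W: "form W" and eq: "!!Xs. set Xs \<subseteq> L ==> T Xs = W Xs"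
 shows "form T"
 using W unfolding form_def cochain_def by (simp add: eq L_add L_sm)

end

context lie_gpd
begin

abbreviation "Q \<equiv> lie_differential G"

text \<open>A real constant, made 0 off the objects so that it belongs to \<open>CO\<close>.\<close>

definition "kc c = (\<lambda>b. if b \<in> pts Ob then c else 0)"

lemma kc_CO: "kc c \<in> CO"
 unfolding kc_def by (rule COI[OF Cinf_const[OF dOb]])

lemma anch_kc: "X \<in> RI ==> anch X (kc c) = 0"
proof
 fix b assume X: "X \<in> RI"
 show "anch X (kc c) b = 0 b"
 proof (cases "b \<in> pts Ob")
  case True
  have "X (un b) (\<lambda>q. c) = X (un b) (\<lambda>q. kc c (tg q))"
   by (rule RI_cong[OF X Cinf_const[OF dAr]]) (simp add: kc_def)
  then show ?thesis
   using tvecD(3)[OF RI_D(1)[OF X un_pts[OF True]] Cinf_const[OF dAr], of c 1]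
    tv_const[OF dAr un_pts[OF True] RI_D(1)[OF X un_pts[OF True]], of c] tv_Cinf[OF dAr un_pts[OF True] RI_D(1)[OF X un_pts[OF True]] Cinf_const[OF dAr]]
    True by (simp add: anch_def)
 qed (simp add: anch_def)
qed

lemma Q_SF: "LR.form (ev \<omega>) ==> Q \<omega> \<in> SF"
 using lie_diff sfo_SF LR.form_ed by simp

lemma ev_Q: "LR.form (ev \<omega>) ==> set Xs \<subseteq> RI ==> ev (Q \<omega>) Xs = LR.ed (ev \<omega>) Xs"
 using lie_diff ev_sfo LR.form_ed by simp

lemma Q_eqI:
 assumes "LR.form (ev \<omega>)" "!!b es. \<not> (b \<in> VB \<and> set es \<subseteq> VF b) ==> \<eta> b es = 0"
  and "!!Xs b. set Xs \<subseteq> RI ==> b \<in> pts Ob ==> LR.ed (ev \<omega>) Xs b = ev \<eta> Xs b"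
 shows "Q \<omega> = \<eta>"
 by (rule sf_eqI[OF SF_D(1)[OF Q_SF[OF assms(1)]] assms(2)]) (simp_all add: ev_Q[OF assms(1)] assms(3))

lemma ev_wedge: "ev (wedge \<omega> \<eta>) = wd (ev \<omega>) (ev \<eta>)"
proof (intro ext)
 fix Xs b
 show "ev (wedge \<omega> \<eta>) Xs b = wd (ev \<omega>) (ev \<eta>) Xs b"
  unfolding wd_apply ev_def wedge_wd wd_map by (cases "b \<in> pts Ob") (simp_all add: wd_0_left)
qed

lemma wedge_outside:
 assumes \<omega>: "\<omega> \<in> SF" and \<eta>: "\<eta> \<in> SF" and out: "\<not> (b \<in> VB \<and> set es \<subseteq> VF b)"
 shows "wedge \<omega> \<eta> b es = 0"
 unfolding wedge_def
proof (rule sum.neutral, rule ballI)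
 fix I
 have "set es \<subseteq> set (nths es I) \<union> set (nths es (- I))"
 proof
  fix e assume "e \<in> set es"
  then obtain i where "i < length es" "es ! i = e" by (auto simp: in_set_conv_nth)
  then show "e \<in> set (nths es I) \<union> set (nths es (- I))"
   by (cases "i \<in> I") (auto simp: set_nths)
 qed
 then have "\<not> (b \<in> VB \<and> set (nths es I) \<subseteq> VF b) \<or> \<not> (b \<in> VB \<and> set (nths es (- I)) \<subseteq> VF b)"
  using out by blast
 then show "(- 1) ^ card {(i, j). i \<in> I \<and> j \<in> {..<length es} - I \<and> j < i} * \<omega> b (nths es I) * \<eta> b (nths es (- I)) = 0"
  by (elim disjE) (simp_all only: SF_D(1)[OF \<omega>] SF_D(1)[OF \<eta>] mult_zero_left mult_zero_right not_False_eq_True)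
qed

text \<open>Where a superfunction of parity d is nonzero, the number of arguments is known modulo 2,
  and the sign \<open>bar\<close> depends on nothing else.\<close>

lemma parity_bar:
 assumes "has_parity d \<omega>"
 shows "bar (ev \<omega>) = (\<lambda>Zs. (-1) ^ d * ev \<omega> Zs)"
proof (intro ext)
 fix Zs b
 have "(-1) ^ length Zs * ev \<omega> Zs b = (-1) ^ d * ev \<omega> Zs b"
 proof (cases "ev \<omega> Zs b = 0")
  case False
  then have "even (length Zs + d)"
   using assms[unfolded has_parity_def, rule_format, of "zer b" "map (\<lambda>X. val X b) Zs"] by (simp add: ev_def split: if_splits)
  then show ?thesis by (cases "even d") (auto simp: uminus_power_if)
 qed simp
 then show "bar (ev \<omega>) Zs b = ((-1) ^ d * ev \<omega> Zs) b" by (simp add: sign_apply)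
qed

text \<open>On a list of the wrong length the differential reads \<omega> on lists shorter by one,
  where it vanishes by its own parity.\<close>

lemma Q_parity:
 assumes \<omega>: "\<omega> \<in> SF" and par: "has_parity d \<omega>"
 shows "has_parity (d + 1) (Q \<omega>)"
 unfolding has_parity_def
proof (intro allI impI, rule ccontr)
 fix \<beta> es assume ne: "Q \<omega> \<beta> es ~= 0" and odd: "odd (length es + (d + 1))"
 note F = ev_form[OF \<omega>]
 have "\<beta> \<in> VB \<and> set es \<subseteq> VF \<beta>" using SF_D(1)[OF Q_SF[OF F], of \<beta> es] ne by blast
 then obtain b where b: "b \<in> pts Ob" "\<beta> = zer b" "set es \<subseteq> VF (zer b)" by (auto simp: VB_iff)
 note R = rext_RI[OF b(3)]
 have "LR.ed (ev \<omega>) (map rext es) = LR.ed (\<lambda>Zs. 0) (map rext es)"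
 proof (rule LR.ed_cong[OF R], rule ext)
  fix Zs :: "('g => 'g tvec) list" and b
  assume "Suc (length Zs) = length (map rext es)"
  then have l: "length es = Suc (length Zs)" by simp
  show "ev \<omega> Zs b = 0 b"
   using odd[unfolded l] par[unfolded has_parity_def, rule_format, of "zer b" "map (\<lambda>X. val X b) Zs"] by (auto simp: ev_def)
 qed
 then have "ev (Q \<omega>) (map rext es) b = 0" using LR.ed_0[OF R] ev_Q[OF F R] by simp
 then show False using ne b(1,2) unfolding ev_def map_val_rext[OF b(3)] by simp
qed

lemma homological_Q: "homological A lie_scale Q"
 unfolding homological_def odd_vector_field_def
proof (intro conjI ballI allI impI)
 fix \<omega> assume \<omega>: "\<omega> \<in> SF"
 note F = ev_form[OF \<omega>]
 show "Q \<omega> \<in> SF" by (rule Q_SF[OF F])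
 show "has_parity (d + 1) (Q \<omega>)" if "has_parity d \<omega>" for d by (rule Q_parity[OF \<omega> that])
 show "Q (Q \<omega>) = (\<lambda>b es. 0)"
 proof (rule Q_eqI[OF ev_form[OF Q_SF[OF F]] refl])
  fix Xs b assume Xs: "set Xs \<subseteq> RI" "b \<in> pts Ob"
  have "LR.ed (ev (Q \<omega>)) Xs = LR.ed (LR.ed (ev \<omega>)) Xs"
   by (rule LR.ed_cong[OF Xs(1)]) (rule ev_Q[OF F])
  then show "LR.ed (ev (Q \<omega>)) Xs b = ev (\<lambda>b es. 0) Xs b"
   using LR.ed_ed[OF F Xs(1)] by (simp add: ev_def)
 qed
 show "Q (\<lambda>b es. c * \<omega> b es) = (\<lambda>b es. c * Q \<omega> b es)" for c
 proof -
  have e: "ev (\<lambda>b es. c * \<eta> b es) = (\<lambda>Zs. kc c * ev \<eta> Zs)" for \<eta>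
   by (simp add: fun_eq_iff ev_def kc_def)
  have "LR.form (\<lambda>Zs. kc c * ev \<omega> Zs)"
   by (rule LR.formI[OF LR.cochain_smult[OF LR.formD(1)[OF F] kc_CO]])
    (simp_all only: LR.formD(2-4)[OF F] distrib_left mult.left_commute mult_zero_right)
  then show ?thesis
   by (intro Q_eqI) (simp_all add: e LR.ed_const[OF anch_kc kc_CO LR.formD(1)[OF F]] ev_Q[OF F] SF_D(1)[OF Q_SF[OF F]] del: times_fun_apply)
 qed
 fix \<eta> assume \<eta>: "\<eta> \<in> SF"
 note H = ev_form[OF \<eta>]
 note c = LR.formD(1)[OF F] LR.formD(1)[OF H]
 show "Q (\<lambda>b es. \<omega> b es + \<eta> b es) = (\<lambda>b es. Q \<omega> b es + Q \<eta> b es)"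
 proof -
  have e: "ev (\<lambda>b es. \<omega> b es + \<eta> b es) = (\<lambda>Zs. ev \<omega> Zs + ev \<eta> Zs)" for \<omega> \<eta>
   by (simp add: fun_eq_iff ev_def)
  show ?thesis
  proof (rule Q_eqI)
   show "Q \<omega> b es + Q \<eta> b es = 0" if "\<not> (b \<in> VB \<and> set es \<subseteq> VF b)" for b es
    using SF_D(1)[OF Q_SF[OF F] that] SF_D(1)[OF Q_SF[OF H] that] by simp
  qed (simp_all only: e LR.form_add[OF F H] LR.ed_add[OF c] ev_Q[OF F] ev_Q[OF H])
 qed
 fix d assume par: "has_parity d \<omega>"
 show "Q (wedge \<omega> \<eta>) = (\<lambda>b es. wedge (Q \<omega>) \<eta> b es + (-1) ^ d * wedge \<omega> (Q \<eta>) b es)"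
 proof (rule Q_eqI)
  show "LR.form (ev (wedge \<omega> \<eta>))" unfolding ev_wedge by (rule LR.form_wd[OF F H])
  show "wedge (Q \<omega>) \<eta> b es + (-1) ^ d * wedge \<omega> (Q \<eta>) b es = 0" if "\<not> (b \<in> VB \<and> set es \<subseteq> VF b)" for b es
   using wedge_outside[OF Q_SF[OF F] \<eta> that] wedge_outside[OF \<omega> Q_SF[OF H] that] by simp
  fix Xs b assume Xs: "set Xs \<subseteq> RI" and b: "b \<in> pts Ob"
  have "ev (\<lambda>b es. wedge (Q \<omega>) \<eta> b es + (-1) ^ d * wedge \<omega> (Q \<eta>) b es) Xs b =
    wd (ev (Q \<omega>)) (ev \<eta>) Xs b + (-1) ^ d * wd (ev \<omega>) (ev (Q \<eta>)) Xs b"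
   using b unfolding ev_wedge[symmetric] by (simp add: ev_def)
  also have "wd (ev (Q \<omega>)) (ev \<eta>) Xs = wd (LR.ed (ev \<omega>)) (ev \<eta>) Xs"
   by (rule LR.wd_cong[OF Xs]) (simp_all add: ev_Q[OF F])
  also have "wd (ev \<omega>) (ev (Q \<eta>)) Xs = wd (ev \<omega>) (LR.ed (ev \<eta>)) Xs"
   by (rule LR.wd_cong[OF Xs]) (simp_all add: ev_Q[OF H])
  finally show "LR.ed (ev (wedge \<omega> \<eta>)) Xs b = ev (\<lambda>b es. wedge (Q \<omega>) \<eta> b es + (-1) ^ d * wedge \<omega> (Q \<eta>) b es) Xs b"
   unfolding ev_wedge LR.ed_wd[OF c Xs] parity_bar[OF par] wd_smult_left by (simp add: sign_apply)
 qed
qed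

section \<open>Pullbacks, and the weight of the differential under scaling\<close>

lemma sf_pullback_outside: "\<not> (b \<in> VB \<and> set es \<subseteq> VF b) ==> sf_pullback A lie_scale \<phi> \<omega> b es = 0"
 by (auto simp: sf_pullback_def)

lemma ev_pullback:
 assumes "set Xs \<subseteq> RI" "b \<in> pts Ob"
 shows "ev (sf_pullback A lie_scale \<phi> \<omega>) Xs b = \<omega> (\<phi> (zer b)) (map (\<lambda>X. \<phi> (val X b)) Xs)"
proof -
 have "zer b \<in> VB \<and> set (map (\<lambda>X. val X b) Xs) \<subseteq> VF (zer b)"
  using assms val_VF by (auto simp: VB_iff)
 then show ?thesis using assms(2) by (simp add: ev_def sf_pullback_def o_def)
qed

text \<open>Scaling the arguments multiplies the component of degree p by s^p, and the differential
  raises the degree by one; the factor s makes up the difference.\<close>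

lemma Q_scale:
 assumes \<omega>: "\<omega> \<in> SF"
 shows "(\<lambda>b es. s * Q (sf_pullback A lie_scale (lie_scale s) \<omega>) b es) = sf_pullback A lie_scale (lie_scale s) (Q \<omega>)"
proof -
 let ?p = "sf_pullback A lie_scale (lie_scale s)" and ?k = "\<lambda>i. kc (s ^ i)"
 have e: "ev (?p \<eta>) Xs = ?k (length Xs) * ev \<eta> Xs" if \<eta>: "\<eta> \<in> SF" and Xs: "set Xs \<subseteq> RI" for \<eta> Xs
 proof
  fix b
  show "ev (?p \<eta>) Xs b = (?k (length Xs) * ev \<eta> Xs) b"
  proof (cases "b \<in> pts Ob")
   case True
   have "(kc s ^ i) b = s ^ i" for i using True by (induction i) (simp_all add: kc_def)
   moreover have "lie_scale s (zer b) = zer b" by (simp add: lie_scale_def zer_def)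
   then have "ev (?p \<eta>) Xs b = ev \<eta> (map (smul (kc s)) Xs) b"
    using True unfolding ev_pullback[OF Xs True] by (simp add: ev_def val_smul o_def kc_def)
   ultimately show ?thesis using LR.form_map_sm[OF kc_CO ev_form[OF \<eta>] Xs] True by (simp add: kc_def)
  qed (simp add: ev_def)
 qed
 note F = ev_form[OF \<omega>]
 have "LR.form (\<lambda>Zs. ?k (length Zs) * ev \<omega> Zs)"
 proof (rule LR.formI)
  show "LR.cochain (\<lambda>Zs. ?k (length Zs) * ev \<omega> Zs)"
   using LR.cochainD[OF LR.formD(1)[OF F]] LR.C_mult[OF kc_CO] by (simp add: LR.cochain_def)
 qed (simp_all only: LR.formD(2-4)[OF F] length_append list.size distrib_left mult.left_commute mult_zero_right)
 then have P: "LR.form (ev (?p \<omega>))" by (rule LR.form_cong[OF _ e[OF \<omega>]])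
 show ?thesis
 proof (rule sf_eqI)
  show "s * Q (?p \<omega>) b es = 0" if "\<not> (b \<in> VB \<and> set es \<subseteq> VF b)" for b es
   using SF_D(1)[OF Q_SF[OF P] that] by simp
  fix Xs b assume Xs: "set Xs \<subseteq> RI" and b: "b \<in> pts Ob"
  \<comment> \<open>The differential reads lists of this length. For empty \<open>Xs\<close> the
    truncated difference is 0 instead of -1, but there the differential vanishes.\<close>
  let ?l = "length Xs - 1"
  have "LR.ed (ev (?p \<omega>)) Xs = LR.ed (\<lambda>Zs. ?k ?l * ev \<omega> Zs) Xs"
   by (rule LR.ed_cong[OF Xs]) (use e[OF \<omega>] in "simp, metis diff_Suc_1'")
  also have "\<dots> = ?k ?l * LR.ed (ev \<omega>) Xs"
   by (rule LR.ed_const[OF anch_kc kc_CO LR.formD(1)[OF F] Xs])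
  finally have "ev (Q (?p \<omega>)) Xs b = s ^ ?l * LR.ed (ev \<omega>) Xs b"
   using b by (simp add: ev_Q[OF P Xs] kc_def)
  then have "s * ev (Q (?p \<omega>)) Xs b = s ^ length Xs * LR.ed (ev \<omega>) Xs b"
   by (cases Xs) simp_all
  then show "ev (\<lambda>b es. s * Q (?p \<omega>) b es) Xs b = ev (?p (Q \<omega>)) Xs b"
   using b e[OF Q_SF[OF F] Xs] by (simp add: ev_Q[OF F Xs] kc_def) (simp add: ev_def)
 qed (rule sf_pullback_outside)
qed

subsection \<open>Smooth families of forms\<close>

text \<open>Families allow the compatibility of the differential with \<open>h t\<close> to be extended to t = 0 by
 continuity.\<close>

definition family :: "(real => ('g => 'g tvec) list => 'b => real) => bool" where
 "family V \<longleftrightarrow> (\<forall>t. LR.cochain (V t)) \<and>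
  (\<forall>Xs. set Xs \<subseteq> RI --> (\<lambda>z. V (fst z) Xs (snd z)) \<in> Cinf (RL Ob))"

lemma familyD:
 assumes "family V"
 shows "LR.cochain (V t)" "set Xs \<subseteq> RI ==> (\<lambda>z. V (fst z) Xs (snd z)) \<in> Cinf (RL Ob)"
 using assms by (simp_all add: family_def)

lemma family_ins: "family V ==> Y \<in> RI ==> family (\<lambda>t. ins Y (V t))"
 by (simp add: family_def LR.cochain_ins)

text \<open>The analytic core: a derivative along X that depends smoothly on the parameter t as
  well. Lie derivative and differential inherit this through their recursions.\<close>

lemma family_anchor:
 assumes V: "family V" and X: "X \<in> RI"
 shows "(\<lambda>z. anch X (V (fst z) []) (snd z)) \<in> Cinf (RL Ob)"
proof (rule CinfI[OF diffspace_prod])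
 let ?P = "RL Ob"
 fix z0 assume z0: "z0 \<in> pts ?P"
 obtain t0 b0 where tb: "z0 = (t0, b0)" by fastforce
 have b0: "b0 \<in> pts Ob" using z0 tb by simp
 have p: "(t0, un b0) \<in> pts real_line \<times> pts Ar" using b0 by simp
 have "smap_at (RL Ar) ?P (t0, un b0) (\<lambda>z. (fst z, tg (snd z)))"
  by (rule smap_at_prod[OF diffspace_prod smap_at_fst[OF p] smap_at_comp'[OF smap_at_snd[OF p] smaps(2)]])
 from sm_pull[where \<phi> = "\<lambda>z. (fst z, tg (snd z))", OF this sm_Cinf[OF familyD(2)[OF V, of "[]"]]] b0
 have K: "smooth_at (RL Ar) (fst z0, un (snd z0)) (\<lambda>z. V (fst z) [] (tg (snd z)))"
  by (simp add: tb)
 have pz: "z0 \<in> pts real_line \<times> pts Ob" using z0 by simp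
 have us: "smap_at ?P Ar z0 (\<lambda>z. un (snd z))"
  by (rule smap_at_comp'[OF smap_at_snd[OF pz] smaps(3)])
 have "smooth_at ?P z0 (\<lambda>z. tv Ar (un (snd z)) (X (un (snd z))) (\<lambda>q. V (fst (fst z, q)) [] (tg (snd (fst z, q)))))"
 proof (rule sm_tv(1)[OF diffspace_real dAr diffspace_prod smap_at_fst[OF pz] us K])
  show "eventually (\<lambda>z. X (un (snd z)) \<in> TS Ar (un (snd z))) (nh ?P z0)"
   by (rule ev_ptsI) (use RI_D(1)[OF X] in auto)
  show "smooth_at ?P z0 (\<lambda>z. X (un (snd z)) u)" if "u \<in> Cinf Ar" for u
   by (rule sm_pull[where \<phi> = "\<lambda>z. un (snd z)", OF us sm_Cinf[OF RI_D(2)[OF X that]]]) (use tb b0 in simp)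
 qed
 moreover have "tv Ar (un (snd z)) (X (un (snd z))) (\<lambda>q. V (fst (fst z, q)) [] (tg (snd (fst z, q)))) = anch X (V (fst z) []) (snd z)"
  if z: "z \<in> pts ?P" for z
 proof -
  have b: "snd z \<in> pts Ob" using z by auto
  have "(\<lambda>q. V (fst z) [] (tg q)) \<in> Cinf Ar"
   by (rule tg_Cinf[OF COD(1)[OF LR.cochainD[OF familyD(1)[OF V]]]]) simp
  then show ?thesis
   using tv_Cinf[OF dAr un_pts[OF b] RI_D(1)[OF X un_pts[OF b]]] b by (simp add: anch_def)
 qed
 ultimately show "smooth_at ?P z0 (\<lambda>z. anch X (V (fst z) []) (snd z))"
  by (rule sm_cong[OF ev_ptsI, rotated])
qed

lemma family_Lie:
 "family V ==> X \<in> RI ==> set Ys \<subseteq> RI ==> (\<lambda>z. LR.Lie X (V (fst z)) Ys (snd z)) \<in> Cinf (RL Ob)"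
proof (induction Ys arbitrary: V)
 case Nil
 then show ?case using family_anchor by simp
next
 case (Cons Y Ys)
 then have Y: "Y \<in> RI" "set Ys \<subseteq> RI" by auto
 have 1: "(\<lambda>z. LR.Lie X (ins Y (V (fst z))) Ys (snd z)) \<in> Cinf (RL Ob)"
  by (rule Cons.IH[OF family_ins[OF Cons.prems(1) Y(1)] Cons.prems(2) Y(2)])
 have 2: "(\<lambda>z. V (fst z) (bra X Y # Ys) (snd z)) \<in> Cinf (RL Ob)"
  by (rule familyD(2)[OF Cons.prems(1)]) (use Y RI_br[OF Cons.prems(2)] in simp)
 show ?case using Cinf_diff[OF diffspace_prod 1 2] by simp
qed

lemma family_ed:
 "family V ==> set Ys \<subseteq> RI ==> (\<lambda>z. LR.ed (V (fst z)) Ys (snd z)) \<in> Cinf (RL Ob)"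
proof (induction Ys arbitrary: V)
 case Nil
 then show ?case using Cinf_const[OF diffspace_prod] by simp
next
 case (Cons Y Ys)
 then have Y: "Y \<in> RI" "set Ys \<subseteq> RI" by auto
 show ?case
  using Cinf_diff[OF diffspace_prod family_Lie[OF Cons.prems(1) Y] Cons.IH[OF family_ins[OF Cons.prems(1) Y(1)] Y(2)]] by (simp del: ins_apply)
qed

lemma family_at:
 assumes f: "f \<in> Cinf (RL Ob)" and b: "b \<in> pts Ob"
 shows "smooth_at real_line t (\<lambda>t. f (t, b))"
proof -
 have "smap_at real_line (RL Ob) t (\<lambda>t. (t, b))"
  by (rule smap_at_prod[OF diffspace_real smap_at_id smap_at_const[OF diffspace_real _ b]]) simp_all
 then show ?thesis using f by (simp add: smap_at_def)
qed

end

section \<open>Compatibility with the homogeneity structure\<close>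

context wlie_gpd
begin

abbreviation "pull t \<equiv> sf_pullback A lie_scale (hh t)"

lemma hh_zer: "b \<in> pts Ob ==> hh t (zer b) = zer (hb t b)"
 using hh_eq[OF zer_lie] h_mor(3) by (simp add: zer_def push_def tv_def fun_eq_iff)

lemma hh_val: "X \<in> RI ==> b \<in> pts Ob ==> hh t (val X b) \<in> VF (zer (hb t b))"
 using hh_pts[OF val_lie] hh_fst[OF val_lie] h_mor(3) by (simp add: VF_iff val_def)

lemma ev_pull:
 "set Xs \<subseteq> RI ==> b \<in> pts Ob ==> ev (pull t \<omega>) Xs b = \<omega> (zer (hb t b)) (map (\<lambda>X. hh t (val X b)) Xs)"
 by (simp add: ev_pullback hh_zer)

text \<open>Joint smoothness in t and in the base point: the former gives the passage to t = 0, the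
  latter makes each pullback a cochain.\<close>

lemma pull_smooth:
 assumes \<omega>: "\<omega> \<in> SF" and Xs: "set Xs \<subseteq> RI"
 shows "(\<lambda>z. ev (pull (fst z) \<omega>) Xs (snd z)) \<in> Cinf (RL Ob)"
proof (rule CinfI[OF diffspace_prod])
 let ?P = "RL Ob"
 fix z assume z: "z \<in> pts ?P"
 then have pz: "z \<in> pts real_line \<times> pts Ob" by simp
 have t: "smooth_at ?P z fst"
  using sm_Cinf[OF fst_Cinf[OF real_Cinf] z] by simp
 have "smap_at ?P Ar z (\<lambda>z. h (fst z) (un (snd z)))"
  by (rule homogeneity_joint[OF hs diffspace_prod t smap_at_comp'[OF smap_at_snd[OF pz] smaps(3)]])
 from smap_at_comp'[OF this smaps(1)]
 have hb: "smap_at ?P Ob z (\<lambda>z. hb (fst z) (snd z))" by (simp add: hb_def)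
 have "smap_at ?P (FP (length Xs)) z (\<lambda>z. (zer (hb (fst z) (snd z)), map (\<lambda>X. hh (fst z) (val X (snd z))) Xs))"
 proof (rule FP_I[OF diffspace_prod z _ hb])
  show "eventually (\<lambda>z. hb (fst z) (snd z) \<in> pts Ob) (nh ?P z)"
   by (rule ev_ptsI) auto
  show "eventually (\<lambda>z. set (map (\<lambda>X. hh (fst z) (val X (snd z))) Xs) \<subseteq> VF (zer (hb (fst z) (snd z))) \<and>
    length (map (\<lambda>X. hh (fst z) (val X (snd z))) Xs) = length Xs) (nh ?P z)"
   by (rule ev_ptsI) (use Xs hh_val in auto)
  fix i f assume i: "i < length Xs" and f: "f \<in> Cinf A"
  have X: "Xs ! i \<in> RI" using Xs nth_mem[OF i] by blast
  have "smooth_map Ob A (val (Xs ! i))"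
   unfolding val_def[abs_def] by (rule lie_sectionsD(1)[OF RI_section[OF X]])
  from homogeneity_joint[OF homogeneity_hh diffspace_prod t smap_at_comp'[OF smap_at_snd[OF pz] this]]
  show "smooth_at ?P z (\<lambda>z. f (map (\<lambda>X. hh (fst z) (val X (snd z))) Xs ! i))"
   using f i by (simp add: smap_at_def)
 qed
 then have "smooth_at ?P z (\<lambda>z. (\<lambda>(b, es). \<omega> b es) (zer (hb (fst z) (snd z)), map (\<lambda>X. hh (fst z) (val X (snd z))) Xs))"
  using SF_D(2)[OF \<omega>, of "length Xs"] unfolding smap_at_def by blast
 then show "smooth_at ?P z (\<lambda>z. ev (pull (fst z) \<omega>) Xs (snd z))"
  by (rule sm_cong[rotated]) (rule ev_ptsI, use ev_pull[OF Xs] in auto)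
qed

text \<open>At t = 0 the lift need not carry right-invariant fields to right-invariant fields. So
  for each b separately the image vectors are extended by \<open>rext\<close>, and tensoriality of
  \<open>ev \<omega>\<close> allows passing to other extensions of the same vectors.\<close>

lemma pull_form:
 assumes \<omega>: "\<omega> \<in> SF"
 shows "LR.form (ev (pull t \<omega>))"
proof (rule LR.formI)
 note F = ev_form[OF \<omega>]
 show "LR.cochain (ev (pull t \<omega>))"
  unfolding LR.cochain_def
 proof (intro allI impI)
  fix Xs assume Xs: "set Xs \<subseteq> RI"
  have "ev (pull t \<omega>) Xs \<in> Cinf Ob"
  proof (rule CinfI[OF dOb])
   fix b assume b: "b \<in> pts Ob"
   have "smap_at Ob (RL Ob) b (\<lambda>b. (t, b))"
    by (rule smap_at_prod[OF dOb smap_at_const[OF dOb b] smap_at_id[OF b]]) simp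
   then show "smooth_at Ob b (ev (pull t \<omega>) Xs)"
    using pull_smooth[OF \<omega> Xs] by (auto simp: smap_at_def)
  qed
  moreover have "ev (pull t \<omega>) Xs b = 0" if "b \<notin> pts Ob" for b using that by (simp add: ev_def)
  ultimately show "ev (pull t \<omega>) Xs \<in> CO" by (simp add: CO_def)
 qed
 fix Xs Ys X Y f assume Xs: "set Xs \<subseteq> RI" and Ys: "set Ys \<subseteq> RI" and X: "X \<in> RI"
 let ?P = "\<lambda>b X. rext (hh t (val X b))"
 have P: "?P b X \<in> RI" "?P b X (un (hb t b)) = snd (hh t (val X b))" "val (?P b X) (hb t b) = hh t (val X b)"
  if "X \<in> RI" "b \<in> pts Ob" for b X
  using rext[of "hh t (val X b)"] hh_val[OF that] val_rext[OF hh_val[OF that]] by (simp_all add: VF_iff)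
 have PS: "set (map (?P b) Zs) \<subseteq> RI" if "set Zs \<subseteq> RI" "b \<in> pts Ob" for Zs b
  using P(1) that by auto
 have e: "ev (pull t \<omega>) (Xs @ Z # Ys) b = ev \<omega> (map (?P b) Xs @ ?P b Z # map (?P b) Ys) (hb t b)"
  if Z: "Z \<in> RI" and b: "b \<in> pts Ob" for Z b
 proof -
  have L: "set (Xs @ Z # Ys) \<subseteq> RI" using Xs Ys Z by simp
  have m: "map (\<lambda>X. hh t (val X b)) (Xs @ Z # Ys) = map (\<lambda>X. val X (hb t b)) (map (?P b) (Xs @ Z # Ys))"
   unfolding map_map o_def by (rule map_cong[OF refl]) (use P(3)[OF _ b, symmetric] L in blast)
  have "ev (pull t \<omega>) (Xs @ Z # Ys) b = ev \<omega> (map (?P b) (Xs @ Z # Ys)) (hb t b)"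
   unfolding ev_pull[OF L b] m using b by (simp add: ev_def)
  then show ?thesis by simp
 qed
 have loc: "ev (pull t \<omega>) (Xs @ Z # Ys) b = ev \<omega> (map (?P b) Xs @ Z' # map (?P b) Ys) (hb t b)"
  if Z: "Z \<in> RI" "Z' \<in> RI" and b: "b \<in> pts Ob" and eq: "snd (hh t (val Z b)) = Z' (un (hb t b))" for Z Z' b
  unfolding e[OF Z(1) b]
  by (rule form_local[OF hb_pts[OF b] F]) (use PS[OF Xs b] PS[OF Ys b] P[OF Z(1) b] Z(2) eq in auto)
 have snd_hh: "snd (hh t (val Z b)) = (\<lambda>f. if f \<in> Cinf Ar then tv Ar (un b) (Z (un b)) (\<lambda>q. f (h t q)) else 0)"
  if "Z \<in> RI" "b \<in> pts Ob" for Z b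
  using hh_eq[OF val_lie[OF that]] by (simp add: val_def push_def)
 show "ev (pull t \<omega>) (Xs @ (X + Y) # Ys) = ev (pull t \<omega>) (Xs @ X # Ys) + ev (pull t \<omega>) (Xs @ Y # Ys)" if Y: "Y \<in> RI"
 proof
  fix b
  show "ev (pull t \<omega>) (Xs @ (X + Y) # Ys) b = (ev (pull t \<omega>) (Xs @ X # Ys) + ev (pull t \<omega>) (Xs @ Y # Ys)) b"
  proof (cases "b \<in> pts Ob")
   case True
   have "ev (pull t \<omega>) (Xs @ (X + Y) # Ys) b = ev \<omega> (map (?P b) Xs @ (?P b X + ?P b Y) # map (?P b) Ys) (hb t b)"
    by (rule loc[OF RI_add[OF X Y] RI_add[OF P(1)[OF X True] P(1)[OF Y True]] True])
     (simp add: snd_hh[OF RI_add[OF X Y] True] P(2) X Y True snd_hh fun_eq_iff tv_def)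
   then show ?thesis
    using LR.formD(2)[OF F PS[OF Xs True] PS[OF Ys True] P(1)[OF X True] P(1)[OF Y True]] e[OF X True] e[OF Y True] by simp
  qed (simp add: ev_def)
 qed
 show "ev (pull t \<omega>) (Xs @ smul f X # Ys) = f * ev (pull t \<omega>) (Xs @ X # Ys)" if f: "f \<in> CO"
 proof
  fix b
  show "ev (pull t \<omega>) (Xs @ smul f X # Ys) b = (f * ev (pull t \<omega>) (Xs @ X # Ys)) b"
  proof (cases "b \<in> pts Ob")
   case True
   note fX = RI_smul[OF X COD(1)[OF f]]
   have "ev (pull t \<omega>) (Xs @ smul f X # Ys) b = ev \<omega> (map (?P b) Xs @ smul (kc (f b)) (?P b X) # map (?P b) Ys) (hb t b)"
    by (rule loc[OF fX RI_smul[OF P(1)[OF X True] COD(1)[OF kc_CO]] True])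
     (simp add: snd_hh[OF fX True] P(2) X True snd_hh fun_eq_iff smul_def tv_def kc_def)
   then show ?thesis
    using LR.formD(3)[OF F PS[OF Xs True] PS[OF Ys True] P(1)[OF X True] kc_CO] e[OF X True] True by (simp add: kc_def)
  qed (simp add: ev_def)
 qed
 show "ev (pull t \<omega>) (Xs @ X # X # Ys) = 0"
 proof
  fix b
  let ?Zs = "map (\<lambda>X. hh t (val X b)) (Xs @ X # X # Ys)"
  show "ev (pull t \<omega>) (Xs @ X # X # Ys) b = 0 b"
  proof (cases "b \<in> pts Ob")
   case True
   have "zer (hb t b) \<in> VB" using True hb_pts by (auto simp: VB_iff)
   then have "\<omega> (zer (hb t b)) ?Zs = 0"
    by (rule SF_D(5)[OF \<omega>, of _ _ "length Xs" "Suc (length Xs)"])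
     (use True Xs Ys X hh_val in "auto simp: nth_append")
   then show ?thesis using ev_pull[of "Xs @ X # X # Ys" b t \<omega>] Xs Ys X True by simp
  qed (simp add: ev_def)
 qed
qed

lemma family_pull: "\<omega> \<in> SF ==> family (\<lambda>t. ev (pull t \<omega>))"
 using pull_smooth LR.formD(1)[OF pull_form] by (simp add: family_def)

text \<open>For nonzero t the map \<open>h t\<close> is an automorphism, so right-invariant vector fields can be pushed
 forward.\<close>

definition ptrans :: "real => ('g => 'g tvec) => 'g => 'g tvec" where
 "ptrans t X g f = (if g \<in> pts Ar \<and> f \<in> Cinf Ar then X (h (1 / t) g) (\<lambda>q. f (h t q)) else 0)"

definition bpull :: "real => ('b => real) => 'b => real" where
 "bpull t f b = (if b \<in> pts Ob then f (hb t b) else 0)"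

lemma h_Cinf: "f \<in> Cinf Ar ==> (\<lambda>q. f (h t q)) \<in> Cinf Ar"
 using h_map[of t] by (auto simp: smooth_map_def o_def)

lemma h_inv: "t ~= 0 ==> p \<in> pts Ar ==> h t (h (1 / t) p) = p" "t ~= 0 ==> p \<in> pts Ar ==> h (1 / t) (h t p) = p"
 by (simp_all add: h_simps)

lemma h_comp: "(g, a) \<in> composable G ==> (h t g, h t a) \<in> composable G"
 by (simp add: composable_iff h_mor)

lemma ptrans_RI:
 assumes t: "t ~= 0" and X: "X \<in> RI"
 shows "ptrans t X \<in> RI"
 unfolding RI_iff
proof (intro conjI ballI allI impI)
 fix p assume p: "p \<in> pts Ar"
 note v = RI_D(1)[OF X h_pts[OF p, of "1 / t"]]
 show "ptrans t X p \<in> TS Ar p"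
  using p tvecD(2,4)[OF v h_Cinf h_Cinf] tvecD(3)[OF v h_Cinf] h_inv(1)[OF t p]
  by (simp add: tangent_space_def ptrans_def Cinf_add[OF dAr] Cinf_cmult[OF dAr] Cinf_mult[OF dAr])
 fix f assume f: "f \<in> Cinf Ob"
 have fs: "(\<lambda>q. f (sr q)) \<in> Cinf Ar" by (rule smooth_map_Cinf[OF smaps(1) f])
 have fb: "(\<lambda>b. f (hb t b)) \<in> Cinf Ob" by (rule smooth_map_Cinf[OF hb_map[of t] f])
 have "X (h (1 / t) p) (\<lambda>q. f (sr (h t q))) = X (h (1 / t) p) (\<lambda>q. f (hb t (sr q)))"
  by (rule RI_cong[OF X h_Cinf[OF fs]]) (simp add: h_mor)
 then show "ptrans t X p (\<lambda>q. f (sr q)) = 0"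
  using RI_D(4)[OF X h_pts[OF p] fb] p fs by (simp add: ptrans_def)
next
 fix f assume f: "f \<in> Cinf Ar"
 have "(\<lambda>p. X (h (1 / t) p) (\<lambda>q. f (h t q))) \<in> Cinf Ar"
  using h_Cinf[OF RI_D(2)[OF X h_Cinf[OF f, of t]]] .
 then show "(\<lambda>p. ptrans t X p f) \<in> Cinf Ar"
  by (rule Cinf_cong[OF dAr]) (simp add: ptrans_def f)
next
 fix a f f' g assume a: "a \<in> pts Ar" and f: "f \<in> Cinf Ar" "f' \<in> Cinf Ar"
  "\<forall>g. (g, a) \<in> composable G --> f' g = f (mu g a)" and g: "(g, a) \<in> composable G"
 have gA: "g \<in> pts Ar" using g by (simp add: composable_iff)
 \<comment> \<open>The automorphism conjugates right translation by a into right translation by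
   \<open>h (1 / t) a\<close>.\<close>
 have "X (h (1 / t) g) (\<lambda>q. f' (h t q)) = X (mu (h (1 / t) g) (h (1 / t) a)) (\<lambda>q. f (h t q))"
 proof (rule RI_D(5)[OF X h_Cinf[OF f(1)] h_Cinf[OF f(2)] _ h_comp[OF g]])
  fix q assume q: "(q, h (1 / t) a) \<in> composable G"
  show "f' (h t q) = f (h t (mu q (h (1 / t) a)))"
   using f(3) h_comp[OF q, of t] h_mor(4)[OF q] h_inv(1)[OF t a] by simp
 qed
 then show "ptrans t X g f' = ptrans t X (mu g a) f"
  using gA mu_pts[OF g] f by (simp add: ptrans_def h_mor(4)[OF g])
qed (simp add: ptrans_def fun_eq_iff)

lemma ptrans_br:
 assumes t: "t ~= 0" and X: "X \<in> RI" and Y: "Y \<in> RI"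
 shows "ptrans t (bra X Y) = bra (ptrans t X) (ptrans t Y)"
proof (rule RI_ext)
 show "ptrans t (bra X Y) \<in> RI" by (rule ptrans_RI[OF t RI_br[OF X Y]])
 show "bra (ptrans t X) (ptrans t Y) \<in> RI" by (rule RI_br[OF ptrans_RI[OF t X] ptrans_RI[OF t Y]])
 fix p f assume p: "p \<in> pts Ar" and f: "f \<in> Cinf Ar"
 have "ptrans t Z p (\<lambda>q. ptrans t Z' q f) = Z (h (1 / t) p) (\<lambda>q. Z' q (\<lambda>q. f (h t q)))"
  if Z: "Z \<in> RI" "Z' \<in> RI" for Z Z'
 proof -
  note C = RI_D(2)[OF ptrans_RI[OF t Z(2)] f]
  have "Z (h (1 / t) p) (\<lambda>q. ptrans t Z' (h t q) f) = Z (h (1 / t) p) (\<lambda>q. Z' q (\<lambda>q. f (h t q)))"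
   by (rule RI_cong[OF Z(1) h_Cinf[OF C]]) (use f h_inv(2)[OF t] in "simp add: ptrans_def")
  then show ?thesis using p C by (simp add: ptrans_def[of t Z])
 qed
 from this[OF X Y] this[OF Y X]
 show "ptrans t (bra X Y) p f = bra (ptrans t X) (ptrans t Y) p f"
  using p f bra_eq[OF X Y h_Cinf[OF f]] bra_eq[OF ptrans_RI[OF t X] ptrans_RI[OF t Y] f]
  by (simp add: ptrans_def[of t "bra X Y"])
qed

lemma ptrans_anch:
 assumes t: "t ~= 0" and X: "X \<in> RI" and f: "f \<in> CO"
 shows "anch X (bpull t f) = bpull t (anch (ptrans t X) f)"
proof
 fix b
 have fC: "f \<in> Cinf Ob" by (rule COD(1)[OF f])
 show "anch X (bpull t f) b = bpull t (anch (ptrans t X) f) b"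
 proof (cases "b \<in> pts Ob")
  case True
  have "X (un b) (\<lambda>q. f (tg (h t q))) = X (un b) (\<lambda>q. bpull t f (tg q))"
   by (rule RI_cong[OF X h_Cinf[OF tg_Cinf[OF fC]]]) (simp add: bpull_def h_mor)
  then show ?thesis
   using True tg_Cinf[OF fC] h_inv(2)[OF t un_pts[OF True]]
   by (simp add: anch_def bpull_def[of t "anch _ _"] ptrans_def h_mor(3)[symmetric])
 qed (simp add: anch_def bpull_def)
qed

text \<open>At the units the lift is the push-forward of fields, which brings the pullback of
  superfunctions under \<open>ed_natural\<close>.\<close>

lemma hh_ptrans:
 assumes t: "t ~= 0" and X: "X \<in> RI" and b: "b \<in> pts Ob"
 shows "hh t (val X b) = val (ptrans t X) (hb t b)"
proof -
 have "snd (hh t (val X b)) f = ptrans t X (un (hb t b)) f" for f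
  using hh_eq[OF val_lie[OF X b]] h_inv(2)[OF t un_pts[OF b]] b
   tv_Cinf[OF dAr un_pts[OF b] RI_D(1)[OF X un_pts[OF b]] h_Cinf]
  by (simp add: val_def push_def ptrans_def h_mor(3)[symmetric])
 moreover have "fst (hh t (val X b)) = un (hb t b)"
  using hh_fst[OF val_lie[OF X b]] h_mor(3)[OF b] by (simp add: val_def)
 ultimately show ?thesis by (simp add: val_def prod_eq_iff fun_eq_iff)
qed

lemma ev_pull_ptrans:
 assumes "t ~= 0" "set Xs \<subseteq> RI"
 shows "ev (pull t \<omega>) Xs = bpull t (ev \<omega> (map (ptrans t) Xs))"
proof
 fix b
 show "ev (pull t \<omega>) Xs b = bpull t (ev \<omega> (map (ptrans t) Xs)) b"
 proof (cases "b \<in> pts Ob")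
  case True
  have m: "map (\<lambda>X. hh t (val X b)) Xs = map (\<lambda>X. val X (hb t b)) (map (ptrans t) Xs)"
   unfolding map_map o_def by (rule map_cong[OF refl]) (use hh_ptrans[OF assms(1) _ True] assms(2) in blast)
  show ?thesis unfolding ev_pull[OF assms(2) True] m using True by (simp add: ev_def bpull_def)
 qed (simp add: ev_def bpull_def)
qed

lemma Q_pull:
 assumes \<omega>: "\<omega> \<in> SF"
 shows "Q (pull t \<omega>) = pull t (Q \<omega>)"
proof (rule Q_eqI[OF pull_form[OF \<omega>] sf_pullback_outside])
 fix Xs b assume Xs: "set Xs \<subseteq> RI" and b: "b \<in> pts Ob"
 note F = ev_form[OF \<omega>]
 have ne: "LR.ed (ev (pull t \<omega>)) Xs b = ev (pull t (Q \<omega>)) Xs b" if t: "t ~= 0" for t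
 proof -
  have PR: "set (map (ptrans t) Xs) \<subseteq> RI" using Xs ptrans_RI[OF t] by auto
  have "LR.ed (ev (pull t \<omega>)) Xs = LR.ed (\<lambda>Zs. bpull t (ev \<omega> (map (ptrans t) Zs))) Xs"
   by (rule LR.ed_cong[OF Xs ev_pull_ptrans[OF t]])
  also have "\<dots> = bpull t (LR.ed (ev \<omega>) (map (ptrans t) Xs))"
   by (rule LR.ed_natural[where c = "bpull t" and P = "ptrans t", OF ptrans_RI[OF t] ptrans_br[OF t] ptrans_anch[OF t] _ LR.formD(1)[OF F] Xs])
    (simp_all add: bpull_def fun_eq_iff)
  also have "\<dots> = ev (pull t (Q \<omega>)) Xs" by (simp only: ev_pull_ptrans[OF t Xs] ev_Q[OF F PR])
  finally show ?thesis by simp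
 qed
 let ?F = "\<lambda>t. LR.ed (ev (pull t \<omega>)) Xs b - ev (pull t (Q \<omega>)) Xs b"
 have 1: "smooth_at real_line 0 (\<lambda>t. LR.ed (ev (pull t \<omega>)) Xs b)"
  using family_at[OF family_ed[OF family_pull[OF \<omega>] Xs] b] by simp
 have 2: "smooth_at real_line 0 (\<lambda>t. ev (pull t (Q \<omega>)) Xs b)"
  using family_at[OF pull_smooth[OF Q_SF[OF F] Xs] b] by simp
 \<comment> \<open>The difference vanishes for all nonzero t, so the radius 1 is an arbitrary
   choice.\<close>
 have "?F 0 = 0"
  by (rule real_line_limit[OF sm_diff[OF diffspace_real 1 2], of 1]) (simp_all add: ne)
 then show "LR.ed (ev (pull t \<omega>)) Xs b = ev (pull t (Q \<omega>)) Xs b"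
  using ne by (cases "t = 0") simp_all
qed

lemma weighted_lie_algebroid_A: "weighted_lie_algebroid (k + 1) A hh lie_scale Q"
 unfolding weighted_lie_algebroid_def using gl_bundle_A homological_Q Q_pull Q_scale by blast

end

theorem theorem4p1:
  fixes G :: "('g, 'b) groupoid" and h :: "real \<Rightarrow> 'g \<Rightarrow> 'g" and k :: nat
  assumes "weighted_lie_groupoid k G h"
  shows "weighted_lie_algebroid (k + 1) (lie_alg G) (\<lambda>t. lie_map G G (h t)) lie_scale
           (lie_differential G)"
proof -
  have G: "lie_groupoid G" "graded_bundle k (arrows G) h"
    "\<And>t. groupoid_morphism G G (h t) (\<lambda>b. src G (h t (ident G b)))"
    using assms by (simp_all add: weighted_lie_groupoid_def)
  obtain n where n: "manifold n (arrows G)"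
    "\<forall>p\<in>pts (arrows G). \<exists>U x w. p \<in> U \<and> homogeneous_chart n (arrows G) h U x w \<and> (\<forall>i<n. w i \<le> k)"
    and hs: "homogeneity_structure (arrows G) h"
    using G(2) unfolding graded_bundle_def by blast
  obtain m where m: "manifold m (objects G)" using G(1) unfolding lie_groupoid_def by blast
  interpret wlie_gpd G n m h k
    by unfold_locales (use G n m hs in auto)
  show ?thesis by (rule weighted_lie_algebroid_A)
qed

end
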